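(* Let the perturbed system $\frac{dr}{dt}=f(r,\varphi,S(t),t)$, $\frac{d\varphi}{dt}=\omega(r)+g(r,\varphi,S(t),t)$ satisfy the conditions of the context (expansions of $f,g$, form of $S$, resonance condition), let $n\in[1,2q]$, $m\in[2,2q]$ be integers with $$\Lambda_i\equiv0\ (1\le i<n),\quad \Lambda_n\not\equiv0,\qquad \Omega_j\equiv0\ (1<j<m),\quad \Omega_m\not\equiv0,$$ and let there exist $\psi_0\in\mathbb R$ such that $\Lambda_n(0,\psi_0)=0$ and $\nu_n:=\partial_\psi\Lambda_n(0,\psi_0)\ne0$. Suppose $\nu_n\eta<0$ and $d_{n,m}<0$. Then there is $N_0\in\mathbb Z_+$ such that for all $N\ge N_0$ and $\varepsilon>0$ there exist $\delta>0$ and $t_\ast\ge t_0$ such that any solution $r(t),\varphi(t)$ of the perturbed system with initial data $r(t_\ast)=r_\ast$, $\varphi(t_\ast)=\varphi_\ast$ satisfying $$\Big|r_\ast-a-t_\ast^{-\frac1{2q}}\varrho_\ast(t_\ast)\Big|+\Big|\varphi_\ast-\frac{\kappa}{\varkappa}S(t_\ast)-\phi_\ast(t_\ast)\Big|\le\delta$$ satisfies $$\Big|r(t)-a-t^{-\frac1{2q}}\varrho_\ast(t)\Big|+\Big|\varphi(t)-\frac{\kappa}{\varkappa}S(t)-\phi_\ast(t)\Big|<\varepsilon$$ for all $t>t_\ast$. Here $\varrho_\ast(t),\phi_\ast(t)$ is the particular solution, described in the context, of the truncated system with index $N$.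
   Context: $\mathbb Z_+$ denotes the positive integers. Setting. $\mathcal R>0$ is a constant. The functions $\omega(r)>0$, $f(r,\varphi,S,t)$, $g(r,\varphi,S,t)$ are infinitely differentiable, defined for all $|r|\le\mathcal R$, $(\varphi,S)\in\mathbb R^2$, $t>0$; $f,g$ are $2\pi$-periodic in $\varphi$ and in $S$; $\omega'\not\equiv0$. Asymptotic expansions: for some $q\in\mathbb Z_+$, $f\sim\sum_{j\ge1}t^{-j/q}f_j(r,\varphi,S)$, $g\sim\sum_{j\ge1}t^{-j/q}g_j(r,\varphi,S)$ as $t\to\infty$, with $f_j,g_j$ smooth and $2\pi$-periodic in $\varphi$ and $S$; i.e. for all $K\ge1$, $f-\sum_{j=1}^{K-1}t^{-j/q}f_j=\mathcal O(t^{-K/q})$ and $g-\sum_{j=1}^{K-1}t^{-j/q}g_j=\mathcal O(t^{-K/q})$ uniformly for $|r|\le\mathcal R$, $(\varphi,S)\in\mathbb R^2$. Phase: $S(t)=s_0t+\sum_{j=1}^{q-1}s_jt^{1-j/q}+s_q\log t$ with constants $s_j$, $s_0>0$. Resonance: there are $a$ with $0<|a|<\mathcal R$ and coprime $\kappa,\varkappa\in\mathbb Z_+$ with $\kappa s_0=\varkappa\omega(a)$ and $\eta:=\omega'(a)\ne0$. Averaged coefficients $\Lambda_k,\Omega_k$. Put $r=a+t^{-\frac1{2q}}R$, $\varphi=\frac\kappa\varkappa S(t)+\Psi$. Then $\frac{dR}{dt}=F(R,\Psi,S(t),t)$, $\frac{d\Psi}{dt}=G(R,\Psi,S(t),t)$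 with $F\sim\sum_{k\ge1}t^{-\frac k{2q}}F_k(R,\Psi,S)$, $G\sim\sum_{k\ge1}t^{-\frac k{2q}}G_k(R,\Psi,S)$, $$F_k=\sum_{i+2j=k+1,\,i\ge0,\,j\ge1}\partial_r^if_j\big(a,\tfrac\kappa\varkappa S+\Psi,S\big)\frac{R^i}{i!}+\delta_{k,2q}\frac R{2q},$$ $$G_k=\omega^{(k)}(a)\frac{R^k}{k!}-\frac\kappa\varkappa s_{k/2}\Big(1-\frac k{2q}+\delta_{k,2q}\Big)+\sum_{i+2j=k,\,i\ge0,\,j\ge1}\partial_r^ig_j\big(a,\tfrac\kappa\varkappa S+\Psi,S\big)\frac{R^i}{i!},$$ where $\delta_{k,2q}$ is the Kronecker delta, $s_j=0$ for $j>q$ and $s_{k/2}=0$ for odd $k$. There are unique functions $u_k,v_k$ of $(R,\Psi,S)$, $2\pi\varkappa$-periodic in $S$ with zero mean over $S\in[0,2\pi\varkappa]$, and unique functions $\Lambda_k,\Omega_k$ of two variables ($k\ge1$) determined recursively in $k$ by requiring that, with $U=R+\sum_{k\ge1}t^{-\frac k{2q}}u_k$, $V=\Psi+\sum_{k\ge1}t^{-\frac k{2q}}v_k$, the identities $$(F\partial_R+G\partial_\Psi+S'(t)\partial_S+\partial_t)U=\sum_{k\ge1}t^{-\frac k{2q}}\Lambda_k(U,V),\quad (F\partial_R+G\partial_\Psi+S'(t)\partial_S+\partial_t)V=\sum_{k\ge1}t^{-\frac k{2q}}\Omega_k(U,V)$$ hold as formal power series in $t^{-\frac1{2q}}$ (the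 right-hand sides Taylor-expanded at $(R,\Psi)$). In particular $\Lambda_1(\rho,\psi)=\frac1{2\pi\varkappa}\int_0^{2\pi\varkappa}f_1(a,\frac\kappa\varkappa S+\psi,S)\,dS$ and $\Omega_1(\rho,\psi)=\eta\rho$. Truncated system (index $N$): $$\frac{d\varrho}{dt}=\sum_{k=1}^Nt^{-\frac k{2q}}\Lambda_k(\varrho,\phi),\qquad \frac{d\phi}{dt}=\sum_{k=1}^Nt^{-\frac k{2q}}\Omega_k(\varrho,\phi).$$ Parameters. $\lambda_n:=\partial_\rho\Lambda_n(0,\psi_0)$, $\omega_m:=\partial_\psi\Omega_m(0,\psi_0)$, and $d_{n,m}:=\lambda_n$ if $n<m$; $d_{n,m}:=\lambda_n+\omega_m$ if $n=m$; $d_{n,m}:=\omega_m$ if $n>m$. Particular solution. For $N\ge\max\{m,n\}$, under the hypotheses of the claim, $\varrho_\ast(t),\phi_\ast(t)$ denotes the solution of the truncated system with asymptotic expansion $$\varrho_\ast(t)\sim\sum_{k\ge1}t^{-\frac{k+m-2}{2q}}\varrho_k,\qquad \phi_\ast(t)\sim\psi_0+\sum_{k\ge1}t^{-\frac k{2q}}\phi_k,\qquad t\to\infty,$$ with constants $\varrho_k,\phi_k$ (obtained by substituting the series into the truncated system and equating powers of $t$). $t_0\ge1$ is a fixed (possibly $N$-dependent) time from which the change of variables $(R,\Psi)\mapsto(\rho,\psi)=(R+\sum_{k=1}^Nt^{-\frac k{2q}}u_k,\Psi+\sum_{k=1}^Nt^{-\frac k{2q}}v_k)$ (with $S=S(t)$)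 is close to the identity and invertible. *)

theory Defs
  imports
    "HOL-Analysis.Analysis"
    "HOL-Computational_Algebra.Formal_Power_Series"
    "HOL-Library.Landau_Symbols"
begin

section \<open>Smoothness\<close>

text \<open>Derivatives are taken relative to \<open>D\<close>; on the convex sets with nonempty interior used
  below they are unique, and one-sided at boundary points that belong to \<open>D\<close>.\<close>

primrec Ck_on :: "nat \<Rightarrow> 'a::real_normed_vector set \<Rightarrow> ('a \<Rightarrow> real) \<Rightarrow> bool" where
  "Ck_on 0 D h \<longleftrightarrow> continuous_on D h"
| "Ck_on (Suc k) D h \<longleftrightarrow>
     (\<exists>h'. (\<forall>x\<in>D. (h has_derivative h' x) (at x within D)) \<and> (\<forall>v. Ck_on k D (\<lambda>x. h' x v)))"

definition smooth_on :: "'a::real_normed_vector set \<Rightarrow> ('a \<Rightarrow> real) \<Rightarrow> bool" where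
  "smooth_on D h \<longleftrightarrow> (\<forall>k. Ck_on k D h)"

section \<open>The perturbed system\<close>

definition admissible_perturbation ::
  "real \<Rightarrow> nat \<Rightarrow> (real \<Rightarrow> real \<Rightarrow> real \<Rightarrow> real \<Rightarrow> real) \<Rightarrow>
     (nat \<Rightarrow> real \<Rightarrow> real \<Rightarrow> real \<Rightarrow> real) \<Rightarrow> bool" where
  "admissible_perturbation \<R> q h hc \<longleftrightarrow>
     smooth_on ({-\<R>..\<R>} \<times> UNIV \<times> UNIV \<times> {0<..}) (\<lambda>(r, \<phi>, S, t). h r \<phi> S t) \<and>
     (\<forall>r\<in>{-\<R>..\<R>}. \<forall>\<phi> S. \<forall>t>0.
        h r (\<phi> + 2 * pi) S t = h r \<phi> S t \<and> h r \<phi> (S + 2 * pi) t = h r \<phi> S t) \<and>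
     (\<forall>j\<ge>1.
        smooth_on ({-\<R>..\<R>} \<times> UNIV \<times> UNIV) (\<lambda>(r, \<phi>, S). hc j r \<phi> S) \<and>
        (\<forall>r\<in>{-\<R>..\<R>}. \<forall>\<phi> S.
           hc j r (\<phi> + 2 * pi) S = hc j r \<phi> S \<and> hc j r \<phi> (S + 2 * pi) = hc j r \<phi> S)) \<and>
     (\<forall>K\<ge>1. \<exists>C. \<forall>\<^sub>F t in at_top. \<forall>r\<in>{-\<R>..\<R>}. \<forall>\<phi> S.
        \<bar>h r \<phi> S t - (\<Sum>j=1..<K. t powr (- (real j / real q)) * hc j r \<phi> S)\<bar>
          \<le> C * t powr (- (real K / real q)))"

definition phase :: "nat \<Rightarrow> (nat \<Rightarrow> real) \<Rightarrow> real \<Rightarrow> real" where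
  "phase q s t =
     s 0 * t + (\<Sum>j=1..<q. s j * t powr (1 - real j / real q)) + s q * ln t"

definition perturbed_solution ::
  "real \<Rightarrow> (real \<Rightarrow> real) \<Rightarrow> (real \<Rightarrow> real \<Rightarrow> real \<Rightarrow> real \<Rightarrow> real) \<Rightarrow>
     (real \<Rightarrow> real \<Rightarrow> real \<Rightarrow> real \<Rightarrow> real) \<Rightarrow> (real \<Rightarrow> real) \<Rightarrow>
     real set \<Rightarrow> (real \<Rightarrow> real) \<Rightarrow> (real \<Rightarrow> real) \<Rightarrow> bool" where
  "perturbed_solution \<R> \<omega> f g Sf J r \<phi> \<longleftrightarrow>
     (\<forall>t\<in>J. \<bar>r t\<bar> \<le> \<R> \<and>
        (r has_real_derivative f (r t) (\<phi> t) (Sf t) t) (at t within J) \<and>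
        (\<phi> has_real_derivative \<omega> (r t) + g (r t) (\<phi> t) (Sf t) t) (at t within J))"

section \<open>Averaged coefficients\<close>

text \<open>All formal power series are in the variable \<open>\<tau> = t powr (- 1 / (2 q))\<close>.  The resonance is
  \<open>\<kappa> : \<mu>\<close>, i.e. \<open>\<kappa> s\<^sub>0 = \<mu> \<omega>(a)\<close>.\<close>

text \<open>Coefficient of \<open>\<tau> ^ k\<close> in the derivative of the phase.\<close>

definition phase_deriv_coeff :: "nat \<Rightarrow> (nat \<Rightarrow> real) \<Rightarrow> nat \<Rightarrow> real" where
  "phase_deriv_coeff q s k =
     (if even k \<and> k \<le> 2 * q
      then s (k div 2) * (1 - real k / (2 * real q) + (if k = 2 * q then 1 else 0)) else 0)"

definition F_coeff ::
  "nat \<Rightarrow> nat \<Rightarrow> nat \<Rightarrow> real \<Rightarrow> (nat \<Rightarrow> real \<Rightarrow> real \<Rightarrow> real \<Rightarrow> real) \<Rightarrow>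
     nat \<Rightarrow> real \<Rightarrow> real \<Rightarrow> real \<Rightarrow> real" where
  "F_coeff q \<kappa> \<mu> a fc k R \<Psi> S =
     (\<Sum>(i, j) \<in> {(i, j). 1 \<le> j \<and> i + 2 * j = k + 1}.
        (deriv ^^ i) (\<lambda>r. fc j r (real \<kappa> / real \<mu> * S + \<Psi>) S) a * R ^ i / fact i)
     + (if k = 2 * q then R / (2 * real q) else 0)"

text \<open>The formula also gives the right value \<open>0\<close> for \<open>k = 0\<close>, by the resonance condition.\<close>

definition G_coeff ::
  "nat \<Rightarrow> nat \<Rightarrow> nat \<Rightarrow> real \<Rightarrow> (nat \<Rightarrow> real) \<Rightarrow> (real \<Rightarrow> real) \<Rightarrow>
     (nat \<Rightarrow> real \<Rightarrow> real \<Rightarrow> real \<Rightarrow> real) \<Rightarrow> nat \<Rightarrow> real \<Rightarrow> real \<Rightarrow> real \<Rightarrow> real" where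
  "G_coeff q \<kappa> \<mu> a s \<omega> gc k R \<Psi> S =
     (deriv ^^ k) \<omega> a * R ^ k / fact k - real \<kappa> / real \<mu> * phase_deriv_coeff q s k
     + (\<Sum>(i, j) \<in> {(i, j). 1 \<le> j \<and> i + 2 * j = k}.
          (deriv ^^ i) (\<lambda>r. gc j r (real \<kappa> / real \<mu> * S + \<Psi>) S) a * R ^ i / fact i)"

definition series_at ::
  "(nat \<Rightarrow> real \<Rightarrow> real \<Rightarrow> real \<Rightarrow> real) \<Rightarrow> real \<Rightarrow> real \<Rightarrow> real \<Rightarrow> real fps" where
  "series_at W R \<Psi> S = Abs_fps (\<lambda>k. W k R \<Psi> S)"

text \<open>The formal operator \<open>F \<partial>\<^sub>R + G \<partial>\<^sub>\<Psi> + S'(t) \<partial>\<^sub>S + \<partial>\<^sub>t\<close>, with coefficients \<open>F\<close>, \<open>G\<close> and \<open>\<sigma>\<close>,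
  applied to \<open>\<Sum>k. \<tau> ^ k * W k\<close>.  The last summand is \<open>\<partial>\<^sub>t = (d\<tau>/dt) \<partial>\<^sub>\<tau>\<close> with
  \<open>d\<tau>/dt = - \<tau> ^ (2 q + 1) / (2 q)\<close>.\<close>

definition formal_total_deriv ::
  "nat \<Rightarrow> (nat \<Rightarrow> real \<Rightarrow> real \<Rightarrow> real \<Rightarrow> real) \<Rightarrow> (nat \<Rightarrow> real \<Rightarrow> real \<Rightarrow> real \<Rightarrow> real) \<Rightarrow>
     (nat \<Rightarrow> real) \<Rightarrow> (nat \<Rightarrow> real \<Rightarrow> real \<Rightarrow> real \<Rightarrow> real) \<Rightarrow>
     real \<Rightarrow> real \<Rightarrow> real \<Rightarrow> real fps" where
  "formal_total_deriv q F G \<sigma> W R \<Psi> S =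
     series_at F R \<Psi> S * Abs_fps (\<lambda>k. deriv (\<lambda>x. W k x \<Psi> S) R)
     + series_at G R \<Psi> S * Abs_fps (\<lambda>k. deriv (\<lambda>x. W k R x S) \<Psi>)
     + Abs_fps \<sigma> * Abs_fps (\<lambda>k. deriv (\<lambda>x. W k R \<Psi> x) S)
     - fps_const (1 / (2 * real q)) * fps_X ^ (2 * q + 1) * fps_deriv (series_at W R \<Psi> S)"

text \<open>The Taylor expansion at \<open>(R, \<Psi>)\<close> of \<open>\<Sum>l\<ge>1. \<tau> ^ l * H l (R + du) (\<Psi> + dv)\<close>, for series
  \<open>du\<close> and \<open>dv\<close> without constant term (so that \<open>i, j \<le> k - l\<close> loses nothing).\<close>

definition taylor_series ::
  "(nat \<Rightarrow> real \<Rightarrow> real \<Rightarrow> real) \<Rightarrow> real \<Rightarrow> real \<Rightarrow> real fps \<Rightarrow> real fps \<Rightarrow> real fps" where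
  "taylor_series H R \<Psi> du dv = Abs_fps (\<lambda>k.
     \<Sum>l=1..k. \<Sum>i\<le>k - l. \<Sum>j\<le>k - l.
       (deriv ^^ i) (\<lambda>x. (deriv ^^ j) (\<lambda>y. H l x y) \<Psi>) R / (fact i * fact j)
         * fps_nth (du ^ i * dv ^ j) (k - l))"

definition with_leading ::
  "(real \<Rightarrow> real \<Rightarrow> real) \<Rightarrow> (nat \<Rightarrow> real \<Rightarrow> real \<Rightarrow> real \<Rightarrow> real) \<Rightarrow>
     nat \<Rightarrow> real \<Rightarrow> real \<Rightarrow> real \<Rightarrow> real" where
  "with_leading w u k R \<Psi> S = (if k = 0 then w R \<Psi> else u k R \<Psi> S)"

text \<open>The conditions that determine \<open>u\<^sub>k\<close>, \<open>v\<^sub>k\<close>, \<open>\<Lambda>\<^sub>k\<close>, \<open>\<Omega>\<^sub>k\<close> uniquely for \<open>k \<ge> 1\<close>.  The values at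
  index \<open>0\<close> are never used.\<close>

definition averaging ::
  "nat \<Rightarrow> nat \<Rightarrow> nat \<Rightarrow> real \<Rightarrow> (nat \<Rightarrow> real) \<Rightarrow> (real \<Rightarrow> real) \<Rightarrow>
     (nat \<Rightarrow> real \<Rightarrow> real \<Rightarrow> real \<Rightarrow> real) \<Rightarrow> (nat \<Rightarrow> real \<Rightarrow> real \<Rightarrow> real \<Rightarrow> real) \<Rightarrow>
     (nat \<Rightarrow> real \<Rightarrow> real \<Rightarrow> real \<Rightarrow> real) \<Rightarrow> (nat \<Rightarrow> real \<Rightarrow> real \<Rightarrow> real \<Rightarrow> real) \<Rightarrow>
     (nat \<Rightarrow> real \<Rightarrow> real \<Rightarrow> real) \<Rightarrow> (nat \<Rightarrow> real \<Rightarrow> real \<Rightarrow> real) \<Rightarrow> bool" where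
  "averaging q \<kappa> \<mu> a s \<omega> fc gc u v \<Lambda> \<Omega> \<longleftrightarrow>
     (\<forall>k\<ge>1.
        smooth_on UNIV (\<lambda>(R, \<Psi>, S). u k R \<Psi> S) \<and>
        smooth_on UNIV (\<lambda>(R, \<Psi>, S). v k R \<Psi> S) \<and>
        smooth_on UNIV (\<lambda>(\<rho>, \<psi>). \<Lambda> k \<rho> \<psi>) \<and>
        smooth_on UNIV (\<lambda>(\<rho>, \<psi>). \<Omega> k \<rho> \<psi>) \<and>
        (\<forall>R \<Psi> S. u k R \<Psi> (S + 2 * pi * real \<mu>) = u k R \<Psi> S \<and>
                  v k R \<Psi> (S + 2 * pi * real \<mu>) = v k R \<Psi> S) \<and>
        (\<forall>R \<Psi>. integral {0..2 * pi * real \<mu>} (u k R \<Psi>) = 0 \<and>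
                integral {0..2 * pi * real \<mu>} (v k R \<Psi>) = 0)) \<and>
     (\<forall>R \<Psi> S.
        let D = formal_total_deriv q (F_coeff q \<kappa> \<mu> a fc) (G_coeff q \<kappa> \<mu> a s \<omega> gc)
                  (phase_deriv_coeff q s);
            du = series_at (with_leading (\<lambda>_ _. 0) u) R \<Psi> S;
            dv = series_at (with_leading (\<lambda>_ _. 0) v) R \<Psi> S
        in D (with_leading (\<lambda>R \<Psi>. R) u) R \<Psi> S = taylor_series \<Lambda> R \<Psi> du dv \<and>
           D (with_leading (\<lambda>R \<Psi>. \<Psi>) v) R \<Psi> S = taylor_series \<Omega> R \<Psi> du dv)"

section \<open>The truncated system and its particular solution\<close>

definition truncated_rhs :: "nat \<Rightarrow> nat \<Rightarrow> (nat \<Rightarrow> real \<Rightarrow> real \<Rightarrow> real) \<Rightarrow>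
    real \<Rightarrow> real \<Rightarrow> real \<Rightarrow> real" where
  "truncated_rhs q N H \<rho> \<phi> t = (\<Sum>k=1..N. t powr (- (real k / (2 * real q))) * H k \<rho> \<phi>)"

text \<open>A solution near \<open>t = \<infinity>\<close> with full asymptotic expansions.  The constants \<open>\<rho>c\<close>, \<open>\<phi>c\<close> are then
  forced to be those found by substituting the series into the system.\<close>

definition particular_solution ::
  "nat \<Rightarrow> nat \<Rightarrow> real \<Rightarrow> nat \<Rightarrow> (nat \<Rightarrow> real \<Rightarrow> real \<Rightarrow> real) \<Rightarrow>
     (nat \<Rightarrow> real \<Rightarrow> real \<Rightarrow> real) \<Rightarrow> (real \<Rightarrow> real) \<Rightarrow> (real \<Rightarrow> real) \<Rightarrow> bool" where
  "particular_solution q m \<psi>0 N \<Lambda> \<Omega> \<rho> \<phi> \<longleftrightarrow>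
     (\<forall>\<^sub>F t in at_top.
        (\<rho> has_real_derivative truncated_rhs q N \<Lambda> (\<rho> t) (\<phi> t) t) (at t) \<and>
        (\<phi> has_real_derivative truncated_rhs q N \<Omega> (\<rho> t) (\<phi> t) t) (at t)) \<and>
     (\<exists>\<rho>c \<phi>c :: nat \<Rightarrow> real. \<forall>K\<ge>1.
        (\<lambda>t. \<rho> t - (\<Sum>k=1..<K. t powr (- ((real k + real m - 2) / (2 * real q))) * \<rho>c k))
          \<in> O[at_top](\<lambda>t. t powr (- ((real K + real m - 2) / (2 * real q)))) \<and>
        (\<lambda>t. \<phi> t - \<psi>0 - (\<Sum>k=1..<K. t powr (- (real k / (2 * real q))) * \<phi>c k))
          \<in> O[at_top](\<lambda>t. t powr (- (real K / (2 * real q)))))"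

definition d_coeff ::
  "nat \<Rightarrow> nat \<Rightarrow> real \<Rightarrow> (nat \<Rightarrow> real \<Rightarrow> real \<Rightarrow> real) \<Rightarrow> (nat \<Rightarrow> real \<Rightarrow> real \<Rightarrow> real) \<Rightarrow> real" where
  "d_coeff n m \<psi>0 \<Lambda> \<Omega> =
     (let lam = deriv (\<lambda>\<rho>. \<Lambda> n \<rho> \<psi>0) 0; om = deriv (\<lambda>\<psi>. \<Omega> m 0 \<psi>) \<psi>0
      in if n < m then lam else if n = m then lam + om else om)"

text \<open>Distance of \<open>(r, \<phi>)\<close> to the resonant state \<open>(a + t powr (- 1 / (2 q)) * \<rho> t, \<kappa> / \<mu> * S t + \<phi>s t)\<close>.\<close>

definition resonant_deviation ::
  "nat \<Rightarrow> nat \<Rightarrow> nat \<Rightarrow> real \<Rightarrow> (real \<Rightarrow> real) \<Rightarrow> (real \<Rightarrow> real) \<Rightarrow> (real \<Rightarrow> real) \<Rightarrow>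
     (real \<Rightarrow> real) \<Rightarrow> (real \<Rightarrow> real) \<Rightarrow> real \<Rightarrow> real" where
  "resonant_deviation q \<kappa> \<mu> a Sf \<rho>s \<phi>s r \<phi> t =
     \<bar>r t - a - t powr (- (1 / (2 * real q))) * \<rho>s t\<bar> + \<bar>\<phi> t - real \<kappa> / real \<mu> * Sf t - \<phi>s t\<bar>"

end

theory Submission
  imports Defs
begin

text \<open>
  Invariance under \<open>(R, \<tau>) \<mapsto> (- R, - \<tau>)\<close> gives \<open>\<Lambda>\<^sub>k\<close> and \<open>\<Omega>\<^sub>k\<close> a parity in \<open>R\<close>.  Hence \<open>n = 2 l + 1\<close>
  is odd, \<open>m < n < 2 q\<close> and \<open>d\<^sub>n\<^sub>,\<^sub>m = \<omega>\<^sub>m < 0\<close>: only the angle is damped.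

  The near-identity change of variables turns the perturbed system into the truncated system with an
  error \<open>O(\<tau> ^ (N + 1))\<close>.  For \<open>X = \<tau> ^ (- l) (\<rho> - \<rho>\<^sub>*)\<close> and \<open>y = \<psi> - \<phi>\<^sub>*\<close>, where \<open>\<rho>\<^sub>*\<close>, \<open>\<phi>\<^sub>*\<close> is the particular
  solution, this is, up to small terms and signs, an oscillator \<open>X' = \<tau> ^ (l + 1) \<nu>\<^sub>n y\<close>,
  \<open>y' = \<tau> ^ (l + 1) \<eta> X + \<tau> ^ m \<omega>\<^sub>m y\<close>.  Its energy, corrected by a small multiple of \<open>X y\<close>, is a Lyapunov
  function \<open>W\<close> with \<open>W' \<le> - \<theta> \<tau> ^ (2 l) (X\<^sup>2 + y\<^sup>2) + O(\<tau> ^ (N + 1 - l))\<close>, so for \<open>N \<ge> 3 n\<close> small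
  sublevel sets of \<open>W\<close> cannot be left.

  It remains to enter such a set: a solution that starts at the particular solution has
  \<open>\<rho> - \<rho>\<^sub>* = \<Sum>k. \<tau> ^ k u\<^sub>k\<close>, which may exceed \<open>\<tau> ^ l\<close>.  As the \<open>u\<^sub>k\<close> have zero mean in \<open>S\<close>, there are arbitrarily
  late times at which this sum is \<open>O(1 / t)\<close>, and \<open>t\<^sub>*\<close> is chosen among them.
\<close>

section \<open>Smooth functions\<close>

text \<open>The obstacle is the weakness of the damping. Scaling by \<open>\<tau> ^ l\<close> gives
  both couplings, \<open>\<tau> ^ n * \<nu> * y\<close> and \<open>\<tau> * \<eta> * x\<close>, the
  same order \<open>\<tau> ^ (l + 1)\<close>. The damping has order \<open>\<tau> ^ m\<close> with
  \<open>m\<close> up to \<open>2 * l\<close>, so a restoring force known only up to a relative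
  error \<open>O(\<tau>)\<close> could leave terms that dominate it. Therefore the potential energy
  is built from all \<open>\<Lambda> k 0\<close> with \<open>n \<le> k \<le> N\<close> and is
  centred at the moving point \<open>\<phi>s t\<close>: the conservative terms cancel identically,
  not just to leading order. What remains is harmless because \<open>\<phi>s\<close> drifts at a
  rate \<open>O(\<tau> ^ (m + 1))\<close>; a rate of exact order \<open>\<tau> ^ m\<close> would
  contradict its convergence. The formal identities for the averaged coefficients become estimates
  through a calculus of expansions that are uniform on a strip. A solution is given only on an
  interval: clamping the radius makes the field globally Lipschitz, the solution is continued for
  the clamped field, and confinement shows afterwards that the clamp is never active.\<close>

lemma Ck_on_cong:
  assumes "Ck_on n D h" and "\<And>x. x \<in> D \<Longrightarrow> k x = h x"
  shows "Ck_on n D k"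
  using assms
proof (induction n arbitrary: h k)
  case 0
  then show ?case using continuous_on_cong[of D D k h] by simp
next
  case (Suc n)
  then obtain h' where h': "\<forall>x\<in>D. (h has_derivative h' x) (at x within D)"
    "\<forall>v. Ck_on n D (\<lambda>x. h' x v)" by auto
  have "\<forall>x\<in>D. (k has_derivative h' x) (at x within D)"
    using h'(1) Suc.prems(2) by (metis has_derivative_transform)
  then show ?case using h'(2) by auto
qed

lemma Ck_on_subset:
  assumes "Ck_on n D h" and "E \<subseteq> D"
  shows "Ck_on n E h"
  using assms
proof (induction n arbitrary: h)
  case 0
  then show ?case by (auto intro: continuous_on_subset)
next
  case (Suc n)
  then obtain h' where h': "\<forall>x\<in>D. (h has_derivative h' x) (at x within D)"
    "\<forall>v. Ck_on n D (\<lambda>x. h' x v)" by auto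
  then have "\<forall>x\<in>E. (h has_derivative h' x) (at x within E)"
    using Suc.prems(2) has_derivative_subset by blast
  then show ?case using h'(2) Suc by auto
qed

lemma smooth_on_subset: "smooth_on D h \<Longrightarrow> E \<subseteq> D \<Longrightarrow> smooth_on E h"
  by (auto simp: smooth_on_def intro: Ck_on_subset)

lemma smooth_on_continuous: "smooth_on D h \<Longrightarrow> continuous_on D h"
  using Ck_on.simps(1) smooth_on_def by blast

lemma smooth_on_obtain_derivative:
  assumes "smooth_on D h"
  obtains h' where "\<And>x. x \<in> D \<Longrightarrow> (h has_derivative h' x) (at x within D)"
    and "\<And>v. continuous_on D (\<lambda>x. h' x v)"
proof -
  have "Ck_on (Suc 0) D h" using assms smooth_on_def by blast
  then show ?thesis using that by auto
qed

text \<open>As a total function of the point, built on \<open>frechet_derivative\<close>, it can be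
  iterated with \<open>^^\<close> without carrying derivative witnesses along. It is meaningful only
  where the function is differentiable at the point itself, hence the open domains below.\<close>

definition dir_deriv :: "'a::real_normed_vector \<Rightarrow> ('a \<Rightarrow> real) \<Rightarrow> 'a \<Rightarrow> real" where
  "dir_deriv v h x = frechet_derivative h (at x) v"

lemma dir_deriv_eq: "(h has_derivative h') (at x) \<Longrightarrow> dir_deriv v h x = h' v"
  by (metis dir_deriv_def frechet_derivative_at)

lemma smooth_on_has_derivative:
  assumes "open D" "smooth_on D h" "x \<in> D"
  shows "(h has_derivative (\<lambda>v. dir_deriv v h x)) (at x)"
proof -
  have "Ck_on (Suc 0) D h" using assms smooth_on_def by blast
  then obtain h' where "\<forall>x\<in>D. (h has_derivative h' x) (at x within D)" by auto
  then have d: "(h has_derivative h' x) (at x)"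
    using assms(3) at_within_open[OF assms(3,1)] by auto
  then have "h' x = (\<lambda>v. dir_deriv v h x)" using dir_deriv_eq[OF d] by simp
  then show ?thesis using d by simp
qed

lemma smooth_on_dir_deriv:
  assumes "open D" "smooth_on D h"
  shows "smooth_on D (dir_deriv v h)"
  unfolding smooth_on_def
proof
  fix n
  have "Ck_on (Suc n) D h" using assms smooth_on_def by blast
  then obtain h' where h': "\<forall>x\<in>D. (h has_derivative h' x) (at x within D)"
    "\<forall>v. Ck_on n D (\<lambda>x. h' x v)" by auto
  have "dir_deriv v h x = h' x v" if "x \<in> D" for x
    using h'(1)[rule_format, OF that] at_within_open[OF that assms(1)] dir_deriv_eq[of h "h' x" x v]
    by simp
  then show "Ck_on n D (dir_deriv v h)" using Ck_on_cong h'(2) by blast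
qed

lemma smooth_on_dir_deriv_iter:
  assumes "open D" "smooth_on D h"
  shows "smooth_on D ((dir_deriv v ^^ i) h)"
  by (induction i) (auto simp: assms smooth_on_dir_deriv)

lemma DERIV_line:
  fixes h :: "'a::real_normed_vector \<Rightarrow> real"
  assumes "open D" "smooth_on D h" "x + r *\<^sub>R v \<in> D"
  shows "((\<lambda>r. h (x + r *\<^sub>R v)) has_real_derivative dir_deriv v h (x + r *\<^sub>R v)) (at r)"
proof -
  have d: "(h has_derivative (\<lambda>w. dir_deriv w h (x + r *\<^sub>R v))) (at (x + r *\<^sub>R v))"
    using smooth_on_has_derivative assms by blast
  have "((\<lambda>r. x + r *\<^sub>R v) has_derivative (\<lambda>s. s *\<^sub>R v)) (at r)"
    by (auto intro!: derivative_eq_intros)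
  from has_derivative_compose[OF this d]
  have "((\<lambda>r. h (x + r *\<^sub>R v)) has_derivative (\<lambda>s. dir_deriv (s *\<^sub>R v) h (x + r *\<^sub>R v))) (at r)" .
  moreover have "(\<lambda>s. dir_deriv (s *\<^sub>R v) h (x + r *\<^sub>R v)) = (*) (dir_deriv v h (x + r *\<^sub>R v))"
    using linear_scale[OF has_derivative_linear[OF d]] by (auto simp: mult.commute)
  ultimately show ?thesis by (simp add: has_field_derivative_def)
qed

text \<open>Translates the iterated slice derivatives \<open>deriv ^^ i\<close> of the definitions
  into iterated directional derivatives, which are smooth functions on the whole domain. The
  induction works because \<open>deriv\<close> depends only on values near \<open>r\<close>, and
  openness of \<open>D\<close> keeps the line inside \<open>D\<close> near \<open>r\<close>.\<close>

lemma deriv_iter_line: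
  fixes h :: "'a::real_normed_vector \<Rightarrow> real"
  assumes "open D" "smooth_on D h" "x + r *\<^sub>R v \<in> D"
  shows "(deriv ^^ i) (\<lambda>r. h (x + r *\<^sub>R v)) r = (dir_deriv v ^^ i) h (x + r *\<^sub>R v)"
  using assms(3)
proof (induction i arbitrary: r)
  case 0
  then show ?case by simp
next
  case (Suc i)
  have "open ((\<lambda>r. x + r *\<^sub>R v) -` D)"
    by (intro open_vimage assms continuous_intros)
  then have "eventually (\<lambda>s. x + s *\<^sub>R v \<in> D) (nhds r)"
    using eventually_nhds_in_open[of "(\<lambda>r. x + r *\<^sub>R v) -` D" r] Suc.prems by simp
  then have ev: "eventually (\<lambda>s. (deriv ^^ i) (\<lambda>r. h (x + r *\<^sub>R v)) s = (dir_deriv v ^^ i) h (x + s *\<^sub>R v)) (nhds r)"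
    by eventually_elim (rule Suc.IH)
  have "deriv ((deriv ^^ i) (\<lambda>r. h (x + r *\<^sub>R v))) r = deriv (\<lambda>s. (dir_deriv v ^^ i) h (x + s *\<^sub>R v)) r"
    using deriv_cong_ev[OF ev refl] .
  also have "\<dots> = dir_deriv v ((dir_deriv v ^^ i) h) (x + r *\<^sub>R v)"
    using DERIV_line[OF assms(1) smooth_on_dir_deriv_iter[OF assms(1,2), where v = v and i = i] Suc.prems]
    by (rule DERIV_imp_deriv)
  finally show ?case by simp
qed

lemma Taylor_line:
  fixes h :: "'a::real_normed_vector \<Rightarrow> real"
  assumes "open D" "smooth_on D h" "\<And>r. \<bar>r\<bar> \<le> \<bar>s\<bar> \<Longrightarrow> x + r *\<^sub>R v \<in> D"
  shows "\<exists>r. \<bar>r\<bar> \<le> \<bar>s\<bar> \<and> h (x + s *\<^sub>R v) =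
     (\<Sum>i<n. (dir_deriv v ^^ i) h x / fact i * s ^ i) + (dir_deriv v ^^ n) h (x + r *\<^sub>R v) / fact n * s ^ n"
proof -
  have "\<forall>m t. m < n \<and> \<bar>t\<bar> \<le> \<bar>s\<bar> \<longrightarrow>
     DERIV (\<lambda>r. (dir_deriv v ^^ m) h (x + r *\<^sub>R v)) t :> (dir_deriv v ^^ Suc m) h (x + t *\<^sub>R v)"
    using DERIV_line[OF assms(1) smooth_on_dir_deriv_iter[OF assms(1,2)]] assms(3) by simp
  from Maclaurin_bi_le[OF _ this, of "\<lambda>r. h (x + r *\<^sub>R v)"] show ?thesis by simp
qed

text \<open>Derivatives inherit periodicity, which lets bounds over one period serve for all phases.
  The invariance of \<open>h\<close> is known on \<open>D\<close> only, so the derivative of the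
  translate is transferred through openness of \<open>D\<close>.\<close>

lemma dir_deriv_iter_translate:
  assumes "open D" "smooth_on D h" "\<And>x. x \<in> D \<Longrightarrow> x + c \<in> D" "\<And>x. x \<in> D \<Longrightarrow> h (x + c) = h x" "x \<in> D"
  shows "(dir_deriv v ^^ i) h (x + c) = (dir_deriv v ^^ i) h x"
  using assms(5)
proof (induction i arbitrary: x)
  case 0
  then show ?case using assms by simp
next
  case (Suc i)
  let ?g = "(dir_deriv v ^^ i) h"
  note sm = smooth_on_dir_deriv_iter[OF assms(1,2), where v = v and i = i]
  have d: "(?g has_derivative (\<lambda>w. dir_deriv w ?g (x + c))) (at (x + c))"
    using smooth_on_has_derivative[OF assms(1) sm] assms(3) Suc.prems by blast
  have "((\<lambda>x. x + c) has_derivative (\<lambda>w. w)) (at x)"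
    by (auto intro!: derivative_eq_intros)
  from has_derivative_compose[OF this d]
  have "((\<lambda>x. ?g (x + c)) has_derivative (\<lambda>w. dir_deriv w ?g (x + c))) (at x)" .
  then have "(?g has_derivative (\<lambda>w. dir_deriv w ?g (x + c))) (at x)"
    by (rule has_derivative_transform_within_open[OF _ assms(1) Suc.prems]) (use Suc.IH in auto)
  then show ?case using dir_deriv_eq[of ?g _ x v] by simp
qed

section \<open>Periodic functions and bounds that are uniform over all periods\<close>

lemma periodic_int:
  fixes h :: "'a::ring_1 \<Rightarrow> 'b"
  assumes "\<And>x. h (x + p) = h x"
  shows "h (x + of_int k * p) = h x"
proof -
  have *: "h (x + of_nat n * p) = h x" for n x
  proof (induction n)
    case (Suc n)
    have "h (x + of_nat (Suc n) * p) = h ((x + of_nat n * p) + p)" by (simp add: algebra_simps)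
    then show ?case using Suc assms by metis
  qed auto
  show ?thesis
  proof (cases k)
    case (nonneg n)
    then show ?thesis using * by simp
  next
    case (neg n)
    have "h x = h ((x + of_int k * p) + of_nat (Suc n) * p)"
      unfolding neg by (simp add: algebra_simps)
    then show ?thesis using *[of "x + of_int k * p" "Suc n"] by simp
  qed
qed

lemma shift_into_period:
  fixes x p :: real
  assumes "p > 0"
  obtains k :: int where "0 \<le> x + of_int k * p" "x + of_int k * p < p"
proof -
  let ?k = "- \<lfloor>x / p\<rfloor>"
  have "x / p = frac (x / p) + of_int \<lfloor>x / p\<rfloor>" by (simp add: frac_def)
  then have "x + of_int ?k * p = frac (x / p) * p" using assms by (simp add: field_simps)
  moreover have "0 \<le> frac (x / p) * p" "frac (x / p) * p < 1 * p"
    using assms frac_ge_0 frac_lt_1 by (auto intro: mult_strict_right_mono)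
  ultimately show ?thesis using that[of ?k] by simp
qed

lemma compact_imp_bounded_real:
  fixes h :: "'a::topological_space \<Rightarrow> real"
  assumes "compact K" "continuous_on K h"
  shows "\<exists>C\<ge>0. \<forall>x\<in>K. \<bar>h x\<bar> \<le> C"
proof -
  have "bounded (h ` K)" using assms compact_continuous_image compact_imp_bounded by blast
  then obtain B where "\<forall>y\<in>h ` K. norm y \<le> B" unfolding bounded_iff by blast
  then have "\<forall>x\<in>K. \<bar>h x\<bar> \<le> max B 0" by (simp add: le_max_iff_disj)
  then show ?thesis by (meson max.cobounded2)
qed

lemma periodic_bounded:
  fixes h :: "'a::topological_space \<Rightarrow> real \<Rightarrow> real"
  assumes "compact K" "continuous_on (K \<times> UNIV) (\<lambda>(z, S). h z S)"
    and "\<And>z S. z \<in> K \<Longrightarrow> h z (S + p) = h z S" "p > 0"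
  shows "\<exists>C\<ge>0. \<forall>z\<in>K. \<forall>S. \<bar>h z S\<bar> \<le> C"
proof -
  have "continuous_on (K \<times> {0..p}) (\<lambda>(z, S). h z S)"
    by (rule continuous_on_subset[OF assms(2)]) auto
  moreover have "compact (K \<times> {0..p})" using assms compact_Times by blast
  ultimately obtain C where C: "C \<ge> 0" "\<forall>x\<in>K \<times> {0..p}. \<bar>(\<lambda>(z, S). h z S) x\<bar> \<le> C"
    using compact_imp_bounded_real by metis
  have "\<bar>h z S\<bar> \<le> C" if "z \<in> K" for z S
  proof -
    obtain k where k: "0 \<le> S + of_int k * p" "S + of_int k * p < p"
      using shift_into_period[OF assms(4)] .
    have "h z (S + of_int k * p) = h z S" using assms(3) that by (intro periodic_int[of "h z" p S k]) auto
    moreover have "(z, S + of_int k * p) \<in> K \<times> {0..p}" using that k by auto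
    ultimately show ?thesis using C(2)[rule_format, of "(z, S + of_int k * p)"] by simp
  qed
  then show ?thesis using C(1) by blast
qed

lemma Ck_on_const: "Ck_on n D (\<lambda>x. c)"
proof (induction n arbitrary: c)
  case (Suc n)
  have "\<forall>x\<in>D. ((\<lambda>x. c) has_derivative (\<lambda>v. 0)) (at x within D)" by simp
  then show ?case using Suc by (auto intro!: exI[of _ "\<lambda>x v. 0"])
qed simp

lemma smooth_on_bounded_linear:
  assumes "bounded_linear h"
  shows "smooth_on D h"
  unfolding smooth_on_def
proof
  fix n
  show "Ck_on n D h"
  proof (cases n)
    case 0
    then show ?thesis using linear_continuous_on[OF assms] by simp
  next
    case (Suc k)
    have "\<forall>x\<in>D. (h has_derivative h) (at x within D)" using assms bounded_linear_imp_has_derivative by blast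
    then show ?thesis using Ck_on_const Suc by (auto intro!: exI[of _ "\<lambda>x. h"])
  qed
qed

text \<open>Lets \<open>\<omega>\<close>, a function of the radius alone, be treated as one more
  function of the radius, the angles and possibly the time.\<close>

lemma Ck_on_fst:
  assumes "Ck_on n D h"
  shows "Ck_on n (D \<times> E) (\<lambda>z. h (fst z))"
  using assms
proof (induction n arbitrary: h)
  case 0
  then show ?case by (auto intro!: continuous_on_compose2[of D h] continuous_intros)
next
  case (Suc n)
  then obtain h' where h': "\<forall>x\<in>D. (h has_derivative h' x) (at x within D)" "\<forall>v. Ck_on n D (\<lambda>x. h' x v)" by auto
  have "((\<lambda>z. h (fst z)) has_derivative (\<lambda>v. h' (fst z) (fst v))) (at z within D \<times> E)" if z: "z \<in> D \<times> E" for z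
  proof (rule has_derivative_in_compose[of fst fst])
    show "(fst has_derivative fst) (at z within D \<times> E)"
      by (rule bounded_linear_imp_has_derivative[OF bounded_linear_fst])
    show "(h has_derivative h' (fst z)) (at (fst z) within fst ` (D \<times> E))"
      by (rule has_derivative_subset[of _ _ _ D]) (use h'(1) z in auto)
  qed
  moreover have "Ck_on n (D \<times> E) (\<lambda>z. h' (fst z) (fst v))" for v using Suc.IH h'(2) by blast
  ultimately show ?case by (auto intro!: exI[of _ "\<lambda>z v. h' (fst z) (fst v)"])
qed

section \<open>Uniform expansions in powers of \<open>t powr (- 1 / (2 q))\<close>\<close>

definition tau :: "nat \<Rightarrow> real \<Rightarrow> real" where
  "tau q t = t powr (- (1 / (2 * real q)))"

lemma tau_pos: "t > 0 \<Longrightarrow> 0 < tau q t"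
  by (simp add: tau_def)

lemma tau_le_1: "1 \<le> t \<Longrightarrow> tau q t \<le> 1"
  using powr_mono[of "- (1 / (2 * real q))" 0 t] by (simp add: tau_def)

lemma tau_power: "t > 0 \<Longrightarrow> tau q t ^ k = t powr (- (real k / (2 * real q)))"
  by (simp add: tau_def powr_powr powr_realpow[symmetric])

lemma tau_power_2q: "q \<ge> 1 \<Longrightarrow> t > 0 \<Longrightarrow> tau q t ^ (2 * q) = 1 / t"
  by (simp add: tau_power powr_minus divide_simps)

lemma tau_tendsto: "q \<ge> 1 \<Longrightarrow> (tau q \<longlongrightarrow> 0) at_top"
  unfolding tau_def by (intro tendsto_neg_powr filterlim_ident) auto

lemma tau_power_mono: "1 \<le> t \<Longrightarrow> i \<le> j \<Longrightarrow> tau q t ^ j \<le> tau q t ^ i"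
  by (rule power_decreasing) (use tau_pos[of t q] tau_le_1[of t q] in auto)

lemma DERIV_tau:
  assumes "q \<ge> 1" "t > 0"
  shows "(tau q has_real_derivative - (1 / (2 * real q)) * tau q t ^ (2 * q + 1)) (at t within A)"
proof -
  have "((\<lambda>t. t powr (- (1 / (2 * real q)))) has_real_derivative
      - (1 / (2 * real q)) * t powr (- (1 / (2 * real q)) - 1)) (at t within A)"
    using assms by (auto intro!: derivative_eq_intros)
  moreover have "t powr (- (1 / (2 * real q)) - 1) = tau q t ^ (2 * q + 1)"
    using assms tau_power_2q[of q t] by (simp add: tau_def powr_diff)
  ultimately show ?thesis by (simp add: tau_def[abs_def])
qed

lemma DERIV_tau_power:
  assumes "q \<ge> 1" "t > 0"
  shows "((\<lambda>t. tau q t ^ j) has_real_derivative - (real j / (2 * real q)) * tau q t ^ (2 * q) * tau q t ^ j) (at t within A)"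
proof (cases j)
  case 0
  then show ?thesis by simp
next
  case (Suc i)
  show ?thesis
    by (rule DERIV_cong[OF DERIV_power[OF DERIV_tau[OF assms]]]) (simp add: Suc)
qed

lemma eventually_tau_less: "q \<ge> 1 \<Longrightarrow> 0 < e \<Longrightarrow> \<forall>\<^sub>F t in at_top. tau q t < e"
  by (rule order_tendstoD(2)[OF tau_tendsto])

text \<open>Agreement with a partial sum up to \<open>O(\<tau> ^ (N + 1))\<close>, uniformly over
  \<open>Z\<close>. The coefficient bounds belong to the definition because products stay uniform
  only if the coefficients are bounded over \<open>Z\<close>. The closure lemmas below let
  identities between formal power series be read as estimates between functions.\<close>

definition expands :: "nat \<Rightarrow> nat \<Rightarrow> 'z set \<Rightarrow> ('z \<Rightarrow> real \<Rightarrow> real) \<Rightarrow> ('z \<Rightarrow> real fps) \<Rightarrow> bool" where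
  "expands q N Z h c \<longleftrightarrow> (\<exists>C. (\<forall>z\<in>Z. \<forall>k\<le>N. \<bar>fps_nth (c z) k\<bar> \<le> C) \<and>
     (\<forall>\<^sub>F t in at_top. \<forall>z\<in>Z.
        \<bar>h z t - (\<Sum>k\<le>N. fps_nth (c z) k * tau q t ^ k)\<bar> \<le> C * tau q t ^ Suc N))"

lemma expandsI:
  assumes "\<And>z k. z \<in> Z \<Longrightarrow> k \<le> N \<Longrightarrow> \<bar>fps_nth (c z) k\<bar> \<le> B"
    and "\<forall>\<^sub>F t in at_top. \<forall>z\<in>Z.
        \<bar>h z t - (\<Sum>k\<le>N. fps_nth (c z) k * tau q t ^ k)\<bar> \<le> C * tau q t ^ Suc N"
  shows "expands q N Z h c"
  unfolding expands_def
proof (intro exI conjI ballI allI impI)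
  show "\<bar>fps_nth (c z) k\<bar> \<le> max B C" if "z \<in> Z" "k \<le> N" for z k
    using assms(1)[OF that] by linarith
  show "\<forall>\<^sub>F t in at_top. \<forall>z\<in>Z.
        \<bar>h z t - (\<Sum>k\<le>N. fps_nth (c z) k * tau q t ^ k)\<bar> \<le> max B C * tau q t ^ Suc N"
    using assms(2) eventually_gt_at_top[of 0]
  proof eventually_elim
    case (elim t)
    have "C * tau q t ^ Suc N \<le> max B C * tau q t ^ Suc N"
      using tau_pos[OF elim(2), of q] by (intro mult_right_mono) auto
    then show ?case using elim(1) by (meson order_trans)
  qed
qed

lemma expandsE:
  assumes "expands q N Z h c"
  obtains C where "C \<ge> 0" "\<And>z k. z \<in> Z \<Longrightarrow> k \<le> N \<Longrightarrow> \<bar>fps_nth (c z) k\<bar> \<le> C"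
    "\<forall>\<^sub>F t in at_top. \<forall>z\<in>Z.
        \<bar>h z t - (\<Sum>k\<le>N. fps_nth (c z) k * tau q t ^ k)\<bar> \<le> C * tau q t ^ Suc N"
\<comment> \<open>An empty \<open>Z\<close> puts no constraint on \<open>C\<close>, so its sign has
  to be chosen separately.\<close>
proof (cases "Z = {}")
  case True
  show ?thesis by (rule that[of 0]) (simp_all add: True)
next
  case False
  obtain C where C: "\<forall>z\<in>Z. \<forall>k\<le>N. \<bar>fps_nth (c z) k\<bar> \<le> C"
    "\<forall>\<^sub>F t in at_top. \<forall>z\<in>Z.
        \<bar>h z t - (\<Sum>k\<le>N. fps_nth (c z) k * tau q t ^ k)\<bar> \<le> C * tau q t ^ Suc N"
    using assms[unfolded expands_def] by (elim exE conjE that)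
  from False obtain z where "z \<in> Z" by blast
  then have "0 \<le> C" using C(1)[rule_format, of z 0] by linarith
  then show ?thesis by (rule that) (use C in blast)+
qed

lemma expands_cong:
  assumes "expands q N Z h c"
    and "\<And>z k. z \<in> Z \<Longrightarrow> k \<le> N \<Longrightarrow> fps_nth (c' z) k = fps_nth (c z) k"
    and "\<forall>\<^sub>F t in at_top. \<forall>z\<in>Z. h' z t = h z t"
  shows "expands q N Z h' c'"
proof -
  obtain C where C: "C \<ge> 0" "\<And>z k. z \<in> Z \<Longrightarrow> k \<le> N \<Longrightarrow> \<bar>fps_nth (c z) k\<bar> \<le> C"
    "\<forall>\<^sub>F t in at_top. \<forall>z\<in>Z.
        \<bar>h z t - (\<Sum>k\<le>N. fps_nth (c z) k * tau q t ^ k)\<bar> \<le> C * tau q t ^ Suc N"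
    using expandsE[OF assms(1)] by blast
  show ?thesis
  proof (rule expandsI)
    show "\<bar>fps_nth (c' z) k\<bar> \<le> C" if "z \<in> Z" "k \<le> N" for z k
      using C(2) assms(2) that by simp
    show "\<forall>\<^sub>F t in at_top. \<forall>z\<in>Z.
        \<bar>h' z t - (\<Sum>k\<le>N. fps_nth (c' z) k * tau q t ^ k)\<bar> \<le> C * tau q t ^ Suc N"
      using C(3) assms(3) by eventually_elim (simp add: assms(2))
  qed
qed

text \<open>Errors of order \<open>\<tau> ^ (N + 1)\<close> are invisible to an expansion of order
  \<open>N\<close>; Taylor remainders and the remainders of \<open>f\<close> and \<open>g\<close>
  are absorbed in this way.\<close>

lemma expands_perturb:
  assumes "expands q N Z h c"
    and "\<forall>\<^sub>F t in at_top. \<forall>z\<in>Z. \<bar>h' z t - h z t\<bar> \<le> B * tau q t ^ Suc N"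
  shows "expands q N Z h' c"
proof -
  obtain C where C: "C \<ge> 0" "\<And>z k. z \<in> Z \<Longrightarrow> k \<le> N \<Longrightarrow> \<bar>fps_nth (c z) k\<bar> \<le> C"
    "\<forall>\<^sub>F t in at_top. \<forall>z\<in>Z.
        \<bar>h z t - (\<Sum>k\<le>N. fps_nth (c z) k * tau q t ^ k)\<bar> \<le> C * tau q t ^ Suc N"
    using expandsE[OF assms(1)] by blast
  show ?thesis
  proof (rule expandsI)
    show "\<bar>fps_nth (c z) k\<bar> \<le> C" if "z \<in> Z" "k \<le> N" for z k
      using C(2) that by simp
    show "\<forall>\<^sub>F t in at_top. \<forall>z\<in>Z.
        \<bar>h' z t - (\<Sum>k\<le>N. fps_nth (c z) k * tau q t ^ k)\<bar> \<le> (C + B) * tau q t ^ Suc N"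
      using C(3) assms(2)
    proof eventually_elim
      case (elim t)
      show ?case
      proof
        fix z assume "z \<in> Z"
        then have "\<bar>h z t - (\<Sum>k\<le>N. fps_nth (c z) k * tau q t ^ k)\<bar> \<le> C * tau q t ^ Suc N"
          "\<bar>h' z t - h z t\<bar> \<le> B * tau q t ^ Suc N" using elim by blast+
        then show "\<bar>h' z t - (\<Sum>k\<le>N. fps_nth (c z) k * tau q t ^ k)\<bar> \<le> (C + B) * tau q t ^ Suc N"
          unfolding distrib_right by linarith
      qed
    qed
  qed
qed

lemma expands_add:
  assumes "expands q N Z h c" "expands q N Z k d"
  shows "expands q N Z (\<lambda>z t. h z t + k z t) (\<lambda>z. c z + d z)"
proof -
  obtain C where C: "C \<ge> 0" "\<And>z k. z \<in> Z \<Longrightarrow> k \<le> N \<Longrightarrow> \<bar>fps_nth (c z) k\<bar> \<le> C"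
    "\<forall>\<^sub>F t in at_top. \<forall>z\<in>Z.
        \<bar>h z t - (\<Sum>k\<le>N. fps_nth (c z) k * tau q t ^ k)\<bar> \<le> C * tau q t ^ Suc N"
    using expandsE[OF assms(1)] by blast
  obtain D where D: "D \<ge> 0" "\<And>z k. z \<in> Z \<Longrightarrow> k \<le> N \<Longrightarrow> \<bar>fps_nth (d z) k\<bar> \<le> D"
    "\<forall>\<^sub>F t in at_top. \<forall>z\<in>Z.
        \<bar>k z t - (\<Sum>k\<le>N. fps_nth (d z) k * tau q t ^ k)\<bar> \<le> D * tau q t ^ Suc N"
    using expandsE[OF assms(2)] by blast
  show ?thesis
  proof (rule expandsI)
    show "\<bar>fps_nth (c z + d z) k\<bar> \<le> C + D" if "z \<in> Z" "k \<le> N" for z k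
      using C(2)[OF that] D(2)[OF that] by simp
    show "\<forall>\<^sub>F t in at_top. \<forall>z\<in>Z.
        \<bar>h z t + k z t - (\<Sum>k\<le>N. fps_nth (c z + d z) k * tau q t ^ k)\<bar> \<le> (C + D) * tau q t ^ Suc N"
      using C(3) D(3)
    proof eventually_elim
      case (elim t)
      show ?case
      proof
        fix z assume "z \<in> Z"
        then have "\<bar>h z t - (\<Sum>k\<le>N. fps_nth (c z) k * tau q t ^ k)\<bar> \<le> C * tau q t ^ Suc N"
          "\<bar>k z t - (\<Sum>k\<le>N. fps_nth (d z) k * tau q t ^ k)\<bar> \<le> D * tau q t ^ Suc N"
          using elim by blast+
        then show "\<bar>h z t + k z t - (\<Sum>k\<le>N. fps_nth (c z + d z) k * tau q t ^ k)\<bar> \<le> (C + D) * tau q t ^ Suc N"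
          unfolding distrib_right fps_add_nth sum.distrib by linarith
      qed
    qed
  qed
qed

text \<open>The product of the partial sums runs over a square of index pairs, the Cauchy product
  over the triangle \<open>i + j \<le> N\<close>. The pairs outside the triangle, at most
  \<open>(N + 1) ^ 2\<close> of them, all carry a power of at least \<open>N + 1\<close>.\<close>

lemma truncated_product_bound:
  fixes a b :: "nat \<Rightarrow> real"
  assumes "\<And>k. k \<le> N \<Longrightarrow> \<bar>a k\<bar> \<le> A" "\<And>k. k \<le> N \<Longrightarrow> \<bar>b k\<bar> \<le> B" "0 \<le> x" "x \<le> 1"
  shows "\<bar>(\<Sum>k\<le>N. a k * x ^ k) * (\<Sum>k\<le>N. b k * x ^ k) - (\<Sum>k\<le>N. (\<Sum>i\<le>k. a i * b (k - i)) * x ^ k)\<bar>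
     \<le> A * B * (real (Suc N))\<^sup>2 * x ^ Suc N"
proof -
  let ?g = "\<lambda>(i, j). a i * b j * x ^ (i + j)"
  let ?I = "{..N} \<times> {..N}" and ?T = "{(i, j). i + j \<le> N}"
  have AB: "0 \<le> A" "0 \<le> B" using assms(1,2)[of 0] by linarith+
  have fin: "finite ?I" by simp
  have sub: "?T \<subseteq> ?I" by auto
  have p: "(\<Sum>k\<le>N. a k * x ^ k) * (\<Sum>k\<le>N. b k * x ^ k) = sum ?g ?I"
    by (simp add: sum_product sum.cartesian_product power_add algebra_simps)
  have t: "(\<Sum>k\<le>N. (\<Sum>i\<le>k. a i * b (k - i)) * x ^ k) = sum ?g ?T"
    by (subst sum.triangle_reindex_eq) (simp add: sum_distrib_right)
  have "sum ?g ?I - sum ?g ?T = sum ?g (?I - ?T)"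
    using sum_diff[OF fin sub, of ?g] by simp
  also have "\<bar>\<dots>\<bar> \<le> (\<Sum>z\<in>?I - ?T. A * B * x ^ Suc N)"
  proof (rule order_trans[OF sum_abs], rule sum_mono)
    fix z assume z: "z \<in> ?I - ?T"
    obtain i j where ij: "z = (i, j)" by (cases z)
    have "i \<le> N" "j \<le> N" "Suc N \<le> i + j" using z ij by auto
    moreover have "x ^ (i + j) \<le> x ^ Suc N"
      using \<open>Suc N \<le> i + j\<close> assms by (intro power_decreasing) auto
    moreover have "\<bar>a i\<bar> * \<bar>b j\<bar> \<le> A * B" using assms(1,2) \<open>i \<le> N\<close> \<open>j \<le> N\<close> AB by (intro mult_mono) auto
    ultimately have "\<bar>a i\<bar> * \<bar>b j\<bar> * x ^ (i + j) \<le> A * B * x ^ Suc N"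
      using assms AB by (intro mult_mono) auto
    then show "\<bar>?g z\<bar> \<le> A * B * x ^ Suc N" using assms by (simp add: ij abs_mult)
  qed
  also have "\<dots> = real (card (?I - ?T)) * (A * B * x ^ Suc N)" by simp
  also have "\<dots> \<le> (real (Suc N))\<^sup>2 * (A * B * x ^ Suc N)"
  proof (rule mult_right_mono)
    have "card (?I - ?T) \<le> card ?I" by (intro card_mono) auto
    then have "real (card (?I - ?T)) \<le> real (card ?I)" by (simp only: of_nat_le_iff)
    then show "real (card (?I - ?T)) \<le> (real (Suc N))\<^sup>2"
      by (simp add: power2_eq_square algebra_simps)
  qed (use AB assms in auto)
  finally show ?thesis unfolding p t by (simp add: algebra_simps)
qed

lemma truncated_sum_bound:
  fixes a :: "nat \<Rightarrow> real"
  assumes "\<And>k. k \<le> N \<Longrightarrow> \<bar>a k\<bar> \<le> A" "0 \<le> x" "x \<le> 1"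
  shows "\<bar>\<Sum>k\<le>N. a k * x ^ k\<bar> \<le> real (Suc N) * A"
proof -
  have "\<bar>a k * x ^ k\<bar> \<le> A" if "k \<le> N" for k
  proof -
    have "\<bar>a k\<bar> * x ^ k \<le> A * 1"
      using assms that by (intro mult_mono) (auto simp: power_le_one intro: order_trans[OF abs_ge_zero])
    then show ?thesis using assms by (simp add: abs_mult)
  qed
  then have "\<bar>\<Sum>k\<le>N. a k * x ^ k\<bar> \<le> (\<Sum>k\<le>N. A)"
    by (intro order_trans[OF sum_abs] sum_mono) auto
  then show ?thesis by simp
qed

lemma expands_bounded:
  assumes "expands q N Z h c"
  shows "\<exists>B\<ge>0. \<forall>\<^sub>F t in at_top. \<forall>z\<in>Z. \<bar>h z t\<bar> \<le> B"
proof -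
  obtain C where C: "C \<ge> 0" "\<And>z k. z \<in> Z \<Longrightarrow> k \<le> N \<Longrightarrow> \<bar>fps_nth (c z) k\<bar> \<le> C"
    "\<forall>\<^sub>F t in at_top. \<forall>z\<in>Z.
        \<bar>h z t - (\<Sum>k\<le>N. fps_nth (c z) k * tau q t ^ k)\<bar> \<le> C * tau q t ^ Suc N"
    using expandsE[OF assms(1)] by blast
  have "\<forall>\<^sub>F t in at_top. \<forall>z\<in>Z. \<bar>h z t\<bar> \<le> C + real (Suc N) * C"
    using C(3) eventually_ge_at_top[of 1]
  proof eventually_elim
    case (elim t)
    have \<tau>: "0 \<le> tau q t" "tau q t \<le> 1" using tau_pos[of t q] tau_le_1[of t q] elim by auto
    have "C * tau q t ^ Suc N \<le> C * 1"
      using C(1) \<tau> by (intro mult_left_mono power_le_one) auto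
    show ?case
    proof
      fix z assume "z \<in> Z"
      then have "\<bar>h z t - (\<Sum>k\<le>N. fps_nth (c z) k * tau q t ^ k)\<bar> \<le> C * tau q t ^ Suc N"
        using elim by blast
      moreover have "\<bar>\<Sum>k\<le>N. fps_nth (c z) k * tau q t ^ k\<bar> \<le> real (Suc N) * C"
        using C(2) \<open>z \<in> Z\<close> \<tau> by (intro truncated_sum_bound) auto
      ultimately show "\<bar>h z t\<bar> \<le> C + real (Suc N) * C"
        using \<open>C * tau q t ^ Suc N \<le> C * 1\<close> by linarith
    qed
  qed
  then show ?thesis using C(1) by (intro exI[of _ "C + real (Suc N) * C"]) auto
qed

lemma expands_mult:
  assumes "expands q N Z h c" "expands q N Z k d"
  shows "expands q N Z (\<lambda>z t. h z t * k z t) (\<lambda>z. c z * d z)"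
proof -
  obtain C where C: "C \<ge> 0" "\<And>z k. z \<in> Z \<Longrightarrow> k \<le> N \<Longrightarrow> \<bar>fps_nth (c z) k\<bar> \<le> C"
    "\<forall>\<^sub>F t in at_top. \<forall>z\<in>Z.
        \<bar>h z t - (\<Sum>k\<le>N. fps_nth (c z) k * tau q t ^ k)\<bar> \<le> C * tau q t ^ Suc N"
    using expandsE[OF assms(1)] by blast
  obtain D where D: "D \<ge> 0" "\<And>z k. z \<in> Z \<Longrightarrow> k \<le> N \<Longrightarrow> \<bar>fps_nth (d z) k\<bar> \<le> D"
    "\<forall>\<^sub>F t in at_top. \<forall>z\<in>Z.
        \<bar>k z t - (\<Sum>k\<le>N. fps_nth (d z) k * tau q t ^ k)\<bar> \<le> D * tau q t ^ Suc N"
    using expandsE[OF assms(2)] by blast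
  obtain B where B: "B \<ge> 0" "\<forall>\<^sub>F t in at_top. \<forall>z\<in>Z. \<bar>k z t\<bar> \<le> B"
    using expands_bounded[OF assms(2)] by blast
  show ?thesis
  proof (rule expandsI)
    show "\<bar>fps_nth (c z * d z) k\<bar> \<le> real (Suc N) * (C * D)" if "z \<in> Z" "k \<le> N" for z k
    proof -
      have "\<bar>fps_nth (c z * d z) k\<bar> \<le> (\<Sum>i=0..k. C * D)"
        unfolding fps_mult_nth
      proof (rule order_trans[OF sum_abs], rule sum_mono)
        fix i assume "i \<in> {0..k}"
        then have "\<bar>fps_nth (c z) i\<bar> \<le> C" "\<bar>fps_nth (d z) (k - i)\<bar> \<le> D" using C D that by auto
        then show "\<bar>fps_nth (c z) i * fps_nth (d z) (k - i)\<bar> \<le> C * D"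
          unfolding abs_mult using C(1) by (intro mult_mono) auto
      qed
      also have "\<dots> = real (Suc k) * (C * D)" by simp
      also have "\<dots> \<le> real (Suc N) * (C * D)" using that C D by (intro mult_right_mono) auto
      finally show ?thesis .
    qed
    show "\<forall>\<^sub>F t in at_top. \<forall>z\<in>Z.
        \<bar>h z t * k z t - (\<Sum>k\<le>N. fps_nth (c z * d z) k * tau q t ^ k)\<bar>
          \<le> (C * B + real (Suc N) * C * D + C * D * (real (Suc N))\<^sup>2) * tau q t ^ Suc N"
      using C(3) D(3) B(2) eventually_ge_at_top[of 1]
    proof eventually_elim
      case (elim t)
      have \<tau>: "0 \<le> tau q t" "tau q t \<le> 1" using tau_pos[of t q] tau_le_1[of t q] elim by auto
      show ?case
      proof
        fix z assume z: "z \<in> Z"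
        let ?P = "\<Sum>k\<le>N. fps_nth (c z) k * tau q t ^ k"
        let ?Q = "\<Sum>k\<le>N. fps_nth (d z) k * tau q t ^ k"
        let ?R = "\<Sum>k\<le>N. fps_nth (c z * d z) k * tau q t ^ k"
        have 1: "\<bar>?P * ?Q - ?R\<bar> \<le> C * D * (real (Suc N))\<^sup>2 * tau q t ^ Suc N"
          using truncated_product_bound[of N "fps_nth (c z)" C "fps_nth (d z)" D "tau q t"] C D z \<tau>
          by (simp add: fps_mult_nth atLeast0AtMost)
        have "\<bar>(h z t - ?P) * k z t\<bar> \<le> (C * tau q t ^ Suc N) * B"
          unfolding abs_mult using elim z C \<tau> by (intro mult_mono) auto
        moreover have "\<bar>?P * (k z t - ?Q)\<bar> \<le> (real (Suc N) * C) * (D * tau q t ^ Suc N)"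
          unfolding abs_mult using elim z C \<tau> by (intro mult_mono truncated_sum_bound) auto
        moreover have "h z t * k z t - ?R = (h z t - ?P) * k z t + ?P * (k z t - ?Q) + (?P * ?Q - ?R)"
          by (simp add: algebra_simps)
        ultimately have "\<bar>h z t * k z t - ?R\<bar> \<le> (C * tau q t ^ Suc N) * B
           + (real (Suc N) * C) * (D * tau q t ^ Suc N) + C * D * (real (Suc N))\<^sup>2 * tau q t ^ Suc N"
          using 1 by linarith
        then show "\<bar>h z t * k z t - ?R\<bar>
          \<le> (C * B + real (Suc N) * C * D + C * D * (real (Suc N))\<^sup>2) * tau q t ^ Suc N"
          by (simp only: algebra_simps)
      qed
    qed
  qed
qed

lemma expands_coeffs:
  assumes "\<And>k. k \<le> N \<Longrightarrow> \<exists>B. \<forall>z\<in>Z. \<bar>w k z\<bar> \<le> B"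
  shows "expands q N Z (\<lambda>z t. \<Sum>k\<le>N. w k z * tau q t ^ k) (\<lambda>z. Abs_fps (\<lambda>k. w k z))"
proof -
  obtain b where b: "\<And>k z. k \<le> N \<Longrightarrow> z \<in> Z \<Longrightarrow> \<bar>w k z\<bar> \<le> b k"
    using assms by metis
  show ?thesis
  proof (rule expandsI)
    show "\<bar>fps_nth (Abs_fps (\<lambda>k. w k z)) k\<bar> \<le> (\<Sum>k\<le>N. \<bar>b k\<bar>)" if "z \<in> Z" "k \<le> N" for z k
    proof -
      have "\<bar>w k z\<bar> \<le> \<bar>b k\<bar>" using b that by fastforce
      also have "\<dots> \<le> (\<Sum>k\<le>N. \<bar>b k\<bar>)" using that by (intro member_le_sum) auto
      finally show ?thesis by simp
    qed
    show "\<forall>\<^sub>F t in at_top. \<forall>z\<in>Z. \<bar>(\<Sum>k\<le>N. w k z * tau q t ^ k) -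
       (\<Sum>k\<le>N. fps_nth (Abs_fps (\<lambda>k. w k z)) k * tau q t ^ k)\<bar> \<le> 0 * tau q t ^ Suc N"
      by simp
  qed
qed

lemma expands_const:
  assumes "\<exists>B. \<forall>z\<in>Z. \<bar>b z\<bar> \<le> B"
  shows "expands q N Z (\<lambda>z t. b z) (\<lambda>z. fps_const (b z))"
proof -
  obtain B where B: "\<forall>z\<in>Z. \<bar>b z\<bar> \<le> B" using assms by blast
  have "\<exists>B. \<forall>z\<in>Z. \<bar>if k = 0 then b z else 0\<bar> \<le> B" for k :: nat
    using B by (cases "k = 0") auto
  then have "expands q N Z (\<lambda>z t. \<Sum>k\<le>N. (if k = 0 then b z else 0) * tau q t ^ k)
     (\<lambda>z. Abs_fps (\<lambda>k. if k = 0 then b z else 0))"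
    by (intro expands_coeffs)
  then show ?thesis
    by (rule expands_cong) (auto simp: if_distrib[of "\<lambda>x. x * _"] sum.delta cong: if_cong)
qed

lemma expands_zero: "expands q N Z (\<lambda>z t. 0) (\<lambda>z. 0)"
  using expands_const[of Z "\<lambda>_. 0"] by auto

lemma expands_tau: "expands q N Z (\<lambda>z t. tau q t) (\<lambda>z. fps_X)"
\<comment> \<open>For \<open>N = 0\<close> the nonzero coefficient of \<open>fps_X\<close> lies
  beyond the order considered, and the function is its own remainder.\<close>
proof (cases "N = 0")
  case True
  show ?thesis
    by (rule expandsI[where B = 1 and C = 1]) (simp_all add: True fps_X_def eventually_mono[OF eventually_gt_at_top[of 0]] tau_pos less_imp_le)
next
  case False
  have "expands q N Z (\<lambda>z t. \<Sum>k\<le>N. (if k = 1 then 1 else 0) * tau q t ^ k)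
     (\<lambda>z. Abs_fps (\<lambda>k. if k = 1 then 1 else 0))"
    by (rule expands_coeffs) (auto intro!: exI[of _ 1])
  then show ?thesis
    by (rule expands_cong) (use False in \<open>auto simp: if_distrib[of "\<lambda>x. x * _"] sum.delta fps_X_def cong: if_cong\<close>)
qed

lemma expands_power:
  "expands q N Z h c \<Longrightarrow> expands q N Z (\<lambda>z t. h z t ^ i) (\<lambda>z. c z ^ i)"
proof (induction i)
  case 0
  show ?case using expands_const[of Z "\<lambda>_. 1"] by auto
next
  case (Suc i)
  then show ?case using expands_mult[OF Suc.prems Suc.IH] by simp
qed

lemma expands_sum:
  assumes "finite I" "\<And>i. i \<in> I \<Longrightarrow> expands q N Z (h i) (c i)"
  shows "expands q N Z (\<lambda>z t. \<Sum>i\<in>I. h i z t) (\<lambda>z. \<Sum>i\<in>I. c i z)"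
  using assms
proof (induction I rule: finite_induct)
  case empty
  then show ?case using expands_zero by simp
next
  case (insert i I)
  then show ?case using expands_add[of q N Z "h i" "c i"] by simp
qed

text \<open>The passage from formal to analytic: equal coefficients up to order \<open>N\<close>
  leave only a difference of order \<open>\<tau> ^ (N + 1)\<close>. It later turns the defining
  identities in \<open>averaging\<close> into a bound for the averaging error.\<close>

lemma expands_unique_bound:
  assumes "expands q N Z h c" "expands q N Z h' c'"
    and "\<And>z k. z \<in> Z \<Longrightarrow> k \<le> N \<Longrightarrow> fps_nth (c' z) k = fps_nth (c z) k"
  shows "\<exists>C\<ge>0. \<forall>\<^sub>F t in at_top. \<forall>z\<in>Z. \<bar>h z t - h' z t\<bar> \<le> C * tau q t ^ Suc N"
proof -
  obtain C where C: "C \<ge> 0" "\<And>z k. z \<in> Z \<Longrightarrow> k \<le> N \<Longrightarrow> \<bar>fps_nth (c z) k\<bar> \<le> C"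
    "\<forall>\<^sub>F t in at_top. \<forall>z\<in>Z.
        \<bar>h z t - (\<Sum>k\<le>N. fps_nth (c z) k * tau q t ^ k)\<bar> \<le> C * tau q t ^ Suc N"
    using expandsE[OF assms(1)] by blast
  obtain D where D: "D \<ge> 0" "\<And>z k. z \<in> Z \<Longrightarrow> k \<le> N \<Longrightarrow> \<bar>fps_nth (c' z) k\<bar> \<le> D"
    "\<forall>\<^sub>F t in at_top. \<forall>z\<in>Z.
        \<bar>h' z t - (\<Sum>k\<le>N. fps_nth (c' z) k * tau q t ^ k)\<bar> \<le> D * tau q t ^ Suc N"
    using expandsE[OF assms(2)] by blast
  have "\<forall>\<^sub>F t in at_top. \<forall>z\<in>Z. \<bar>h z t - h' z t\<bar> \<le> (C + D) * tau q t ^ Suc N"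
    using C(3) D(3)
  proof eventually_elim
    case (elim t)
    show ?case
    proof
      fix z assume z: "z \<in> Z"
      have "(\<Sum>k\<le>N. fps_nth (c' z) k * tau q t ^ k) = (\<Sum>k\<le>N. fps_nth (c z) k * tau q t ^ k)"
        using assms(3)[OF z] by simp
      moreover have "\<bar>h z t - (\<Sum>k\<le>N. fps_nth (c z) k * tau q t ^ k)\<bar> \<le> C * tau q t ^ Suc N"
        "\<bar>h' z t - (\<Sum>k\<le>N. fps_nth (c' z) k * tau q t ^ k)\<bar> \<le> D * tau q t ^ Suc N"
        using elim z by blast+
      ultimately show "\<bar>h z t - h' z t\<bar> \<le> (C + D) * tau q t ^ Suc N"
        unfolding distrib_right by linarith
    qed
  qed
  then show ?thesis using C(1) D(1) by (intro exI[of _ "C + D"]) auto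
qed

lemma expands_small:
  assumes "expands q N Z h c" "\<And>z. z \<in> Z \<Longrightarrow> fps_nth (c z) 0 = 0"
  shows "\<exists>B\<ge>0. \<forall>\<^sub>F t in at_top. \<forall>z\<in>Z. \<bar>h z t\<bar> \<le> B * tau q t"
proof -
  obtain C where C: "C \<ge> 0" "\<And>z k. z \<in> Z \<Longrightarrow> k \<le> N \<Longrightarrow> \<bar>fps_nth (c z) k\<bar> \<le> C"
    "\<forall>\<^sub>F t in at_top. \<forall>z\<in>Z.
        \<bar>h z t - (\<Sum>k\<le>N. fps_nth (c z) k * tau q t ^ k)\<bar> \<le> C * tau q t ^ Suc N"
    using expandsE[OF assms(1)] by blast
  have "\<forall>\<^sub>F t in at_top. \<forall>z\<in>Z. \<bar>h z t\<bar> \<le> (C + real (Suc N) * C) * tau q t"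
    using C(3) eventually_ge_at_top[of 1]
  proof eventually_elim
    case (elim t)
    have \<tau>: "0 \<le> tau q t" "tau q t \<le> 1" using tau_pos[of t q] tau_le_1[of t q] elim by auto
    have *: "tau q t ^ k \<le> tau q t" if "k \<noteq> 0" for k
      using power_decreasing[of 1 k "tau q t"] \<tau> that by simp
    have 1: "C * tau q t ^ Suc N \<le> C * tau q t"
      using C(1) *[of "Suc N"] by (intro mult_left_mono) simp_all
    show ?case
    proof
      fix z assume "z \<in> Z"
      then have "\<bar>h z t - (\<Sum>k\<le>N. fps_nth (c z) k * tau q t ^ k)\<bar> \<le> C * tau q t ^ Suc N"
        using elim by blast
      moreover have "\<bar>\<Sum>k\<le>N. fps_nth (c z) k * tau q t ^ k\<bar> \<le> (\<Sum>k\<le>N. C * tau q t)"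
      proof (rule order_trans[OF sum_abs], rule sum_mono)
        fix k assume "k \<in> {..N}"
        then have c: "\<bar>fps_nth (c z) k\<bar> \<le> C" using C \<open>z \<in> Z\<close> by auto
        show "\<bar>fps_nth (c z) k * tau q t ^ k\<bar> \<le> C * tau q t"
        proof (cases "k = 0")
          case True
          then show ?thesis using assms(2)[OF \<open>z \<in> Z\<close>] C \<tau> by simp
        next
          case False
          then show ?thesis unfolding abs_mult using c \<tau> * C(1) by (intro mult_mono) auto
        qed
      qed
      ultimately show "\<bar>h z t\<bar> \<le> (C + real (Suc N) * C) * tau q t"
        using 1 by (simp add: distrib_right)
    qed
  qed
  then show ?thesis using C(1) by (intro exI[of _ "C + real (Suc N) * C"]) auto
qed

section \<open>Global solutions of Lipschitz differential equations\<close>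

text \<open>Gronwall in differential form: \<open>exp (- 2 * L * s)\<close> times the squared
  distance of the two solutions cannot increase. The inner product makes the squared distance
  differentiable.\<close>

lemma Lipschitz_ode_unique:
  fixes F :: "real \<Rightarrow> 'a::real_inner \<Rightarrow> 'a"
  assumes J: "is_interval J" "t0 \<in> J" "J \<subseteq> {t0..}"
    and lip: "\<And>T. T \<ge> t0 \<Longrightarrow> \<exists>L\<ge>0. \<forall>t\<in>{t0..T}. \<forall>x y. norm (F t x - F t y) \<le> L * norm (x - y)"
    and x: "\<And>t. t \<in> J \<Longrightarrow> (x has_vector_derivative F t (x t)) (at t within J)"
    and y: "\<And>t. t \<in> J \<Longrightarrow> (y has_vector_derivative F t (y t)) (at t within J)"
    and "x t0 = y t0" "t \<in> J"
  shows "x t = y t"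
proof (cases "t = t0")
  case False
  then have t: "t0 < t" using assms by force
  obtain L where L: "L \<ge> 0" "\<forall>s\<in>{t0..t}. \<forall>x y. norm (F s x - F s y) \<le> L * norm (x - y)"
    using lip[of t] t by auto
  have sub: "{t0..t} \<subseteq> J"
    using J(1,2) \<open>t \<in> J\<close> unfolding is_interval_1 by (meson atLeastAtMost_iff subsetI)
  let ?d = "\<lambda>s. x s - y s"
  let ?e = "\<lambda>s. exp (- 2 * L * s) * (?d s \<bullet> ?d s)"
  have dv: "(?d has_vector_derivative F s (x s) - F s (y s)) (at s within {t0..t})" if "s \<in> {t0..t}" for s
    using has_vector_derivative_within_subset[OF has_vector_derivative_diff[OF x y] sub] that sub by blast
  have cd: "continuous_on {t0..t} ?d"
    using dv has_vector_derivative_continuous continuous_on_eq_continuous_within by blast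
  have "?e t \<le> ?e t0"
  proof (rule DERIV_nonpos_imp_decreasing_open[where f = ?e and a = t0 and b = t])
    show "t0 \<le> t" using t by simp
    show "continuous_on {t0..t} ?e" by (intro continuous_intros cd)
    fix s assume s: "t0 < s" "s < t"
    then have "at s within {t0..t} = at s" by (intro at_within_interior) auto
    then have "(?d has_vector_derivative F s (x s) - F s (y s)) (at s)" using dv[of s] s by simp
    then have d: "(?d has_derivative (\<lambda>h. h *\<^sub>R (F s (x s) - F s (y s)))) (at s)"
      unfolding has_vector_derivative_def .
    have "((\<lambda>s. ?d s \<bullet> ?d s) has_derivative
       (\<lambda>h. ?d s \<bullet> (h *\<^sub>R (F s (x s) - F s (y s))) + (h *\<^sub>R (F s (x s) - F s (y s))) \<bullet> ?d s)) (at s)"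
      by (rule has_derivative_inner[OF d d])
    then have i: "((\<lambda>s. ?d s \<bullet> ?d s) has_real_derivative 2 * (?d s \<bullet> (F s (x s) - F s (y s)))) (at s)"
      unfolding has_field_derivative_def
      by (rule has_derivative_eq_rhs) (auto simp: inner_commute algebra_simps)
    have "(?e has_real_derivative (- 2 * L) * exp (- 2 * L * s) * (?d s \<bullet> ?d s)
        + exp (- 2 * L * s) * (2 * (?d s \<bullet> (F s (x s) - F s (y s))))) (at s)"
      by (rule DERIV_mult' [OF _ i, THEN DERIV_cong]) (auto intro!: derivative_eq_intros simp: algebra_simps)
    moreover have "(- 2 * L) * exp (- 2 * L * s) * (?d s \<bullet> ?d s)
        + exp (- 2 * L * s) * (2 * (?d s \<bullet> (F s (x s) - F s (y s)))) \<le> 0"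
    proof -
      have "?d s \<bullet> (F s (x s) - F s (y s)) \<le> norm (?d s) * norm (F s (x s) - F s (y s))"
        by (rule norm_cauchy_schwarz)
      also have "\<dots> \<le> norm (?d s) * (L * norm (?d s))"
        using L(2) s by (intro mult_left_mono) auto
      also have "\<dots> = L * (?d s \<bullet> ?d s)" by (simp add: dot_square_norm power2_eq_square)
      finally have "exp (- 2 * L * s) * (?d s \<bullet> (F s (x s) - F s (y s))) \<le> exp (- 2 * L * s) * (L * (?d s \<bullet> ?d s))"
        by (intro mult_left_mono) auto
      then show ?thesis by (simp only: algebra_simps)
    qed
    ultimately show "\<exists>D. (?e has_real_derivative D) (at s) \<and> D \<le> 0" by blast
  qed
  then have "exp (- 2 * L * t) * (?d t \<bullet> ?d t) \<le> 0" using \<open>x t0 = y t0\<close> by simp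
  then have "?d t \<bullet> ?d t \<le> 0" by (simp add: mult_le_0_iff)
  then show ?thesis using inner_ge_zero[of "?d t"] by simp
qed (use assms in simp)

text \<open>Picard iteration on the whole half-line at once. As the Lipschitz bound is global in the
  state, the increments on \<open>{t0..T}\<close> are dominated by the terms of an exponential
  series, which are summable for every \<open>T\<close>; no shrinking of the time interval is
  needed.\<close>

lemma Lipschitz_ode_global_solution:
  fixes F :: "real \<Rightarrow> 'a::euclidean_space \<Rightarrow> 'a"
  assumes cont: "continuous_on ({t0..} \<times> UNIV) (\<lambda>(t, x). F t x)"
    and lip: "\<And>T. T \<ge> t0 \<Longrightarrow> \<exists>L\<ge>0. \<forall>t\<in>{t0..T}. \<forall>x y. norm (F t x - F t y) \<le> L * norm (x - y)"
  shows "\<exists>x. x t0 = x0 \<and> (\<forall>t\<ge>t0. (x has_vector_derivative F t (x t)) (at t within {t0..}))"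
proof -
  define X where "X = rec_nat (\<lambda>t. x0) (\<lambda>_ Y t. x0 + integral {t0..t} (\<lambda>s. F s (Y s)))"
  have X0: "X 0 t = x0" and XS: "X (Suc n) t = x0 + integral {t0..t} (\<lambda>s. F s (X n s))" for n t
    by (simp_all add: X_def)
  have Fc: "continuous_on {t0..T} (\<lambda>s. F s (Y s))" if "continuous_on {t0..T} Y" for Y T
  proof -
    have "continuous_on {t0..T} (\<lambda>s. (s, Y s))" using that by (intro continuous_intros)
    moreover have "(\<lambda>s. (s, Y s)) ` {t0..T} \<subseteq> {t0..} \<times> UNIV" by auto
    ultimately show ?thesis using continuous_on_compose2[OF cont] by fastforce
  qed
  have Xc: "continuous_on {t0..T} (X n)" for n T
  proof (induction n)
    case 0
    then show ?case by (simp add: X0[abs_def])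
  next
    case (Suc n)
    show ?case unfolding XS[abs_def]
      by (intro continuous_intros indefinite_integral_continuous_1 integrable_continuous_real Fc Suc)
  qed
  have FX: "(\<lambda>s. F s (X n s)) integrable_on {t0..t}" for n t
    by (intro integrable_continuous_real Fc Xc)
  \<comment> \<open>The limit of the iterates, written as a telescoping series so that the
    Weierstrass test applies on each \<open>{t0..T}\<close> while \<open>x\<close> itself does not
    depend on \<open>T\<close>.\<close>
  define x where "x t = x0 + (\<Sum>i. X (Suc i) t - X i t)" for t
  have unif: "uniform_limit {t0..T} X x sequentially" if T: "T \<ge> t0" for T
  proof -
    obtain L where L: "L \<ge> 0" "\<forall>t\<in>{t0..T}. \<forall>x y. norm (F t x - F t y) \<le> L * norm (x - y)"
      using lip[OF T] by blast
    have "continuous_on {t0..T} (\<lambda>t. norm (X 1 t - X 0 t))" by (intro continuous_intros Xc)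
    from compact_imp_bounded_real[OF compact_Icc this]
    obtain M where M: "M \<ge> 0" "\<forall>t\<in>{t0..T}. \<bar>norm (X 1 t - X 0 t)\<bar> \<le> M" by blast
    have step: "norm (X (Suc n) t - X n t) \<le> M * (L ^ n * (t - t0) ^ n / fact n)" if "t \<in> {t0..T}" for n t
      using that
    proof (induction n arbitrary: t)
      case 0
      then show ?case using M by simp
    next
      case (Suc n)
      have "((\<lambda>s. M * (L ^ Suc n * (s - t0) ^ n / fact n)) has_integral
          M * (L ^ Suc n * (t - t0) ^ Suc n / fact (Suc n)) - M * (L ^ Suc n * (t0 - t0) ^ Suc n / fact (Suc n))) {t0..t}"
      proof (rule fundamental_theorem_of_calculus)
        fix s assume "s \<in> {t0..t}"
        have "((\<lambda>s. M * (L ^ Suc n * (s - t0) ^ Suc n / fact (Suc n))) has_real_derivative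
           M * (L ^ Suc n * (real (Suc n) * (s - t0) ^ n) / fact (Suc n))) (at s within {t0..t})"
          by (rule derivative_eq_intros refl | simp)+
        moreover have "M * (L ^ Suc n * (real (Suc n) * (s - t0) ^ n) / fact (Suc n)) = M * (L ^ Suc n * (s - t0) ^ n / fact n)"
          by (simp add: field_simps del: of_nat_Suc)
        ultimately show "((\<lambda>s. M * (L ^ Suc n * (s - t0) ^ Suc n / fact (Suc n))) has_vector_derivative
           M * (L ^ Suc n * (s - t0) ^ n / fact n)) (at s within {t0..t})"
          by (simp only: has_real_derivative_iff_has_vector_derivative)
      qed (use Suc.prems in auto)
      then have I: "((\<lambda>s. M * (L ^ Suc n * (s - t0) ^ n / fact n)) has_integral
          M * (L ^ Suc n * (t - t0) ^ Suc n / fact (Suc n))) {t0..t}" by simp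
      have "X (Suc (Suc n)) t - X (Suc n) t = integral {t0..t} (\<lambda>s. F s (X (Suc n) s) - F s (X n s))"
        by (simp add: XS[of "Suc n"] XS[of n t] integral_diff[OF FX FX])
      also have "norm \<dots> \<le> integral {t0..t} (\<lambda>s. M * (L ^ Suc n * (s - t0) ^ n / fact n))"
      proof (rule integral_norm_bound_integral)
        show "(\<lambda>s. F s (X (Suc n) s) - F s (X n s)) integrable_on {t0..t}"
          by (intro integrable_diff FX)
        show "(\<lambda>s. M * (L ^ Suc n * (s - t0) ^ n / fact n)) integrable_on {t0..t}" using I by blast
        fix s assume s: "s \<in> {t0..t}"
        then have "norm (F s (X (Suc n) s) - F s (X n s)) \<le> L * norm (X (Suc n) s - X n s)"
          using L(2) Suc.prems by auto
        also have "\<dots> \<le> L * (M * (L ^ n * (s - t0) ^ n / fact n))"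
          using Suc.IH[of s] s Suc.prems L(1) by (intro mult_left_mono) auto
        finally show "norm (F s (X (Suc n) s) - F s (X n s)) \<le> M * (L ^ Suc n * (s - t0) ^ n / fact n)"
          by (simp add: algebra_simps)
      qed
      also have "\<dots> = M * (L ^ Suc n * (t - t0) ^ Suc n / fact (Suc n))" using I by (rule integral_unique)
      finally show ?case .
    qed
    have "summable (\<lambda>n. M * ((L * (T - t0)) ^ n /\<^sub>R fact n))"
      by (intro summable_mult summable_exp_generic)
    then have sm: "summable (\<lambda>n. M * (L ^ n * (T - t0) ^ n / fact n))"
      by (simp add: power_mult_distrib divide_inverse mult_ac)
    have "uniform_limit {t0..T} (\<lambda>n t. \<Sum>i<n. X (Suc i) t - X i t) (\<lambda>t. \<Sum>i. X (Suc i) t - X i t) sequentially"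
    proof (rule Weierstrass_m_test[OF _ sm])
      fix n t assume t: "t \<in> {t0..T}"
      have "(t - t0) ^ n \<le> (T - t0) ^ n" using t by (intro power_mono) auto
      then have "M * (L ^ n * (t - t0) ^ n / fact n) \<le> M * (L ^ n * (T - t0) ^ n / fact n)"
        using M L by (intro mult_left_mono divide_right_mono) auto
      then show "norm (X (Suc n) t - X n t) \<le> M * (L ^ n * (T - t0) ^ n / fact n)"
        using step[OF t, of n] by linarith
    qed
    then have "uniform_limit {t0..T} (\<lambda>n t. x0 + (\<Sum>i<n. X (Suc i) t - X i t)) x sequentially"
      unfolding x_def by (intro uniform_limit_intros)
    then show ?thesis by (simp add: sum_lessThan_telescope[of "\<lambda>i. X i _"] X0)
  qed
  have xc: "continuous_on {t0..T} x" if "T \<ge> t0" for T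
    by (rule uniform_limit_theorem[OF _ unif[OF that]]) (simp_all add: Xc)
  have xint: "x t = x0 + integral {t0..t} (\<lambda>s. F s (x s))" if t: "t \<ge> t0" for t
  proof -
    obtain L where L: "L \<ge> 0" "\<forall>s\<in>{t0..t}. \<forall>x y. norm (F s x - F s y) \<le> L * norm (x - y)"
      using lip[OF t] by blast
    have "uniform_limit {t0..t} (\<lambda>n s. F s (X n s)) (\<lambda>s. F s (x s)) sequentially"
    proof (rule uniform_limitI)
      fix e :: real assume "e > 0"
      then have "\<forall>\<^sub>F n in sequentially. \<forall>s\<in>{t0..t}. dist (X n s) (x s) < e / (L + 1)"
        using uniform_limitD[OF unif[OF t], of "e / (L + 1)"] L(1) by simp
      then show "\<forall>\<^sub>F n in sequentially. \<forall>s\<in>{t0..t}. dist (F s (X n s)) (F s (x s)) < e"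
      proof eventually_elim
        case (elim n)
        show ?case
        proof
          fix s assume s: "s \<in> {t0..t}"
          have "dist (F s (X n s)) (F s (x s)) \<le> L * dist (X n s) (x s)"
            using L(2) s by (simp add: dist_norm)
          also have "\<dots> \<le> L * (e / (L + 1))" using elim s L(1) by (intro mult_left_mono) (auto intro: less_imp_le)
          also have "\<dots> < e" using L(1) \<open>e > 0\<close> by (simp add: field_simps)
          finally show "dist (F s (X n s)) (F s (x s)) < e" .
        qed
      qed
    qed
    then obtain I J where IJ: "\<And>n. ((\<lambda>s. F s (X n s)) has_integral I n) {t0..t}"
      "((\<lambda>s. F s (x s)) has_integral J) {t0..t}" "I \<longlonglongrightarrow> J"
      using Fc[OF Xc] by (rule uniform_limit_integral) auto
    have "I = (\<lambda>n. integral {t0..t} (\<lambda>s. F s (X n s)))" "J = integral {t0..t} (\<lambda>s. F s (x s))"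
      using integral_unique[OF IJ(1)] integral_unique[OF IJ(2)] by auto
    then have "(\<lambda>n. integral {t0..t} (\<lambda>s. F s (X n s))) \<longlonglongrightarrow> integral {t0..t} (\<lambda>s. F s (x s))"
      using IJ(3) by simp
    then have "(\<lambda>n. X (Suc n) t) \<longlonglongrightarrow> x0 + integral {t0..t} (\<lambda>s. F s (x s))"
      unfolding XS by (intro tendsto_intros)
    moreover have "(\<lambda>n. X (Suc n) t) \<longlonglongrightarrow> x t"
      using t by (intro LIMSEQ_Suc tendsto_uniform_limitI[OF unif[OF t]]) auto
    ultimately show ?thesis using LIMSEQ_unique by blast
  qed
  have "(x has_vector_derivative F t (x t)) (at t within {t0..})" if t: "t \<ge> t0" for t
  proof -
    have "((\<lambda>t. integral {t0..t} (\<lambda>s. F s (x s))) has_vector_derivative F t (x t)) (at t within {t0..t + 1})"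
      using integral_has_vector_derivative[OF Fc[OF xc]] t by auto
    then have "((\<lambda>t. x0 + integral {t0..t} (\<lambda>s. F s (x s))) has_vector_derivative F t (x t)) (at t within {t0..t + 1})"
      by (auto intro!: derivative_eq_intros)
    then have "(x has_vector_derivative F t (x t)) (at t within {t0..t + 1})"
      by (rule has_vector_derivative_transform[rotated 2]) (use xint t in auto)
    moreover have "at t within {t0..t + 1} = at t within {t0..}"
      by (rule at_within_nhd[of _ "{..<t + 1}"]) auto
    ultimately show ?thesis by simp
  qed
  moreover have "x t0 = x0" using xint[of t0] by simp
  ultimately show ?thesis by blast
qed

section \<open>Parity of the averaged coefficients\<close>

text \<open>The construction is invariant under \<open>(R, \<tau>) \<mapsto> (- R, - \<tau>)\<close>.  By uniqueness the averaged
  coefficients have a parity in \<open>R\<close>; this restricts the hypotheses on \<open>n\<close> and \<open>m\<close> to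
  \<open>m < n < 2 q\<close> with \<open>n\<close> odd.\<close>

lemma F_coeff_minus: "F_coeff q \<kappa> \<mu> a fc k (- R) \<Psi> S = (- 1) ^ Suc k * F_coeff q \<kappa> \<mu> a fc k R \<Psi> S"
proof -
  have *: "(- R) ^ i = (- 1) ^ Suc k * R ^ i" if "i + 2 * j = k + 1" for i j :: nat
  proof -
    have "(- 1 :: real) ^ Suc k = (- 1) ^ (i + 2 * j)" using that by simp
    then show ?thesis by (simp only: power_add power_mult power_minus[of R]) simp
  qed
  have "(if k = 2 * q then - R / (2 * real q) else 0) = (- 1) ^ Suc k * (if k = 2 * q then R / (2 * real q) else 0)"
    by simp
  then show ?thesis
    unfolding F_coeff_def distrib_left sum_distrib_left
    by (intro arg_cong2[of _ _ _ _ "(+)"] sum.cong) (auto simp: * simp del: power_Suc)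
qed

lemma phase_deriv_coeff_minus: "phase_deriv_coeff q s k = (- 1) ^ k * phase_deriv_coeff q s k"
  by (simp add: phase_deriv_coeff_def)

lemma G_coeff_minus: "G_coeff q \<kappa> \<mu> a s \<omega> gc k (- R) \<Psi> S = (- 1) ^ k * G_coeff q \<kappa> \<mu> a s \<omega> gc k R \<Psi> S"
proof -
  have *: "(- R) ^ i = (- 1) ^ k * R ^ i" if "i + 2 * j = k" for i j :: nat
  proof -
    have "(- 1 :: real) ^ k = (- 1) ^ (i + 2 * j)" using that by simp
    then show ?thesis by (simp only: power_add power_mult power_minus[of R]) simp
  qed
  have "(deriv ^^ k) \<omega> a * (- R) ^ k / fact k = (- 1) ^ k * ((deriv ^^ k) \<omega> a * R ^ k / fact k)"
    by (simp only: power_minus[of R]) simp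
  moreover have "real \<kappa> / real \<mu> * phase_deriv_coeff q s k = (- 1) ^ k * (real \<kappa> / real \<mu> * phase_deriv_coeff q s k)"
    using phase_deriv_coeff_minus[of q s k] by simp
  ultimately show ?thesis
    unfolding G_coeff_def distrib_left sum_distrib_left right_diff_distrib
    by (intro arg_cong2[of _ _ _ _ "(+)"] arg_cong2[of _ _ _ _ "(-)"] sum.cong) (auto simp: *)
qed

lemma F_coeff_0: "q \<ge> 1 \<Longrightarrow> F_coeff q \<kappa> \<mu> a fc 0 R \<Psi> S = 0"
proof -
  assume "q \<ge> 1"
  have "{(i, j). 1 \<le> j \<and> i + 2 * j = 0 + (1::nat)} = {}" by auto
  then show ?thesis using \<open>q \<ge> 1\<close> by (simp only: F_coeff_def) simp
qed

lemma phase_deriv_coeff_0: "q \<ge> 1 \<Longrightarrow> phase_deriv_coeff q s 0 = s 0"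
  by (simp add: phase_deriv_coeff_def)

lemma G_coeff_0:
  assumes "q \<ge> 1" "\<mu> \<ge> 1" "real \<kappa> * s 0 = real \<mu> * \<omega> a"
  shows "G_coeff q \<kappa> \<mu> a s \<omega> gc 0 R \<Psi> S = 0"
proof -
  have "{(i, j). 1 \<le> j \<and> i + 2 * j = (0::nat)} = {}" by auto
  then have "G_coeff q \<kappa> \<mu> a s \<omega> gc 0 R \<Psi> S = \<omega> a - real \<kappa> / real \<mu> * s 0"
    using assms by (simp only: G_coeff_def phase_deriv_coeff_0) simp
  then show ?thesis using assms by (simp add: field_simps)
qed

text \<open>The part of the coefficient of order \<open>k\<close> that involves only
  \<open>W j\<close> with \<open>j < k\<close>. Since \<open>F\<close> and \<open>G\<close> start at
  order one, the sole contribution of \<open>W k\<close> is its phase derivative with factor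
  \<open>\<sigma> 0\<close>; in the recursion everything here is known data.\<close>

definition lower_deriv_coeff ::
  "nat \<Rightarrow> (nat \<Rightarrow> real \<Rightarrow> real \<Rightarrow> real \<Rightarrow> real) \<Rightarrow> (nat \<Rightarrow> real \<Rightarrow> real \<Rightarrow> real \<Rightarrow> real) \<Rightarrow>
     (nat \<Rightarrow> real) \<Rightarrow> (nat \<Rightarrow> real \<Rightarrow> real \<Rightarrow> real \<Rightarrow> real) \<Rightarrow> nat \<Rightarrow> real \<Rightarrow> real \<Rightarrow> real \<Rightarrow> real" where
  "lower_deriv_coeff q F G \<sigma> W k R \<Psi> S =
     (\<Sum>i=1..k. F i R \<Psi> S * deriv (\<lambda>x. W (k - i) x \<Psi> S) R + G i R \<Psi> S * deriv (\<lambda>x. W (k - i) R x S) \<Psi>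
        + \<sigma> i * deriv (\<lambda>x. W (k - i) R \<Psi> x) S)
     - (if k < 2 * q + 1 then 0 else real (k - 2 * q) / (2 * real q) * W (k - 2 * q) R \<Psi> S)"

lemma formal_total_deriv_nth:
  assumes "\<And>R \<Psi> S. F 0 R \<Psi> S = 0" "\<And>R \<Psi> S. G 0 R \<Psi> S = 0"
  shows "fps_nth (formal_total_deriv q F G \<sigma> W R \<Psi> S) k =
     \<sigma> 0 * deriv (\<lambda>x. W k R \<Psi> x) S + lower_deriv_coeff q F G \<sigma> W k R \<Psi> S"
proof -
  have split: "(\<Sum>i=0..k. h i) = h 0 + (\<Sum>i=1..k. h i)" for h :: "nat \<Rightarrow> real"
    by (simp add: sum.atLeast_Suc_atMost)
  have X: "fps_nth (fps_const (1 / (2 * real q)) * fps_X ^ (2 * q + 1) * fps_deriv (series_at W R \<Psi> S)) k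
     = (if k < 2 * q + 1 then 0 else real (k - 2 * q) / (2 * real q) * W (k - 2 * q) R \<Psi> S)"
  proof -
    have "k - (2 * q + 1) + 1 = k - 2 * q" if "\<not> k < 2 * q + 1" using that by simp
    then show ?thesis
      unfolding mult.assoc fps_mult_left_const_nth fps_X_power_mult_nth fps_deriv_nth series_at_def
      by (auto simp: algebra_simps)
  qed
  show ?thesis
    unfolding formal_total_deriv_def fps_sub_nth fps_add_nth X
    by (simp add: fps_mult_nth series_at_def split assms lower_deriv_coeff_def sum.distrib del: One_nat_def)
qed

text \<open>Likewise the data already known when \<open>H k\<close> is determined:
  \<open>H l\<close> for \<open>l < k\<close> and coefficients of \<open>du\<close>,
  \<open>dv\<close> of index below \<open>k\<close>. The omitted summand \<open>l = k\<close>
  reduces to \<open>i = j = 0\<close>, that is, to \<open>H k\<close> itself.\<close>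

definition lower_taylor_coeff ::
  "(nat \<Rightarrow> real \<Rightarrow> real \<Rightarrow> real) \<Rightarrow> nat \<Rightarrow> real \<Rightarrow> real \<Rightarrow> real fps \<Rightarrow> real fps \<Rightarrow> real" where
  "lower_taylor_coeff H k R \<Psi> du dv =
     (\<Sum>l=1..<k. \<Sum>i\<le>k - l. \<Sum>j\<le>k - l.
       (deriv ^^ i) (\<lambda>x. (deriv ^^ j) (\<lambda>y. H l x y) \<Psi>) R / (fact i * fact j)
         * fps_nth (du ^ i * dv ^ j) (k - l))"

lemma taylor_series_nth:
  assumes "k \<ge> 1"
  shows "fps_nth (taylor_series H R \<Psi> du dv) k = H k R \<Psi> + lower_taylor_coeff H k R \<Psi> du dv"
proof -
  have "{1..k} = insert k {1..<k}" using assms by auto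
  then show ?thesis unfolding taylor_series_def lower_taylor_coeff_def by simp
qed

lemma deriv_of_reflected:
  fixes h :: "real \<Rightarrow> real"
  assumes "\<And>x. h (- x) = c * h x" "h field_differentiable (at R)" "h field_differentiable (at (- R))"
  shows "deriv h (- R) = - c * deriv h R"
proof -
  have "((\<lambda>x. h (- x)) has_field_derivative deriv h (- R) * (- 1)) (at R)"
    by (rule DERIV_chain2[of h]) (use assms(3) in \<open>auto simp: field_differentiable_derivI intro!: derivative_eq_intros\<close>)
  moreover have "((\<lambda>x. c * h x) has_field_derivative c * deriv h R) (at R)"
    by (intro DERIV_cmult field_differentiable_derivI assms)
  ultimately have "deriv h (- R) * (- 1) = c * deriv h R"
    using DERIV_unique unfolding assms(1) by blast
  then show ?thesis by simp
qed

text \<open>The sign \<open>\<epsilon>\<close> is \<open>- 1\<close> for the radial series and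
  \<open>1\<close> for the angular one. The signs of orders \<open>i\<close> and
  \<open>k - i\<close> multiply to that of order \<open>k\<close>: differentiation in
  \<open>R\<close> costs one sign, which the additional sign of \<open>F\<close> repays;
  \<open>\<sigma>\<close> lives on even indices; and the shift by \<open>2 * q\<close> is
  even.\<close>

lemma lower_deriv_coeff_minus:
  assumes F: "\<And>i. F i (- R) \<Psi> S = (- 1) ^ Suc i * F i R \<Psi> S"
    and G: "\<And>i. G i (- R) \<Psi> S = (- 1) ^ i * G i R \<Psi> S"
    and \<sigma>: "\<And>i. \<sigma> i = (- 1) ^ i * \<sigma> i"
    and W: "\<And>j R \<Psi> S. j < k \<Longrightarrow> W j (- R) \<Psi> S = \<epsilon> * (- 1) ^ j * W j R \<Psi> S"
    and d: "\<And>j R. j < k \<Longrightarrow> (\<lambda>x. W j x \<Psi> S) field_differentiable (at R)"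
      "\<And>j \<Psi>. j < k \<Longrightarrow> (\<lambda>x. W j R x S) field_differentiable (at \<Psi>)"
      "\<And>j S. j < k \<Longrightarrow> (\<lambda>x. W j R \<Psi> x) field_differentiable (at S)"
    and q: "q \<ge> 1"
  shows "lower_deriv_coeff q F G \<sigma> W k (- R) \<Psi> S = \<epsilon> * (- 1) ^ k * lower_deriv_coeff q F G \<sigma> W k R \<Psi> S"
proof -
  have t: "F i (- R) \<Psi> S * deriv (\<lambda>x. W (k - i) x \<Psi> S) (- R) + G i (- R) \<Psi> S * deriv (\<lambda>x. W (k - i) (- R) x S) \<Psi>
        + \<sigma> i * deriv (\<lambda>x. W (k - i) (- R) \<Psi> x) S
      = \<epsilon> * (- 1) ^ k * (F i R \<Psi> S * deriv (\<lambda>x. W (k - i) x \<Psi> S) R + G i R \<Psi> S * deriv (\<lambda>x. W (k - i) R x S) \<Psi>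
        + \<sigma> i * deriv (\<lambda>x. W (k - i) R \<Psi> x) S)" if i: "i \<in> {1..k}" for i
  proof -
    let ?c = "\<epsilon> * (- 1) ^ (k - i)"
    have j: "k - i < k" using i by auto
    have s: "(- 1 :: real) ^ k = (- 1) ^ i * (- 1) ^ (k - i)" using i by (simp flip: power_add)
    have 1: "deriv (\<lambda>x. W (k - i) x \<Psi> S) (- R) = - ?c * deriv (\<lambda>x. W (k - i) x \<Psi> S) R"
      by (rule deriv_of_reflected) (use W[OF j] d[OF j] in auto)
    have 2: "deriv (\<lambda>x. W (k - i) (- R) x S) \<Psi> = ?c * deriv (\<lambda>x. W (k - i) R x S) \<Psi>"
      unfolding W[OF j] by (rule deriv_cmult) (rule d[OF j])
    have 3: "deriv (\<lambda>x. W (k - i) (- R) \<Psi> x) S = ?c * deriv (\<lambda>x. W (k - i) R \<Psi> x) S"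
      unfolding W[OF j] by (rule deriv_cmult) (rule d[OF j])
    have 4: "\<sigma> i * z = (- 1) ^ i * \<sigma> i * z" for z using \<sigma>[of i] by simp
    have "F i (- R) \<Psi> S * deriv (\<lambda>x. W (k - i) x \<Psi> S) (- R) = \<epsilon> * (- 1) ^ k * (F i R \<Psi> S * deriv (\<lambda>x. W (k - i) x \<Psi> S) R)"
      unfolding F 1 s by simp
    moreover have "G i (- R) \<Psi> S * deriv (\<lambda>x. W (k - i) (- R) x S) \<Psi> = \<epsilon> * (- 1) ^ k * (G i R \<Psi> S * deriv (\<lambda>x. W (k - i) R x S) \<Psi>)"
      unfolding G 2 s by simp
    moreover have "\<sigma> i * deriv (\<lambda>x. W (k - i) (- R) \<Psi> x) S = \<epsilon> * (- 1) ^ k * (\<sigma> i * deriv (\<lambda>x. W (k - i) R \<Psi> x) S)"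
      unfolding 3 s by (subst 4) simp
    ultimately show ?thesis by (simp only: distrib_left)
  qed
  have w: "(if k < 2 * q + 1 then 0 else real (k - 2 * q) / (2 * real q) * W (k - 2 * q) (- R) \<Psi> S)
     = \<epsilon> * (- 1) ^ k * (if k < 2 * q + 1 then 0 else real (k - 2 * q) / (2 * real q) * W (k - 2 * q) R \<Psi> S)"
  proof (cases "k < 2 * q + 1")
    case False
    then have "even (k - 2 * q) = even k" by auto
    then have "(- 1 :: real) ^ (k - 2 * q) = (- 1) ^ k" by (simp add: minus_one_power_iff)
    then show ?thesis using W[of "k - 2 * q" R \<Psi> S] False q by simp
  qed simp
  show ?thesis
    unfolding lower_deriv_coeff_def w right_diff_distrib sum_distrib_left
    by (intro arg_cong2[of _ _ _ _ "(-)"] sum.cong refl t)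
qed

lemma deriv_iter_cmult:
  fixes g :: "real \<Rightarrow> real"
  assumes "\<And>i x. (deriv ^^ i) g field_differentiable (at x)"
  shows "(deriv ^^ i) (\<lambda>y. c * g y) = (\<lambda>y. c * (deriv ^^ i) g y)"
proof (induction i)
  case (Suc i)
  have "deriv (\<lambda>y. c * (deriv ^^ i) g y) = (\<lambda>y. c * deriv ((deriv ^^ i) g) y)"
    by (intro ext deriv_cmult assms)
  then show ?case using Suc by simp
qed simp

lemma deriv_iter_reflect:
  fixes g :: "real \<Rightarrow> real"
  assumes "\<And>i x. (deriv ^^ i) g field_differentiable (at x)"
  shows "(deriv ^^ i) (\<lambda>x. g (- x)) = (\<lambda>x. (- 1) ^ i * (deriv ^^ i) g (- x))"
proof (induction i)
  case (Suc i)
  have "((\<lambda>x. (- 1) ^ i * (deriv ^^ i) g (- x)) has_field_derivative (- 1) ^ i * (deriv ((deriv ^^ i) g) (- x) * (- 1))) (at x)" for x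
    by (intro DERIV_cmult DERIV_chain2[of "(deriv ^^ i) g"] field_differentiable_derivI assms)
      (auto intro!: derivative_eq_intros)
  then have "deriv (\<lambda>x. (- 1) ^ i * (deriv ^^ i) g (- x)) = (\<lambda>x. (- 1) ^ i * (deriv ((deriv ^^ i) g) (- x) * (- 1)))"
    using DERIV_imp_deriv by blast
  then show ?case using Suc by simp
qed simp

lemma fps_parity_mult:
  fixes A A' B B' :: "real fps"
  assumes "\<And>k. k \<le> M \<Longrightarrow> fps_nth A' k = \<epsilon> * (- 1) ^ k * fps_nth A k"
    and "\<And>k. k \<le> M \<Longrightarrow> fps_nth B' k = \<delta> * (- 1) ^ k * fps_nth B k" and "k \<le> M"
  shows "fps_nth (A' * B') k = (\<epsilon> * \<delta>) * (- 1) ^ k * fps_nth (A * B) k"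
  unfolding fps_mult_nth sum_distrib_left
proof (rule sum.cong[OF refl])
  fix i assume i: "i \<in> {0..k}"
  then have "(- 1 :: real) ^ k = (- 1) ^ i * (- 1) ^ (k - i)" by (simp flip: power_add)
  then show "fps_nth A' i * fps_nth B' (k - i) = \<epsilon> * \<delta> * (- 1) ^ k * (fps_nth A i * fps_nth B (k - i))"
    using i assms by simp
qed

lemma fps_parity_power:
  fixes A A' :: "real fps"
  assumes "\<And>k. k \<le> M \<Longrightarrow> fps_nth A' k = \<epsilon> * (- 1) ^ k * fps_nth A k" and "k \<le> M"
  shows "fps_nth (A' ^ i) k = \<epsilon> ^ i * (- 1) ^ k * fps_nth (A ^ i) k"
  using assms(2)
proof (induction i arbitrary: k)
  case 0
  then show ?case by (cases k) auto
next
  case (Suc i)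
  show ?case unfolding power_Suc
    by (rule fps_parity_mult[OF assms(1) Suc.IH Suc.prems])
qed

text \<open>Each of the \<open>i\<close> derivatives in \<open>R\<close> changes the parity of
  \<open>H l\<close>, and each of the \<open>i\<close> factors \<open>du\<close> contributes one
  further sign. These cancel and leave the signs of the orders \<open>l\<close> and
  \<open>k - l\<close>.\<close>

lemma lower_taylor_coeff_minus:
  assumes H: "\<And>l R \<Psi>. 1 \<le> l \<Longrightarrow> l < k \<Longrightarrow> H l (- R) \<Psi> = \<epsilon> * (- 1) ^ l * H l R \<Psi>"
    and sm: "\<And>l. 1 \<le> l \<Longrightarrow> smooth_on UNIV (\<lambda>(\<rho>, \<psi>). H l \<rho> \<psi>)"
    and du: "\<And>j. j < k \<Longrightarrow> fps_nth du' j = - 1 * (- 1) ^ j * fps_nth du j"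
    and dv: "\<And>j. j < k \<Longrightarrow> fps_nth dv' j = 1 * (- 1) ^ j * fps_nth dv j"
  shows "lower_taylor_coeff H k (- R) \<Psi> du' dv' = \<epsilon> * (- 1) ^ k * lower_taylor_coeff H k R \<Psi> du dv"
  unfolding lower_taylor_coeff_def sum_distrib_left
proof (intro sum.cong refl)
  fix l i j assume l: "l \<in> {1..<k}"
  then have l1: "1 \<le> l" "l < k" by auto
  let ?h = "\<lambda>(\<rho>, \<psi>). H l \<rho> \<psi>"
  let ?D2 = "(dir_deriv (0, 1) ^^ j) ?h"
  have smh: "smooth_on UNIV ?h" using sm l1 by blast
  have sm2: "smooth_on UNIV ?D2" by (rule smooth_on_dir_deriv_iter[OF open_UNIV smh])
  have y: "(deriv ^^ j) (\<lambda>y. H l x y) \<Psi> = ?D2 (x, \<Psi>)" for x \<Psi>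
    using deriv_iter_line[OF open_UNIV smh, of "(x, 0)" \<Psi> "(0, 1)" j] by simp
  have dy: "(deriv ^^ j) (\<lambda>y. H l x y) field_differentiable (at \<Psi>)" for x j \<Psi>
  proof -
    have "(deriv ^^ j) (\<lambda>y. H l x y) = (\<lambda>r. ((dir_deriv (0, 1) ^^ j) ?h) ((x, 0) + r *\<^sub>R (0, 1)))"
      using deriv_iter_line[OF open_UNIV smh, of "(x, 0)" _ "(0, 1)" j] by auto
    then show ?thesis
      using DERIV_line[OF open_UNIV smooth_on_dir_deriv_iter[OF open_UNIV smh, where v = "(0, 1)" and i = j], of "(x, 0)" \<Psi> "(0, 1)"]
      by (auto simp: field_differentiable_def)
  qed
  let ?g = "\<lambda>x. (deriv ^^ j) (\<lambda>y. H l x y) \<Psi>"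
  have dx: "(deriv ^^ i) ?g field_differentiable (at x)" for i x
  proof -
    have "(deriv ^^ i) ?g = (\<lambda>r. ((dir_deriv (1, 0) ^^ i) ?D2) ((0, \<Psi>) + r *\<^sub>R (1, 0)))"
      unfolding y using deriv_iter_line[OF open_UNIV sm2, of "(0, \<Psi>)" _ "(1, 0)" i] by auto
    then show ?thesis
      using DERIV_line[OF open_UNIV smooth_on_dir_deriv_iter[OF open_UNIV sm2, where v = "(1, 0)" and i = i], of "(0, \<Psi>)" x "(1, 0)"]
      by (auto simp: field_differentiable_def)
  qed
  have g: "?g (- x) = \<epsilon> * (- 1) ^ l * ?g x" for x
    unfolding H[OF l1] by (simp add: deriv_iter_cmult[OF dy])
  have "(deriv ^^ i) (\<lambda>x. ?g (- x)) R = \<epsilon> * (- 1) ^ l * (deriv ^^ i) ?g R"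
    unfolding g deriv_iter_cmult[OF dx] by simp
  then have "(- 1) ^ i * (deriv ^^ i) ?g (- R) = \<epsilon> * (- 1) ^ l * (deriv ^^ i) ?g R"
    unfolding deriv_iter_reflect[OF dx] .
  then have "(- 1) ^ i * ((- 1) ^ i * (deriv ^^ i) ?g (- R)) = (- 1) ^ i * (\<epsilon> * (- 1) ^ l * (deriv ^^ i) ?g R)"
    by simp
  then have 1: "(deriv ^^ i) ?g (- R) = \<epsilon> * (- 1) ^ l * (- 1) ^ i * (deriv ^^ i) ?g R"
    by (simp flip: mult.assoc power_mult_distrib)
  have 2: "fps_nth (du' ^ i * dv' ^ j) (k - l) = ((- 1) ^ i * 1 ^ j) * (- 1) ^ (k - l) * fps_nth (du ^ i * dv ^ j) (k - l)"
    by (rule fps_parity_mult[where M = "k - 1"]; (rule fps_parity_power[where M = "k - 1"])?)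
      (use l1 du dv in auto)
  have 3: "(- 1 :: real) ^ k = (- 1) ^ l * (- 1) ^ (k - l)" using l1 by (simp flip: power_add)
  have 4: "(- 1 :: real) ^ i * (- 1) ^ i = 1" by (simp flip: power_mult_distrib)
  have "\<epsilon> * (- 1) ^ l * (- 1) ^ i * d / f * ((- 1) ^ i * 1 ^ j * (- 1) ^ (k - l) * p)
     = ((- 1) ^ i * (- 1) ^ i) * (\<epsilon> * ((- 1) ^ l * (- 1) ^ (k - l)) * (d / f * p))" for d f p :: real
    by simp
  then show "(deriv ^^ i) ?g (- R) / (fact i * fact j) * fps_nth (du' ^ i * dv' ^ j) (k - l)
     = \<epsilon> * (- 1) ^ k * ((deriv ^^ i) ?g R / (fact i * fact j) * fps_nth (du ^ i * dv ^ j) (k - l))"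
    unfolding 1 2 3 by (simp only: 4 mult_1)
qed

text \<open>This is the uniqueness behind the averaging recursion: a nonzero constant slope is
  incompatible with periodicity, and a constant of zero mean is zero.\<close>

lemma periodic_zero_mean_linear:
  fixes g :: "real \<Rightarrow> real"
  assumes d: "\<And>S. (g has_real_derivative c) (at S)" and "g P = g 0" "P > 0" "integral {0..P} g = 0"
  shows "c = 0" "g S = 0"
proof -
  have lin: "g S - c * S = g 0" for S
  proof -
    have "((\<lambda>S. g S - c * S) has_real_derivative 0) (at S)" for S
      by (rule derivative_eq_intros d refl | simp)+
    then have "(\<lambda>S. g S - c * S) S = (\<lambda>S. g S - c * S) 0" using DERIV_isconst_all by blast
    then show ?thesis by simp
  qed
  show "c = 0" using lin[of P] assms by simp
  then have const: "g S = g 0" for S using lin[of S] by simp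
  then have "integral {0..P} g = integral {0..P} (\<lambda>_. g 0)"
    by (intro arg_cong[of _ _ "integral {0..P}"] ext)
  then have "g 0 = 0" using assms by simp
  then show "g S = 0" using const[of S] by simp
qed

section \<open>Parity for the averaged system\<close>

locale averaged_system =
  fixes q \<kappa> \<mu> :: nat and a :: real and s :: "nat \<Rightarrow> real" and \<omega> :: "real \<Rightarrow> real"
    and fc gc u v :: "nat \<Rightarrow> real \<Rightarrow> real \<Rightarrow> real \<Rightarrow> real" and \<Lambda> \<Omega> :: "nat \<Rightarrow> real \<Rightarrow> real \<Rightarrow> real"
  assumes q1: "q \<ge> 1" and \<mu>1: "\<mu> \<ge> 1" and s0: "s 0 > 0"
    and resonance: "real \<kappa> * s 0 = real \<mu> * \<omega> a"
    and averaging: "averaging q \<kappa> \<mu> a s \<omega> fc gc u v \<Lambda> \<Omega>"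
begin

abbreviation "F \<equiv> F_coeff q \<kappa> \<mu> a fc"
abbreviation "G \<equiv> G_coeff q \<kappa> \<mu> a s \<omega> gc"
abbreviation "\<sigma> \<equiv> phase_deriv_coeff q s"
abbreviation "U \<equiv> with_leading (\<lambda>R \<Psi>. R) u"
abbreviation "V \<equiv> with_leading (\<lambda>R \<Psi>. \<Psi>) v"
abbreviation "du R \<Psi> S \<equiv> series_at (with_leading (\<lambda>_ _. 0) u) R \<Psi> S"
abbreviation "dv R \<Psi> S \<equiv> series_at (with_leading (\<lambda>_ _. 0) v) R \<Psi> S"
abbreviation "period \<equiv> 2 * pi * real \<mu>"

lemma period_pos: "period > 0" using \<mu>1 by simp

lemma smooth_u: "k \<ge> 1 \<Longrightarrow> smooth_on UNIV (\<lambda>(R, \<Psi>, S). u k R \<Psi> S)"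
  and smooth_v: "k \<ge> 1 \<Longrightarrow> smooth_on UNIV (\<lambda>(R, \<Psi>, S). v k R \<Psi> S)"
  and smooth_\<Lambda>: "k \<ge> 1 \<Longrightarrow> smooth_on UNIV (\<lambda>(\<rho>, \<psi>). \<Lambda> k \<rho> \<psi>)"
  and smooth_\<Omega>: "k \<ge> 1 \<Longrightarrow> smooth_on UNIV (\<lambda>(\<rho>, \<psi>). \<Omega> k \<rho> \<psi>)"
  and periodic_u: "k \<ge> 1 \<Longrightarrow> u k R \<Psi> (S + period) = u k R \<Psi> S"
  and periodic_v: "k \<ge> 1 \<Longrightarrow> v k R \<Psi> (S + period) = v k R \<Psi> S"
  and mean_u: "k \<ge> 1 \<Longrightarrow> integral {0..period} (u k R \<Psi>) = 0"
  and mean_v: "k \<ge> 1 \<Longrightarrow> integral {0..period} (v k R \<Psi>) = 0"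
proof -
  note a = averaging[unfolded averaging_def, THEN conjunct1, rule_format]
  show "k \<ge> 1 \<Longrightarrow> smooth_on UNIV (\<lambda>(R, \<Psi>, S). u k R \<Psi> S)"
    "k \<ge> 1 \<Longrightarrow> smooth_on UNIV (\<lambda>(R, \<Psi>, S). v k R \<Psi> S)"
    "k \<ge> 1 \<Longrightarrow> smooth_on UNIV (\<lambda>(\<rho>, \<psi>). \<Lambda> k \<rho> \<psi>)"
    "k \<ge> 1 \<Longrightarrow> smooth_on UNIV (\<lambda>(\<rho>, \<psi>). \<Omega> k \<rho> \<psi>)"
    "k \<ge> 1 \<Longrightarrow> u k R \<Psi> (S + period) = u k R \<Psi> S" "k \<ge> 1 \<Longrightarrow> v k R \<Psi> (S + period) = v k R \<Psi> S"
    "k \<ge> 1 \<Longrightarrow> integral {0..period} (u k R \<Psi>) = 0" "k \<ge> 1 \<Longrightarrow> integral {0..period} (v k R \<Psi>) = 0"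
    using a[of k] by simp_all
qed

lemma total_deriv_U: "formal_total_deriv q F G \<sigma> U R \<Psi> S = taylor_series \<Lambda> R \<Psi> (du R \<Psi> S) (dv R \<Psi> S)"
  and total_deriv_V: "formal_total_deriv q F G \<sigma> V R \<Psi> S = taylor_series \<Omega> R \<Psi> (du R \<Psi> S) (dv R \<Psi> S)"
  using averaging[unfolded averaging_def Let_def, THEN conjunct2, rule_format, of R \<Psi> S] by simp_all

lemma coeff_equation_U:
  assumes "k \<ge> 1"
  shows "s 0 * deriv (\<lambda>x. u k R \<Psi> x) S + lower_deriv_coeff q F G \<sigma> U k R \<Psi> S
     = \<Lambda> k R \<Psi> + lower_taylor_coeff \<Lambda> k R \<Psi> (du R \<Psi> S) (dv R \<Psi> S)"
  using arg_cong[OF total_deriv_U[of R \<Psi> S], of "\<lambda>A. fps_nth A k"] assms q1 \<mu>1 resonance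
  by (simp add: formal_total_deriv_nth taylor_series_nth F_coeff_0 G_coeff_0 phase_deriv_coeff_0 with_leading_def[of _ _ k])

lemma coeff_equation_V:
  assumes "k \<ge> 1"
  shows "s 0 * deriv (\<lambda>x. v k R \<Psi> x) S + lower_deriv_coeff q F G \<sigma> V k R \<Psi> S
     = \<Omega> k R \<Psi> + lower_taylor_coeff \<Omega> k R \<Psi> (du R \<Psi> S) (dv R \<Psi> S)"
  using arg_cong[OF total_deriv_V[of R \<Psi> S], of "\<lambda>A. fps_nth A k"] assms q1 \<mu>1 resonance
  by (simp add: formal_total_deriv_nth taylor_series_nth F_coeff_0 G_coeff_0 phase_deriv_coeff_0 with_leading_def[of _ _ k])

lemma smooth_slices:
  assumes "smooth_on UNIV (\<lambda>(R, \<Psi>, S). w R \<Psi> S)"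
  shows "(\<lambda>x. w x \<Psi> S) field_differentiable (at R)" "(\<lambda>x. w R x S) field_differentiable (at \<Psi>)"
    "(\<lambda>x. w R \<Psi> x) field_differentiable (at S)"
proof -
  show "(\<lambda>x. w x \<Psi> S) field_differentiable (at R)"
    unfolding field_differentiable_def
    using DERIV_line[OF open_UNIV assms, of "(0, \<Psi>, S)" R "(1, 0, 0)"] by (intro exI) simp
  show "(\<lambda>x. w R x S) field_differentiable (at \<Psi>)"
    unfolding field_differentiable_def
    using DERIV_line[OF open_UNIV assms, of "(R, 0, S)" \<Psi> "(0, 1, 0)"] by (intro exI) simp
  show "(\<lambda>x. w R \<Psi> x) field_differentiable (at S)"
    unfolding field_differentiable_def
    using DERIV_line[OF open_UNIV assms, of "(R, \<Psi>, 0)" S "(0, 0, 1)"] by (intro exI) simp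
qed

lemma U_slices:
  "(\<lambda>x. U j x \<Psi> S) field_differentiable (at R)" "(\<lambda>x. U j R x S) field_differentiable (at \<Psi>)"
  "(\<lambda>x. U j R \<Psi> x) field_differentiable (at S)"
  using smooth_slices[OF smooth_u[of j], where R = R and \<Psi> = \<Psi> and S = S]
  by (cases "j = 0"; simp add: with_leading_def)+

lemma V_slices:
  "(\<lambda>x. V j x \<Psi> S) field_differentiable (at R)" "(\<lambda>x. V j R x S) field_differentiable (at \<Psi>)"
  "(\<lambda>x. V j R \<Psi> x) field_differentiable (at S)"
  using smooth_slices[OF smooth_v[of j], where R = R and \<Psi> = \<Psi> and S = S]
  by (cases "j = 0"; simp add: with_leading_def)+

text \<open>The parity defect, \<open>w\<close> at \<open>- R\<close> minus \<open>c\<close> times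
  \<open>w\<close> at \<open>R\<close>, has a phase derivative that does not depend on the phase. It
  is periodic with zero mean, so both this defect and the corresponding defect of \<open>H\<close>
  vanish.\<close>

lemma parity_step:
  fixes w :: "real \<Rightarrow> real \<Rightarrow> real \<Rightarrow> real"
  assumes eq: "\<And>R \<Psi> S. s 0 * deriv (\<lambda>x. w R \<Psi> x) S + L R \<Psi> S = H R \<Psi> + B R \<Psi> S"
    and L: "\<And>R \<Psi> S. L (- R) \<Psi> S = c * L R \<Psi> S" and B: "\<And>R \<Psi> S. B (- R) \<Psi> S = c * B R \<Psi> S"
    and sm: "smooth_on UNIV (\<lambda>(R, \<Psi>, S). w R \<Psi> S)"
    and per: "\<And>R \<Psi> S. w R \<Psi> (S + period) = w R \<Psi> S" and mean: "\<And>R \<Psi>. integral {0..period} (w R \<Psi>) = 0"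
  shows "H (- R) \<Psi> = c * H R \<Psi> \<and> w (- R) \<Psi> S = c * w R \<Psi> S"
proof -
  define g where "g S = w (- R) \<Psi> S - c * w R \<Psi> S" for S
  have d: "(w R \<Psi> has_real_derivative deriv (w R \<Psi>) S) (at S)" for R \<Psi> S
    using smooth_slices(3)[OF sm] by (simp add: field_differentiable_derivI)
  have "(g has_real_derivative (H (- R) \<Psi> - c * H R \<Psi>) / s 0) (at S)" for S
  proof -
    have "(g has_real_derivative deriv (w (- R) \<Psi>) S - c * deriv (w R \<Psi>) S) (at S)"
      unfolding g_def by (intro derivative_intros d DERIV_cmult)
    moreover have "s 0 * deriv (w (- R) \<Psi>) S + L (- R) \<Psi> S = H (- R) \<Psi> + B (- R) \<Psi> S"
      "c * (s 0 * deriv (w R \<Psi>) S + L R \<Psi> S) = c * (H R \<Psi> + B R \<Psi> S)"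
      using eq[of "- R" \<Psi> S] eq[of R \<Psi> S] by simp_all
    then have "s 0 * (deriv (w (- R) \<Psi>) S - c * deriv (w R \<Psi>) S) = H (- R) \<Psi> - c * H R \<Psi>"
      unfolding L B by (simp add: algebra_simps)
    then have "deriv (w (- R) \<Psi>) S - c * deriv (w R \<Psi>) S = (H (- R) \<Psi> - c * H R \<Psi>) / s 0"
      using s0 by (simp add: field_simps)
    ultimately show ?thesis by simp
  qed
  moreover have "g period = g 0" using per[of _ \<Psi> 0] by (simp add: g_def)
  moreover have "integral {0..period} g = 0"
  proof -
    have c: "continuous_on {0..period} (\<lambda>S. w R \<Psi> S)" for R
      by (rule DERIV_continuous_on) (rule has_field_derivative_at_within[OF d])
    have "integral {0..period} g = integral {0..period} (w (- R) \<Psi>) - integral {0..period} (\<lambda>S. c * w R \<Psi> S)"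
      unfolding g_def by (intro integral_diff integrable_continuous_real continuous_intros c)
    then show ?thesis by (simp add: mean)
  qed
  ultimately have "(H (- R) \<Psi> - c * H R \<Psi>) / s 0 = 0" "g S = 0"
    using periodic_zero_mean_linear[OF _ _ period_pos] by blast+
  then show ?thesis using s0 by (simp add: g_def)
qed

text \<open>One strong induction must treat both families, because the Taylor data of order
  \<open>k\<close> for either of them contain lower orders of both \<open>u\<close> and
  \<open>v\<close>.\<close>

lemma parity:
  assumes "k \<ge> 1"
  shows "\<Lambda> k (- R) \<Psi> = - 1 * (- 1) ^ k * \<Lambda> k R \<Psi> \<and> u k (- R) \<Psi> S = - 1 * (- 1) ^ k * u k R \<Psi> S"
    "\<Omega> k (- R) \<Psi> = 1 * (- 1) ^ k * \<Omega> k R \<Psi> \<and> v k (- R) \<Psi> S = 1 * (- 1) ^ k * v k R \<Psi> S"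
proof -
  have "k \<ge> 1 \<longrightarrow> (\<forall>R \<Psi> S. (\<Lambda> k (- R) \<Psi> = - 1 * (- 1) ^ k * \<Lambda> k R \<Psi> \<and> u k (- R) \<Psi> S = - 1 * (- 1) ^ k * u k R \<Psi> S)
     \<and> (\<Omega> k (- R) \<Psi> = 1 * (- 1) ^ k * \<Omega> k R \<Psi> \<and> v k (- R) \<Psi> S = 1 * (- 1) ^ k * v k R \<Psi> S))"
  proof (induction k rule: less_induct)
    case (less k)
    have IH: "\<Lambda> j (- R) \<Psi> = - 1 * (- 1) ^ j * \<Lambda> j R \<Psi>" "u j (- R) \<Psi> S = - 1 * (- 1) ^ j * u j R \<Psi> S"
      "\<Omega> j (- R) \<Psi> = 1 * (- 1) ^ j * \<Omega> j R \<Psi>" "v j (- R) \<Psi> S = 1 * (- 1) ^ j * v j R \<Psi> S"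
      if "j < k" "1 \<le> j" for j R \<Psi> S
      using less[OF that(1)] that(2) by blast+
    have U: "U j (- R) \<Psi> S = - 1 * (- 1) ^ j * U j R \<Psi> S" if "j < k" for j R \<Psi> S
      using IH(2)[OF that] by (cases "j = 0") (auto simp: with_leading_def)
    have V: "V j (- R) \<Psi> S = 1 * (- 1) ^ j * V j R \<Psi> S" if "j < k" for j R \<Psi> S
      using IH(4)[OF that] by (cases "j = 0") (auto simp: with_leading_def)
    have du: "fps_nth (du (- R) \<Psi> S) j = - 1 * (- 1) ^ j * fps_nth (du R \<Psi> S) j" if "j < k" for j R \<Psi> S
      using IH(2)[OF that] by (cases "j = 0") (auto simp: with_leading_def series_at_def)
    have dv: "fps_nth (dv (- R) \<Psi> S) j = 1 * (- 1) ^ j * fps_nth (dv R \<Psi> S) j" if "j < k" for j R \<Psi> S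
      using IH(4)[OF that] by (cases "j = 0") (auto simp: with_leading_def series_at_def)
    show ?case
    proof (intro impI allI)
      fix R \<Psi> S assume k: "1 \<le> k"
      show "(\<Lambda> k (- R) \<Psi> = - 1 * (- 1) ^ k * \<Lambda> k R \<Psi> \<and> u k (- R) \<Psi> S = - 1 * (- 1) ^ k * u k R \<Psi> S)
     \<and> (\<Omega> k (- R) \<Psi> = 1 * (- 1) ^ k * \<Omega> k R \<Psi> \<and> v k (- R) \<Psi> S = 1 * (- 1) ^ k * v k R \<Psi> S)"
      proof
        show "\<Lambda> k (- R) \<Psi> = - 1 * (- 1) ^ k * \<Lambda> k R \<Psi> \<and> u k (- R) \<Psi> S = - 1 * (- 1) ^ k * u k R \<Psi> S"
        proof (rule parity_step[OF coeff_equation_U[OF k]])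
          show "lower_deriv_coeff q F G \<sigma> U k (- R) \<Psi> S = - 1 * (- 1) ^ k * lower_deriv_coeff q F G \<sigma> U k R \<Psi> S" for R \<Psi> S
            by (rule lower_deriv_coeff_minus[where W = U], rule F_coeff_minus, rule G_coeff_minus,
              rule phase_deriv_coeff_minus, erule U, rule U_slices, rule U_slices, rule U_slices, rule q1)
          show "lower_taylor_coeff \<Lambda> k (- R) \<Psi> (du (- R) \<Psi> S) (dv (- R) \<Psi> S) =
             - 1 * (- 1) ^ k * lower_taylor_coeff \<Lambda> k R \<Psi> (du R \<Psi> S) (dv R \<Psi> S)" for R \<Psi> S
            by (rule lower_taylor_coeff_minus[OF IH(1) smooth_\<Lambda> du dv])
        qed (use smooth_u[OF k] periodic_u[OF k] mean_u[OF k] in auto)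
        show "\<Omega> k (- R) \<Psi> = 1 * (- 1) ^ k * \<Omega> k R \<Psi> \<and> v k (- R) \<Psi> S = 1 * (- 1) ^ k * v k R \<Psi> S"
        proof (rule parity_step[OF coeff_equation_V[OF k]])
          show "lower_deriv_coeff q F G \<sigma> V k (- R) \<Psi> S = 1 * (- 1) ^ k * lower_deriv_coeff q F G \<sigma> V k R \<Psi> S" for R \<Psi> S
            by (rule lower_deriv_coeff_minus[where W = V], rule F_coeff_minus, rule G_coeff_minus,
              rule phase_deriv_coeff_minus, erule V, rule V_slices, rule V_slices, rule V_slices, rule q1)
          show "lower_taylor_coeff \<Omega> k (- R) \<Psi> (du (- R) \<Psi> S) (dv (- R) \<Psi> S) =
             1 * (- 1) ^ k * lower_taylor_coeff \<Omega> k R \<Psi> (du R \<Psi> S) (dv R \<Psi> S)" for R \<Psi> S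
            by (rule lower_taylor_coeff_minus[OF IH(3) smooth_\<Omega> du dv])
        qed (use smooth_v[OF k] periodic_v[OF k] mean_v[OF k] in auto)
      qed
    qed
  qed
  then show "\<Lambda> k (- R) \<Psi> = - 1 * (- 1) ^ k * \<Lambda> k R \<Psi> \<and> u k (- R) \<Psi> S = - 1 * (- 1) ^ k * u k R \<Psi> S"
    "\<Omega> k (- R) \<Psi> = 1 * (- 1) ^ k * \<Omega> k R \<Psi> \<and> v k (- R) \<Psi> S = 1 * (- 1) ^ k * v k R \<Psi> S"
    using assms by blast+
qed

text \<open>At order one the known data of the angular equation reduce to \<open>G 1\<close>, which
  is free of the phase; periodicity of \<open>v 1\<close> then forces \<open>\<Omega> 1\<close> to
  equal it.\<close>

lemma \<Omega>_1: "\<Omega> 1 R \<Psi> = deriv \<omega> a * R"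
proof -
  have e: "{(i, j). 1 \<le> j \<and> i + 2 * j = (1::nat)} = {}" by auto
  have G1: "G 1 R \<Psi> S = deriv \<omega> a * R" for S
    unfolding G_coeff_def e by (simp add: phase_deriv_coeff_def)
  have "s 0 * deriv (\<lambda>x. v 1 R \<Psi> x) S + deriv \<omega> a * R = \<Omega> 1 R \<Psi>" for S
    using coeff_equation_V[of 1 R \<Psi> S] q1
    by (simp add: lower_deriv_coeff_def lower_taylor_coeff_def with_leading_def G1[simplified])
  then have *: "deriv (\<lambda>x. v 1 R \<Psi> x) S = (\<Omega> 1 R \<Psi> - deriv \<omega> a * R) / s 0" for S
    using s0 by (simp add: field_simps)
  have "(v 1 R \<Psi> has_real_derivative (\<Omega> 1 R \<Psi> - deriv \<omega> a * R) / s 0) (at S)" for S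
    using smooth_slices(3)[OF smooth_v[of 1], of R \<Psi> S] *[of S] by (metis field_differentiable_derivI order_refl)
  from periodic_zero_mean_linear(1)[OF this _ period_pos mean_v[of 1]] periodic_v[of 1 R \<Psi> 0]
  show ?thesis using s0 by simp
qed

text \<open>Parity also excludes \<open>n = m = 2 q\<close>, where a negative \<open>d\<^sub>n\<^sub>,\<^sub>m\<close> of order \<open>1 / t\<close> would not
  suffice for stability.\<close>

lemma parity_restriction:
  assumes n: "1 \<le> n" and m: "2 \<le> m" "n \<le> 2 * q"
    and \<nu>: "deriv (\<lambda>\<psi>. \<Lambda> n 0 \<psi>) \<psi>0 \<noteq> 0" and d: "d_coeff n m \<psi>0 \<Lambda> \<Omega> < 0"
  shows "odd n" "m < n" "n < 2 * q" "deriv (\<lambda>\<psi>. \<Omega> m 0 \<psi>) \<psi>0 < 0"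
proof -
  show odd: "odd n"
  proof
    assume "even n"
    then have "\<Lambda> n 0 \<psi> = 0" for \<psi> using parity(1)[OF n, of 0 \<psi>] by simp
    then show False using \<nu> by simp
  qed
  have dl: "(\<lambda>\<rho>. \<Lambda> n \<rho> \<psi>0) field_differentiable (at 0)"
    using DERIV_line[OF open_UNIV smooth_\<Lambda>[OF n], of "(0, \<psi>0)" 0 "(1, 0)"]
    by (auto simp: field_differentiable_def)
  \<comment> \<open>For odd \<open>n\<close> the function \<open>\<Lambda> n\<close> is even in the
    radius.\<close>
  have lam: "deriv (\<lambda>\<rho>. \<Lambda> n \<rho> \<psi>0) 0 = 0"
    using deriv_of_reflected[of "\<lambda>\<rho>. \<Lambda> n \<rho> \<psi>0" 1 0] parity(1)[OF n] odd dl by simp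
  have om: "deriv (\<lambda>\<psi>. \<Omega> m 0 \<psi>) \<psi>0 = 0" if "odd m"
  proof -
    have "\<Omega> m 0 \<psi> = 0" for \<psi> using parity(2)[of m 0 \<psi>] that m by simp
    then show ?thesis by simp
  qed
  \<comment> \<open>For \<open>n < m\<close> the number \<open>d_coeff\<close> is the radial
    derivative, which vanishes; for \<open>n = m\<close> the index \<open>m\<close> is odd too and
    both summands vanish. Either case contradicts its negativity.\<close>
  show "m < n"
    using d lam om odd by (cases n m rule: linorder_cases) (auto simp: d_coeff_def Let_def)
  then show "deriv (\<lambda>\<psi>. \<Omega> m 0 \<psi>) \<psi>0 < 0" using d by (simp add: d_coeff_def Let_def)
  have "n \<noteq> 2 * q" using odd by auto
  then show "n < 2 * q" using m(2) by simp
qed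

end

section \<open>The Lyapunov function\<close>

text \<open>The two exponents may have an odd sum, hence the square roots of \<open>\<tau>\<close>;
  surplus powers only help because \<open>\<tau> \<le> 1\<close>.\<close>

lemma weighted_am_gm:
  fixes \<tau> x y :: real
  assumes "0 < \<tau>" "\<tau> \<le> 1" "k1 + k2 \<le> 2 * j"
  shows "\<tau> ^ j * \<bar>x\<bar> * \<bar>y\<bar> \<le> (\<tau> ^ k1 * x\<^sup>2 + \<tau> ^ k2 * y\<^sup>2) / 2"
proof -
  have *: "\<tau> ^ k = sqrt \<tau> ^ k * sqrt \<tau> ^ k" for k
    using assms(1) by (simp flip: power_mult_distrib)
  have "\<tau> ^ j = sqrt \<tau> ^ (2 * j)" using assms(1) by (simp add: power_mult)
  also have "\<dots> \<le> sqrt \<tau> ^ (k1 + k2)" using assms by (intro power_decreasing) auto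
  finally have "\<tau> ^ j * (\<bar>x\<bar> * \<bar>y\<bar>) \<le> sqrt \<tau> ^ (k1 + k2) * (\<bar>x\<bar> * \<bar>y\<bar>)"
    by (intro mult_right_mono) auto
  also have "\<dots> = (sqrt \<tau> ^ k1 * \<bar>x\<bar>) * (sqrt \<tau> ^ k2 * \<bar>y\<bar>)" by (simp add: power_add)
  also have "\<dots> \<le> ((sqrt \<tau> ^ k1 * \<bar>x\<bar>)\<^sup>2 + (sqrt \<tau> ^ k2 * \<bar>y\<bar>)\<^sup>2) / 2"
    using sum_squares_bound[of "sqrt \<tau> ^ k1 * \<bar>x\<bar>" "sqrt \<tau> ^ k2 * \<bar>y\<bar>"] by simp
  also have "\<dots> = (\<tau> ^ k1 * x\<^sup>2 + \<tau> ^ k2 * y\<^sup>2) / 2"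
    using *[of k1] *[of k2] by (simp add: power2_eq_square algebra_simps)
  finally show ?thesis by (simp add: mult.assoc)
qed

text \<open>A surplus of one full power is kept as a small factor, so that such terms can later be
  absorbed by the dissipation.\<close>

lemma weighted_am_gm_tau:
  fixes \<tau> x y :: real
  assumes "0 < \<tau>" "\<tau> \<le> 1" "k1 + k2 + 2 \<le> 2 * j"
  shows "\<tau> ^ j * \<bar>x\<bar> * \<bar>y\<bar> \<le> \<tau> * ((\<tau> ^ k1 * x\<^sup>2 + \<tau> ^ k2 * y\<^sup>2) / 2)"
proof -
  obtain i where i: "j = Suc i" using assms(3) by (cases j) auto
  have "\<tau> ^ i * \<bar>x\<bar> * \<bar>y\<bar> \<le> (\<tau> ^ k1 * x\<^sup>2 + \<tau> ^ k2 * y\<^sup>2) / 2"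
    by (rule weighted_am_gm) (use assms i in auto)
  then have "\<tau> * (\<tau> ^ i * \<bar>x\<bar> * \<bar>y\<bar>) \<le> \<tau> * ((\<tau> ^ k1 * x\<^sup>2 + \<tau> ^ k2 * y\<^sup>2) / 2)"
    using assms(1) by (intro mult_left_mono) auto
  then show ?thesis by (simp add: i algebra_simps)
qed

text \<open>Here \<open>\<gamma> = \<bar>m - 1 - l\<bar>\<close>; the cross term \<open>c \<tau>\<^sup>\<gamma> X y\<close> transfers the damping of \<open>y\<close>, of
  order \<open>\<tau>\<^sup>m\<close>, to \<open>X\<close>, both when \<open>\<tau>\<^sup>m\<close> is smaller and when it is larger than the frequency
  \<open>\<tau> ^ (l + 1)\<close>.\<close>

lemma lyapunov_derivative_bound:
  fixes e b w C :: real and l m \<gamma> q :: nat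
  assumes pos: "e > 0" "b > 0" "w > 0" "C \<ge> 0" and ml: "2 \<le> m" "m \<le> 2 * l" "l + 1 \<le> q"
    and \<gamma>: "\<gamma> = (if l + 1 \<le> m then m - (l + 1) else (l + 1) - m)"
  shows "\<exists>c>0. \<exists>s0>0. \<exists>\<theta>>0. \<exists>K>0. \<forall>\<tau> X y A Q E1 E2 E3 \<rho>.
     0 < \<tau> \<and> \<bar>y\<bar> + \<tau> \<le> s0 \<and> \<bar>X\<bar> \<le> 1 \<and> 0 \<le> \<rho> \<and>
     \<bar>A + b * y\<bar> \<le> C * (\<bar>y\<bar> + \<tau>) * \<bar>y\<bar> \<and> \<bar>Q + b / 2 * y\<^sup>2\<bar> \<le> C * (\<bar>y\<bar> + \<tau>) * y\<^sup>2 \<and>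
     \<bar>E1\<bar> \<le> C * (\<tau> ^ (2 * l + 1) * \<bar>X\<bar> + \<tau> ^ (l + m) * \<bar>y\<bar> + \<rho>) \<and>
     \<bar>E2 + w * \<tau> ^ m * y\<bar> \<le> C * (\<tau> ^ m * (\<tau> ^ l * \<bar>X\<bar> + (\<bar>y\<bar> + \<tau>) * \<bar>y\<bar>) + \<rho>) \<and>
     \<bar>E3\<bar> \<le> C * \<tau> ^ (m + 1) * y\<^sup>2 \<longrightarrow>
     (X\<^sup>2 + y\<^sup>2) / K \<le> e / 2 * X\<^sup>2 - Q - c * \<tau> ^ \<gamma> * X * y \<and>
     e / 2 * X\<^sup>2 - Q - c * \<tau> ^ \<gamma> * X * y \<le> K * (X\<^sup>2 + y\<^sup>2) \<and>
     e * X * (\<tau> ^ (l + 1) * A + E1) - (A * (\<tau> ^ (l + 1) * e * X + E2) + E3)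
      - c * \<tau> ^ \<gamma> * ((\<tau> ^ (l + 1) * A + E1) * y + X * (\<tau> ^ (l + 1) * e * X + E2))
      + c * (real \<gamma> / (2 * real q)) * \<tau> ^ (\<gamma> + 2 * q) * X * y
      \<le> - \<theta> * \<tau> ^ (2 * l) * (X\<^sup>2 + y\<^sup>2) + K * \<rho>"
proof -
  \<comment> \<open>The energy is \<open>e / 2 * X\<^sup>2 - Q\<close> with \<open>Q\<close> close
    to \<open>- b / 2 * y\<^sup>2\<close>. The number \<open>c\<close> is small enough to keep it
    definite after the cross term is included, and small enough that the terms in \<open>D1\<close>
    which the cross term produces, with factor \<open>2 * b + 4 * w\<^sup>2 / e\<close>, cost at
    most a quarter of \<open>w * b\<close>.\<close>
  define c where "c = min (min 1 (min (e / 2) (b / 2))) (w * b / 4 / (2 * b + 4 * w\<^sup>2 / e))"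
  \<comment> \<open>Exceeds the total coefficient with which \<open>s * (D1 + D2)\<close>, and
    likewise \<open>\<rho>\<close>, occurs in the estimates \<open>T1\<close> to
    \<open>T8\<close>.\<close>
  define M where "M = 2 * e * C + w * C + 4 * b * C + 5 * C + real \<gamma> + 1"
  \<comment> \<open>Small enough for \<open>C * s\<close> not to spoil the leading behaviour of
    \<open>A\<close>, \<open>Q\<close> and \<open>E2\<close>, and for \<open>M * s\<close> to
    consume at most a quarter of each dissipation coefficient, \<open>w * b\<close> and
    \<open>c * e\<close>.\<close>
  define s0 where "s0 = min (min 1 (b / (8 * (C + 1)))) (min (w / (C + 1)) (min (w * b / 4 / M) (c * e / 4 / M)))"
  define \<theta> where "\<theta> = min (w * b / 2) (c * e / 2)"
  define K where "K = M + 4 / e + 8 / b + e + b + C + 1"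
  have den: "2 * b + 4 * w\<^sup>2 / e > 0" using pos by (intro add_pos_pos) auto
  have c: "c > 0" "c \<le> 1" "c \<le> e / 2" "c \<le> b / 2" "c * (2 * b + 4 * w\<^sup>2 / e) \<le> w * b / 4"
  proof -
    show "c > 0" using pos den by (simp add: c_def)
    show "c \<le> 1" "c \<le> e / 2" "c \<le> b / 2"
      by (simp_all only: c_def min_le_iff_disj order_refl simp_thms)
    have "c \<le> w * b / 4 / (2 * b + 4 * w\<^sup>2 / e)"
      by (simp only: c_def min_le_iff_disj order_refl simp_thms)
    then show "c * (2 * b + 4 * w\<^sup>2 / e) \<le> w * b / 4" using den by (simp only: pos_le_divide_eq)
  qed
  have M: "M > 0" unfolding M_def using pos by (intro add_nonneg_pos add_nonneg_nonneg mult_nonneg_nonneg) auto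
  have s0: "s0 > 0" "s0 \<le> 1" "s0 * (8 * (C + 1)) \<le> b" "s0 * (C + 1) \<le> w" "s0 * M \<le> w * b / 4" "s0 * M \<le> c * e / 4"
  proof -
    have C1: "8 * (C + 1) > 0" "C + 1 > 0" using pos by auto
    show "s0 > 0" using pos M c C1 by (simp add: s0_def)
    show "s0 \<le> 1" by (simp only: s0_def min_le_iff_disj order_refl simp_thms)
    have "s0 \<le> b / (8 * (C + 1))" "s0 \<le> w / (C + 1)" "s0 \<le> w * b / 4 / M" "s0 \<le> c * e / 4 / M"
      by (simp_all only: s0_def min_le_iff_disj order_refl simp_thms)
    then show "s0 * (8 * (C + 1)) \<le> b" "s0 * (C + 1) \<le> w" "s0 * M \<le> w * b / 4" "s0 * M \<le> c * e / 4"
      using C1 M by (simp_all only: pos_le_divide_eq)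
  qed
  have \<theta>: "\<theta> > 0" using pos c by (simp add: \<theta>_def)
  have Kp: "K > 0" unfolding K_def using pos M by (intro add_nonneg_pos add_nonneg_nonneg) auto
  have Kb: "K \<ge> M" "4 / e \<le> K" "8 / b \<le> K" "K \<ge> e + b + C"
    unfolding K_def using pos M by (auto simp: add_nonneg_nonneg intro!: add_increasing add_increasing2)
  \<comment> \<open>All exponent arithmetic in one place. The decay rate of \<open>X\<close> has the
    exponent \<open>\<gamma> + l + 1\<close>, which is \<open>m\<close> if
    \<open>l + 1 \<le> m\<close> and \<open>2 * l + 2 - m\<close> otherwise; by
    \<open>2 \<le> m \<le> 2 * l\<close> it lies between \<open>m\<close> and
    \<open>2 * l\<close>.\<close>
  have ex: "m \<le> \<gamma> + l + 1" "\<gamma> + l + 1 \<le> 2 * l" "m + (\<gamma> + l + 1) \<le> 2 * (\<gamma> + m)"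
    "\<gamma> + l + 1 + m + 2 \<le> 2 * (l + m)" "\<gamma> + l + 1 + 1 \<le> \<gamma> + m + l"
    using ml \<gamma> by auto
  show ?thesis
  proof (rule exI[of _ c], rule conjI[OF c(1)], rule exI[of _ s0], rule conjI[OF s0(1)],
      rule exI[of _ \<theta>], rule conjI[OF \<theta>], rule exI[of _ K], rule conjI[OF Kp], intro allI impI)
    fix \<tau> X y A Q E1 E2 E3 \<rho> :: real
    define s where "s = \<bar>y\<bar> + \<tau>"
    define Y where "Y = \<bar>y\<bar>"
    \<comment> \<open>The two dissipation rates: \<open>D1\<close> stems from the damping of
      \<open>y\<close>, \<open>D2\<close> from the cross term.\<close>
    define D1 where "D1 = \<tau> ^ m * y\<^sup>2"
    define D2 where "D2 = \<tau> ^ (\<gamma> + l + 1) * X\<^sup>2"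
    assume "0 < \<tau> \<and> \<bar>y\<bar> + \<tau> \<le> s0 \<and> \<bar>X\<bar> \<le> 1 \<and> 0 \<le> \<rho> \<and>
     \<bar>A + b * y\<bar> \<le> C * (\<bar>y\<bar> + \<tau>) * \<bar>y\<bar> \<and> \<bar>Q + b / 2 * y\<^sup>2\<bar> \<le> C * (\<bar>y\<bar> + \<tau>) * y\<^sup>2 \<and>
     \<bar>E1\<bar> \<le> C * (\<tau> ^ (2 * l + 1) * \<bar>X\<bar> + \<tau> ^ (l + m) * \<bar>y\<bar> + \<rho>) \<and>
     \<bar>E2 + w * \<tau> ^ m * y\<bar> \<le> C * (\<tau> ^ m * (\<tau> ^ l * \<bar>X\<bar> + (\<bar>y\<bar> + \<tau>) * \<bar>y\<bar>) + \<rho>) \<and>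
     \<bar>E3\<bar> \<le> C * \<tau> ^ (m + 1) * y\<^sup>2"
    then have \<tau>: "0 < \<tau>" and s: "s \<le> s0" and X: "\<bar>X\<bar> \<le> 1" and \<rho>: "0 \<le> \<rho>"
      and A: "\<bar>A + b * y\<bar> \<le> C * s * Y" and Q: "\<bar>Q + b / 2 * y\<^sup>2\<bar> \<le> C * s * y\<^sup>2"
      and E1: "\<bar>E1\<bar> \<le> C * (\<tau> ^ (2 * l + 1) * \<bar>X\<bar> + \<tau> ^ (l + m) * Y + \<rho>)"
      and E2: "\<bar>E2 + w * \<tau> ^ m * y\<bar> \<le> C * (\<tau> ^ m * (\<tau> ^ l * \<bar>X\<bar> + s * Y) + \<rho>)"
      and E3: "\<bar>E3\<bar> \<le> C * \<tau> ^ (m + 1) * y\<^sup>2"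
      by (simp_all add: s_def Y_def)
    have \<tau>s: "\<tau> \<le> s" and Ys: "Y \<le> s" and Y0: "0 \<le> Y" and s00: "0 \<le> s" using \<tau> by (auto simp: s_def Y_def)
    have \<tau>1: "\<tau> \<le> 1" and Y1: "Y \<le> 1" and s1: "s \<le> 1" using \<tau>s Ys s s0 by linarith+
    have Y2: "Y\<^sup>2 = y\<^sup>2" by (simp add: Y_def)
    have D: "0 \<le> D1" "0 \<le> D2" using \<tau> by (simp_all add: D1_def D2_def)
    have Cs: "8 * (C * s) \<le> b" "C * s \<le> w"
    proof -
      have "s * (8 * (C + 1)) \<le> b" "s * (C + 1) \<le> w"
        using mult_right_mono[OF s, of "8 * (C + 1)"] mult_right_mono[OF s, of "C + 1"] s0 pos by linarith+
      then show "8 * (C * s) \<le> b" "C * s \<le> w" using s00 by (auto simp: algebra_simps)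
    qed
    have pw: "\<tau> ^ j \<le> \<tau> ^ i" if "i \<le> j" for i j using that \<tau> \<tau>1 by (intro power_decreasing) auto
    have pp: "0 \<le> \<tau> ^ i" for i using \<tau> by simp
    have sD: "\<tau> * D1 \<le> s * D1" "\<tau> * D2 \<le> s * D2" using \<tau>s D by (auto intro: mult_right_mono)
    have Dd: "s * (D1 + D2) = s * D1 + s * D2" by (simp add: distrib_left)
    have Dn: "0 \<le> s * D1" "0 \<le> s * D2" using D s00 by simp_all
    have cg: "0 \<le> c * \<tau> ^ k" for k using c pp[of k] by simp
    have XY0: "0 \<le> \<bar>X\<bar> * Y" using Y0 by simp
    have g1: "\<tau> ^ (l + m) * \<bar>X\<bar> * Y \<le> s * (D1 + D2) / 2"
      using weighted_am_gm_tau[OF \<tau> \<tau>1, of "\<gamma> + l + 1" m "l + m" X y] ex sD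
      by (simp add: D1_def D2_def Y_def algebra_simps)
    have g2: "\<tau> ^ (2 * l + 1) * \<bar>X\<bar> * Y \<le> s * (D1 + D2) / 2"
      using weighted_am_gm_tau[OF \<tau> \<tau>1, of "\<gamma> + l + 1" m "2 * l + 1" X y] ex ml sD
      by (simp add: D1_def D2_def Y_def algebra_simps)
    have g3: "\<tau> ^ (2 * l + 1) * X\<^sup>2 \<le> s * D2"
    proof -
      have "\<tau> ^ (2 * l + 1) * X\<^sup>2 \<le> \<tau> ^ (\<gamma> + l + 1 + 1) * X\<^sup>2" using ex by (intro mult_right_mono pw) auto
      then show ?thesis using sD by (simp add: D2_def)
    qed
    have g4: "\<tau> ^ (\<gamma> + m + l) * X\<^sup>2 \<le> s * D2"
    proof -
      have "\<tau> ^ (\<gamma> + m + l) * X\<^sup>2 \<le> \<tau> ^ (\<gamma> + l + 1 + 1) * X\<^sup>2" using ex by (intro mult_right_mono pw) auto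
      then show ?thesis using sD by (simp add: D2_def)
    qed
    have g5: "\<tau> ^ (m + 1) * y\<^sup>2 \<le> s * D1" using sD by (simp add: D1_def)
    have g5': "\<tau> ^ (l + m) * y\<^sup>2 \<le> s * D1"
    proof -
      have "\<tau> ^ (l + m) * y\<^sup>2 \<le> \<tau> ^ (m + 1) * y\<^sup>2" using ml by (intro mult_right_mono pw) auto
      then show ?thesis using g5 by linarith
    qed
    \<comment> \<open>The one mixed term without a spare small factor. The rescaling by
      \<open>r\<close> fixes its share of \<open>D2\<close>: after multiplication by
      \<open>2 * c * w\<close> it is \<open>c * e / 4\<close>, a quarter of the dissipation of
      \<open>X\<close>.\<close>
    have g6: "\<tau> ^ (\<gamma> + m) * \<bar>X\<bar> * Y \<le> e / (8 * w) * D2 + 2 * w / e * D1"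
    proof -
      define r where "r = sqrt (e / (4 * w))"
      have r: "r > 0" "r\<^sup>2 = e / (4 * w)" using pos by (simp_all add: r_def)
      have "\<tau> ^ (\<gamma> + m) * \<bar>r * X\<bar> * \<bar>y / r\<bar> \<le> (\<tau> ^ (\<gamma> + l + 1) * (r * X)\<^sup>2 + \<tau> ^ m * (y / r)\<^sup>2) / 2"
        by (rule weighted_am_gm[OF \<tau> \<tau>1]) (use ex in auto)
      moreover have "\<tau> ^ (\<gamma> + m) * \<bar>r * X\<bar> * \<bar>y / r\<bar> = \<tau> ^ (\<gamma> + m) * \<bar>X\<bar> * Y"
        using r by (simp add: abs_mult Y_def)
      moreover have "(\<tau> ^ (\<gamma> + l + 1) * (r * X)\<^sup>2 + \<tau> ^ m * (y / r)\<^sup>2) / 2 = e / (8 * w) * D2 + 2 * w / e * D1"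
        using pos by (simp add: power_mult_distrib power_divide r D1_def D2_def field_simps)
      ultimately show ?thesis by (simp only:)
    qed
    have g7: "\<tau> ^ (\<gamma> + 2 * q) * \<bar>X\<bar> * Y \<le> s * (D1 + D2) / 2"
    proof -
      have "\<tau> ^ (\<gamma> + 2 * q) * (\<bar>X\<bar> * Y) \<le> \<tau> ^ (2 * l + 1) * (\<bar>X\<bar> * Y)"
        using ml XY0 by (intro mult_right_mono pw) auto
      then show ?thesis using g2 by (simp add: algebra_simps)
    qed
    have g8: "\<tau> ^ (\<gamma> + l + 1) * y\<^sup>2 \<le> D1"
      unfolding D1_def using ex by (intro mult_right_mono pw) auto
    have \<rho>X: "\<rho> * \<bar>X\<bar> \<le> \<rho>" "\<rho> * Y \<le> \<rho>" using \<rho> X Y1 by (auto intro: mult_left_le)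
    have \<gamma>1: "\<tau> ^ \<gamma> \<le> 1" using \<tau> \<tau>1 by (intro power_le_one) auto
    have Ab: "\<bar>A\<bar> \<le> 2 * b * Y"
    proof -
      have "\<bar>b * y\<bar> = b * Y" using pos by (simp add: Y_def abs_mult)
      then have "\<bar>A\<bar> \<le> C * s * Y + b * Y" using A by linarith
      moreover have "C * s * Y \<le> b * Y" using Cs pos s00 Y0 by (intro mult_right_mono) auto
      ultimately show ?thesis by simp
    qed
    have T1: "e * X * E1 \<le> e * C * (3 / 2 * (s * (D1 + D2)) + \<rho>)"
    proof -
      have "X * E1 \<le> \<bar>X\<bar> * \<bar>E1\<bar>" by (metis abs_ge_self abs_mult)
      also have "\<dots> \<le> \<bar>X\<bar> * (C * (\<tau> ^ (2 * l + 1) * \<bar>X\<bar> + \<tau> ^ (l + m) * Y + \<rho>))"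
        using E1 by (intro mult_left_mono) auto
      also have "\<dots> = C * (\<tau> ^ (2 * l + 1) * X\<^sup>2 + \<tau> ^ (l + m) * \<bar>X\<bar> * Y + \<rho> * \<bar>X\<bar>)"
        by (simp add: algebra_simps power2_eq_square abs_mult_self_eq flip: abs_mult)
      also have "\<dots> \<le> C * (s * D2 + s * (D1 + D2) / 2 + \<rho>)"
        using g3 g1 \<rho>X pos by (intro mult_left_mono add_mono) auto
      also have "\<dots> \<le> C * (3 / 2 * (s * (D1 + D2)) + \<rho>)"
        using D s00 pos by (intro mult_left_mono) (auto simp: algebra_simps)
      finally have "e * (X * E1) \<le> e * (C * (3 / 2 * (s * (D1 + D2)) + \<rho>))"
        using pos by (intro mult_left_mono) auto
      then show ?thesis by (simp add: mult.assoc)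
    qed
    \<comment> \<open>The damping enters here: \<open>A\<close> is close to \<open>- b * y\<close>
      and \<open>E2\<close> to \<open>- w * \<tau> ^ m * y\<close>, so \<open>- A * E2\<close> is
      close to \<open>- w * b * D1\<close>.\<close>
    have T2: "- A * E2 \<le> - (w * b) * D1 + w * C * (s * (D1 + D2)) + 2 * b * C * (3 / 2 * (s * (D1 + D2)) + \<rho>)"
    proof -
      have "\<bar>A * y + b * y\<^sup>2\<bar> \<le> C * s * y\<^sup>2"
      proof -
        have "\<bar>A * y + b * y\<^sup>2\<bar> = \<bar>A + b * y\<bar> * Y"
          by (simp add: Y_def power2_eq_square algebra_simps flip: abs_mult)
        also have "\<dots> \<le> C * s * Y * Y" using A Y0 by (intro mult_right_mono)
        finally show ?thesis using Y2 by (simp add: power2_eq_square mult.assoc)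
      qed
      then have "A * y \<le> - (b * y\<^sup>2) + C * s * y\<^sup>2" by linarith
      then have "w * \<tau> ^ m * (A * y) \<le> w * \<tau> ^ m * (- (b * y\<^sup>2) + C * s * y\<^sup>2)"
        using pos pp by (intro mult_left_mono) auto
      then have 1: "w * \<tau> ^ m * (A * y) \<le> - (w * b) * D1 + w * C * (s * D1)"
        by (simp add: D1_def algebra_simps)
      have "\<bar>A * (E2 + w * \<tau> ^ m * y)\<bar> \<le> 2 * b * Y * (C * (\<tau> ^ m * (\<tau> ^ l * \<bar>X\<bar> + s * Y) + \<rho>))"
        unfolding abs_mult using Ab E2 pos Y0 by (intro mult_mono) auto
      also have "\<dots> = 2 * b * C * (\<tau> ^ (l + m) * \<bar>X\<bar> * Y + s * D1 + \<rho> * Y)"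
        using Y2 by (simp add: D1_def power_add power2_eq_square algebra_simps)
      also have "\<dots> \<le> 2 * b * C * (3 / 2 * (s * (D1 + D2)) + \<rho>)"
      proof (rule mult_left_mono)
        have "0 \<le> s * D2" using D s00 by simp
        then show "\<tau> ^ (l + m) * \<bar>X\<bar> * Y + s * D1 + \<rho> * Y \<le> 3 / 2 * (s * (D1 + D2)) + \<rho>"
          using g1 \<rho>X Dd Dn by linarith
      qed (use pos in auto)
      finally have 2: "- (A * (E2 + w * \<tau> ^ m * y)) \<le> 2 * b * C * (3 / 2 * (s * (D1 + D2)) + \<rho>)"
        by linarith
      have 3: "w * C * (s * D1) \<le> w * C * (s * (D1 + D2))"
        using D s00 pos by (intro mult_left_mono) auto
      have "- A * E2 = w * \<tau> ^ m * (A * y) - A * (E2 + w * \<tau> ^ m * y)" by (simp add: algebra_simps)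
      then show ?thesis using 1 2 3 by linarith
    qed
    have T3: "- E3 \<le> C * (s * (D1 + D2))"
    proof -
      have "- E3 \<le> C * (\<tau> ^ (m + 1) * y\<^sup>2)" using E3 by (simp add: mult.assoc)
      also have "\<dots> \<le> C * (s * (D1 + D2))"
      proof (rule mult_left_mono)
        have "0 \<le> s * D2" using D s00 by simp
        then show "\<tau> ^ (m + 1) * y\<^sup>2 \<le> s * (D1 + D2)" using g5 by (simp add: algebra_simps)
      qed (use pos in auto)
      finally show ?thesis .
    qed
    have T4: "- (c * \<tau> ^ \<gamma> * (\<tau> ^ (l + 1) * A * y)) \<le> c * (2 * b) * D1"
    proof -
      have "- (A * y) \<le> \<bar>A\<bar> * Y" unfolding Y_def by (metis abs_ge_minus_self abs_mult)
      also have "\<dots> \<le> 2 * b * Y * Y" using Ab Y0 by (intro mult_right_mono)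
      finally have "- (A * y) \<le> 2 * b * y\<^sup>2" using Y2 by (simp add: power2_eq_square mult.assoc)
      then have "c * \<tau> ^ (\<gamma> + l + 1) * (- (A * y)) \<le> c * \<tau> ^ (\<gamma> + l + 1) * (2 * b * y\<^sup>2)"
        by (intro mult_left_mono cg)
      also have "\<dots> = c * (2 * b) * (\<tau> ^ (\<gamma> + l + 1) * y\<^sup>2)" by simp
      also have "\<dots> \<le> c * (2 * b) * D1" using g8 c pos by (intro mult_left_mono) auto
      finally show ?thesis by (simp add: power_add algebra_simps)
    qed
    have T5: "- (c * \<tau> ^ \<gamma> * (E1 * y)) \<le> C * (3 / 2 * (s * (D1 + D2)) + \<rho>)"
    proof -
      have "- (E1 * y) \<le> \<bar>E1\<bar> * Y" unfolding Y_def by (metis abs_ge_minus_self abs_mult)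
      also have "\<dots> \<le> (C * (\<tau> ^ (2 * l + 1) * \<bar>X\<bar> + \<tau> ^ (l + m) * Y + \<rho>)) * Y"
        using E1 Y0 by (intro mult_right_mono)
      also have "\<dots> = C * (\<tau> ^ (2 * l + 1) * \<bar>X\<bar> * Y + \<tau> ^ (l + m) * y\<^sup>2 + \<rho> * Y)"
        using Y2 by (simp add: power2_eq_square algebra_simps)
      also have "\<dots> \<le> C * (3 / 2 * (s * (D1 + D2)) + \<rho>)"
      proof (rule mult_left_mono)
        have "0 \<le> s * D2" using D s00 by simp
        then show "\<tau> ^ (2 * l + 1) * \<bar>X\<bar> * Y + \<tau> ^ (l + m) * y\<^sup>2 + \<rho> * Y \<le> 3 / 2 * (s * (D1 + D2)) + \<rho>"
          using g2 g5' \<rho>X Dd Dn by linarith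
      qed (use pos in auto)
      finally have *: "- (E1 * y) \<le> C * (3 / 2 * (s * (D1 + D2)) + \<rho>)" .
      have "0 \<le> C * (3 / 2 * (s * (D1 + D2)) + \<rho>)" using D s00 pos \<rho> by simp
      moreover have "0 \<le> c * \<tau> ^ \<gamma>" "c * \<tau> ^ \<gamma> \<le> 1" using c pp \<gamma>1 by (auto intro: mult_le_one)
      ultimately have "c * \<tau> ^ \<gamma> * (- (E1 * y)) \<le> C * (3 / 2 * (s * (D1 + D2)) + \<rho>)"
        using mult_left_mono[OF *, of "c * \<tau> ^ \<gamma>"] mult_left_le_one_le[of "C * (3 / 2 * (s * (D1 + D2)) + \<rho>)" "c * \<tau> ^ \<gamma>"]
        by linarith
      then show ?thesis by simp
    qed
    \<comment> \<open>Through the cross term the conservative coupling itself yields dissipation of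
      \<open>X\<close>.\<close>
    have T6: "- (c * \<tau> ^ \<gamma> * (X * (\<tau> ^ (l + 1) * e * X))) = - (c * e) * D2"
      by (simp add: D2_def power_add power2_eq_square algebra_simps)
    have T7: "- (c * \<tau> ^ \<gamma> * (X * E2)) \<le> c * (e / 4) * D2 + c * (4 * w\<^sup>2 / e) * D1 + C * (s * (D1 + D2) + \<rho>)"
    proof -
      have e2: "\<bar>E2\<bar> \<le> w * \<tau> ^ m * Y + C * (\<tau> ^ m * (\<tau> ^ l * \<bar>X\<bar> + s * Y) + \<rho>)"
      proof -
        have "\<bar>w * \<tau> ^ m * y\<bar> = w * \<tau> ^ m * Y" using pos pp by (simp add: Y_def abs_mult)
        then show ?thesis using E2 by linarith
      qed
      have "- (X * E2) \<le> \<bar>X\<bar> * \<bar>E2\<bar>" by (metis abs_ge_minus_self abs_mult)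
      also have "\<dots> \<le> \<bar>X\<bar> * (w * \<tau> ^ m * Y + C * (\<tau> ^ m * (\<tau> ^ l * \<bar>X\<bar> + s * Y) + \<rho>))"
        using e2 by (intro mult_left_mono) auto
      also have "\<dots> = (w + C * s) * (\<tau> ^ m * \<bar>X\<bar> * Y) + C * (\<tau> ^ (m + l) * X\<^sup>2 + \<rho> * \<bar>X\<bar>)"
        by (simp add: power_add power2_eq_square algebra_simps abs_mult_self_eq flip: abs_mult)
      also have "\<dots> \<le> 2 * w * (\<tau> ^ m * \<bar>X\<bar> * Y) + C * (\<tau> ^ (m + l) * X\<^sup>2 + \<rho>)"
        using Cs \<rho>X pos pp XY0 by (intro add_mono mult_right_mono mult_left_mono) (auto simp: mult.assoc)
      finally have "c * \<tau> ^ \<gamma> * (- (X * E2)) \<le> c * \<tau> ^ \<gamma> * (2 * w * (\<tau> ^ m * \<bar>X\<bar> * Y) + C * (\<tau> ^ (m + l) * X\<^sup>2 + \<rho>))"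
        using c pp by (intro mult_left_mono) auto
      also have "\<dots> = c * (2 * w) * (\<tau> ^ (\<gamma> + m) * \<bar>X\<bar> * Y) + C * (c * (\<tau> ^ (\<gamma> + m + l) * X\<^sup>2) + c * \<tau> ^ \<gamma> * \<rho>)"
        by (simp add: power_add algebra_simps)
      also have "\<dots> \<le> c * (2 * w) * (e / (8 * w) * D2 + 2 * w / e * D1) + C * (s * (D1 + D2) + \<rho>)"
      proof (intro add_mono mult_left_mono g6)
        have "c * (\<tau> ^ (\<gamma> + m + l) * X\<^sup>2) \<le> 1 * (\<tau> ^ (\<gamma> + m + l) * X\<^sup>2)"
          using c pp by (intro mult_right_mono) auto
        moreover have "0 \<le> s * D1" using D s00 by simp
        ultimately show "c * (\<tau> ^ (\<gamma> + m + l) * X\<^sup>2) \<le> s * (D1 + D2)" using g4 by (simp add: algebra_simps)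
        have "c * \<tau> ^ \<gamma> \<le> 1" using c pp \<gamma>1 by (auto intro: mult_le_one)
        then show "c * \<tau> ^ \<gamma> * \<rho> \<le> \<rho>" using mult_right_mono[of "c * \<tau> ^ \<gamma>" 1 \<rho>] \<rho> by simp
      qed (use c pos in auto)
      also have "c * (2 * w) * (e / (8 * w) * D2 + 2 * w / e * D1) = c * (e / 4) * D2 + c * (4 * w\<^sup>2 / e) * D1"
        using pos by (simp add: field_simps power2_eq_square)
      finally show ?thesis by simp
    qed
    have T8: "c * (real \<gamma> / (2 * real q)) * \<tau> ^ (\<gamma> + 2 * q) * X * y \<le> real \<gamma> * (s * (D1 + D2))"
    proof -
      have q: "real \<gamma> / (2 * real q) \<le> real \<gamma>" using ml by (simp add: field_simps mult_le_cancel_left1)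
      have "X * y \<le> \<bar>X\<bar> * Y" unfolding Y_def by (metis abs_ge_self abs_mult)
      then have "c * (real \<gamma> / (2 * real q)) * \<tau> ^ (\<gamma> + 2 * q) * (X * y) \<le> c * (real \<gamma> / (2 * real q)) * \<tau> ^ (\<gamma> + 2 * q) * (\<bar>X\<bar> * Y)"
        using c pp by (intro mult_left_mono) auto
      also have "\<dots> = c * (real \<gamma> / (2 * real q)) * (\<tau> ^ (\<gamma> + 2 * q) * \<bar>X\<bar> * Y)" by simp
      also have "\<dots> \<le> (1 * real \<gamma>) * (s * (D1 + D2))"
      proof (rule mult_mono)
        show "c * (real \<gamma> / (2 * real q)) \<le> 1 * real \<gamma>" by (rule mult_mono) (use c q in auto)
        have "0 \<le> s * (D1 + D2)" using D s00 by simp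
        then show "\<tau> ^ (\<gamma> + 2 * q) * \<bar>X\<bar> * Y \<le> s * (D1 + D2)" using g7 by linarith
      qed (use c q pp Y0 in auto)
      finally show ?thesis by (simp add: mult.assoc)
    qed
    define Z where "Z = s * (D1 + D2)"
    have Z: "0 \<le> Z" using D s00 by (simp add: Z_def)
    have tot: "e * X * (\<tau> ^ (l + 1) * A + E1) - (A * (\<tau> ^ (l + 1) * e * X + E2) + E3)
      - c * \<tau> ^ \<gamma> * ((\<tau> ^ (l + 1) * A + E1) * y + X * (\<tau> ^ (l + 1) * e * X + E2))
      + c * (real \<gamma> / (2 * real q)) * \<tau> ^ (\<gamma> + 2 * q) * X * y
      \<le> - (w * b) * D1 + c * (2 * b + 4 * w\<^sup>2 / e) * D1 - 3 / 4 * (c * e) * D2 + M * Z + M * \<rho>"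
    proof -
      \<comment> \<open>The products of \<open>e * X\<close> with
        \<open>\<tau> ^ (l + 1) * A\<close> coming from the kinetic and from the potential part
        cancel identically, so they are never estimated.\<close>
      have split: "e * X * (\<tau> ^ (l + 1) * A + E1) - (A * (\<tau> ^ (l + 1) * e * X + E2) + E3)
        - c * \<tau> ^ \<gamma> * ((\<tau> ^ (l + 1) * A + E1) * y + X * (\<tau> ^ (l + 1) * e * X + E2))
        = e * X * E1 + (- A * E2) + (- E3) + (- (c * \<tau> ^ \<gamma> * (\<tau> ^ (l + 1) * A * y)))
          + (- (c * \<tau> ^ \<gamma> * (E1 * y))) + (- (c * \<tau> ^ \<gamma> * (X * (\<tau> ^ (l + 1) * e * X)))) + (- (c * \<tau> ^ \<gamma> * (X * E2)))"
        by (simp add: algebra_simps)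
      have MZ: "M * Z = 2 * (e * C * Z) + w * C * Z + 4 * (b * C * Z) + 5 * (C * Z) + real \<gamma> * Z + Z"
        and M\<rho>: "M * \<rho> = 2 * (e * C * \<rho>) + w * C * \<rho> + 4 * (b * C * \<rho>) + 5 * (C * \<rho>) + real \<gamma> * \<rho> + \<rho>"
        by (simp_all add: M_def algebra_simps)
      have nn: "0 \<le> e * C * Z" "0 \<le> w * C * Z" "0 \<le> b * C * Z" "0 \<le> C * Z" "0 \<le> real \<gamma> * Z"
        "0 \<le> e * C * \<rho>" "0 \<le> w * C * \<rho>" "0 \<le> b * C * \<rho>" "0 \<le> C * \<rho>" "0 \<le> real \<gamma> * \<rho>"
        using pos Z \<rho> by simp_all
      have t1: "e * X * E1 \<le> 3 / 2 * (e * C * Z) + e * C * \<rho>" using T1 unfolding Z_def[symmetric] by (simp add: algebra_simps)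
      have t2: "- A * E2 \<le> - (w * b) * D1 + w * C * Z + 3 * (b * C * Z) + 2 * (b * C * \<rho>)"
        using T2 unfolding Z_def[symmetric] by (simp add: algebra_simps)
      have t5: "- (c * \<tau> ^ \<gamma> * (E1 * y)) \<le> 3 / 2 * (C * Z) + C * \<rho>" using T5 unfolding Z_def[symmetric] by (simp add: algebra_simps)
      have t7: "- (c * \<tau> ^ \<gamma> * (X * E2)) \<le> 1 / 4 * (c * e) * D2 + c * (4 * w\<^sup>2 / e) * D1 + C * Z + C * \<rho>"
        using T7 unfolding Z_def[symmetric] by (simp add: algebra_simps)
      have t34: "c * (2 * b + 4 * w\<^sup>2 / e) * D1 = c * (2 * b) * D1 + c * (4 * w\<^sup>2 / e) * D1"
        by (simp add: algebra_simps)
      have t6: "- 3 / 4 * (c * e) * D2 = - (c * e) * D2 + 1 / 4 * (c * e) * D2" by (simp add: algebra_simps)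
      show ?thesis unfolding split MZ M\<rho> t34
        using t1 t2 T3 T4 t5 T6 t7 T8 nn Z \<rho> t6 unfolding Z_def[symmetric] by linarith
    qed
    have small: "M * Z \<le> w * b / 4 * D1 + c * e / 4 * D2"
    proof -
      have "M * s \<le> s0 * M" using mult_left_mono[OF s, of M] M by (simp add: mult.commute)
      then have ms: "M * s \<le> w * b / 4" "M * s \<le> c * e / 4" using s0 by linarith+
      show ?thesis
        using mult_right_mono[OF ms(1) D(1)] mult_right_mono[OF ms(2) D(2)] by (simp add: Z_def algebra_simps)
    qed
    have cD: "c * (2 * b + 4 * w\<^sup>2 / e) * D1 \<le> w * b / 4 * D1" using c D by (intro mult_right_mono) auto
    \<comment> \<open>Both rates dominate \<open>\<tau> ^ (2 * l)\<close> times the respective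
      square, since \<open>m\<close> and \<open>\<gamma> + l + 1\<close> are at most
      \<open>2 * l\<close>; this gives one common decay rate.\<close>
    have dd: "\<theta> * \<tau> ^ (2 * l) * (X\<^sup>2 + y\<^sup>2) \<le> w * b / 2 * D1 + c * e / 2 * D2"
    proof -
      have "\<tau> ^ (2 * l) * y\<^sup>2 \<le> D1" "\<tau> ^ (2 * l) * X\<^sup>2 \<le> D2"
        unfolding D1_def D2_def using ex ml by (intro mult_right_mono pw; simp)+
      moreover have "\<theta> \<le> w * b / 2" "\<theta> \<le> c * e / 2"
        by (simp_all only: \<theta>_def min_le_iff_disj order_refl simp_thms)
      moreover have "0 \<le> w * b / 2" "0 \<le> c * e / 2" "0 \<le> \<tau> ^ (2 * l) * y\<^sup>2" "0 \<le> \<tau> ^ (2 * l) * X\<^sup>2"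
        using pos c pp by simp_all
      ultimately have "\<theta> * (\<tau> ^ (2 * l) * y\<^sup>2) \<le> w * b / 2 * D1" "\<theta> * (\<tau> ^ (2 * l) * X\<^sup>2) \<le> c * e / 2 * D2"
        by (simp_all only: mult_mono)
      then show ?thesis by (simp add: algebra_simps)
    qed
    have K\<rho>: "M * \<rho> \<le> K * \<rho>" using Kb \<rho> by (intro mult_right_mono) auto
    have w1: "\<bar>c * \<tau> ^ \<gamma> * X * y\<bar> \<le> c * ((X\<^sup>2 + y\<^sup>2) / 2)"
    proof -
      have "\<bar>c * \<tau> ^ \<gamma> * X * y\<bar> = c * (\<tau> ^ \<gamma> * (\<bar>X\<bar> * Y))" using c pp by (simp add: abs_mult Y_def)
      also have "\<dots> \<le> c * (1 * (\<bar>X\<bar> * Y))" using \<gamma>1 c XY0 by (intro mult_left_mono mult_right_mono) auto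
      also have "\<dots> \<le> c * ((X\<^sup>2 + y\<^sup>2) / 2)"
        using sum_squares_bound[of "\<bar>X\<bar>" Y] c Y2 by (intro mult_left_mono) auto
      finally show ?thesis .
    qed
    have cX: "c * X\<^sup>2 \<le> e / 2 * X\<^sup>2" "c * y\<^sup>2 \<le> b / 2 * y\<^sup>2"
      by (rule mult_right_mono; use c in simp)+
    have Csy: "C * s * y\<^sup>2 \<le> b / 8 * y\<^sup>2" using Cs by (intro mult_right_mono) auto
    have wb: "c * ((X\<^sup>2 + y\<^sup>2) / 2) = c * X\<^sup>2 / 2 + c * y\<^sup>2 / 2" by (simp add: algebra_simps)
    have lo: "(X\<^sup>2 + y\<^sup>2) / K \<le> e / 4 * X\<^sup>2 + b / 8 * y\<^sup>2"
    proof -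
      have "1 / K \<le> e / 4" "1 / K \<le> b / 8" using Kb Kp pos by (simp_all add: field_simps)
      then have "1 / K * X\<^sup>2 \<le> e / 4 * X\<^sup>2" "1 / K * y\<^sup>2 \<le> b / 8 * y\<^sup>2"
        by (simp_all only: mult_right_mono zero_le_power2)
      moreover have "(X\<^sup>2 + y\<^sup>2) / K = 1 / K * X\<^sup>2 + 1 / K * y\<^sup>2" by (simp add: add_divide_distrib)
      ultimately show ?thesis by linarith
    qed
    have hi: "(e + b) * X\<^sup>2 + (e + b) * y\<^sup>2 \<le> K * (X\<^sup>2 + y\<^sup>2)"
    proof -
      have "(e + b) * (X\<^sup>2 + y\<^sup>2) \<le> K * (X\<^sup>2 + y\<^sup>2)" using Kb pos by (intro mult_right_mono) auto
      then show ?thesis by (simp add: algebra_simps)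
    qed
    have pX: "0 \<le> e * X\<^sup>2" "0 \<le> b * X\<^sup>2" "0 \<le> e * y\<^sup>2" "0 \<le> b * y\<^sup>2" using pos by simp_all
    show "(X\<^sup>2 + y\<^sup>2) / K \<le> e / 2 * X\<^sup>2 - Q - c * \<tau> ^ \<gamma> * X * y \<and>
     e / 2 * X\<^sup>2 - Q - c * \<tau> ^ \<gamma> * X * y \<le> K * (X\<^sup>2 + y\<^sup>2) \<and>
     e * X * (\<tau> ^ (l + 1) * A + E1) - (A * (\<tau> ^ (l + 1) * e * X + E2) + E3)
      - c * \<tau> ^ \<gamma> * ((\<tau> ^ (l + 1) * A + E1) * y + X * (\<tau> ^ (l + 1) * e * X + E2))
      + c * (real \<gamma> / (2 * real q)) * \<tau> ^ (\<gamma> + 2 * q) * X * y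
      \<le> - \<theta> * \<tau> ^ (2 * l) * (X\<^sup>2 + y\<^sup>2) + K * \<rho>"
    proof (intro conjI)
      show "(X\<^sup>2 + y\<^sup>2) / K \<le> e / 2 * X\<^sup>2 - Q - c * \<tau> ^ \<gamma> * X * y"
        using w1 wb cX Csy lo Q pX by (simp add: abs_le_iff) linarith
      show "e / 2 * X\<^sup>2 - Q - c * \<tau> ^ \<gamma> * X * y \<le> K * (X\<^sup>2 + y\<^sup>2)"
        using w1 wb cX Csy hi Q pX unfolding abs_le_iff ring_distribs by linarith
      have comb: "P \<le> - \<theta> * \<tau> ^ (2 * l) * (X\<^sup>2 + y\<^sup>2) + K * \<rho>"
        if "P \<le> - (w * b) * D1 + G - 3 / 4 * (c * e) * D2 + M * Z + M * \<rho>" "G \<le> w * b / 4 * D1" for P G :: real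
      proof -
        have "\<theta> * \<tau> ^ (2 * l) * (X\<^sup>2 + y\<^sup>2) \<le> (w * b * D1) / 2 + (c * e * D2) / 2"
          "M * Z \<le> (w * b * D1) / 4 + (c * e * D2) / 4"
          "P \<le> - (w * b * D1) + G - 3 / 4 * (c * e * D2) + M * Z + M * \<rho>" "G \<le> (w * b * D1) / 4"
          using dd small that by (simp_all add: mult.assoc)
        then have "P \<le> - (\<theta> * \<tau> ^ (2 * l) * (X\<^sup>2 + y\<^sup>2)) + K * \<rho>" using K\<rho> by linarith
        then show ?thesis by simp
      qed
      show "e * X * (\<tau> ^ (l + 1) * A + E1) - (A * (\<tau> ^ (l + 1) * e * X + E2) + E3)
        - c * \<tau> ^ \<gamma> * ((\<tau> ^ (l + 1) * A + E1) * y + X * (\<tau> ^ (l + 1) * e * X + E2))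
        + c * (real \<gamma> / (2 * real q)) * \<tau> ^ (\<gamma> + 2 * q) * X * y
        \<le> - \<theta> * \<tau> ^ (2 * l) * (X\<^sup>2 + y\<^sup>2) + K * \<rho>"
        by (rule comb[OF tot cD])
    qed
  qed
qed

section \<open>The near-identity change of variables\<close>

lemma periodic_bounded3:
  fixes h :: "real \<times> real \<times> real \<Rightarrow> real"
  assumes "compact A" "compact B" "continuous_on (A \<times> B \<times> UNIV) h" "P > 0"
    and per: "\<And>x y S. x \<in> A \<Longrightarrow> y \<in> B \<Longrightarrow> h (x, y, S + P) = h (x, y, S)"
  shows "\<exists>C\<ge>0. \<forall>x\<in>A. \<forall>y\<in>B. \<forall>S. \<bar>h (x, y, S)\<bar> \<le> C"
proof -
  have "continuous_on ((A \<times> B) \<times> UNIV) (\<lambda>z. h (fst (fst z), snd (fst z), snd z))"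
    by (rule continuous_on_compose2[OF assms(3)]) (auto intro!: continuous_intros)
  then have "continuous_on ((A \<times> B) \<times> UNIV) (\<lambda>(z, S). h (fst z, snd z, S))"
    by (simp add: case_prod_beta)
  from periodic_bounded[OF compact_Times[OF assms(1,2)] this, of P] assms(4) per
  show ?thesis by fastforce
qed

lemma Taylor_line_bound:
  fixes h :: "'a::real_normed_vector \<Rightarrow> real"
  assumes "open D" "smooth_on D h" "\<And>r. \<bar>r\<bar> \<le> \<bar>s\<bar> \<Longrightarrow> x + r *\<^sub>R v \<in> D"
    and "\<And>r. \<bar>r\<bar> \<le> \<bar>s\<bar> \<Longrightarrow> \<bar>(dir_deriv v ^^ Suc N) h (x + r *\<^sub>R v)\<bar> \<le> C"
  shows "\<bar>h (x + s *\<^sub>R v) - (\<Sum>i\<le>N. (dir_deriv v ^^ i) h x / fact i * s ^ i)\<bar> \<le> C * \<bar>s\<bar> ^ Suc N"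
proof -
  obtain r where r: "\<bar>r\<bar> \<le> \<bar>s\<bar>" "h (x + s *\<^sub>R v) =
     (\<Sum>i<Suc N. (dir_deriv v ^^ i) h x / fact i * s ^ i) + (dir_deriv v ^^ Suc N) h (x + r *\<^sub>R v) / fact (Suc N) * s ^ Suc N"
    using Taylor_line[OF assms(1-3), where n = "Suc N"] by blast
  have e: "h (x + s *\<^sub>R v) - (\<Sum>i\<le>N. (dir_deriv v ^^ i) h x / fact i * s ^ i)
     = (dir_deriv v ^^ Suc N) h (x + r *\<^sub>R v) / fact (Suc N) * s ^ Suc N"
    unfolding r(2) lessThan_Suc_atMost by simp
  have b: "\<bar>(dir_deriv v ^^ Suc N) h (x + r *\<^sub>R v)\<bar> \<le> C" using assms(4) r(1) by blast
  have "\<bar>(dir_deriv v ^^ Suc N) h (x + r *\<^sub>R v) / fact (Suc N)\<bar> \<le> \<bar>(dir_deriv v ^^ Suc N) h (x + r *\<^sub>R v)\<bar> / 1"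
    unfolding abs_divide by (intro divide_left_mono) (auto simp del: fact_Suc intro: fact_ge_1)
  then have "\<bar>(dir_deriv v ^^ Suc N) h (x + r *\<^sub>R v) / fact (Suc N)\<bar> \<le> C" using b by simp
  then show ?thesis unfolding e abs_mult power_abs by (rule mult_right_mono) simp
qed

text \<open>Inserting \<open>a + \<tau> * R\<close> into a series in squares of
  \<open>\<tau>\<close> produces the powers \<open>i + 2 * j\<close>, and division by
  \<open>\<tau> ^ e\<close> shifts them. The radial field, which is divided by
  \<open>\<tau>\<close>, needs \<open>e = 1\<close>, the angular one \<open>e = 0\<close>.\<close>

lemma double_index_sum:
  fixes c :: "nat \<Rightarrow> nat \<Rightarrow> real"
  assumes "k + e < 2 * K" "e \<le> 1"
  shows "(\<Sum>j=1..<K. fps_nth (fps_X ^ (2 * j - e) * Abs_fps (\<lambda>i. c j i)) k)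
     = (\<Sum>(i, j) \<in> {(i, j). 1 \<le> j \<and> i + 2 * j = k + e}. c j i)"
proof -
  have "(\<Sum>j=1..<K. fps_nth (fps_X ^ (2 * j - e) * Abs_fps (\<lambda>i. c j i)) k)
     = (\<Sum>j\<in>{1..<K}. if 2 * j \<le> k + e then c j (k + e - 2 * j) else 0)"
  proof (rule sum.cong[OF refl])
    fix j assume "j \<in> {1..<K}"
    then have "(k < 2 * j - e) = (\<not> 2 * j \<le> k + e)" "k - (2 * j - e) = k + e - 2 * j"
      using assms by auto
    then show "fps_nth (fps_X ^ (2 * j - e) * Abs_fps (\<lambda>i. c j i)) k = (if 2 * j \<le> k + e then c j (k + e - 2 * j) else 0)"
      by (simp add: fps_X_power_mult_nth)
  qed
  also have "\<dots> = (\<Sum>j\<in>{j\<in>{1..<K}. 2 * j \<le> k + e}. c j (k + e - 2 * j))"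
    by (rule sum.inter_filter[symmetric]) simp
  also have "\<dots> = (\<Sum>(i, j) \<in> {(i, j). 1 \<le> j \<and> i + 2 * j = k + e}. c j i)"
    by (rule sum.reindex_bij_witness[of _ "\<lambda>(i, j). j" "\<lambda>j. (k + e - 2 * j, j)"]) (use assms in auto)
  finally show ?thesis .
qed

text \<open>Unbounded in the phase, where uniformity comes from periodicity. Motions near the
  particular solution are later confined to this set.\<close>

definition strip :: "real \<Rightarrow> (real \<times> real \<times> real) set" where
  "strip \<psi>0 = {(R, \<Psi>, S). \<bar>R\<bar> \<le> 1 \<and> \<bar>\<Psi> - \<psi>0\<bar> \<le> 1}"

lemma bounded_on_strip:
  fixes h :: "real \<times> real \<times> real \<Rightarrow> real"
  assumes "continuous_on UNIV h" "\<And>x y S. h (x, y, S + P) = h (x, y, S)" "P > 0"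
  shows "\<exists>B. \<forall>z\<in>strip \<psi>0. \<bar>h z\<bar> \<le> B"
proof -
  have "\<exists>C\<ge>0. \<forall>x\<in>{-1..1}. \<forall>y\<in>{\<psi>0 - 1..\<psi>0 + 1}. \<forall>S. \<bar>h (x, y, S)\<bar> \<le> C"
    by (rule periodic_bounded3[OF _ _ _ assms(3)]) (auto intro: continuous_on_subset[OF assms(1)] simp: assms(2))
  then obtain C where C: "\<forall>x\<in>{-1..1}. \<forall>y\<in>{\<psi>0 - 1..\<psi>0 + 1}. \<forall>S. \<bar>h (x, y, S)\<bar> \<le> C" by blast
  have "\<bar>h z\<bar> \<le> C" if "z \<in> strip \<psi>0" for z
  proof -
    obtain x y S where z: "z = (x, y, S)" by (cases z) auto
    have "x \<in> {-1..1}" "y \<in> {\<psi>0 - 1..\<psi>0 + 1}" using that by (auto simp: z strip_def)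
    then show ?thesis using C z by blast
  qed
  then show ?thesis by blast
qed

lemma smooth_periodic_bounded_on_strip:
  fixes h :: "real \<times> real \<times> real \<Rightarrow> real"
  assumes "smooth_on UNIV h" "\<And>x y S. h (x, y, S + P) = h (x, y, S)" "P > 0"
  shows "\<exists>B. \<forall>z\<in>strip \<psi>0. \<bar>h z\<bar> \<le> B" "\<exists>B. \<forall>z\<in>strip \<psi>0. \<bar>dir_deriv v h z\<bar> \<le> B"
proof -
  show "\<exists>B. \<forall>z\<in>strip \<psi>0. \<bar>h z\<bar> \<le> B"
    by (rule bounded_on_strip[OF smooth_on_continuous[OF assms(1)] assms(2,3)])
  have "dir_deriv v h (z + (0, 0, P)) = dir_deriv v h z" for z
    using dir_deriv_iter_translate[OF open_UNIV assms(1), where c = "(0, 0, P)" and x = z and v = v and i = 1] assms(2)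
    by (auto simp: split_paired_all)
  from this[of "(_, _, _)"]
  show "\<exists>B. \<forall>z\<in>strip \<psi>0. \<bar>dir_deriv v h z\<bar> \<le> B"
    by (intro bounded_on_strip[OF smooth_on_continuous[OF smooth_on_dir_deriv[OF open_UNIV assms(1)]] _ assms(3)]) simp
qed

text \<open>Along the resonance the angle is \<open>\<kappa> / \<mu> * S + \<Psi>\<close>, so an
  increase of \<open>S\<close> by \<open>2 * pi * \<mu>\<close> advances the two angular arguments
  by \<open>2 * pi * \<kappa>\<close> and \<open>2 * pi * \<mu>\<close>. This common period makes
  the Taylor remainders uniform in \<open>S\<close>.\<close>

lemma fc_slice_Taylor:
  fixes hc :: "real \<Rightarrow> real \<Rightarrow> real \<Rightarrow> real"
  assumes sm: "smooth_on ({-\<R>..\<R>} \<times> UNIV \<times> UNIV) (\<lambda>(r, \<phi>, S). hc r \<phi> S)"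
    and per: "\<And>r \<phi> S. r \<in> {-\<R>..\<R>} \<Longrightarrow> hc r (\<phi> + 2 * pi) S = hc r \<phi> S \<and> hc r \<phi> (S + 2 * pi) = hc r \<phi> S"
    and a: "\<bar>a\<bar> < \<R>" and \<mu>: "\<mu> \<ge> (1::nat)" and q: "q \<ge> 1"
  shows "expands q N (strip \<psi>0) (\<lambda>(R, \<Psi>, S) t. hc (a + tau q t * R) (real \<kappa> / real \<mu> * S + \<Psi>) S)
     (\<lambda>(R, \<Psi>, S). Abs_fps (\<lambda>i. (deriv ^^ i) (\<lambda>r. hc r (real \<kappa> / real \<mu> * S + \<Psi>) S) a * R ^ i / fact i))"
proof -
  let ?D = "{-\<R><..<\<R>} \<times> (UNIV :: real set) \<times> (UNIV :: real set)"
  let ?h = "\<lambda>(r, \<phi>, S). hc r \<phi> S"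
  let ?e = "(1, 0, 0) :: real \<times> real \<times> real"
  \<comment> \<open>Half the distance of \<open>a\<close> to the boundary, so that the Taylor
    segments stay in the open domain.\<close>
  define d where "d = (\<R> - \<bar>a\<bar>) / 2"
  have d: "d > 0" "\<And>r. \<bar>r\<bar> \<le> d \<Longrightarrow> \<bar>a + r\<bar> < \<R>" using a by (auto simp: d_def)
  have op: "open ?D" by (intro open_Times) auto
  have smD: "smooth_on ?D ?h" by (rule smooth_on_subset[OF sm]) auto
  have pr: "(dir_deriv ?e ^^ i) ?h (x + (0, 2 * pi * real \<kappa>, 2 * pi * real \<mu>)) = (dir_deriv ?e ^^ i) ?h x"
    if "x \<in> ?D" for x i
  proof (rule dir_deriv_iter_translate[OF op smD _ _ that])
    fix x assume "x \<in> ?D"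
    then obtain r \<phi> S where x: "x = (r, \<phi>, S)" "r \<in> {-\<R>..\<R>}" by (cases x) auto
    show "x + (0, 2 * pi * real \<kappa>, 2 * pi * real \<mu>) \<in> ?D" using \<open>x \<in> ?D\<close> by auto
    have "hc r (\<phi> + 2 * pi * real \<kappa>) (S + 2 * pi * real \<mu>) = hc r (\<phi> + 2 * pi * real \<kappa>) S"
      using periodic_int[of "\<lambda>S. hc r (\<phi> + 2 * pi * real \<kappa>) S" "2 * pi" S "int \<mu>"] per[OF x(2)]
      by (simp add: mult.commute)
    also have "\<dots> = hc r \<phi> S"
      using periodic_int[of "\<lambda>\<phi>. hc r \<phi> S" "2 * pi" \<phi> "int \<kappa>"] per[OF x(2)]
      by (simp add: mult.commute)
    finally show "?h (x + (0, 2 * pi * real \<kappa>, 2 * pi * real \<mu>)) = ?h x" by (simp add: x)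
  qed
  have bd: "\<exists>C\<ge>0. \<forall>r\<in>{a - d..a + d}. \<forall>\<Psi>\<in>{\<psi>0 - 1..\<psi>0 + 1}. \<forall>S.
      \<bar>(dir_deriv ?e ^^ i) ?h (r, real \<kappa> / real \<mu> * S + \<Psi>, S)\<bar> \<le> C" for i
  proof -
    have sub: "r \<in> {-\<R><..<\<R>}" if "r \<in> {a - d..a + d}" for r
      using d(2)[of "r - a"] that by (auto simp: abs_le_iff abs_less_iff)
    have c: "continuous_on ({a - d..a + d} \<times> {\<psi>0 - 1..\<psi>0 + 1} \<times> UNIV)
       (\<lambda>z. (dir_deriv ?e ^^ i) ?h (fst z, real \<kappa> / real \<mu> * snd (snd z) + fst (snd z), snd (snd z)))"
      by (rule continuous_on_compose2[OF smooth_on_continuous[OF smooth_on_dir_deriv_iter[OF op smD]]])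
        (use sub \<mu> in \<open>auto intro!: continuous_intros\<close>)
    have "\<exists>C\<ge>0. \<forall>r\<in>{a - d..a + d}. \<forall>\<Psi>\<in>{\<psi>0 - 1..\<psi>0 + 1}. \<forall>S. \<bar>(\<lambda>z. (dir_deriv ?e ^^ i) ?h
       (fst z, real \<kappa> / real \<mu> * snd (snd z) + fst (snd z), snd (snd z))) (r, \<Psi>, S)\<bar> \<le> C"
    proof (rule periodic_bounded3[OF compact_Icc compact_Icc c, of "2 * pi * real \<mu>"])
      show "2 * pi * real \<mu> > 0" using \<mu> by simp
      fix r \<Psi> S assume r: "r \<in> {a - d..a + d}"
      have "(r, real \<kappa> / real \<mu> * (S + 2 * pi * real \<mu>) + \<Psi>, S + 2 * pi * real \<mu>)
         = (r, real \<kappa> / real \<mu> * S + \<Psi>, S) + (0, 2 * pi * real \<kappa>, 2 * pi * real \<mu>)"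
        using \<mu> by (simp add: field_simps)
      then show "(\<lambda>z. (dir_deriv ?e ^^ i) ?h (fst z, real \<kappa> / real \<mu> * snd (snd z) + fst (snd z), snd (snd z))) (r, \<Psi>, S + 2 * pi * real \<mu>)
         = (\<lambda>z. (dir_deriv ?e ^^ i) ?h (fst z, real \<kappa> / real \<mu> * snd (snd z) + fst (snd z), snd (snd z))) (r, \<Psi>, S)"
        using pr[of "(r, real \<kappa> / real \<mu> * S + \<Psi>, S)" i] sub[OF r] by (simp add: add_ac)
    qed
    then show ?thesis by simp
  qed
  have dd: "(deriv ^^ i) (\<lambda>r. hc r \<phi> S) a = (dir_deriv ?e ^^ i) ?h (a, \<phi>, S)" for i \<phi> S
    using deriv_iter_line[OF op smD, of "(0, \<phi>, S)" a ?e i] a by (simp add: abs_less_iff)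
  obtain B where B: "\<And>i. B i \<ge> 0" "\<And>i r \<Psi> S. r \<in> {a - d..a + d} \<Longrightarrow> \<Psi> \<in> {\<psi>0 - 1..\<psi>0 + 1} \<Longrightarrow>
      \<bar>(dir_deriv ?e ^^ i) ?h (r, real \<kappa> / real \<mu> * S + \<Psi>, S)\<bar> \<le> B i"
    using bd by metis
  define w where "w i = (\<lambda>(R, \<Psi>, S). (deriv ^^ i) (\<lambda>r. hc r (real \<kappa> / real \<mu> * S + \<Psi>) S) a * R ^ i / fact i)" for i
  have wb: "\<bar>w i z\<bar> \<le> B i" if zb: "z \<in> strip \<psi>0" for i z
  proof -
    obtain R \<Psi> S where z: "z = (R, \<Psi>, S)" "\<bar>R\<bar> \<le> 1" "\<Psi> \<in> {\<psi>0 - 1..\<psi>0 + 1}"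
      using zb by (cases z) (auto simp: strip_def abs_diff_le_iff)
    have "\<bar>R\<bar> ^ i / fact i \<le> 1" using z(2) by (simp add: divide_le_eq_1 order_trans[OF power_le_one fact_ge_1])
    moreover have "\<bar>(deriv ^^ i) (\<lambda>r. hc r (real \<kappa> / real \<mu> * S + \<Psi>) S) a\<bar> \<le> B i"
      unfolding dd using B(2)[of a \<Psi> i S] d z by simp
    ultimately have "\<bar>(deriv ^^ i) (\<lambda>r. hc r (real \<kappa> / real \<mu> * S + \<Psi>) S) a\<bar> * (\<bar>R\<bar> ^ i / fact i) \<le> B i * 1"
      using B(1) by (intro mult_mono) auto
    then show ?thesis by (simp add: w_def z abs_mult power_abs)
  qed
  have "expands q N (strip \<psi>0) (\<lambda>z t. \<Sum>k\<le>N. w k z * tau q t ^ k) (\<lambda>z. Abs_fps (\<lambda>k. w k z))"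
    by (rule expands_coeffs) (use wb in blast)
  then have "expands q N (strip \<psi>0) (\<lambda>(R, \<Psi>, S) t. hc (a + tau q t * R) (real \<kappa> / real \<mu> * S + \<Psi>) S)
     (\<lambda>z. Abs_fps (\<lambda>k. w k z))"
  proof (rule expands_perturb)
    show "\<forall>\<^sub>F t in at_top. \<forall>z\<in>strip \<psi>0.
       \<bar>(case z of (R, \<Psi>, S) \<Rightarrow> \<lambda>t. hc (a + tau q t * R) (real \<kappa> / real \<mu> * S + \<Psi>) S) t - (\<Sum>k\<le>N. w k z * tau q t ^ k)\<bar>
         \<le> B (Suc N) * tau q t ^ Suc N"
      using eventually_tau_less[OF q d(1)] eventually_gt_at_top[of 0]
    proof eventually_elim
      case (elim t)
      have \<tau>: "0 < tau q t" using tau_pos elim by blast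
      show ?case
      proof
        fix z assume "z \<in> strip \<psi>0"
        then obtain R \<Psi> S where z: "z = (R, \<Psi>, S)" "\<bar>R\<bar> \<le> 1" "\<Psi> \<in> {\<psi>0 - 1..\<psi>0 + 1}"
          by (cases z) (auto simp: strip_def abs_diff_le_iff)
        let ?\<phi> = "real \<kappa> / real \<mu> * S + \<Psi>"
        have small: "\<bar>tau q t * R\<bar> \<le> tau q t" using z \<tau> by (simp add: abs_mult mult_left_le)
        have "\<bar>?h ((a, ?\<phi>, S) + (tau q t * R) *\<^sub>R ?e) - (\<Sum>i\<le>N. (dir_deriv ?e ^^ i) ?h (a, ?\<phi>, S) / fact i * (tau q t * R) ^ i)\<bar>
           \<le> B (Suc N) * \<bar>tau q t * R\<bar> ^ Suc N"
        proof (rule Taylor_line_bound[OF op smD])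
          fix r assume r: "\<bar>r\<bar> \<le> \<bar>tau q t * R\<bar>"
          then have rd: "\<bar>r\<bar> \<le> d" using small elim by linarith
          then show "(a, ?\<phi>, S) + r *\<^sub>R ?e \<in> ?D" using d(2)[OF rd] by (simp add: abs_less_iff)
          have "a + r \<in> {a - d..a + d}" using rd by (auto simp: abs_le_iff)
          then show "\<bar>(dir_deriv ?e ^^ Suc N) ?h ((a, ?\<phi>, S) + r *\<^sub>R ?e)\<bar> \<le> B (Suc N)"
            using B(2)[of "a + r" \<Psi> "Suc N" S] z by simp
        qed
        also have "\<dots> \<le> B (Suc N) * tau q t ^ Suc N"
          using small B(1) by (intro mult_left_mono power_mono) auto
        also have "(\<Sum>i\<le>N. (dir_deriv ?e ^^ i) ?h (a, ?\<phi>, S) / fact i * (tau q t * R) ^ i) = (\<Sum>k\<le>N. w k z * tau q t ^ k)"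
          by (intro sum.cong refl) (simp add: w_def z dd power_mult_distrib)
        finally show "\<bar>(case z of (R, \<Psi>, S) \<Rightarrow> \<lambda>t. hc (a + tau q t * R) (real \<kappa> / real \<mu> * S + \<Psi>) S) t - (\<Sum>k\<le>N. w k z * tau q t ^ k)\<bar>
         \<le> B (Suc N) * tau q t ^ Suc N" by (simp add: z)
      qed
    qed
  qed
  then show ?thesis by (rule expands_cong) (auto simp: w_def)
qed

lemma admissible_expands:
  assumes adm: "admissible_perturbation \<R> q h hc" and a: "\<bar>a\<bar> < \<R>" and \<mu>: "\<mu> \<ge> (1::nat)" and q: "q \<ge> 1" and e: "e \<le> (1::nat)"
  shows "expands q N (strip \<psi>0) (\<lambda>(R, \<Psi>, S) t. h (a + tau q t * R) (real \<kappa> / real \<mu> * S + \<Psi>) S t / tau q t ^ e)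
     (\<lambda>(R, \<Psi>, S). Abs_fps (\<lambda>k. \<Sum>(i, j) \<in> {(i, j). 1 \<le> j \<and> i + 2 * j = k + e}.
        (deriv ^^ i) (\<lambda>r. hc j r (real \<kappa> / real \<mu> * S + \<Psi>) S) a * R ^ i / fact i))"
proof -
  \<comment> \<open>The remainder of the given expansion is of order
    \<open>\<tau> ^ (2 * K)\<close>. With \<open>K = N + 2\<close> it is negligible at order
    \<open>N\<close> even after division by \<open>\<tau> ^ e\<close>, and
    \<open>k + e < 2 * K\<close> holds for all \<open>k \<le> N\<close>.\<close>
  define K where "K = N + 2"
  define c where "c j = (\<lambda>(R, \<Psi>, S). Abs_fps (\<lambda>i. (deriv ^^ i) (\<lambda>r. hc j r (real \<kappa> / real \<mu> * S + \<Psi>) S) a * R ^ i / fact i))" for j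
  have "expands q N (strip \<psi>0) (\<lambda>z t. \<Sum>j\<in>{1..<K}. tau q t ^ (2 * j - e) *
      (case z of (R, \<Psi>, S) \<Rightarrow> \<lambda>t. hc j (a + tau q t * R) (real \<kappa> / real \<mu> * S + \<Psi>) S) t)
     (\<lambda>z. \<Sum>j\<in>{1..<K}. fps_X ^ (2 * j - e) * c j z)"
  proof (rule expands_sum)
    fix j assume "j \<in> {1..<K}"
    then have j: "j \<ge> 1" by simp
    have "expands q N (strip \<psi>0) (\<lambda>(R, \<Psi>, S) t. hc j (a + tau q t * R) (real \<kappa> / real \<mu> * S + \<Psi>) S) (c j)"
      unfolding c_def
      by (rule fc_slice_Taylor[OF _ _ a \<mu> q]) (use adm j in \<open>auto simp: admissible_perturbation_def\<close>)
    then show "expands q N (strip \<psi>0) (\<lambda>z t. tau q t ^ (2 * j - e) *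
      (case z of (R, \<Psi>, S) \<Rightarrow> \<lambda>t. hc j (a + tau q t * R) (real \<kappa> / real \<mu> * S + \<Psi>) S) t) (\<lambda>z. fps_X ^ (2 * j - e) * c j z)"
      by (intro expands_mult expands_power expands_tau)
  qed simp
  moreover obtain C where C: "\<forall>\<^sub>F t in at_top. \<forall>r\<in>{-\<R>..\<R>}. \<forall>\<phi> S.
        \<bar>h r \<phi> S t - (\<Sum>j=1..<K. t powr (- (real j / real q)) * hc j r \<phi> S)\<bar> \<le> C * t powr (- (real K / real q))"
  proof -
    have "K \<ge> 1" by (simp add: K_def)
    then show ?thesis using adm that unfolding admissible_perturbation_def by blast
  qed
  have "\<forall>\<^sub>F t in at_top. tau q t < \<R> - \<bar>a\<bar>" by (rule eventually_tau_less[OF q]) (use a in simp)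
  then have "\<forall>\<^sub>F t in at_top. \<forall>z\<in>strip \<psi>0.
      \<bar>(case z of (R, \<Psi>, S) \<Rightarrow> \<lambda>t. h (a + tau q t * R) (real \<kappa> / real \<mu> * S + \<Psi>) S t / tau q t ^ e) t
        - (\<Sum>j\<in>{1..<K}. tau q t ^ (2 * j - e) * (case z of (R, \<Psi>, S) \<Rightarrow> \<lambda>t. hc j (a + tau q t * R) (real \<kappa> / real \<mu> * S + \<Psi>) S) t)\<bar>
      \<le> \<bar>C\<bar> * tau q t ^ Suc N"
    using C eventually_ge_at_top[of 1]
  proof eventually_elim
    case (elim t)
    have \<tau>: "0 < tau q t" "tau q t \<le> 1" using tau_pos[of t q] tau_le_1[of t q] elim by auto
    have tj: "t powr (- (real j / real q)) = tau q t ^ (2 * j)" for j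
      using tau_power[of t q "2 * j"] elim(3) by simp
    show ?case
    proof
      fix z assume "z \<in> strip \<psi>0"
      then obtain R \<Psi> S where z: "z = (R, \<Psi>, S)" "\<bar>R\<bar> \<le> 1" by (auto simp: strip_def)
      let ?r = "a + tau q t * R" and ?\<phi> = "real \<kappa> / real \<mu> * S + \<Psi>"
      have "\<bar>tau q t * R\<bar> \<le> tau q t" using z \<tau> by (simp add: abs_mult mult_left_le)
      then have "?r \<in> {-\<R>..\<R>}" using elim(1) by (auto simp: abs_le_iff)
      then have b: "\<bar>h ?r ?\<phi> S t - (\<Sum>j=1..<K. tau q t ^ (2 * j) * hc j ?r ?\<phi> S)\<bar> \<le> C * tau q t ^ (2 * K)"
        using elim(2) unfolding tj by blast
      have pw: "tau q t ^ (2 * j) / tau q t ^ e = tau q t ^ (2 * j - e)" if "j \<ge> 1" for j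
        using \<tau> e that by (simp add: power_diff)
      have "h ?r ?\<phi> S t / tau q t ^ e - (\<Sum>j=1..<K. tau q t ^ (2 * j - e) * hc j ?r ?\<phi> S)
         = (h ?r ?\<phi> S t - (\<Sum>j=1..<K. tau q t ^ (2 * j) * hc j ?r ?\<phi> S)) / tau q t ^ e"
        unfolding diff_divide_distrib sum_divide_distrib
        by (intro arg_cong2[of _ _ _ _ "(-)"] sum.cong refl) (simp add: pw[symmetric])
      then have "\<bar>h ?r ?\<phi> S t / tau q t ^ e - (\<Sum>j=1..<K. tau q t ^ (2 * j - e) * hc j ?r ?\<phi> S)\<bar>
         \<le> C * tau q t ^ (2 * K) / tau q t ^ e"
        using b \<tau> by (simp add: abs_divide divide_right_mono)
      also have "\<dots> = C * tau q t ^ (2 * K - e)"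
      proof -
        have "K \<ge> 1" by (simp add: K_def)
        then show ?thesis by (simp only: times_divide_eq_right[symmetric] pw)
      qed
      also have "\<dots> \<le> \<bar>C\<bar> * tau q t ^ Suc N"
        using \<tau> e by (intro mult_mono power_decreasing) (auto simp: K_def)
      finally show "\<bar>(case z of (R, \<Psi>, S) \<Rightarrow> \<lambda>t. h (a + tau q t * R) (real \<kappa> / real \<mu> * S + \<Psi>) S t / tau q t ^ e) t
        - (\<Sum>j\<in>{1..<K}. tau q t ^ (2 * j - e) * (case z of (R, \<Psi>, S) \<Rightarrow> \<lambda>t. hc j (a + tau q t * R) (real \<kappa> / real \<mu> * S + \<Psi>) S) t)\<bar>
        \<le> \<bar>C\<bar> * tau q t ^ Suc N" by (simp add: z)
    qed
  qed
  ultimately have "expands q N (strip \<psi>0)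
      (\<lambda>(R, \<Psi>, S) t. h (a + tau q t * R) (real \<kappa> / real \<mu> * S + \<Psi>) S t / tau q t ^ e)
      (\<lambda>z. \<Sum>j\<in>{1..<K}. fps_X ^ (2 * j - e) * c j z)"
    by (rule expands_perturb)
  then show ?thesis
  proof (rule expands_cong)
    fix z k assume "z \<in> strip \<psi>0" "k \<le> N"
    obtain R \<Psi> S where z: "z = (R, \<Psi>, S)" by (cases z) auto
    have "k + e < 2 * K" using \<open>k \<le> N\<close> e by (simp add: K_def)
    from double_index_sum[OF this e, of "\<lambda>j i. (deriv ^^ i) (\<lambda>r. hc j r (real \<kappa> / real \<mu> * S + \<Psi>) S) a * R ^ i / fact i"]
    show "fps_nth (case z of (R, \<Psi>, S) \<Rightarrow> Abs_fps (\<lambda>k. \<Sum>(i, j) \<in> {(i, j). 1 \<le> j \<and> i + 2 * j = k + e}.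
        (deriv ^^ i) (\<lambda>r. hc j r (real \<kappa> / real \<mu> * S + \<Psi>) S) a * R ^ i / fact i)) k
        = fps_nth (\<Sum>j\<in>{1..<K}. fps_X ^ (2 * j - e) * c j z) k"
      by (simp add: z c_def fps_sum_nth)
  qed simp
qed

text \<open>Only even powers of \<open>\<tau>\<close> occur. The logarithm contributes
  \<open>s q / t\<close>, which explains the correction in \<open>phase_deriv_coeff\<close> at
  \<open>k = 2 * q\<close>, where the factor \<open>1 - k / (2 * q)\<close> vanishes.\<close>

lemma DERIV_phase:
  assumes "q \<ge> 1" "t > 0"
  shows "(phase q s has_real_derivative (\<Sum>k\<le>2 * q. phase_deriv_coeff q s k * tau q t ^ k)) (at t within A)"
proof -
  have "{..2 * q} = (\<lambda>j. 2 * j) ` {..q} \<union> {k. k \<le> 2 * q \<and> odd k}"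
    by (auto elim!: evenE)
  then have "(\<Sum>k\<le>2 * q. phase_deriv_coeff q s k * tau q t ^ k)
     = (\<Sum>k\<in>(\<lambda>j. 2 * j) ` {..q} \<union> {k. k \<le> 2 * q \<and> odd k}. phase_deriv_coeff q s k * tau q t ^ k)" by simp
  also have "\<dots> = (\<Sum>k\<in>(\<lambda>j. 2 * j) ` {..q}. phase_deriv_coeff q s k * tau q t ^ k)
      + (\<Sum>k\<in>{k. k \<le> 2 * q \<and> odd k}. phase_deriv_coeff q s k * tau q t ^ k)"
    by (rule sum.union_disjoint) auto
  also have "(\<Sum>k\<in>{k. k \<le> 2 * q \<and> odd k}. phase_deriv_coeff q s k * tau q t ^ k) = 0"
    by (rule sum.neutral) (auto simp: phase_deriv_coeff_def)
  also have "(\<Sum>k\<in>(\<lambda>j. 2 * j) ` {..q}. phase_deriv_coeff q s k * tau q t ^ k)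
      = (\<Sum>j\<le>q. phase_deriv_coeff q s (2 * j) * tau q t ^ (2 * j))"
    by (subst sum.reindex) (auto simp: inj_on_def)
  also have "{..q} = insert 0 (insert q {1..<q})" using assms by auto
  also have "(\<Sum>j\<in>insert 0 (insert q {1..<q}). phase_deriv_coeff q s (2 * j) * tau q t ^ (2 * j))
     = s 0 + s q * (1 / t) + (\<Sum>j=1..<q. s j * (1 - real j / real q) * t powr (- (real j / real q)))"
  proof -
    have "(\<Sum>j=1..<q. phase_deriv_coeff q s (2 * j) * tau q t ^ (2 * j))
       = (\<Sum>j=1..<q. s j * (1 - real j / real q) * t powr (- (real j / real q)))"
      by (rule sum.cong) (use assms tau_power[of t q] in \<open>auto simp: phase_deriv_coeff_def\<close>)
    then show ?thesis using assms tau_power_2q[of q t] by (simp add: phase_deriv_coeff_def)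
  qed
  finally have eq: "(\<Sum>k\<le>2 * q. phase_deriv_coeff q s k * tau q t ^ k)
     = s 0 + s q * (1 / t) + (\<Sum>j=1..<q. s j * (1 - real j / real q) * t powr (- (real j / real q)))" by simp
  have "((\<lambda>t. s j * t powr (1 - real j / real q)) has_real_derivative
      s j * (1 - real j / real q) * t powr (- (real j / real q))) (at t within A)" for j
    using assms by (auto intro!: derivative_eq_intros simp: diff_diff_eq)
  then have D: "((\<lambda>t. \<Sum>j=1..<q. s j * t powr (1 - real j / real q)) has_real_derivative
      (\<Sum>j=1..<q. s j * (1 - real j / real q) * t powr (- (real j / real q)))) (at t within A)"
    by (rule DERIV_sum)
  have D0: "((\<lambda>t. s 0 * t) has_real_derivative s 0) (at t within A)"
    and Dq: "((\<lambda>t. s q * ln t) has_real_derivative s q * (1 / t)) (at t within A)"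
    using assms by (auto intro!: derivative_eq_intros)
  from DERIV_add[OF DERIV_add[OF D0 D] Dq]
  show ?thesis unfolding eq by (simp add: phase_def[abs_def] add_ac)
qed

text \<open>Two expansions in succession: first in \<open>y\<close> at the fixed abscissa
  \<open>R + x\<close>, then each of the coefficients in \<open>x\<close>. The compact set of radius
  2 contains all intermediate points.\<close>

lemma Taylor_2d_bound:
  fixes h :: "real \<times> real \<Rightarrow> real"
  assumes sm: "smooth_on UNIV h"
  shows "\<exists>C\<ge>0. \<forall>R \<Psi> x y. \<bar>R\<bar> \<le> 1 \<and> \<bar>\<Psi> - \<psi>0\<bar> \<le> 1 \<and> \<bar>x\<bar> \<le> 1 \<and> \<bar>y\<bar> \<le> 1 \<longrightarrow>
     \<bar>h (R + x, \<Psi> + y) - (\<Sum>j\<le>N. \<Sum>i\<le>N. (dir_deriv (1, 0) ^^ i) ((dir_deriv (0, 1) ^^ j) h) (R, \<Psi>) / (fact i * fact j) * (x ^ i * y ^ j))\<bar>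
       \<le> C * (\<bar>x\<bar> ^ Suc N + \<bar>y\<bar> ^ Suc N)"
proof -
  let ?K = "{-2..2::real} \<times> {\<psi>0 - 2..\<psi>0 + 2}"
  have K: "compact ?K" by (intro compact_Times) auto
  let ?D = "\<lambda>j. (dir_deriv (0, 1) ^^ j) h"
  have smD: "smooth_on UNIV (?D j)" for j by (rule smooth_on_dir_deriv_iter[OF open_UNIV sm])
  have "\<exists>C\<ge>0. \<forall>z\<in>?K. \<bar>(dir_deriv (1, 0) ^^ Suc N) (?D j) z\<bar> \<le> C" for j
    by (rule compact_imp_bounded_real[OF K])
      (rule continuous_on_subset[OF smooth_on_continuous[OF smooth_on_dir_deriv_iter[OF open_UNIV smD]]], simp)
  then obtain A where A: "\<And>j. A j \<ge> 0" "\<And>j z. z \<in> ?K \<Longrightarrow> \<bar>(dir_deriv (1, 0) ^^ Suc N) (?D j) z\<bar> \<le> A j"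
    by metis
  have "\<exists>C\<ge>0. \<forall>z\<in>?K. \<bar>?D (Suc N) z\<bar> \<le> C"
    by (rule compact_imp_bounded_real[OF K]) (rule continuous_on_subset[OF smooth_on_continuous[OF smD]], simp)
  then obtain B where B: "B \<ge> 0" "\<And>z. z \<in> ?K \<Longrightarrow> \<bar>?D (Suc N) z\<bar> \<le> B" by blast
  show ?thesis
  proof (intro exI[of _ "B + (\<Sum>j\<le>N. A j)"] conjI allI impI)
    have SA: "0 \<le> (\<Sum>j\<le>N. A j)" using A(1) by (intro sum_nonneg) auto
    then show "0 \<le> B + (\<Sum>j\<le>N. A j)" using B(1) by simp
    fix R \<Psi> x y :: real assume "\<bar>R\<bar> \<le> 1 \<and> \<bar>\<Psi> - \<psi>0\<bar> \<le> 1 \<and> \<bar>x\<bar> \<le> 1 \<and> \<bar>y\<bar> \<le> (1::real)"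
    then have b: "\<bar>R\<bar> \<le> 1" "\<bar>\<Psi> - \<psi>0\<bar> \<le> 1" "\<bar>x\<bar> \<le> 1" "\<bar>y\<bar> \<le> 1" by auto
    have "\<bar>h ((R + x, \<Psi>) + y *\<^sub>R (0, 1)) - (\<Sum>j\<le>N. ?D j (R + x, \<Psi>) / fact j * y ^ j)\<bar> \<le> B * \<bar>y\<bar> ^ Suc N"
    proof (rule Taylor_line_bound[OF open_UNIV sm])
      fix r assume r: "\<bar>r\<bar> \<le> \<bar>y\<bar>"
      have "(R + x, \<Psi>) + r *\<^sub>R (0, 1) \<in> ?K" using r b by (auto simp: abs_le_iff)
      then show "\<bar>?D (Suc N) ((R + x, \<Psi>) + r *\<^sub>R (0, 1))\<bar> \<le> B" by (rule B(2))
    qed simp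
    then have 1: "\<bar>h (R + x, \<Psi> + y) - (\<Sum>j\<le>N. ?D j (R + x, \<Psi>) / fact j * y ^ j)\<bar> \<le> B * \<bar>y\<bar> ^ Suc N" by simp
    let ?T = "\<lambda>j. \<Sum>i\<le>N. (dir_deriv (1, 0) ^^ i) (?D j) (R, \<Psi>) / fact i * x ^ i"
    have 2: "\<bar>?D j (R + x, \<Psi>) - ?T j\<bar> \<le> A j * \<bar>x\<bar> ^ Suc N" for j
    proof -
      have "\<bar>?D j ((R, \<Psi>) + x *\<^sub>R (1, 0)) - ?T j\<bar> \<le> A j * \<bar>x\<bar> ^ Suc N"
      proof (rule Taylor_line_bound[OF open_UNIV smD])
        fix r assume r: "\<bar>r\<bar> \<le> \<bar>x\<bar>"
        have "(R, \<Psi>) + r *\<^sub>R (1, 0) \<in> ?K" using r b by (auto simp: abs_le_iff)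
        then show "\<bar>(dir_deriv (1, 0) ^^ Suc N) (?D j) ((R, \<Psi>) + r *\<^sub>R (1, 0))\<bar> \<le> A j" by (rule A(2))
      qed simp
      then show ?thesis by simp
    qed
    have "\<bar>(\<Sum>j\<le>N. ?D j (R + x, \<Psi>) / fact j * y ^ j) - (\<Sum>j\<le>N. ?T j / fact j * y ^ j)\<bar> \<le> (\<Sum>j\<le>N. A j * \<bar>x\<bar> ^ Suc N)"
      unfolding sum_subtractf[symmetric]
    proof (rule order_trans[OF sum_abs], rule sum_mono)
      fix j
      have "\<bar>?D j (R + x, \<Psi>) / fact j * y ^ j - ?T j / fact j * y ^ j\<bar> = \<bar>?D j (R + x, \<Psi>) - ?T j\<bar> * (\<bar>y\<bar> ^ j / fact j)"
        by (simp add: abs_mult power_abs abs_divide flip: left_diff_distrib diff_divide_distrib)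
      also have "\<dots> \<le> A j * \<bar>x\<bar> ^ Suc N * 1"
      proof (rule mult_mono[OF 2])
        show "\<bar>y\<bar> ^ j / fact j \<le> 1" using b by (simp add: divide_le_eq_1 order_trans[OF power_le_one fact_ge_1])
      qed (use A in auto)
      finally show "\<bar>?D j (R + x, \<Psi>) / fact j * y ^ j - ?T j / fact j * y ^ j\<bar> \<le> A j * \<bar>x\<bar> ^ Suc N" by simp
    qed
    also have "\<dots> = (\<Sum>j\<le>N. A j) * \<bar>x\<bar> ^ Suc N" by (simp only: sum_distrib_right)
    finally have 3: "\<bar>(\<Sum>j\<le>N. ?D j (R + x, \<Psi>) / fact j * y ^ j) - (\<Sum>j\<le>N. ?T j / fact j * y ^ j)\<bar> \<le> (\<Sum>j\<le>N. A j) * \<bar>x\<bar> ^ Suc N" .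
    have 4: "(\<Sum>j\<le>N. ?T j / fact j * y ^ j) = (\<Sum>j\<le>N. \<Sum>i\<le>N. (dir_deriv (1, 0) ^^ i) (?D j) (R, \<Psi>) / (fact i * fact j) * (x ^ i * y ^ j))"
      unfolding sum_divide_distrib sum_distrib_right by (intro sum.cong refl) simp
    have "B * \<bar>y\<bar> ^ Suc N + (\<Sum>j\<le>N. A j) * \<bar>x\<bar> ^ Suc N \<le> (B + (\<Sum>j\<le>N. A j)) * (\<bar>x\<bar> ^ Suc N + \<bar>y\<bar> ^ Suc N)"
    proof -
      have "0 \<le> B * \<bar>x\<bar> ^ Suc N" "0 \<le> (\<Sum>j\<le>N. A j) * \<bar>y\<bar> ^ Suc N" using B(1) SA by simp_all
      then show ?thesis by (simp only: distrib_left distrib_right)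
    qed
    then show "\<bar>h (R + x, \<Psi> + y) - (\<Sum>j\<le>N. \<Sum>i\<le>N. (dir_deriv (1, 0) ^^ i) (?D j) (R, \<Psi>) / (fact i * fact j) * (x ^ i * y ^ j))\<bar>
       \<le> (B + (\<Sum>j\<le>N. A j)) * (\<bar>x\<bar> ^ Suc N + \<bar>y\<bar> ^ Suc N)"
      using 1 3 unfolding 4 by linarith
  qed
qed

lemma fps_power_mult_nth_small:
  fixes A B :: "real fps"
  assumes "fps_nth A 0 = 0" "fps_nth B 0 = 0" "m < i \<or> m < j"
  shows "fps_nth (A ^ i * B ^ j) m = 0"
proof -
  have z: "fps_nth (C ^ i) k = 0" if "fps_nth C 0 = 0" "k < i" for C :: "real fps" and i k
    using startsby_zero_power_prefix[OF that(1)] that(2) by blast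
  show ?thesis unfolding fps_mult_nth
  proof (rule sum.neutral, rule ballI)
    fix k assume "k \<in> {0..m}"
    then have "k < i \<or> m - k < j" using assms(3) by auto
    then show "fps_nth (A ^ i) k * fps_nth (B ^ j) (m - k) = 0" using z assms by auto
  qed
qed

lemma expands_Taylor_2d:
  fixes H :: "real \<Rightarrow> real \<Rightarrow> real"
  assumes sm: "smooth_on UNIV (\<lambda>(x, y). H x y)" and q: "q \<ge> 1"
    and x: "expands q N (strip \<psi>0) x du" and y: "expands q N (strip \<psi>0) y dv"
    and 0: "\<And>z. fps_nth (du z) 0 = 0" "\<And>z. fps_nth (dv z) 0 = 0"
  shows "expands q N (strip \<psi>0) (\<lambda>(R, \<Psi>, S) t. H (R + x (R, \<Psi>, S) t) (\<Psi> + y (R, \<Psi>, S) t))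
     (\<lambda>(R, \<Psi>, S). \<Sum>j\<le>N. \<Sum>i\<le>N. fps_const ((deriv ^^ i) (\<lambda>x. (deriv ^^ j) (\<lambda>y. H x y) \<Psi>) R / (fact i * fact j))
        * (du (R, \<Psi>, S) ^ i * dv (R, \<Psi>, S) ^ j))"
proof -
  let ?h = "\<lambda>(x, y). H x y"
  let ?M = "\<lambda>i j. (dir_deriv (1, 0) ^^ i) ((dir_deriv (0, 1) ^^ j) ?h)"
  have smj: "smooth_on UNIV ((dir_deriv (0, 1) ^^ j) ?h)" for j by (rule smooth_on_dir_deriv_iter[OF open_UNIV sm])
  have M: "(deriv ^^ i) (\<lambda>x. (deriv ^^ j) (\<lambda>y. H x y) \<Psi>) R = ?M i j (R, \<Psi>)" for i j R \<Psi>
  proof -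
    have "(\<lambda>x. (deriv ^^ j) (\<lambda>y. H x y) \<Psi>) = (\<lambda>x. (dir_deriv (0, 1) ^^ j) ?h ((0, \<Psi>) + x *\<^sub>R (1, 0)))"
    proof
      fix x
      show "(deriv ^^ j) (\<lambda>y. H x y) \<Psi> = (dir_deriv (0, 1) ^^ j) ?h ((0, \<Psi>) + x *\<^sub>R (1, 0))"
        using deriv_iter_line[OF open_UNIV sm, of "(x, 0)" \<Psi> "(0, 1)" j] by simp
    qed
    then show ?thesis using deriv_iter_line[OF open_UNIV smj, of "(0, \<Psi>)" R "(1, 0)" i] by simp
  qed
  define b where "b i j z = (case z of (R, \<Psi>, S) \<Rightarrow> ?M i j (R, \<Psi>) / (fact i * fact j))" for i j and z :: "real \<times> real \<times> real"
  have bb: "\<exists>B. \<forall>z\<in>strip \<psi>0. \<bar>b i j z\<bar> \<le> B" for i j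
  proof -
    have "continuous_on ({-1..1} \<times> {\<psi>0 - 1..\<psi>0 + 1}) (\<lambda>z. ?M i j z / (fact i * fact j))"
      by (intro continuous_intros continuous_on_subset[OF smooth_on_continuous[OF smooth_on_dir_deriv_iter[OF open_UNIV smj]]]) auto
    from compact_imp_bounded_real[OF compact_Times[OF compact_Icc compact_Icc] this]
    obtain B where B: "\<forall>z\<in>{-1..1} \<times> {\<psi>0 - 1..\<psi>0 + 1}. \<bar>?M i j z / (fact i * fact j)\<bar> \<le> B" by blast
    have "\<bar>b i j z\<bar> \<le> B" if "z \<in> strip \<psi>0" for z
    proof -
      obtain R \<Psi> S where z: "z = (R, \<Psi>, S)" by (cases z) auto
      have "(R, \<Psi>) \<in> {-1..1} \<times> {\<psi>0 - 1..\<psi>0 + 1}" using that by (auto simp: z strip_def abs_le_iff)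
      then show ?thesis using B by (auto simp: b_def z)
    qed
    then show ?thesis by blast
  qed
  have ex: "expands q N (strip \<psi>0) (\<lambda>z t. \<Sum>j\<le>N. \<Sum>i\<le>N. b i j z * (x z t ^ i * y z t ^ j))
     (\<lambda>z. \<Sum>j\<le>N. \<Sum>i\<le>N. fps_const (b i j z) * (du z ^ i * dv z ^ j))"
    by (intro expands_sum expands_mult expands_const expands_power x y bb finite_atMost)
  obtain X where X: "X \<ge> 0" "\<forall>\<^sub>F t in at_top. \<forall>z\<in>strip \<psi>0. \<bar>x z t\<bar> \<le> X * tau q t" using expands_small[OF x] 0 by blast
  obtain Y where Y: "Y \<ge> 0" "\<forall>\<^sub>F t in at_top. \<forall>z\<in>strip \<psi>0. \<bar>y z t\<bar> \<le> Y * tau q t" using expands_small[OF y] 0 by blast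
  obtain C where C: "C \<ge> 0" "\<And>R \<Psi> x y. \<bar>R\<bar> \<le> 1 \<Longrightarrow> \<bar>\<Psi> - \<psi>0\<bar> \<le> 1 \<Longrightarrow> \<bar>x\<bar> \<le> 1 \<Longrightarrow> \<bar>y\<bar> \<le> 1 \<Longrightarrow>
     \<bar>?h (R + x, \<Psi> + y) - (\<Sum>j\<le>N. \<Sum>i\<le>N. ?M i j (R, \<Psi>) / (fact i * fact j) * (x ^ i * y ^ j))\<bar>
       \<le> C * (\<bar>x\<bar> ^ Suc N + \<bar>y\<bar> ^ Suc N)"
    using Taylor_2d_bound[OF sm, of \<psi>0 N] by blast
  have "\<forall>\<^sub>F t in at_top. tau q t < 1 / (X + Y + 1)" by (rule eventually_tau_less[OF q]) (use X Y in simp)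
  then have "\<forall>\<^sub>F t in at_top. \<forall>z\<in>strip \<psi>0.
     \<bar>(case z of (R, \<Psi>, S) \<Rightarrow> \<lambda>t. H (R + x (R, \<Psi>, S) t) (\<Psi> + y (R, \<Psi>, S) t)) t - (\<Sum>j\<le>N. \<Sum>i\<le>N. b i j z * (x z t ^ i * y z t ^ j))\<bar>
       \<le> (C * (X ^ Suc N + Y ^ Suc N)) * tau q t ^ Suc N"
    using X(2) Y(2) eventually_gt_at_top[of 0]
  proof eventually_elim
    case (elim t)
    have \<tau>: "0 < tau q t" using tau_pos elim by blast
    have "tau q t * (X + Y + 1) < 1" using elim(1) X Y by (simp add: pos_less_divide_eq)
    then have XY: "X * tau q t \<le> 1" "Y * tau q t \<le> 1" using X(1) Y(1) \<tau>
      by (smt (verit) mult_nonneg_nonneg distrib_left mult.commute)+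
    show ?case
    proof
      fix z assume z0: "z \<in> strip \<psi>0"
      then obtain R \<Psi> S where z: "z = (R, \<Psi>, S)" "\<bar>R\<bar> \<le> 1" "\<bar>\<Psi> - \<psi>0\<bar> \<le> 1" by (auto simp: strip_def)
      have x1: "\<bar>x z t\<bar> \<le> X * tau q t" "\<bar>y z t\<bar> \<le> Y * tau q t" using elim z0 by blast+
      have "\<bar>?h (R + x z t, \<Psi> + y z t) - (\<Sum>j\<le>N. \<Sum>i\<le>N. ?M i j (R, \<Psi>) / (fact i * fact j) * (x z t ^ i * y z t ^ j))\<bar>
         \<le> C * (\<bar>x z t\<bar> ^ Suc N + \<bar>y z t\<bar> ^ Suc N)"
        by (rule C(2)[OF z(2,3)]) (use x1 XY in linarith)+
      also have "\<dots> \<le> C * ((X * tau q t) ^ Suc N + (Y * tau q t) ^ Suc N)"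
        using x1 C(1) by (intro mult_left_mono add_mono power_mono) auto
      also have "\<dots> = (C * (X ^ Suc N + Y ^ Suc N)) * tau q t ^ Suc N" by (simp add: power_mult_distrib algebra_simps)
      finally show "\<bar>(case z of (R, \<Psi>, S) \<Rightarrow> \<lambda>t. H (R + x (R, \<Psi>, S) t) (\<Psi> + y (R, \<Psi>, S) t)) t
          - (\<Sum>j\<le>N. \<Sum>i\<le>N. b i j z * (x z t ^ i * y z t ^ j))\<bar> \<le> (C * (X ^ Suc N + Y ^ Suc N)) * tau q t ^ Suc N"
        by (simp add: z b_def)
    qed
  qed
  from expands_perturb[OF ex this] show ?thesis
    by (rule expands_cong) (auto simp: b_def M)
qed

text \<open>The analytic expansion takes derivatives up to order \<open>N\<close> for every
  \<open>l\<close>, the formal one only up to \<open>k - l\<close>. They agree because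
  \<open>du\<close> and \<open>dv\<close> lack constant terms, so higher powers do not reach the
  order considered.\<close>

lemma expands_taylor_series:
  assumes sm: "\<And>l. l \<ge> 1 \<Longrightarrow> smooth_on UNIV (\<lambda>(x, y). H l x y)" and q: "q \<ge> 1"
    and x: "expands q N (strip \<psi>0) x du" and y: "expands q N (strip \<psi>0) y dv"
    and 0: "\<And>z. fps_nth (du z) 0 = 0" "\<And>z. fps_nth (dv z) 0 = 0"
  shows "expands q N (strip \<psi>0) (\<lambda>(R, \<Psi>, S) t. truncated_rhs q N H (R + x (R, \<Psi>, S) t) (\<Psi> + y (R, \<Psi>, S) t) t)
     (\<lambda>(R, \<Psi>, S). taylor_series H R \<Psi> (du (R, \<Psi>, S)) (dv (R, \<Psi>, S)))"
proof -
  let ?c = "\<lambda>l i j R \<Psi>. (deriv ^^ i) (\<lambda>x. (deriv ^^ j) (\<lambda>y. H l x y) \<Psi>) R / (fact i * fact j)"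
  have "expands q N (strip \<psi>0) (\<lambda>z t. \<Sum>l\<in>{1..N}. tau q t ^ l * (case z of (R, \<Psi>, S) \<Rightarrow> \<lambda>t. H l (R + x (R, \<Psi>, S) t) (\<Psi> + y (R, \<Psi>, S) t)) t)
     (\<lambda>z. \<Sum>l\<in>{1..N}. fps_X ^ l * (case z of (R, \<Psi>, S) \<Rightarrow> \<Sum>j\<le>N. \<Sum>i\<le>N. fps_const (?c l i j R \<Psi>)
        * (du (R, \<Psi>, S) ^ i * dv (R, \<Psi>, S) ^ j)))"
  proof (rule expands_sum)
    fix l assume "l \<in> {1..N}"
    then have "l \<ge> 1" by simp
    show "expands q N (strip \<psi>0) (\<lambda>z t. tau q t ^ l * (case z of (R, \<Psi>, S) \<Rightarrow> \<lambda>t. H l (R + x (R, \<Psi>, S) t) (\<Psi> + y (R, \<Psi>, S) t)) t)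
     (\<lambda>z. fps_X ^ l * (case z of (R, \<Psi>, S) \<Rightarrow> \<Sum>j\<le>N. \<Sum>i\<le>N. fps_const (?c l i j R \<Psi>)
        * (du (R, \<Psi>, S) ^ i * dv (R, \<Psi>, S) ^ j)))"
      by (intro expands_mult expands_power expands_tau expands_Taylor_2d[OF sm[OF \<open>l \<ge> 1\<close>] q x y 0])
  qed simp
  then show ?thesis
  proof (rule expands_cong)
    fix z k assume "z \<in> strip \<psi>0" and k: "k \<le> N"
    obtain R \<Psi> S where z: "z = (R, \<Psi>, S)" by (cases z) auto
    let ?A = "du (R, \<Psi>, S)" and ?B = "dv (R, \<Psi>, S)"
    have "fps_nth (\<Sum>l\<in>{1..N}. fps_X ^ l * (\<Sum>j\<le>N. \<Sum>i\<le>N. fps_const (?c l i j R \<Psi>) * (?A ^ i * ?B ^ j))) k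
      = (\<Sum>l\<in>{1..N}. if k < l then 0 else \<Sum>j\<le>N. \<Sum>i\<le>N. ?c l i j R \<Psi> * fps_nth (?A ^ i * ?B ^ j) (k - l))"
      by (simp only: fps_sum_nth fps_X_power_mult_nth fps_mult_left_const_nth)
    also have "\<dots> = (\<Sum>l\<in>{1..k}. if k < l then 0 else \<Sum>j\<le>N. \<Sum>i\<le>N. ?c l i j R \<Psi> * fps_nth (?A ^ i * ?B ^ j) (k - l))"
      by (rule sum.mono_neutral_right) (use k in auto)
    also have "\<dots> = (\<Sum>l\<in>{1..k}. \<Sum>i\<le>k - l. \<Sum>j\<le>k - l. ?c l i j R \<Psi> * fps_nth (?A ^ i * ?B ^ j) (k - l))"
    proof (rule sum.cong[OF refl])
      fix l assume l: "l \<in> {1..k}"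
      have kl: "{..k - l} \<subseteq> {..N}" using k by auto
      have small: "fps_nth (?A ^ i * ?B ^ j) (k - l) = 0" if "k - l < i \<or> k - l < j" for i j
        by (rule fps_power_mult_nth_small[OF 0 that])
      have "(\<Sum>j\<le>N. \<Sum>i\<le>N. ?c l i j R \<Psi> * fps_nth (?A ^ i * ?B ^ j) (k - l))
        = (\<Sum>j\<le>k - l. \<Sum>i\<le>N. ?c l i j R \<Psi> * fps_nth (?A ^ i * ?B ^ j) (k - l))"
        by (rule sum.mono_neutral_right[OF _ kl]) (auto intro!: sum.neutral small)
      also have "\<dots> = (\<Sum>j\<le>k - l. \<Sum>i\<le>k - l. ?c l i j R \<Psi> * fps_nth (?A ^ i * ?B ^ j) (k - l))"
        by (intro sum.cong refl sum.mono_neutral_right[OF _ kl]) (auto intro!: small)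
      also have "\<dots> = (\<Sum>i\<le>k - l. \<Sum>j\<le>k - l. ?c l i j R \<Psi> * fps_nth (?A ^ i * ?B ^ j) (k - l))"
        by (rule sum.swap)
      finally show "(if k < l then 0 else \<Sum>j\<le>N. \<Sum>i\<le>N. ?c l i j R \<Psi> * fps_nth (?A ^ i * ?B ^ j) (k - l))
        = (\<Sum>i\<le>k - l. \<Sum>j\<le>k - l. ?c l i j R \<Psi> * fps_nth (?A ^ i * ?B ^ j) (k - l))" using l by simp
    qed
    also have "\<dots> = fps_nth (taylor_series H R \<Psi> ?A ?B) k" by (simp add: taylor_series_def)
    finally show "fps_nth (case z of (R, \<Psi>, S) \<Rightarrow> taylor_series H R \<Psi> (du (R, \<Psi>, S)) (dv (R, \<Psi>, S))) k
      = fps_nth (\<Sum>l\<in>{1..N}. fps_X ^ l * (case z of (R, \<Psi>, S) \<Rightarrow> \<Sum>j\<le>N. \<Sum>i\<le>N. fps_const (?c l i j R \<Psi>)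
        * (du (R, \<Psi>, S) ^ i * dv (R, \<Psi>, S) ^ j))) k" by (simp add: z)
  next
    show "\<forall>\<^sub>F t in at_top. \<forall>z\<in>strip \<psi>0.
       (case z of (R, \<Psi>, S) \<Rightarrow> \<lambda>t. truncated_rhs q N H (R + x (R, \<Psi>, S) t) (\<Psi> + y (R, \<Psi>, S) t) t) t
       = (\<Sum>l\<in>{1..N}. tau q t ^ l * (case z of (R, \<Psi>, S) \<Rightarrow> \<lambda>t. H l (R + x (R, \<Psi>, S) t) (\<Psi> + y (R, \<Psi>, S) t)) t)"
      using eventually_gt_at_top[of 0] by eventually_elim (auto simp: truncated_rhs_def tau_power)
  qed
qed

section \<open>The scaled system and its exact transformation\<close>

locale perturbed_system = averaged_system q \<kappa> \<mu> a s \<omega> fc gc u v \<Lambda> \<Omega>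
  for q \<kappa> \<mu> :: nat and a :: real and s :: "nat \<Rightarrow> real" and \<omega> :: "real \<Rightarrow> real"
    and fc gc u v :: "nat \<Rightarrow> real \<Rightarrow> real \<Rightarrow> real \<Rightarrow> real" and \<Lambda> \<Omega> :: "nat \<Rightarrow> real \<Rightarrow> real \<Rightarrow> real" +
  fixes \<R> :: real and f g :: "real \<Rightarrow> real \<Rightarrow> real \<Rightarrow> real \<Rightarrow> real"
  assumes smooth_\<omega>: "smooth_on {-\<R>..\<R>} \<omega>"
    and adm_f: "admissible_perturbation \<R> q f fc" and adm_g: "admissible_perturbation \<R> q g gc"
    and a_less: "\<bar>a\<bar> < \<R>"
begin

text \<open>The exact, not expanded, field of \<open>R = (r - a) / \<tau>\<close>. The first summand
  is \<open>R / (2 * q * t)\<close> and comes from differentiating the factor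
  \<open>1 / \<tau>\<close>.\<close>

definition Rfield :: "real \<times> real \<times> real \<Rightarrow> real \<Rightarrow> real" where
  "Rfield = (\<lambda>(R, \<Psi>, S) t. R / (2 * real q) * tau q t ^ (2 * q)
     + f (a + tau q t * R) (real \<kappa> / real \<mu> * S + \<Psi>) S t / tau q t)"

definition Sfield :: "real \<Rightarrow> real" where
  "Sfield t = (\<Sum>k\<le>2 * q. \<sigma> k * tau q t ^ k)"

definition \<Psi>field :: "real \<times> real \<times> real \<Rightarrow> real \<Rightarrow> real" where
  "\<Psi>field = (\<lambda>(R, \<Psi>, S) t. \<omega> (a + tau q t * R)
     + g (a + tau q t * R) (real \<kappa> / real \<mu> * S + \<Psi>) S t - real \<kappa> / real \<mu> * Sfield t)"

lemma fst_bounded_on_strip: "\<exists>B. \<forall>z\<in>strip \<psi>0. \<bar>fst z * c\<bar> \<le> B"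
  by (rule exI[of _ "\<bar>c\<bar>"]) (auto simp: strip_def abs_mult intro: mult_left_le_one_le)

lemma expands_Rfield: "expands q N (strip \<psi>0) Rfield (\<lambda>(R, \<Psi>, S). series_at F R \<Psi> S)"
proof -
  have "expands q N (strip \<psi>0) (\<lambda>z t. fst z * (1 / (2 * real q)) * tau q t ^ (2 * q)
     + (case z of (R, \<Psi>, S) \<Rightarrow> \<lambda>t. f (a + tau q t * R) (real \<kappa> / real \<mu> * S + \<Psi>) S t / tau q t ^ 1) t)
    (\<lambda>z. fps_const (fst z * (1 / (2 * real q))) * fps_X ^ (2 * q)
     + (case z of (R, \<Psi>, S) \<Rightarrow> Abs_fps (\<lambda>k. \<Sum>(i, j) \<in> {(i, j). 1 \<le> j \<and> i + 2 * j = k + 1}.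
        (deriv ^^ i) (\<lambda>r. fc j r (real \<kappa> / real \<mu> * S + \<Psi>) S) a * R ^ i / fact i)))"
    by (intro expands_add expands_mult expands_power expands_tau expands_const fst_bounded_on_strip
        admissible_expands[OF adm_f a_less \<mu>1 q1]) simp
  then show ?thesis
    by (rule expands_cong) (auto simp: series_at_def F_coeff_def fps_X_power_nth Rfield_def split_beta)
qed

lemma expands_Sfield: "expands q N (strip \<psi>0) (\<lambda>z. Sfield) (\<lambda>z. Abs_fps \<sigma>)"
proof -
  have "expands q N (strip \<psi>0) (\<lambda>z t. \<Sum>k\<in>{..2 * q}. \<sigma> k * tau q t ^ k) (\<lambda>z. \<Sum>k\<in>{..2 * q}. fps_const (\<sigma> k) * fps_X ^ k)"
    by (intro expands_sum expands_mult expands_const expands_power expands_tau) auto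
  then show ?thesis
  proof (rule expands_cong)
    fix k
    have "fps_nth (\<Sum>j\<in>{..2 * q}. fps_const (\<sigma> j) * fps_X ^ j) k = (\<Sum>j\<in>{..2 * q}. if j = k then \<sigma> k else 0)"
      unfolding fps_sum_nth by (intro sum.cong refl) (auto simp: fps_X_power_nth)
    also have "\<dots> = \<sigma> k" by (auto simp: phase_deriv_coeff_def)
    finally show "fps_nth (Abs_fps \<sigma>) k = fps_nth (\<Sum>j\<in>{..2 * q}. fps_const (\<sigma> j) * fps_X ^ j) k" by simp
  qed (simp add: Sfield_def)
qed

lemma expands_\<Psi>field: "expands q N (strip \<psi>0) \<Psi>field (\<lambda>(R, \<Psi>, S). series_at G R \<Psi> S)"
proof -
  have "smooth_on ({-\<R>..\<R>} \<times> (UNIV :: (real \<times> real) set)) (\<lambda>z. \<omega> (fst z))"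
    using smooth_\<omega> Ck_on_fst unfolding smooth_on_def by blast
  then have "smooth_on ({-\<R>..\<R>} \<times> UNIV \<times> UNIV) (\<lambda>(r, \<phi> :: real, S :: real). \<omega> r)"
    by (simp add: case_prod_unfold)
  from fc_slice_Taylor[OF this _ a_less \<mu>1 q1]
  have 1: "expands q N (strip \<psi>0) (\<lambda>(R, \<Psi>, S) t. \<omega> (a + tau q t * R)) (\<lambda>(R, \<Psi>, S). Abs_fps (\<lambda>i. (deriv ^^ i) \<omega> a * R ^ i / fact i))"
    by simp
  have "expands q N (strip \<psi>0) (\<lambda>z t. (case z of (R, \<Psi>, S) \<Rightarrow> \<lambda>t. \<omega> (a + tau q t * R)) t + - (real \<kappa> / real \<mu>) * Sfield t
     + (case z of (R, \<Psi>, S) \<Rightarrow> \<lambda>t. g (a + tau q t * R) (real \<kappa> / real \<mu> * S + \<Psi>) S t / tau q t ^ 0) t)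
    (\<lambda>z. (case z of (R, \<Psi>, S) \<Rightarrow> Abs_fps (\<lambda>i. (deriv ^^ i) \<omega> a * R ^ i / fact i)) + fps_const (- (real \<kappa> / real \<mu>)) * Abs_fps \<sigma>
     + (case z of (R, \<Psi>, S) \<Rightarrow> Abs_fps (\<lambda>k. \<Sum>(i, j) \<in> {(i, j). 1 \<le> j \<and> i + 2 * j = k + 0}.
        (deriv ^^ i) (\<lambda>r. gc j r (real \<kappa> / real \<mu> * S + \<Psi>) S) a * R ^ i / fact i)))"
    by (intro expands_add expands_mult expands_const 1 expands_Sfield
        admissible_expands[OF adm_g a_less \<mu>1 q1]) auto
  then show ?thesis
    by (rule expands_cong) (auto simp: series_at_def G_coeff_def \<Psi>field_def split_beta)
qed

lemma smooth_U: "smooth_on UNIV (\<lambda>(R, \<Psi>, S). U k R \<Psi> S)"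
proof (cases "k = 0")
  case True
  have "smooth_on UNIV (\<lambda>z :: real \<times> real \<times> real. fst z)" by (intro smooth_on_bounded_linear bounded_linear_fst)
  then show ?thesis using True by (simp add: with_leading_def case_prod_unfold)
next
  case False
  then show ?thesis using smooth_u[of k] by (simp add: with_leading_def)
qed

lemma smooth_V: "smooth_on UNIV (\<lambda>(R, \<Psi>, S). V k R \<Psi> S)"
proof (cases "k = 0")
  case True
  have "smooth_on UNIV (\<lambda>z :: real \<times> real \<times> real. fst (snd z))"
    by (intro smooth_on_bounded_linear bounded_linear_fst_comp bounded_linear_snd)
  then show ?thesis using True by (simp add: with_leading_def case_prod_unfold)
next
  case False
  then show ?thesis using smooth_v[of k] by (simp add: with_leading_def)
qed

lemma periodic_U: "U k R \<Psi> (S + period) = U k R \<Psi> S" and periodic_V: "V k R \<Psi> (S + period) = V k R \<Psi> S"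
  using periodic_u[of k] periodic_v[of k] by (auto simp: with_leading_def)

lemma deriv_slices:
  assumes "smooth_on UNIV (\<lambda>(R, \<Psi>, S). w R \<Psi> S)"
  shows "deriv (\<lambda>x. w x \<Psi> S) R = dir_deriv (1, 0, 0) (\<lambda>(R, \<Psi>, S). w R \<Psi> S) (R, \<Psi>, S)"
    "deriv (\<lambda>x. w R x S) \<Psi> = dir_deriv (0, 1, 0) (\<lambda>(R, \<Psi>, S). w R \<Psi> S) (R, \<Psi>, S)"
    "deriv (\<lambda>x. w R \<Psi> x) S = dir_deriv (0, 0, 1) (\<lambda>(R, \<Psi>, S). w R \<Psi> S) (R, \<Psi>, S)"
proof -
  show "deriv (\<lambda>x. w x \<Psi> S) R = dir_deriv (1, 0, 0) (\<lambda>(R, \<Psi>, S). w R \<Psi> S) (R, \<Psi>, S)"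
    using DERIV_imp_deriv[OF DERIV_line[OF open_UNIV assms, of "(0, \<Psi>, S)" R "(1, 0, 0)"]] by simp
  show "deriv (\<lambda>x. w R x S) \<Psi> = dir_deriv (0, 1, 0) (\<lambda>(R, \<Psi>, S). w R \<Psi> S) (R, \<Psi>, S)"
    using DERIV_imp_deriv[OF DERIV_line[OF open_UNIV assms, of "(R, 0, S)" \<Psi> "(0, 1, 0)"]] by simp
  show "deriv (\<lambda>x. w R \<Psi> x) S = dir_deriv (0, 0, 1) (\<lambda>(R, \<Psi>, S). w R \<Psi> S) (R, \<Psi>, S)"
    using DERIV_imp_deriv[OF DERIV_line[OF open_UNIV assms, of "(R, \<Psi>, 0)" S "(0, 0, 1)"]] by simp
qed

text \<open>Analytic counterpart of \<open>formal_total_deriv\<close>: a partial sum of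
  \<open>W\<close> differentiated along the exact fields. Nothing is truncated afterwards, so along
  solutions it is a true derivative.\<close>

definition total_deriv_sum :: "(nat \<Rightarrow> real \<Rightarrow> real \<Rightarrow> real \<Rightarrow> real) \<Rightarrow> nat \<Rightarrow> real \<times> real \<times> real \<Rightarrow> real \<Rightarrow> real" where
  "total_deriv_sum W N = (\<lambda>(R, \<Psi>, S) t.
     Rfield (R, \<Psi>, S) t * (\<Sum>k\<le>N. deriv (\<lambda>x. W k x \<Psi> S) R * tau q t ^ k)
     + \<Psi>field (R, \<Psi>, S) t * (\<Sum>k\<le>N. deriv (\<lambda>x. W k R x S) \<Psi> * tau q t ^ k)
     + Sfield t * (\<Sum>k\<le>N. deriv (\<lambda>x. W k R \<Psi> x) S * tau q t ^ k)
     - 1 / (2 * real q) * tau q t ^ (2 * q) * (\<Sum>k\<le>N. real k * W k R \<Psi> S * tau q t ^ k))"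

lemma expands_total_deriv_sum:
  assumes sm: "\<And>k. smooth_on UNIV (\<lambda>(R, \<Psi>, S). W k R \<Psi> S)"
    and per: "\<And>k R \<Psi> S. W k R \<Psi> (S + period) = W k R \<Psi> S"
  shows "expands q N (strip \<psi>0) (total_deriv_sum W N) (\<lambda>(R, \<Psi>, S). formal_total_deriv q F G \<sigma> W R \<Psi> S)"
proof -
  let ?h = "\<lambda>k (R, \<Psi>, S). W k R \<Psi> S"
  have b0: "\<exists>B. \<forall>z\<in>strip \<psi>0. \<bar>?h k z\<bar> \<le> B" and b1: "\<exists>B. \<forall>z\<in>strip \<psi>0. \<bar>dir_deriv d (?h k) z\<bar> \<le> B" for k d
    using smooth_periodic_bounded_on_strip[OF sm[of k] _ period_pos] per by auto
  have bk: "\<exists>B. \<forall>z\<in>strip \<psi>0. \<bar>real k * ?h k z\<bar> \<le> B" for k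
  proof -
    obtain B where "\<forall>z\<in>strip \<psi>0. \<bar>?h k z\<bar> \<le> B" using b0 by blast
    then have "\<forall>z\<in>strip \<psi>0. \<bar>real k * ?h k z\<bar> \<le> real k * B" by (auto simp: abs_mult intro: mult_left_mono)
    then show ?thesis by blast
  qed
  have d: "expands q N (strip \<psi>0) (\<lambda>z t. \<Sum>k\<le>N. dir_deriv d (?h k) z * tau q t ^ k) (\<lambda>z. Abs_fps (\<lambda>k. dir_deriv d (?h k) z))" for d
    by (rule expands_coeffs) (rule b1)
  have w: "expands q N (strip \<psi>0) (\<lambda>z t. \<Sum>k\<le>N. real k * ?h k z * tau q t ^ k) (\<lambda>z. Abs_fps (\<lambda>k. real k * ?h k z))"
    by (rule expands_coeffs) (rule bk)
  have "expands q N (strip \<psi>0) (\<lambda>z t. Rfield z t * (\<Sum>k\<le>N. dir_deriv (1, 0, 0) (?h k) z * tau q t ^ k)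
     + \<Psi>field z t * (\<Sum>k\<le>N. dir_deriv (0, 1, 0) (?h k) z * tau q t ^ k)
     + Sfield t * (\<Sum>k\<le>N. dir_deriv (0, 0, 1) (?h k) z * tau q t ^ k)
     + - (1 / (2 * real q)) * tau q t ^ (2 * q) * (\<Sum>k\<le>N. real k * ?h k z * tau q t ^ k))
    (\<lambda>z. (case z of (R, \<Psi>, S) \<Rightarrow> series_at F R \<Psi> S) * Abs_fps (\<lambda>k. dir_deriv (1, 0, 0) (?h k) z)
     + (case z of (R, \<Psi>, S) \<Rightarrow> series_at G R \<Psi> S) * Abs_fps (\<lambda>k. dir_deriv (0, 1, 0) (?h k) z)
     + Abs_fps \<sigma> * Abs_fps (\<lambda>k. dir_deriv (0, 0, 1) (?h k) z)
     + fps_const (- (1 / (2 * real q))) * fps_X ^ (2 * q) * Abs_fps (\<lambda>k. real k * ?h k z))"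
    by (intro expands_add expands_mult expands_power expands_tau expands_const expands_Rfield expands_\<Psi>field expands_Sfield d w) auto
  then show ?thesis
  proof (rule expands_cong)
    fix z :: "real \<times> real \<times> real" and k
    obtain R \<Psi> S where z: "z = (R, \<Psi>, S)" by (cases z) auto
    \<comment> \<open>One factor of \<open>fps_X ^ (2 * q + 1)\<close> combines with
      \<open>fps_deriv\<close> to the Euler operator, which multiplies the coefficient of order
      \<open>k\<close> by \<open>k\<close>.\<close>
    have "fps_X * fps_deriv (series_at W R \<Psi> S) = Abs_fps (\<lambda>k. real k * W k R \<Psi> S)"
      by (rule fps_ext) (simp add: series_at_def)
    then have X: "fps_const (1 / (2 * real q)) * fps_X ^ (2 * q + 1) * fps_deriv (series_at W R \<Psi> S)
      = - (fps_const (- (1 / (2 * real q))) * fps_X ^ (2 * q) * Abs_fps (\<lambda>k. real k * W k R \<Psi> S))"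
      by (simp add: power_add mult.assoc mult.left_commute flip: fps_const_neg)
    show "fps_nth (case z of (R, \<Psi>, S) \<Rightarrow> formal_total_deriv q F G \<sigma> W R \<Psi> S) k = fps_nth
     ((case z of (R, \<Psi>, S) \<Rightarrow> series_at F R \<Psi> S) * Abs_fps (\<lambda>k. dir_deriv (1, 0, 0) (?h k) z)
     + (case z of (R, \<Psi>, S) \<Rightarrow> series_at G R \<Psi> S) * Abs_fps (\<lambda>k. dir_deriv (0, 1, 0) (?h k) z)
     + Abs_fps \<sigma> * Abs_fps (\<lambda>k. dir_deriv (0, 0, 1) (?h k) z)
     + fps_const (- (1 / (2 * real q))) * fps_X ^ (2 * q) * Abs_fps (\<lambda>k. real k * ?h k z)) k"
      unfolding z prod.case formal_total_deriv_def deriv_slices[OF sm] by (subst X) simp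
  next
    show "\<forall>\<^sub>F t in at_top. \<forall>z\<in>strip \<psi>0. total_deriv_sum W N z t =
     Rfield z t * (\<Sum>k\<le>N. dir_deriv (1, 0, 0) (?h k) z * tau q t ^ k)
     + \<Psi>field z t * (\<Sum>k\<le>N. dir_deriv (0, 1, 0) (?h k) z * tau q t ^ k)
     + Sfield t * (\<Sum>k\<le>N. dir_deriv (0, 0, 1) (?h k) z * tau q t ^ k)
     + - (1 / (2 * real q)) * tau q t ^ (2 * q) * (\<Sum>k\<le>N. real k * ?h k z * tau q t ^ k)"
      by (rule always_eventually) (auto simp: total_deriv_sum_def deriv_slices[OF sm])
  qed
qed

lemma expands_near_identity:
  assumes "\<And>k. k \<ge> 1 \<Longrightarrow> smooth_on UNIV (\<lambda>(R, \<Psi>, S). w k R \<Psi> S)"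
    and "\<And>k R \<Psi> S. k \<ge> 1 \<Longrightarrow> w k R \<Psi> (S + period) = w k R \<Psi> S"
  shows "expands q N (strip \<psi>0) (\<lambda>(R, \<Psi>, S) t. \<Sum>k=1..N. w k R \<Psi> S * tau q t ^ k)
     (\<lambda>(R, \<Psi>, S). series_at (with_leading (\<lambda>_ _. 0) w) R \<Psi> S)"
proof -
  let ?w = "\<lambda>k (R, \<Psi>, S). with_leading (\<lambda>_ _. 0) w k R \<Psi> S"
  have "\<exists>B. \<forall>z\<in>strip \<psi>0. \<bar>?w k z\<bar> \<le> B" for k
  proof (cases "k = 0")
    case True
    then show ?thesis by (auto simp: with_leading_def)
  next
    case False
    then have "k \<ge> 1" by simp
    have "\<exists>B. \<forall>z\<in>strip \<psi>0. \<bar>(\<lambda>(R, \<Psi>, S). w k R \<Psi> S) z\<bar> \<le> B"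
      by (rule smooth_periodic_bounded_on_strip(1)[OF assms(1)[OF \<open>k \<ge> 1\<close>] _ period_pos])
        (use assms(2)[OF \<open>k \<ge> 1\<close>] in simp)
    then show ?thesis using False by (simp add: with_leading_def)
  qed
  then have "expands q N (strip \<psi>0) (\<lambda>z t. \<Sum>k\<le>N. ?w k z * tau q t ^ k) (\<lambda>z. Abs_fps (\<lambda>k. ?w k z))"
    by (intro expands_coeffs)
  then show ?thesis
  proof (rule expands_cong)
    have "{..N} = insert 0 {1..N}" by auto
    then have "(\<Sum>k\<le>N. ?w k (R, \<Psi>, S) * tau q t ^ k) = (\<Sum>k=1..N. w k R \<Psi> S * tau q t ^ k)" for R \<Psi> S t
      by (simp add: with_leading_def)
    then show "\<forall>\<^sub>F t in at_top. \<forall>z\<in>strip \<psi>0. (case z of (R, \<Psi>, S) \<Rightarrow> \<lambda>t. \<Sum>k=1..N. w k R \<Psi> S * tau q t ^ k) t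
       = (\<Sum>k\<le>N. ?w k z * tau q t ^ k)"
      by (auto intro!: always_eventually)
  qed (auto simp: series_at_def)
qed

definition \<rho>map :: "nat \<Rightarrow> real \<Rightarrow> real \<Rightarrow> real \<Rightarrow> real \<Rightarrow> real" where
  "\<rho>map N R \<Psi> S t = R + (\<Sum>k=1..N. u k R \<Psi> S * tau q t ^ k)"

definition \<psi>map :: "nat \<Rightarrow> real \<Rightarrow> real \<Rightarrow> real \<Rightarrow> real \<Rightarrow> real" where
  "\<psi>map N R \<Psi> S t = \<Psi> + (\<Sum>k=1..N. v k R \<Psi> S * tau q t ^ k)"

lemma \<rho>map_eq: "\<rho>map N R \<Psi> S t = (\<Sum>k\<le>N. U k R \<Psi> S * tau q t ^ k)"
proof -
  have "{..N} = insert 0 {1..N}" by auto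
  then show ?thesis by (simp add: \<rho>map_def with_leading_def)
qed

lemma \<psi>map_eq: "\<psi>map N R \<Psi> S t = (\<Sum>k\<le>N. V k R \<Psi> S * tau q t ^ k)"
proof -
  have "{..N} = insert 0 {1..N}" by auto
  then show ?thesis by (simp add: \<psi>map_def with_leading_def)
qed

text \<open>By the defining identities of \<open>averaging\<close>, the derivative of the new
  variables and the truncated field at the new variables have the same formal series up to order
  \<open>N\<close>; hence they differ by \<open>O(\<tau> ^ (N + 1))\<close>.\<close>

lemma averaged_remainder:
  "\<exists>C\<ge>0. \<forall>\<^sub>F t in at_top. \<forall>R \<Psi> S. \<bar>R\<bar> \<le> 1 \<and> \<bar>\<Psi> - \<psi>0\<bar> \<le> 1 \<longrightarrow>
     \<bar>total_deriv_sum U N (R, \<Psi>, S) t - truncated_rhs q N \<Lambda> (\<rho>map N R \<Psi> S t) (\<psi>map N R \<Psi> S t) t\<bar> \<le> C * tau q t ^ Suc N \<and>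
     \<bar>total_deriv_sum V N (R, \<Psi>, S) t - truncated_rhs q N \<Omega> (\<rho>map N R \<Psi> S t) (\<psi>map N R \<Psi> S t) t\<bar> \<le> C * tau q t ^ Suc N \<and>
     \<bar>\<rho>map N R \<Psi> S t - R\<bar> \<le> C * tau q t \<and> \<bar>\<psi>map N R \<Psi> S t - \<Psi>\<bar> \<le> C * tau q t"
proof -
  let ?x = "\<lambda>(R, \<Psi>, S) t. \<Sum>k=1..N. u k R \<Psi> S * tau q t ^ k" and ?y = "\<lambda>(R, \<Psi>, S) t. \<Sum>k=1..N. v k R \<Psi> S * tau q t ^ k"
  let ?du = "\<lambda>(R, \<Psi>, S). du R \<Psi> S" and ?dv = "\<lambda>(R, \<Psi>, S). dv R \<Psi> S"
  have x: "expands q N (strip \<psi>0) ?x ?du" by (rule expands_near_identity[OF smooth_u periodic_u])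
  have y: "expands q N (strip \<psi>0) ?y ?dv" by (rule expands_near_identity[OF smooth_v periodic_v])
  have z: "fps_nth (?du z) 0 = 0" "fps_nth (?dv z) 0 = 0" for z
    by (auto simp: series_at_def with_leading_def split: prod.split)
  obtain A where A: "A \<ge> 0" "\<forall>\<^sub>F t in at_top. \<forall>z\<in>strip \<psi>0. \<bar>?x z t\<bar> \<le> A * tau q t" using expands_small[OF x z(1)] by blast
  obtain B where B: "B \<ge> 0" "\<forall>\<^sub>F t in at_top. \<forall>z\<in>strip \<psi>0. \<bar>?y z t\<bar> \<le> B * tau q t" using expands_small[OF y z(2)] by blast
  have "\<exists>C\<ge>0. \<forall>\<^sub>F t in at_top. \<forall>z\<in>strip \<psi>0. \<bar>total_deriv_sum U N z t
     - (\<lambda>(R, \<Psi>, S) t. truncated_rhs q N \<Lambda> (R + ?x (R, \<Psi>, S) t) (\<Psi> + ?y (R, \<Psi>, S) t) t) z t\<bar> \<le> C * tau q t ^ Suc N"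
    by (rule expands_unique_bound[OF expands_total_deriv_sum[OF smooth_U periodic_U] expands_taylor_series[OF smooth_\<Lambda> q1 x y z]])
      (auto simp: total_deriv_U)
  then obtain C where C: "C \<ge> 0" "\<forall>\<^sub>F t in at_top. \<forall>z\<in>strip \<psi>0. \<bar>total_deriv_sum U N z t
     - (\<lambda>(R, \<Psi>, S) t. truncated_rhs q N \<Lambda> (R + ?x (R, \<Psi>, S) t) (\<Psi> + ?y (R, \<Psi>, S) t) t) z t\<bar> \<le> C * tau q t ^ Suc N"
    by blast
  have "\<exists>C\<ge>0. \<forall>\<^sub>F t in at_top. \<forall>z\<in>strip \<psi>0. \<bar>total_deriv_sum V N z t
     - (\<lambda>(R, \<Psi>, S) t. truncated_rhs q N \<Omega> (R + ?x (R, \<Psi>, S) t) (\<Psi> + ?y (R, \<Psi>, S) t) t) z t\<bar> \<le> C * tau q t ^ Suc N"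
    by (rule expands_unique_bound[OF expands_total_deriv_sum[OF smooth_V periodic_V] expands_taylor_series[OF smooth_\<Omega> q1 x y z]])
      (auto simp: total_deriv_V)
  then obtain D where D: "D \<ge> 0" "\<forall>\<^sub>F t in at_top. \<forall>z\<in>strip \<psi>0. \<bar>total_deriv_sum V N z t
     - (\<lambda>(R, \<Psi>, S) t. truncated_rhs q N \<Omega> (R + ?x (R, \<Psi>, S) t) (\<Psi> + ?y (R, \<Psi>, S) t) t) z t\<bar> \<le> D * tau q t ^ Suc N"
    by blast
  define M where "M = max (max A B) (max C D)"
  have M: "A \<le> M" "B \<le> M" "C \<le> M" "D \<le> M" "0 \<le> M" using A by (auto simp: M_def)
  show ?thesis
  proof (intro exI[of _ M] conjI M(5))
    show "\<forall>\<^sub>F t in at_top. \<forall>R \<Psi> S. \<bar>R\<bar> \<le> 1 \<and> \<bar>\<Psi> - \<psi>0\<bar> \<le> 1 \<longrightarrow>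
     \<bar>total_deriv_sum U N (R, \<Psi>, S) t - truncated_rhs q N \<Lambda> (\<rho>map N R \<Psi> S t) (\<psi>map N R \<Psi> S t) t\<bar> \<le> M * tau q t ^ Suc N \<and>
     \<bar>total_deriv_sum V N (R, \<Psi>, S) t - truncated_rhs q N \<Omega> (\<rho>map N R \<Psi> S t) (\<psi>map N R \<Psi> S t) t\<bar> \<le> M * tau q t ^ Suc N \<and>
     \<bar>\<rho>map N R \<Psi> S t - R\<bar> \<le> M * tau q t \<and> \<bar>\<psi>map N R \<Psi> S t - \<Psi>\<bar> \<le> M * tau q t"
      using A(2) B(2) C(2) D(2) eventually_gt_at_top[of 0]
    proof eventually_elim
      case (elim t)
      have \<tau>: "0 \<le> tau q t" "0 \<le> tau q t ^ Suc N" using tau_pos[of t q] elim by auto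
      have m: "c * tau q t \<le> M * tau q t" "c * tau q t ^ Suc N \<le> M * tau q t ^ Suc N" if "c \<le> M" for c
        using that \<tau> by (auto intro: mult_right_mono simp del: power_Suc)
      show ?case
      proof (intro allI impI)
        fix R \<Psi> S :: real assume "\<bar>R\<bar> \<le> 1 \<and> \<bar>\<Psi> - \<psi>0\<bar> \<le> 1"
        then have zb: "(R, \<Psi>, S) \<in> strip \<psi>0" by (simp add: strip_def)
        have e: "\<rho>map N R \<Psi> S t = R + ?x (R, \<Psi>, S) t" "\<psi>map N R \<Psi> S t = \<Psi> + ?y (R, \<Psi>, S) t"
          by (simp_all add: \<rho>map_def \<psi>map_def)
        have "\<bar>?x (R, \<Psi>, S) t\<bar> \<le> A * tau q t" "\<bar>?y (R, \<Psi>, S) t\<bar> \<le> B * tau q t"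
          using elim(1,2) zb by blast+
        moreover have "\<bar>total_deriv_sum U N (R, \<Psi>, S) t - truncated_rhs q N \<Lambda> (R + ?x (R, \<Psi>, S) t) (\<Psi> + ?y (R, \<Psi>, S) t) t\<bar> \<le> C * tau q t ^ Suc N"
          "\<bar>total_deriv_sum V N (R, \<Psi>, S) t - truncated_rhs q N \<Omega> (R + ?x (R, \<Psi>, S) t) (\<Psi> + ?y (R, \<Psi>, S) t) t\<bar> \<le> D * tau q t ^ Suc N"
          using bspec[OF elim(3) zb] bspec[OF elim(4) zb] by simp_all
        ultimately show "\<bar>total_deriv_sum U N (R, \<Psi>, S) t - truncated_rhs q N \<Lambda> (\<rho>map N R \<Psi> S t) (\<psi>map N R \<Psi> S t) t\<bar> \<le> M * tau q t ^ Suc N \<and>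
         \<bar>total_deriv_sum V N (R, \<Psi>, S) t - truncated_rhs q N \<Omega> (\<rho>map N R \<Psi> S t) (\<psi>map N R \<Psi> S t) t\<bar> \<le> M * tau q t ^ Suc N \<and>
         \<bar>\<rho>map N R \<Psi> S t - R\<bar> \<le> M * tau q t \<and> \<bar>\<psi>map N R \<Psi> S t - \<Psi>\<bar> \<le> M * tau q t"
          unfolding e using m(1)[OF M(1)] m(1)[OF M(2)] m(2)[OF M(3)] m(2)[OF M(4)]
          by (smt (verit, ccfv_threshold))
      qed
    qed
  qed
qed

lemma DERIV_along_curve:
  fixes W :: "nat \<Rightarrow> real \<Rightarrow> real \<Rightarrow> real \<Rightarrow> real"
  assumes sm: "\<And>k. smooth_on UNIV (\<lambda>(R, \<Psi>, S). W k R \<Psi> S)" and t: "t > 0"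
    and R: "(R has_real_derivative Rfield (R t, \<Psi> t, S t) t) (at t within J)"
    and \<Psi>: "(\<Psi> has_real_derivative \<Psi>field (R t, \<Psi> t, S t) t) (at t within J)"
    and S: "(S has_real_derivative Sfield t) (at t within J)"
  shows "((\<lambda>t. \<Sum>k\<le>N. W k (R t) (\<Psi> t) (S t) * tau q t ^ k) has_real_derivative total_deriv_sum W N (R t, \<Psi> t, S t) t) (at t within J)"
proof -
  let ?R = "Rfield (R t, \<Psi> t, S t) t" and ?P = "\<Psi>field (R t, \<Psi> t, S t) t" and ?S = "Sfield t"
  have w: "((\<lambda>t. W k (R t) (\<Psi> t) (S t)) has_real_derivative
      ?R * deriv (\<lambda>x. W k x (\<Psi> t) (S t)) (R t) + ?P * deriv (\<lambda>x. W k (R t) x (S t)) (\<Psi> t) + ?S * deriv (\<lambda>x. W k (R t) (\<Psi> t) x) (S t))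
      (at t within J)" for k
  proof -
    let ?h = "\<lambda>(R, \<Psi>, S). W k R \<Psi> S"
    have dh: "(?h has_derivative (\<lambda>v. dir_deriv v ?h (R t, \<Psi> t, S t))) (at (R t, \<Psi> t, S t))"
      by (rule smooth_on_has_derivative[OF open_UNIV sm]) simp
    have "((\<lambda>t. (R t, \<Psi> t, S t)) has_derivative (\<lambda>x. (?R * x, ?P * x, ?S * x))) (at t within J)"
      by (intro has_derivative_Pair) (use R \<Psi> S in \<open>auto simp: has_field_derivative_def\<close>)
    from has_derivative_compose[OF this dh]
    have 1: "((\<lambda>t. W k (R t) (\<Psi> t) (S t)) has_derivative (\<lambda>x. dir_deriv (?R * x, ?P * x, ?S * x) ?h (R t, \<Psi> t, S t))) (at t within J)"
      by simp
    have lin: "linear (\<lambda>v. dir_deriv v ?h (R t, \<Psi> t, S t))" using dh has_derivative_linear by blast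
    have "dir_deriv (?R * x, ?P * x, ?S * x) ?h (R t, \<Psi> t, S t) =
      (?R * dir_deriv (1, 0, 0) ?h (R t, \<Psi> t, S t) + ?P * dir_deriv (0, 1, 0) ?h (R t, \<Psi> t, S t) + ?S * dir_deriv (0, 0, 1) ?h (R t, \<Psi> t, S t)) * x" for x
    proof -
      have "(?R * x, ?P * x, ?S * x) = (?R * x) *\<^sub>R (1, 0, 0) + (?P * x) *\<^sub>R (0, 1, 0) + (?S * x) *\<^sub>R (0, 0, 1)" by simp
      then have "dir_deriv (?R * x, ?P * x, ?S * x) ?h (R t, \<Psi> t, S t) =
         (?R * x) * dir_deriv (1, 0, 0) ?h (R t, \<Psi> t, S t) + (?P * x) * dir_deriv (0, 1, 0) ?h (R t, \<Psi> t, S t)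
          + (?S * x) * dir_deriv (0, 0, 1) ?h (R t, \<Psi> t, S t)"
        by (simp only: linear_add[OF lin] linear_scale[OF lin] real_scaleR_def)
      then show ?thesis by (simp add: algebra_simps)
    qed
    then show ?thesis using 1 unfolding has_field_derivative_def deriv_slices[OF sm] by simp
  qed
  have p: "((\<lambda>t. tau q t ^ k) has_real_derivative - (1 / (2 * real q)) * tau q t ^ (2 * q) * real k * tau q t ^ k) (at t within J)" for k
    by (rule DERIV_cong[OF DERIV_tau_power[OF q1 t]]) simp
  have "((\<lambda>t. \<Sum>k\<le>N. W k (R t) (\<Psi> t) (S t) * tau q t ^ k) has_real_derivative
     (\<Sum>k\<le>N. (?R * deriv (\<lambda>x. W k x (\<Psi> t) (S t)) (R t) + ?P * deriv (\<lambda>x. W k (R t) x (S t)) (\<Psi> t) + ?S * deriv (\<lambda>x. W k (R t) (\<Psi> t) x) (S t)) * tau q t ^ k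
       + - (1 / (2 * real q)) * tau q t ^ (2 * q) * real k * tau q t ^ k * W k (R t) (\<Psi> t) (S t))) (at t within J)"
    by (intro DERIV_sum DERIV_mult w p)
  moreover have "(\<Sum>k\<le>N. (?R * deriv (\<lambda>x. W k x (\<Psi> t) (S t)) (R t) + ?P * deriv (\<lambda>x. W k (R t) x (S t)) (\<Psi> t) + ?S * deriv (\<lambda>x. W k (R t) (\<Psi> t) x) (S t)) * tau q t ^ k
       + - (1 / (2 * real q)) * tau q t ^ (2 * q) * real k * tau q t ^ k * W k (R t) (\<Psi> t) (S t)) = total_deriv_sum W N (R t, \<Psi> t, S t) t"
    unfolding total_deriv_sum_def prod.case sum_distrib_left sum.distrib[symmetric] sum_subtractf[symmetric]
    by (rule sum.cong[OF refl]) (simp add: algebra_simps)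
  ultimately show ?thesis by simp
qed

lemma DERIV_scaled_solution:
  assumes t: "t > 0" and r: "(r has_real_derivative f (r t) (\<phi> t) (phase q s t) t) (at t within J)"
    and \<phi>: "(\<phi> has_real_derivative \<omega> (r t) + g (r t) (\<phi> t) (phase q s t) t) (at t within J)"
  defines "R \<equiv> \<lambda>t. (r t - a) / tau q t" and "\<Psi> \<equiv> \<lambda>t. \<phi> t - real \<kappa> / real \<mu> * phase q s t"
  shows "((\<lambda>t. \<rho>map N (R t) (\<Psi> t) (phase q s t) t) has_real_derivative total_deriv_sum U N (R t, \<Psi> t, phase q s t) t) (at t within J)"
    "((\<lambda>t. \<psi>map N (R t) (\<Psi> t) (phase q s t) t) has_real_derivative total_deriv_sum V N (R t, \<Psi> t, phase q s t) t) (at t within J)"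
proof -
  have \<tau>: "tau q t \<noteq> 0" using tau_pos[OF t, of q] by simp
  have S: "(phase q s has_real_derivative Sfield t) (at t within J)"
    unfolding Sfield_def by (rule DERIV_phase[OF q1 t])
  have rt: "a + tau q t * R t = r t" using \<tau> by (simp add: R_def)
  have pt: "real \<kappa> / real \<mu> * phase q s t + \<Psi> t = \<phi> t" by (simp add: \<Psi>_def)
  have "(R has_real_derivative ((f (r t) (\<phi> t) (phase q s t) t - 0) * tau q t - (r t - a) * (- (1 / (2 * real q)) * tau q t ^ (2 * q + 1))) / (tau q t * tau q t)) (at t within J)"
    unfolding R_def by (intro DERIV_divide DERIV_diff r DERIV_const DERIV_tau q1 t \<tau>)
  moreover have "((f (r t) (\<phi> t) (phase q s t) t - 0) * tau q t - (r t - a) * (- (1 / (2 * real q)) * tau q t ^ (2 * q + 1))) / (tau q t * tau q t)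
      = Rfield (R t, \<Psi> t, phase q s t) t"
  proof -
    have "((F - 0) * T - X * (- (1 / (2 * Q)) * (P * T))) / (T * T) = X / T / (2 * Q) * P + F / T"
      if "T \<noteq> 0" "Q \<noteq> 0" for F T X Q P :: real
      using that by (simp add: field_simps)
    note gen = this
    show ?thesis
      unfolding Rfield_def prod.case rt pt unfolding R_def power_add power_one_right
      by (rule gen[OF \<tau>]) (use q1 in simp)
  qed
  ultimately have R': "(R has_real_derivative Rfield (R t, \<Psi> t, phase q s t) t) (at t within J)" by simp
  have "(\<Psi> has_real_derivative \<omega> (r t) + g (r t) (\<phi> t) (phase q s t) t - real \<kappa> / real \<mu> * Sfield t) (at t within J)"
    unfolding \<Psi>_def by (intro DERIV_diff \<phi> DERIV_cmult S)
  then have \<Psi>': "(\<Psi> has_real_derivative \<Psi>field (R t, \<Psi> t, phase q s t) t) (at t within J)"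
    unfolding \<Psi>field_def prod.case rt pt .
  show "((\<lambda>t. \<rho>map N (R t) (\<Psi> t) (phase q s t) t) has_real_derivative total_deriv_sum U N (R t, \<Psi> t, phase q s t) t) (at t within J)"
    unfolding \<rho>map_eq by (rule DERIV_along_curve[OF smooth_U t R' \<Psi>' S])
  show "((\<lambda>t. \<psi>map N (R t) (\<Psi> t) (phase q s t) t) has_real_derivative total_deriv_sum V N (R t, \<Psi> t, phase q s t) t) (at t within J)"
    unfolding \<psi>map_eq by (rule DERIV_along_curve[OF smooth_V t R' \<Psi>' S])
qed

end

section \<open>Continuation of solutions\<close>

text \<open>A Lipschitz retraction onto the interval on which the fields are given. Composition with
  it yields a field on the whole plane that agrees with the original one as long as the radius stays
  in this interval.\<close>

definition clamp_radius :: "real \<Rightarrow> real \<Rightarrow> real" where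
  "clamp_radius \<R> r = max (- \<R>) (min \<R> r)"

lemma clamp_radius_range: "\<R> > 0 \<Longrightarrow> clamp_radius \<R> r \<in> {-\<R>..\<R>}"
  and clamp_radius_id: "\<bar>r\<bar> \<le> \<R> \<Longrightarrow> clamp_radius \<R> r = r"
  and clamp_radius_Lipschitz: "\<bar>clamp_radius \<R> r - clamp_radius \<R> r'\<bar> \<le> \<bar>r - r'\<bar>"
  by (auto simp: clamp_radius_def max_def min_def abs_le_iff abs_real_def split: if_splits)

text \<open>The angle ranges over a noncompact set. For angles at most 1 apart, a common multiple of
  \<open>2 * pi\<close> brings both into \<open>{-1..2 * pi + 1}\<close>, where the derivative bound
  on a compact convex set applies. For angles further apart, the crude bound \<open>2 * M\<close> is
  already at most \<open>2 * M\<close> times their distance.\<close>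

lemma smooth_periodic_Lipschitz:
  fixes h :: "real \<Rightarrow> real \<Rightarrow> real \<Rightarrow> real \<Rightarrow> real"
  assumes sm: "smooth_on ({-\<R>..\<R>} \<times> UNIV \<times> UNIV \<times> {0<..}) (\<lambda>(r, \<phi>, S, t). h r \<phi> S t)"
    and per: "\<And>r \<phi> S t. r \<in> {-\<R>..\<R>} \<Longrightarrow> t > 0 \<Longrightarrow> h r (\<phi> + 2 * pi) S t = h r \<phi> S t"
    and Sc: "continuous_on {t0..T} Sf" and t0: "t0 > 0" and \<R>: "\<R> > 0"
  shows "\<exists>L\<ge>0. \<forall>t\<in>{t0..T}. \<forall>r \<phi> r' \<phi>'.
     \<bar>h (clamp_radius \<R> r) \<phi> (Sf t) t - h (clamp_radius \<R> r') \<phi>' (Sf t) t\<bar> \<le> L * (\<bar>r - r'\<bar> + \<bar>\<phi> - \<phi>'\<bar>)"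
proof -
  let ?D = "{-\<R>..\<R>} \<times> (UNIV :: real set) \<times> (UNIV :: real set) \<times> {0<..}"
  let ?h = "\<lambda>(r, \<phi>, S, t). h r \<phi> S t"
  obtain B where B: "B \<ge> 0" "\<forall>t\<in>{t0..T}. \<bar>Sf t\<bar> \<le> B" using compact_imp_bounded_real[OF compact_Icc Sc] by blast
  define K where "K = {-\<R>..\<R>} \<times> {-1..2 * pi + 1} \<times> {-B..B} \<times> {t0..T}"
  have K: "compact K" "convex K" "K \<subseteq> ?D"
    unfolding K_def using t0 by (auto intro!: compact_Times convex_Times)
  obtain h' where h': "\<And>x. x \<in> ?D \<Longrightarrow> (?h has_derivative h' x) (at x within ?D)"
    "\<And>v. continuous_on ?D (\<lambda>x. h' x v)"
    using smooth_on_obtain_derivative[OF sm] by blast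
  have "\<exists>C\<ge>0. \<forall>x\<in>K. \<bar>h' x v\<bar> \<le> C" for v
    by (rule compact_imp_bounded_real[OF K(1) continuous_on_subset[OF h'(2) K(3)]])
  then obtain C where C: "\<And>v. C v \<ge> 0" "\<And>v x. x \<in> K \<Longrightarrow> \<bar>h' x v\<bar> \<le> C v" by metis
  define C1 where "C1 = C (1, 0, 0, 0) + C (0, 1, 0, 0) + C (0, 0, 1, 0) + C (0, 0, 0, 1)"
  have C1: "C1 \<ge> 0" using C(1) by (simp add: C1_def)
  have lipK: "\<bar>?h x - ?h y\<bar> \<le> C1 * norm (x - y)" if xy: "x \<in> K" "y \<in> K" for x y
  proof -
    have "norm (?h x - ?h y) \<le> C1 * norm (x - y)"
    proof (rule differentiable_bound[OF K(2) _ _ xy])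
      fix z assume z: "z \<in> K"
      then show "(?h has_derivative h' z) (at z within K)"
        using h'(1) K(3) has_derivative_subset by blast
      have lin: "linear (h' z)" using h'(1) z K(3) has_derivative_linear by blast
      show "onorm (h' z) \<le> C1"
      proof (rule onorm_bound[OF C1])
        fix v :: "real \<times> real \<times> real \<times> real"
        obtain v1 v2 v3 v4 where v: "v = (v1, v2, v3, v4)" by (cases v) auto
        have c: "\<bar>v1\<bar> \<le> norm v" "\<bar>v2\<bar> \<le> norm v" "\<bar>v3\<bar> \<le> norm v" "\<bar>v4\<bar> \<le> norm v"
        proof -
          have "\<bar>v1\<bar> \<le> norm v" "norm (v2, v3, v4) \<le> norm v"
            using norm_fst_le[of v1 "(v2, v3, v4)"] norm_snd_le[of "(v2, v3, v4)" v1] by (simp_all add: v)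
          moreover have "\<bar>v2\<bar> \<le> norm (v2, v3, v4)" "norm (v3, v4) \<le> norm (v2, v3, v4)"
            using norm_fst_le[of v2 "(v3, v4)"] norm_snd_le[of "(v3, v4)" v2] by simp_all
          moreover have "\<bar>v3\<bar> \<le> norm (v3, v4)" "\<bar>v4\<bar> \<le> norm (v3, v4)"
            using norm_fst_le[of v3 v4] norm_snd_le[of v4 v3] by simp_all
          ultimately show "\<bar>v1\<bar> \<le> norm v" "\<bar>v2\<bar> \<le> norm v" "\<bar>v3\<bar> \<le> norm v" "\<bar>v4\<bar> \<le> norm v" by linarith+
        qed
        have "v = v1 *\<^sub>R (1, 0, 0, 0) + v2 *\<^sub>R (0, 1, 0, 0) + v3 *\<^sub>R (0, 0, 1, 0) + v4 *\<^sub>R (0, 0, 0, 1)" by (simp add: v)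
        then have e: "h' z v = v1 * h' z (1, 0, 0, 0) + v2 * h' z (0, 1, 0, 0) + v3 * h' z (0, 0, 1, 0) + v4 * h' z (0, 0, 0, 1)"
          by (simp only: linear_add[OF lin] linear_scale[OF lin] real_scaleR_def)
        have b: "\<bar>w * h' z d\<bar> \<le> C d * norm v" if "\<bar>w\<bar> \<le> norm v" for w d
          using mult_mono[OF that C(2)[OF z, of d]] by (simp add: abs_mult mult.commute)
        show "norm (h' z v) \<le> C1 * norm v"
          unfolding e C1_def distrib_right real_norm_def using b[OF c(1), of "(1, 0, 0, 0)"] b[OF c(2), of "(0, 1, 0, 0)"]
            b[OF c(3), of "(0, 0, 1, 0)"] b[OF c(4), of "(0, 0, 0, 1)"] by linarith
      qed
    qed
    then show ?thesis by simp
  qed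
  obtain M where M: "M \<ge> 0" "\<forall>x\<in>K. \<bar>?h x\<bar> \<le> M"
    using compact_imp_bounded_real[OF K(1) continuous_on_subset[OF smooth_on_continuous[OF sm] K(3)]] by blast
  have shift: "h r (\<phi> + of_int k * (2 * pi)) S t = h r \<phi> S t" if "r \<in> {-\<R>..\<R>}" "t > 0" for r \<phi> S t k
    using periodic_int[of "\<lambda>\<phi>. h r \<phi> S t" "2 * pi" \<phi> k] per[OF that] by simp
  have inK: "(r, \<phi>, Sf t, t) \<in> K" if "r \<in> {-\<R>..\<R>}" "-1 \<le> \<phi>" "\<phi> \<le> 2 * pi + 1" "t \<in> {t0..T}" for r \<phi> t
  proof -
    have "\<bar>Sf t\<bar> \<le> B" using B(2) that by blast
    then have "- B \<le> Sf t" "Sf t \<le> B" by linarith+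
    then show ?thesis using that by (simp add: K_def)
  qed
  have bnd: "\<bar>h r \<phi> (Sf t) t\<bar> \<le> M" if r: "r \<in> {-\<R>..\<R>}" and t: "t \<in> {t0..T}" for r \<phi> t
  proof -
    obtain k where k: "0 \<le> \<phi> + of_int k * (2 * pi)" "\<phi> + of_int k * (2 * pi) < 2 * pi"
      using shift_into_period[of "2 * pi" \<phi>] by auto
    have "(r, \<phi> + of_int k * (2 * pi), Sf t, t) \<in> K" using k by (intro inK r t) auto
    then have "\<bar>h r (\<phi> + of_int k * (2 * pi)) (Sf t) t\<bar> \<le> M" using M(2) by force
    then show ?thesis using shift[OF r, of t \<phi> k "Sf t"] t t0 by simp
  qed
  show ?thesis
  proof (intro exI[of _ "C1 + 2 * M"] conjI ballI allI)
    show "0 \<le> C1 + 2 * M" using C1 M by simp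
    fix t r \<phi> r' \<phi>' assume t: "t \<in> {t0..T}"
    let ?r = "clamp_radius \<R> r" and ?r' = "clamp_radius \<R> r'"
    have r: "?r \<in> {-\<R>..\<R>}" "?r' \<in> {-\<R>..\<R>}" using clamp_radius_range[OF \<R>] by blast+
    have nn: "0 \<le> C1 * (\<bar>r - r'\<bar> + \<bar>\<phi> - \<phi>'\<bar>)" "0 \<le> M * (\<bar>r - r'\<bar> + \<bar>\<phi> - \<phi>'\<bar>)" using C1 M by auto
    show "\<bar>h ?r \<phi> (Sf t) t - h ?r' \<phi>' (Sf t) t\<bar> \<le> (C1 + 2 * M) * (\<bar>r - r'\<bar> + \<bar>\<phi> - \<phi>'\<bar>)"
    proof (cases "\<bar>\<phi> - \<phi>'\<bar> \<le> 1")
      case True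
      obtain k where k: "0 \<le> \<phi> + of_int k * (2 * pi)" "\<phi> + of_int k * (2 * pi) < 2 * pi"
        using shift_into_period[of "2 * pi" \<phi>] by auto
      have "(?r, \<phi> + of_int k * (2 * pi), Sf t, t) \<in> K" by (intro inK r t) (use k in linarith)+
      moreover have "(?r', \<phi>' + of_int k * (2 * pi), Sf t, t) \<in> K" by (intro inK r t) (use k True in linarith)+
      ultimately have "\<bar>?h (?r, \<phi> + of_int k * (2 * pi), Sf t, t) - ?h (?r', \<phi>' + of_int k * (2 * pi), Sf t, t)\<bar>
         \<le> C1 * norm ((?r, \<phi> + of_int k * (2 * pi), Sf t, t) - (?r', \<phi>' + of_int k * (2 * pi), Sf t, t))"
        by (rule lipK)
      then have "\<bar>h ?r \<phi> (Sf t) t - h ?r' \<phi>' (Sf t) t\<bar> \<le> C1 * norm (?r - ?r', \<phi> - \<phi>', 0::real, 0::real)"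
        using shift[OF r(1), of t \<phi> k "Sf t"] shift[OF r(2), of t \<phi>' k "Sf t"] t t0 by (simp add: zero_prod_def)
      also have "\<dots> \<le> C1 * (\<bar>r - r'\<bar> + \<bar>\<phi> - \<phi>'\<bar>)"
      proof (rule mult_left_mono[OF _ C1])
        have "norm (?r - ?r', \<phi> - \<phi>', 0::real, 0::real) \<le> \<bar>?r - ?r'\<bar> + norm (\<phi> - \<phi>', 0::real, 0::real)"
          using norm_Pair_le[of "?r - ?r'" "(\<phi> - \<phi>', 0::real, 0::real)"] by simp
        moreover have "norm (\<phi> - \<phi>', 0::real, 0::real) \<le> \<bar>\<phi> - \<phi>'\<bar>"
          using norm_Pair_le[of "\<phi> - \<phi>'" "(0::real, 0::real)"] by (simp add: norm_Pair)
        ultimately show "norm (?r - ?r', \<phi> - \<phi>', 0::real, 0::real) \<le> \<bar>r - r'\<bar> + \<bar>\<phi> - \<phi>'\<bar>"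
          using clamp_radius_Lipschitz[of \<R> r r'] by linarith
      qed
      finally show ?thesis using nn by (simp add: distrib_right)
    next
      case False
      have "\<bar>h ?r \<phi> (Sf t) t - h ?r' \<phi>' (Sf t) t\<bar> \<le> M + M"
        using bnd[OF r(1) t, of \<phi>] bnd[OF r(2) t, of \<phi>'] by linarith
      moreover have "M * 1 \<le> M * (\<bar>r - r'\<bar> + \<bar>\<phi> - \<phi>'\<bar>)" using False M by (intro mult_left_mono) auto
      moreover have "(C1 + 2 * M) * (\<bar>r - r'\<bar> + \<bar>\<phi> - \<phi>'\<bar>) =
         C1 * (\<bar>r - r'\<bar> + \<bar>\<phi> - \<phi>'\<bar>) + 2 * (M * (\<bar>r - r'\<bar> + \<bar>\<phi> - \<phi>'\<bar>))" by (simp add: algebra_simps)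
      ultimately show ?thesis using nn by linarith
    qed
  qed
qed

section \<open>The clamped field and its global solutions\<close>

context perturbed_system
begin

definition clamped_field :: "real \<Rightarrow> real \<times> real \<Rightarrow> real \<times> real" where
  "clamped_field t = (\<lambda>(r, \<phi>). (f (clamp_radius \<R> r) \<phi> (phase q s t) t,
     \<omega> (clamp_radius \<R> r) + g (clamp_radius \<R> r) \<phi> (phase q s t) t))"

lemma radius_pos: "\<R> > 0" using a_less by linarith

lemma continuous_on_phase: "A \<subseteq> {0<..} \<Longrightarrow> continuous_on A (phase q s)"
  by (rule DERIV_continuous_on[OF DERIV_phase[OF q1]]) auto

lemma smooth_fields:
  "smooth_on ({-\<R>..\<R>} \<times> UNIV \<times> UNIV \<times> {0<..}) (\<lambda>(r, \<phi>, S, t). f r \<phi> S t)"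
  "smooth_on ({-\<R>..\<R>} \<times> UNIV \<times> UNIV \<times> {0<..}) (\<lambda>(r, \<phi>, S, t). g r \<phi> S t)"
  "smooth_on ({-\<R>..\<R>} \<times> UNIV \<times> UNIV \<times> {0<..}) (\<lambda>(r, \<phi> :: real, S :: real, t :: real). \<omega> r)"
proof -
  show "smooth_on ({-\<R>..\<R>} \<times> UNIV \<times> UNIV \<times> {0<..}) (\<lambda>(r, \<phi>, S, t). f r \<phi> S t)"
    "smooth_on ({-\<R>..\<R>} \<times> UNIV \<times> UNIV \<times> {0<..}) (\<lambda>(r, \<phi>, S, t). g r \<phi> S t)"
    using adm_f adm_g by (simp_all add: admissible_perturbation_def)
  have "smooth_on ({-\<R>..\<R>} \<times> ((UNIV :: real set) \<times> (UNIV :: real set) \<times> {0::real<..})) (\<lambda>z. \<omega> (fst z))"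
    using smooth_\<omega> Ck_on_fst unfolding smooth_on_def by blast
  then show "smooth_on ({-\<R>..\<R>} \<times> UNIV \<times> UNIV \<times> {0<..}) (\<lambda>(r, \<phi> :: real, S :: real, t :: real). \<omega> r)"
    by (simp add: case_prod_unfold)
qed

lemma clamped_field_Lipschitz:
  assumes ts: "ts > 0"
  shows "\<exists>L\<ge>0. \<forall>t\<in>{ts..T}. \<forall>x y. norm (clamped_field t x - clamped_field t y) \<le> L * norm (x - y)"
proof -
  have Sc: "continuous_on {ts..T} (phase q s)" using ts by (intro continuous_on_phase) auto
  have pf: "f r (\<phi> + 2 * pi) S t = f r \<phi> S t" "g r (\<phi> + 2 * pi) S t = g r \<phi> S t" if "r \<in> {-\<R>..\<R>}" "t > 0" for r \<phi> S t
    using adm_f adm_g that by (auto simp: admissible_perturbation_def)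
  obtain A where A: "A \<ge> 0" "\<And>t r \<phi> r' \<phi>'. t \<in> {ts..T} \<Longrightarrow>
     \<bar>f (clamp_radius \<R> r) \<phi> (phase q s t) t - f (clamp_radius \<R> r') \<phi>' (phase q s t) t\<bar> \<le> A * (\<bar>r - r'\<bar> + \<bar>\<phi> - \<phi>'\<bar>)"
    using smooth_periodic_Lipschitz[OF smooth_fields(1) pf(1) Sc ts radius_pos] by blast
  obtain B where B: "B \<ge> 0" "\<And>t r \<phi> r' \<phi>'. t \<in> {ts..T} \<Longrightarrow>
     \<bar>g (clamp_radius \<R> r) \<phi> (phase q s t) t - g (clamp_radius \<R> r') \<phi>' (phase q s t) t\<bar> \<le> B * (\<bar>r - r'\<bar> + \<bar>\<phi> - \<phi>'\<bar>)"
    using smooth_periodic_Lipschitz[OF smooth_fields(2) pf(2) Sc ts radius_pos] by blast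
  obtain C where C: "C \<ge> 0" "\<And>t r \<phi> r' \<phi>' :: real. t \<in> {ts..T} \<Longrightarrow>
     \<bar>\<omega> (clamp_radius \<R> r) - \<omega> (clamp_radius \<R> r')\<bar> \<le> C * (\<bar>r - r'\<bar> + \<bar>\<phi> - \<phi>'\<bar>)"
    using smooth_periodic_Lipschitz[OF smooth_fields(3) _ Sc ts radius_pos] by blast
  show ?thesis
  proof (intro exI[of _ "2 * (A + B + C)"] conjI ballI allI)
    show "0 \<le> 2 * (A + B + C)" using A B C by simp
    fix t and x y :: "real \<times> real" assume t: "t \<in> {ts..T}"
    obtain r \<phi> r' \<phi>' where xy: "x = (r, \<phi>)" "y = (r', \<phi>')" by (cases x, cases y) auto
    define d where "d = \<bar>r - r'\<bar> + \<bar>\<phi> - \<phi>'\<bar>"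
    have d: "d \<le> 2 * norm (x - y)"
      using norm_fst_le[of "r - r'" "\<phi> - \<phi>'"] norm_snd_le[of "\<phi> - \<phi>'" "r - r'"] by (simp add: d_def xy)
    let ?F = "f (clamp_radius \<R> r) \<phi> (phase q s t) t - f (clamp_radius \<R> r') \<phi>' (phase q s t) t"
    let ?G = "(\<omega> (clamp_radius \<R> r) - \<omega> (clamp_radius \<R> r')) + (g (clamp_radius \<R> r) \<phi> (phase q s t) t - g (clamp_radius \<R> r') \<phi>' (phase q s t) t)"
    have "clamped_field t x - clamped_field t y = (?F, ?G)" by (simp add: clamped_field_def xy)
    then have "norm (clamped_field t x - clamped_field t y) \<le> \<bar>?F\<bar> + \<bar>?G\<bar>"
      using norm_Pair_le[of ?F ?G] by simp
    also have "\<dots> \<le> A * d + (C * d + B * d)"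
      using A(2)[OF t, of r \<phi> r' \<phi>'] B(2)[OF t, of r \<phi> r' \<phi>'] C(2)[OF t, of r r' \<phi> \<phi>'] unfolding d_def by linarith
    also have "\<dots> = (A + B + C) * d" by (simp add: algebra_simps)
    also have "\<dots> \<le> (A + B + C) * (2 * norm (x - y))" using d A B C by (intro mult_left_mono) auto
    finally show "norm (clamped_field t x - clamped_field t y) \<le> 2 * (A + B + C) * norm (x - y)" by (simp add: algebra_simps)
  qed
qed

lemma continuous_on_clamped_field:
  assumes ts: "ts > 0"
  shows "continuous_on ({ts..} \<times> UNIV) (\<lambda>(t, x). clamped_field t x)"
proof -
  have c: "continuous_on ({ts..} \<times> UNIV) (\<lambda>z :: real \<times> real \<times> real. clamp_radius \<R> (fst (snd z)))"
    unfolding clamp_radius_def by (intro continuous_intros)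
  have p: "continuous_on ({ts..} \<times> UNIV) (\<lambda>z :: real \<times> real \<times> real. phase q s (fst z))"
    by (rule continuous_on_compose2[OF continuous_on_phase[of "{ts..}"]]) (use ts in \<open>auto intro!: continuous_intros\<close>)
  have k: "continuous_on ({ts..} \<times> UNIV) (\<lambda>z :: real \<times> real \<times> real. (clamp_radius \<R> (fst (snd z)), snd (snd z), phase q s (fst z), fst z))"
    by (intro continuous_intros c p)
  have im: "(\<lambda>z :: real \<times> real \<times> real. (clamp_radius \<R> (fst (snd z)), snd (snd z), phase q s (fst z), fst z)) ` ({ts..} \<times> UNIV)
      \<subseteq> {-\<R>..\<R>} \<times> UNIV \<times> UNIV \<times> {0<..}"
    using ts clamp_radius_range[OF radius_pos] by auto
  have h: "continuous_on ({ts..} \<times> UNIV) (\<lambda>z. h (clamp_radius \<R> (fst (snd z))) (snd (snd z)) (phase q s (fst z)) (fst z))"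
    if "smooth_on ({-\<R>..\<R>} \<times> UNIV \<times> UNIV \<times> {0<..}) (\<lambda>(r, \<phi>, S, t). h r \<phi> S t)" for h :: "real \<Rightarrow> real \<Rightarrow> real \<Rightarrow> real \<Rightarrow> real"
    using continuous_on_compose2[OF smooth_on_continuous[OF that] k im] by simp
  have "continuous_on ({ts..} \<times> UNIV) (\<lambda>z. (f (clamp_radius \<R> (fst (snd z))) (snd (snd z)) (phase q s (fst z)) (fst z),
     \<omega> (clamp_radius \<R> (fst (snd z))) + g (clamp_radius \<R> (fst (snd z))) (snd (snd z)) (phase q s (fst z)) (fst z)))"
    by (intro continuous_intros h[OF smooth_fields(1)] h[OF smooth_fields(2)] h[OF smooth_fields(3)])
  then show ?thesis by (simp add: clamped_field_def case_prod_unfold)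
qed

text \<open>On \<open>J\<close> the given solution also solves the clamped equation, so by
  uniqueness it is a restriction of the global clamped solution. Beyond \<open>J\<close> the
  extension solves the original equation only once its radius is shown to stay within
  \<open>\<R>\<close>.\<close>

lemma clamped_extension:
  assumes ts: "ts > 0" and J: "is_interval J" "ts \<in> J" "J \<subseteq> {ts..}"
    and sol: "perturbed_solution \<R> \<omega> f g (phase q s) J r \<phi>"
  obtains r' \<phi>' where "\<And>t. t \<in> J \<Longrightarrow> r' t = r t \<and> \<phi>' t = \<phi> t"
    "\<And>t. t \<ge> ts \<Longrightarrow> (r' has_real_derivative f (clamp_radius \<R> (r' t)) (\<phi>' t) (phase q s t) t) (at t within {ts..})"
    "\<And>t. t \<ge> ts \<Longrightarrow> (\<phi>' has_real_derivative \<omega> (clamp_radius \<R> (r' t)) + g (clamp_radius \<R> (r' t)) (\<phi>' t) (phase q s t) t) (at t within {ts..})"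
proof -
  obtain x where x: "x ts = (r ts, \<phi> ts)" "\<And>t. t \<ge> ts \<Longrightarrow> (x has_vector_derivative clamped_field t (x t)) (at t within {ts..})"
    using Lipschitz_ode_global_solution[OF continuous_on_clamped_field[OF ts] clamped_field_Lipschitz[OF ts], of "(r ts, \<phi> ts)"] by blast
  have y: "((\<lambda>t. (r t, \<phi> t)) has_vector_derivative clamped_field t (r t, \<phi> t)) (at t within J)" if "t \<in> J" for t
  proof -
    have "(r has_real_derivative f (r t) (\<phi> t) (phase q s t) t) (at t within J)"
      "(\<phi> has_real_derivative \<omega> (r t) + g (r t) (\<phi> t) (phase q s t) t) (at t within J)" "\<bar>r t\<bar> \<le> \<R>"
      using sol that by (auto simp: perturbed_solution_def)
    then show ?thesis
      unfolding clamped_field_def prod.case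
      by (intro has_vector_derivative_Pair) (simp_all add: clamp_radius_id has_real_derivative_iff_has_vector_derivative)
  qed
  have eq: "x t = (r t, \<phi> t)" if "t \<in> J" for t
  proof (rule Lipschitz_ode_unique[OF J clamped_field_Lipschitz[OF ts] _ y _ that])
    show "(x has_vector_derivative clamped_field t (x t)) (at t within J)" if "t \<in> J" for t
      using x(2)[of t] J(3) that has_vector_derivative_within_subset by blast
  qed (use x in auto)
  show thesis
  proof (rule that[of "\<lambda>t. fst (x t)" "\<lambda>t. snd (x t)"])
    show "fst (x t) = r t \<and> snd (x t) = \<phi> t" if "t \<in> J" for t using eq[OF that] by simp
    fix t assume t: "t \<ge> ts"
    show "((\<lambda>t. fst (x t)) has_real_derivative f (clamp_radius \<R> (fst (x t))) (snd (x t)) (phase q s t) t) (at t within {ts..})"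
      using bounded_linear.has_vector_derivative[OF bounded_linear_fst x(2)[OF t]]
      by (simp add: clamped_field_def case_prod_unfold has_real_derivative_iff_has_vector_derivative)
    show "((\<lambda>t. snd (x t)) has_real_derivative \<omega> (clamp_radius \<R> (fst (x t))) + g (clamp_radius \<R> (fst (x t))) (snd (x t)) (phase q s t) t) (at t within {ts..})"
      using bounded_linear.has_vector_derivative[OF bounded_linear_snd x(2)[OF t]]
      by (simp add: clamped_field_def case_prod_unfold has_real_derivative_iff_has_vector_derivative)
  qed
qed

end

text \<open>At the infimum of the times at which \<open>h\<close> is not negative, continuity forces
  \<open>h\<close> to vanish; the hypothesis \<open>bar\<close> excludes exactly such a first
  contact.\<close>

lemma barrier_argument:
  fixes h :: "real \<Rightarrow> real"
  assumes c: "continuous_on {ts..} h" and "h ts < 0"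
    and bar: "\<And>t. ts < t \<Longrightarrow> (\<And>s. ts \<le> s \<Longrightarrow> s < t \<Longrightarrow> h s < 0) \<Longrightarrow> h t = 0 \<Longrightarrow> False"
    and "t \<ge> ts"
  shows "h t < 0"
proof (rule ccontr)
  assume neg: "\<not> h t < 0"
  define B where "B = {x \<in> {ts..t}. h x \<in> {0..}}"
  have ct: "continuous_on {ts..t} h" by (rule continuous_on_subset[OF c]) auto
  have "closed ({ts..t} \<inter> h -` {0..})" by (rule continuous_closed_preimage[OF ct]) auto
  then have cl: "closed B" by (simp add: B_def Int_def vimage_def)
  have ne: "t \<in> B" using neg assms(4) by (simp add: B_def)
  have bd: "bdd_below B" by (rule bdd_belowI[of _ ts]) (simp add: B_def)
  define x where "x = Inf B"
  have xB: "x \<in> B" unfolding x_def using closed_contains_Inf[of B] ne bd cl by blast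
  have less: "h s < 0" if "ts \<le> s" "s < x" for s
  proof (rule ccontr)
    assume "\<not> h s < 0"
    then have "s \<in> B" using that xB by (auto simp: B_def)
    then have "x \<le> s" unfolding x_def by (rule cInf_lower[OF _ bd])
    then show False using that by simp
  qed
  have x: "ts < x" using xB assms(2) by (cases "x = ts") (auto simp: B_def)
  have "h x = 0"
  proof (rule ccontr)
    assume "h x \<noteq> 0"
    then have hx: "0 < h x" using xB by (simp add: B_def)
    have "continuous_on {ts..x} h" by (rule continuous_on_subset[OF c]) auto
    then obtain y where y: "ts \<le> y" "y \<le> x" "h y = 0"
      using IVT'[of h ts 0 x] assms(2) hx x by auto
    then show False using less[of y] hx by (cases "y = x") auto
  qed
  then show False using bar[OF x less] by blast
qed

text \<open>Consequences of bounded derivatives up to second order, under one constant. The mixed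
  difference serves to replace the radius \<open>\<rho>s t\<close> by zero in the restoring force,
  the linearisation at \<open>(0, \<psi>0)\<close> extracts \<open>\<nu>\<close> and the damping,
  and the last bound controls the effect of the moving centre in \<open>Esum\<close>.\<close>

definition C2_bounded :: "real \<Rightarrow> real \<Rightarrow> (real \<Rightarrow> real \<Rightarrow> real) \<Rightarrow> bool" where
  "C2_bounded \<psi>0 C H \<longleftrightarrow> (\<forall>x1 x2 y1 y2. \<bar>x1\<bar> \<le> 2 \<and> \<bar>x2\<bar> \<le> 2 \<and> \<bar>y1 - \<psi>0\<bar> \<le> 2 \<and> \<bar>y2 - \<psi>0\<bar> \<le> 2 \<longrightarrow>
     \<bar>H x1 y1\<bar> \<le> C \<and> \<bar>H x1 y1 - H x2 y1\<bar> \<le> C * \<bar>x1 - x2\<bar> \<and> \<bar>H x1 y1 - H x1 y2\<bar> \<le> C * \<bar>y1 - y2\<bar> \<and>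
     \<bar>(H x1 y1 - H x1 y2) - (H x2 y1 - H x2 y2)\<bar> \<le> C * \<bar>x1 - x2\<bar> * \<bar>y1 - y2\<bar> \<and>
     \<bar>H x1 y1 - H x1 y2 - deriv (H 0) \<psi>0 * (y1 - y2)\<bar> \<le> C * (\<bar>y1 - y2\<bar> + \<bar>x1\<bar> + \<bar>y2 - \<psi>0\<bar>) * \<bar>y1 - y2\<bar> \<and>
     \<bar>H 0 y1 - H 0 y2 - deriv (H 0) y2 * (y1 - y2)\<bar> \<le> C * (y1 - y2)\<^sup>2)"

lemma C2_boundedD:
  assumes "C2_bounded \<psi>0 C H" "\<bar>x1\<bar> \<le> 2" "\<bar>x2\<bar> \<le> 2" "\<bar>y1 - \<psi>0\<bar> \<le> 2" "\<bar>y2 - \<psi>0\<bar> \<le> 2"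
  shows "\<bar>H x1 y1\<bar> \<le> C"
    "\<bar>H x1 y1 - H x2 y1\<bar> \<le> C * \<bar>x1 - x2\<bar>"
    "\<bar>H x1 y1 - H x1 y2\<bar> \<le> C * \<bar>y1 - y2\<bar>"
    "\<bar>(H x1 y1 - H x1 y2) - (H x2 y1 - H x2 y2)\<bar> \<le> C * \<bar>x1 - x2\<bar> * \<bar>y1 - y2\<bar>"
    "\<bar>H x1 y1 - H x1 y2 - deriv (H 0) \<psi>0 * (y1 - y2)\<bar> \<le> C * (\<bar>y1 - y2\<bar> + \<bar>x1\<bar> + \<bar>y2 - \<psi>0\<bar>) * \<bar>y1 - y2\<bar>"
    "\<bar>H 0 y1 - H 0 y2 - deriv (H 0) y2 * (y1 - y2)\<bar> \<le> C * (y1 - y2)\<^sup>2"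
  using assms(1)[unfolded C2_bounded_def, rule_format, of x1 x2 y1 y2] assms(2-) by simp_all

lemma C2_bounded_mono:
  assumes "C2_bounded \<psi>0 D H" "D \<le> C"
  shows "C2_bounded \<psi>0 C H"
  unfolding C2_bounded_def
proof (intro allI impI)
  fix x1 x2 y1 y2 :: real assume "\<bar>x1\<bar> \<le> 2 \<and> \<bar>x2\<bar> \<le> 2 \<and> \<bar>y1 - \<psi>0\<bar> \<le> 2 \<and> \<bar>y2 - \<psi>0\<bar> \<le> 2"
  then have b: "\<bar>x1\<bar> \<le> 2" "\<bar>x2\<bar> \<le> 2" "\<bar>y1 - \<psi>0\<bar> \<le> 2" "\<bar>y2 - \<psi>0\<bar> \<le> 2" by auto
  note d = C2_boundedD[OF assms(1) b]
  have up: "z \<le> C * w" if "z \<le> D * w" "0 \<le> w" for z w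
    using mult_right_mono[OF assms(2) that(2)] that(1) by linarith
  have "\<bar>H x1 y1\<bar> \<le> C" using d(1) assms(2) by linarith
  moreover have "\<bar>H x1 y1 - H x2 y1\<bar> \<le> C * \<bar>x1 - x2\<bar>" by (rule up[OF d(2)]) simp
  moreover have "\<bar>H x1 y1 - H x1 y2\<bar> \<le> C * \<bar>y1 - y2\<bar>" by (rule up[OF d(3)]) simp
  moreover have "\<bar>(H x1 y1 - H x1 y2) - (H x2 y1 - H x2 y2)\<bar> \<le> C * \<bar>x1 - x2\<bar> * \<bar>y1 - y2\<bar>"
    using up[OF d(4)[unfolded mult.assoc]] by (simp add: mult.assoc)
  moreover have "\<bar>H x1 y1 - H x1 y2 - deriv (H 0) \<psi>0 * (y1 - y2)\<bar> \<le> C * (\<bar>y1 - y2\<bar> + \<bar>x1\<bar> + \<bar>y2 - \<psi>0\<bar>) * \<bar>y1 - y2\<bar>"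
    using up[OF d(5)[unfolded mult.assoc]] by (simp add: mult.assoc)
  moreover have "\<bar>H 0 y1 - H 0 y2 - deriv (H 0) y2 * (y1 - y2)\<bar> \<le> C * (y1 - y2)\<^sup>2" by (rule up[OF d(6)]) simp
  ultimately show "\<bar>H x1 y1\<bar> \<le> C \<and> \<bar>H x1 y1 - H x2 y1\<bar> \<le> C * \<bar>x1 - x2\<bar> \<and> \<bar>H x1 y1 - H x1 y2\<bar> \<le> C * \<bar>y1 - y2\<bar> \<and>
     \<bar>(H x1 y1 - H x1 y2) - (H x2 y1 - H x2 y2)\<bar> \<le> C * \<bar>x1 - x2\<bar> * \<bar>y1 - y2\<bar> \<and>
     \<bar>H x1 y1 - H x1 y2 - deriv (H 0) \<psi>0 * (y1 - y2)\<bar> \<le> C * (\<bar>y1 - y2\<bar> + \<bar>x1\<bar> + \<bar>y2 - \<psi>0\<bar>) * \<bar>y1 - y2\<bar> \<and>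
     \<bar>H 0 y1 - H 0 y2 - deriv (H 0) y2 * (y1 - y2)\<bar> \<le> C * (y1 - y2)\<^sup>2" by blast
qed

lemma C2_estimates:
  fixes H :: "real \<Rightarrow> real \<Rightarrow> real"
  assumes sm: "smooth_on UNIV (\<lambda>(x, y). H x y)"
  shows "\<exists>C\<ge>0. C2_bounded \<psi>0 C H"
proof -
  let ?h = "\<lambda>(x, y). H x y"
  let ?hx = "dir_deriv (1, 0) ?h" and ?hy = "dir_deriv (0, 1) ?h"
  let ?hyx = "dir_deriv (1, 0) ?hy" and ?hyy = "dir_deriv (0, 1) ?hy"
  \<comment> \<open>A point of modulus at most 2, moved by at most the distance 4 of two such
    points, stays within 6.\<close>
  define K where "K = {-6..6::real} \<times> {\<psi>0 - 6..\<psi>0 + 6}"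
  have K: "compact K" unfolding K_def by (intro compact_Times) auto
  have smy: "smooth_on UNIV ?hy" by (rule smooth_on_dir_deriv[OF open_UNIV sm])
  have bd: "\<exists>C\<ge>0. \<forall>z\<in>K. \<bar>k z\<bar> \<le> C" if "smooth_on UNIV k" for k
    by (rule compact_imp_bounded_real[OF K continuous_on_subset[OF smooth_on_continuous[OF that]]]) simp
  obtain C0 where C0: "C0 \<ge> 0" "\<And>z. z \<in> K \<Longrightarrow> \<bar>?h z\<bar> \<le> C0" using bd[OF sm] by blast
  obtain C1 where C1: "C1 \<ge> 0" "\<And>z. z \<in> K \<Longrightarrow> \<bar>?hx z\<bar> \<le> C1" using bd[OF smooth_on_dir_deriv[OF open_UNIV sm]] by blast
  obtain C2 where C2: "C2 \<ge> 0" "\<And>z. z \<in> K \<Longrightarrow> \<bar>?hy z\<bar> \<le> C2" using bd[OF smy] by blast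
  obtain C3 where C3: "C3 \<ge> 0" "\<And>z. z \<in> K \<Longrightarrow> \<bar>?hyx z\<bar> \<le> C3" using bd[OF smooth_on_dir_deriv[OF open_UNIV smy]] by blast
  obtain C4 where C4: "C4 \<ge> 0" "\<And>z. z \<in> K \<Longrightarrow> \<bar>?hyy z\<bar> \<le> C4" using bd[OF smooth_on_dir_deriv[OF open_UNIV smy]] by blast
  define C where "C = C0 + C1 + C2 + C3 + C4"
  have C: "0 \<le> C" "C0 \<le> C" "C1 \<le> C" "C2 \<le> C" "C3 \<le> C" "C4 \<le> C" "C3 + C4 \<le> C"
    using C0 C1 C2 C3 C4 by (auto simp: C_def)
  have inx: "(x2, y) + r *\<^sub>R (1, 0) \<in> K" if "\<bar>x1\<bar> \<le> 2" "\<bar>x2\<bar> \<le> 2" "\<bar>y - \<psi>0\<bar> \<le> 2" "\<bar>r\<bar> \<le> \<bar>x1 - x2\<bar>" for x1 x2 y r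
    using that by (auto simp: K_def abs_le_iff)
  have iny: "(x, y2) + r *\<^sub>R (0, 1) \<in> K" if "\<bar>x\<bar> \<le> 2" "\<bar>y1 - \<psi>0\<bar> \<le> 2" "\<bar>y2 - \<psi>0\<bar> \<le> 2" "\<bar>r\<bar> \<le> \<bar>y1 - y2\<bar>" for x y1 y2 r
    using that by (auto simp: K_def abs_le_iff)
  have lx: "\<bar>k (x1, y) - k (x2, y)\<bar> \<le> D * \<bar>x1 - x2\<bar>"
    if "smooth_on UNIV k" "\<And>z. z \<in> K \<Longrightarrow> \<bar>dir_deriv (1, 0) k z\<bar> \<le> D" "\<bar>x1\<bar> \<le> 2" "\<bar>x2\<bar> \<le> 2" "\<bar>y - \<psi>0\<bar> \<le> 2" for k D x1 x2 y
    using Taylor_line_bound[OF open_UNIV that(1), of "x1 - x2" "(x2, y)" "(1, 0)" 0 D] that(2)[OF inx[OF that(3-5)]] by simp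
  have ly: "\<bar>k (x, y1) - k (x, y2)\<bar> \<le> D * \<bar>y1 - y2\<bar>"
    if "smooth_on UNIV k" "\<And>z. z \<in> K \<Longrightarrow> \<bar>dir_deriv (0, 1) k z\<bar> \<le> D" "\<bar>x\<bar> \<le> 2" "\<bar>y1 - \<psi>0\<bar> \<le> 2" "\<bar>y2 - \<psi>0\<bar> \<le> 2" for k D x y1 y2
    using Taylor_line_bound[OF open_UNIV that(1), of "y1 - y2" "(x, y2)" "(0, 1)" 0 D] that(2)[OF iny[OF that(3-5)]] by simp
  have dH: "(H x has_real_derivative ?hy (x, y)) (at y)" for x y
    using DERIV_line[OF open_UNIV sm, of "(x, 0)" y "(0, 1)"] by simp
  have dH0: "deriv (H 0) y = ?hy (0, y)" for y using DERIV_imp_deriv[OF dH] .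
  have T2: "\<bar>H x y1 - H x y2 - ?hy (x, y2) * (y1 - y2)\<bar> \<le> C4 * (y1 - y2)\<^sup>2"
    if "\<bar>x\<bar> \<le> 2" "\<bar>y1 - \<psi>0\<bar> \<le> 2" "\<bar>y2 - \<psi>0\<bar> \<le> 2" for x y1 y2
    using Taylor_line_bound[OF open_UNIV sm, of "y1 - y2" "(x, y2)" "(0, 1)" 1 C4] C4(2)[OF iny[OF that]]
    by (simp add: numeral_2_eq_2 power2_eq_square diff_diff_eq flip: abs_mult)
  show ?thesis
    unfolding C2_bounded_def
  proof (intro exI[of _ C] conjI C(1) allI impI)
    fix x1 x2 y1 y2 :: real assume "\<bar>x1\<bar> \<le> 2 \<and> \<bar>x2\<bar> \<le> 2 \<and> \<bar>y1 - \<psi>0\<bar> \<le> 2 \<and> \<bar>y2 - \<psi>0\<bar> \<le> 2"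
    then have b: "\<bar>x1\<bar> \<le> 2" "\<bar>x2\<bar> \<le> 2" "\<bar>y1 - \<psi>0\<bar> \<le> 2" "\<bar>y2 - \<psi>0\<bar> \<le> 2" by auto
    have up: "c * z \<le> C * z" if "c \<le> C" "0 \<le> z" for c z using that by (rule mult_right_mono)
    have "(x1, y1) \<in> K" using b by (auto simp: K_def abs_le_iff)
    from C0(2)[OF this] show "\<bar>H x1 y1\<bar> \<le> C" using C by simp
    show "\<bar>H x1 y1 - H x2 y1\<bar> \<le> C * \<bar>x1 - x2\<bar>"
      using lx[OF sm C1(2) b(1,2,3)] up[OF C(3), of "\<bar>x1 - x2\<bar>"] by simp
    show "\<bar>H x1 y1 - H x1 y2\<bar> \<le> C * \<bar>y1 - y2\<bar>"
      using ly[OF sm C2(2) b(1,3,4)] up[OF C(4), of "\<bar>y1 - y2\<bar>"] by simp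
    \<comment> \<open>The mixed difference is the increment in \<open>y\<close> of
      \<open>H x1 y - H x2 y\<close>, whose derivative is itself a difference in
      \<open>x\<close>.\<close>
    have "\<bar>(H x1 y1 - H x2 y1) - (H x1 y2 - H x2 y2)\<bar> \<le> (C3 * \<bar>x1 - x2\<bar>) * \<bar>y1 - y2\<bar>"
    proof -
      have "norm ((\<lambda>y. H x1 y - H x2 y) y1 - (\<lambda>y. H x1 y - H x2 y) y2) \<le> (C3 * \<bar>x1 - x2\<bar>) * norm (y1 - y2)"
      proof (rule field_differentiable_bound[of "{\<psi>0 - 2..\<psi>0 + 2}"])
        fix y assume y: "y \<in> {\<psi>0 - 2..\<psi>0 + 2}"
        show "((\<lambda>y. H x1 y - H x2 y) has_field_derivative ?hy (x1, y) - ?hy (x2, y)) (at y within {\<psi>0 - 2..\<psi>0 + 2})"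
          by (intro DERIV_diff has_field_derivative_at_within[OF dH])
        have "\<bar>y - \<psi>0\<bar> \<le> 2" using y by (auto simp: abs_le_iff)
        from lx[OF smy C3(2) b(1,2) this] show "norm (?hy (x1, y) - ?hy (x2, y)) \<le> C3 * \<bar>x1 - x2\<bar>" by simp
      qed (use b in \<open>auto simp: abs_le_iff\<close>)
      then show ?thesis by simp
    qed
    also have "\<dots> \<le> C * \<bar>x1 - x2\<bar> * \<bar>y1 - y2\<bar>" using C by (intro mult_right_mono) auto
    finally show "\<bar>(H x1 y1 - H x1 y2) - (H x2 y1 - H x2 y2)\<bar> \<le> C * \<bar>x1 - x2\<bar> * \<bar>y1 - y2\<bar>"
      by (simp add: algebra_simps)
    show "\<bar>H 0 y1 - H 0 y2 - deriv (H 0) y2 * (y1 - y2)\<bar> \<le> C * (y1 - y2)\<^sup>2"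
      using T2[OF _ b(3,4), of 0] up[OF C(6), of "(y1 - y2)\<^sup>2"] unfolding dH0 by simp
    have "\<bar>?hy (x1, y2) - ?hy (0, \<psi>0)\<bar> \<le> C3 * \<bar>x1\<bar> + C4 * \<bar>y2 - \<psi>0\<bar>"
      using lx[OF smy C3(2) b(1) _ b(4), of 0] ly[OF smy C4(2) _ b(4), of 0 \<psi>0] by simp
    also have "\<dots> \<le> (C3 + C4) * (\<bar>x1\<bar> + \<bar>y2 - \<psi>0\<bar>)"
      using C3(1) C4(1) by (simp add: distrib_left distrib_right)
    finally have "\<bar>(?hy (x1, y2) - ?hy (0, \<psi>0)) * (y1 - y2)\<bar> \<le> (C3 + C4) * (\<bar>x1\<bar> + \<bar>y2 - \<psi>0\<bar>) * \<bar>y1 - y2\<bar>"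
      unfolding abs_mult by (rule mult_right_mono) simp
    moreover have "H x1 y1 - H x1 y2 - deriv (H 0) \<psi>0 * (y1 - y2)
       = (H x1 y1 - H x1 y2 - ?hy (x1, y2) * (y1 - y2)) + (?hy (x1, y2) - ?hy (0, \<psi>0)) * (y1 - y2)"
      by (simp add: dH0 algebra_simps)
    moreover have "C4 * (y1 - y2)\<^sup>2 \<le> (C3 + C4) * \<bar>y1 - y2\<bar> * \<bar>y1 - y2\<bar>"
    proof -
      have "(y1 - y2)\<^sup>2 = \<bar>y1 - y2\<bar> * \<bar>y1 - y2\<bar>" by (simp add: power2_eq_square)
      then show ?thesis using C3(1) by (simp add: distrib_right mult.assoc)
    qed
    ultimately have "\<bar>H x1 y1 - H x1 y2 - deriv (H 0) \<psi>0 * (y1 - y2)\<bar>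
       \<le> (C3 + C4) * \<bar>y1 - y2\<bar> * \<bar>y1 - y2\<bar> + (C3 + C4) * (\<bar>x1\<bar> + \<bar>y2 - \<psi>0\<bar>) * \<bar>y1 - y2\<bar>"
      using T2[OF b(1,3,4)] by linarith
    also have "\<dots> = (C3 + C4) * ((\<bar>y1 - y2\<bar> + \<bar>x1\<bar> + \<bar>y2 - \<psi>0\<bar>) * \<bar>y1 - y2\<bar>)" by (simp add: algebra_simps)
    also have "\<dots> \<le> C * ((\<bar>y1 - y2\<bar> + \<bar>x1\<bar> + \<bar>y2 - \<psi>0\<bar>) * \<bar>y1 - y2\<bar>)" by (rule up[OF C(7)]) simp
    finally show "\<bar>H x1 y1 - H x1 y2 - deriv (H 0) \<psi>0 * (y1 - y2)\<bar> \<le> C * (\<bar>y1 - y2\<bar> + \<bar>x1\<bar> + \<bar>y2 - \<psi>0\<bar>) * \<bar>y1 - y2\<bar>"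
      by (simp add: mult.assoc)
  qed
qed

section \<open>Slow variation in time, and zeros of periodic functions of mean zero\<close>

lemma powr_slowly_varying:
  fixes e t1 t2 P :: real
  assumes "e \<ge> 0" "1 \<le> t1" "t1 \<le> t2" "t2 \<le> t1 + P"
  shows "\<bar>t2 powr (- e) - t1 powr (- e)\<bar> \<le> e * P / t1"
proof -
  have "norm (t2 powr (- e) - t1 powr (- e)) \<le> (e / t1) * norm (t2 - t1)"
  proof (rule field_differentiable_bound[of "{t1..t2}"])
    fix t assume t: "t \<in> {t1..t2}"
    show "((\<lambda>t. t powr (- e)) has_field_derivative (- e) * t powr (- e - 1)) (at t within {t1..t2})"
      using t assms by (auto intro!: derivative_eq_intros)
    have "t powr (- e - 1) \<le> t powr (- 1)" using t assms by (intro powr_mono) auto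
    also have "\<dots> = 1 / t" using t assms by (simp add: powr_minus divide_inverse)
    also have "\<dots> \<le> 1 / t1" using t assms by (intro divide_left_mono) auto
    finally have "e * t powr (- e - 1) \<le> e * (1 / t1)" using assms(1) by (rule mult_left_mono)
    then show "norm ((- e) * t powr (- e - 1)) \<le> e / t1" using assms(1) by (simp add: abs_mult)
  qed (use assms in auto)
  also have "\<dots> \<le> (e / t1) * P" using assms by (intro mult_left_mono) auto
  finally show ?thesis by simp
qed

text \<open>A continuous function without zeros on a period has a fixed sign, so its integral cannot
  vanish; periodicity then moves the zero into any prescribed period.\<close>

lemma zero_mean_has_zero:
  fixes g :: "real \<Rightarrow> real"
  assumes c: "continuous_on UNIV g" and per: "\<And>S. g (S + P) = g S" and P: "P > 0" and mean: "integral {0..P} g = 0"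
  obtains S where "S1 \<le> S" "S < S1 + P" "g S = 0"
proof -
  have c0: "continuous_on {0..P} g" by (rule continuous_on_subset[OF c]) simp
  have "\<exists>z\<in>{0..P}. g z = 0"
  proof (rule ccontr)
    assume no: "\<not> (\<exists>z\<in>{0..P}. g z = 0)"
    have pos: False if k: "continuous_on {0..P} k" "integral {0..P} k = 0" "\<And>z. z \<in> {0..P} \<Longrightarrow> 0 < k z" for k :: "real \<Rightarrow> real"
    proof -
      have "(k has_integral 0) (cbox 0 P)"
        using integrable_integral[OF integrable_continuous_real[OF k(1)]] k(2) by simp
      then have "k 0 = 0"
        using has_integral_0_cbox_imp_0[of 0 P k 0] k(1,3) P by (auto simp: less_imp_le)
      then show False using k(3)[of 0] P by simp
    qed
    consider "\<forall>z\<in>{0..P}. 0 < g z" | "\<forall>z\<in>{0..P}. g z < 0" | z1 z2 where "z1 \<in> {0..P}" "z2 \<in> {0..P}" "g z1 \<le> 0" "0 \<le> g z2"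
      by force
    then show False
    proof cases
      case 1
      then show ?thesis using pos[OF c0 mean] by blast
    next
      case 2
      have "continuous_on {0..P} (\<lambda>z. - g z)" by (intro continuous_intros c0)
      moreover have "integral {0..P} (\<lambda>z. - g z) = 0" using mean by simp
      ultimately show ?thesis by (rule pos) (use 2 in auto)
    next
      case (3 z1 z2)
      have "connected (g ` {0..P})" by (rule connected_continuous_image[OF c0]) simp
      then have "0 \<in> g ` {0..P}" using connectedD_interval[of "g ` {0..P}" "g z1" "g z2" 0] 3 by auto
      then show ?thesis using no by auto
    qed
  qed
  then obtain z where z: "g z = 0" by blast
  obtain k where k: "0 \<le> (z - S1) + of_int k * P" "(z - S1) + of_int k * P < P" using shift_into_period[OF P] .
  have "g (z + of_int k * P) = 0" using periodic_int[of g P z k] per z by simp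
  then show ?thesis using k by (intro that[of "z + of_int k * P"]) auto
qed

section \<open>Stability of the particular solution\<close>

text \<open>The situation left by \<open>parity_restriction\<close>: \<open>2 * l + 1\<close> stands
  for \<open>n\<close>, and \<open>m \<le> 2 * l\<close>, \<open>l + 1 \<le> q\<close> express
  \<open>m < n < 2 * q\<close>. The index \<open>N\<close> and the particular solution are fixed
  here, so all constants may depend on them.\<close>

locale resonant_system = perturbed_system q \<kappa> \<mu> a s \<omega> fc gc u v \<Lambda> \<Omega> \<R> f g
  for q \<kappa> \<mu> :: nat and a :: real and s :: "nat \<Rightarrow> real" and \<omega> :: "real \<Rightarrow> real"
    and fc gc u v :: "nat \<Rightarrow> real \<Rightarrow> real \<Rightarrow> real \<Rightarrow> real" and \<Lambda> \<Omega> :: "nat \<Rightarrow> real \<Rightarrow> real \<Rightarrow> real"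
    and \<R> :: real and f g :: "real \<Rightarrow> real \<Rightarrow> real \<Rightarrow> real \<Rightarrow> real" +
  fixes l m N :: nat and \<psi>0 :: real and \<rho>s \<phi>s :: "real \<Rightarrow> real"
  assumes m2: "2 \<le> m" and ml: "m \<le> 2 * l" and lq: "l + 1 \<le> q" and N3: "3 * (2 * l + 1) \<le> N"
    and \<Lambda>_zero: "\<And>i x y. 1 \<le> i \<Longrightarrow> i < 2 * l + 1 \<Longrightarrow> \<Lambda> i x y = 0"
    and \<Omega>_zero: "\<And>i x y. 1 < i \<Longrightarrow> i < m \<Longrightarrow> \<Omega> i x y = 0"
    and equilibrium: "\<Lambda> (2 * l + 1) 0 \<psi>0 = 0"
    and \<nu>\<eta>: "deriv (\<Lambda> (2 * l + 1) 0) \<psi>0 * deriv \<omega> a < 0"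
    and damping: "deriv (\<Omega> m 0) \<psi>0 < 0"
    and particular: "particular_solution q m \<psi>0 N \<Lambda> \<Omega> \<rho>s \<phi>s"
begin

abbreviation "\<eta> \<equiv> deriv \<omega> a"
abbreviation "\<nu> \<equiv> deriv (\<Lambda> (2 * l + 1) 0) \<psi>0"
abbreviation "w \<equiv> - deriv (\<Omega> m 0) \<psi>0"
abbreviation "\<tau> \<equiv> tau q"

abbreviation "d\<rho> \<equiv> truncated_rhs q N \<Lambda>"
abbreviation "d\<phi> \<equiv> truncated_rhs q N \<Omega>"

lemma \<nu>_nz: "\<nu> \<noteq> 0" and \<eta>_nz: "\<eta> \<noteq> 0"
  using \<nu>\<eta> by auto

lemma rhs_\<Lambda>:
  assumes "t > 0"
  shows "d\<rho> x y t = (\<Sum>k=2 * l + 1..N. \<tau> t ^ k * \<Lambda> k x y)"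
proof -
  have "d\<rho> x y t = (\<Sum>k=1..N. \<tau> t ^ k * \<Lambda> k x y)"
    unfolding truncated_rhs_def using tau_power[OF assms] by simp
  also have "\<dots> = (\<Sum>k=2 * l + 1..N. \<tau> t ^ k * \<Lambda> k x y)"
    by (rule sum.mono_neutral_right) (auto simp: \<Lambda>_zero)
  finally show ?thesis .
qed

lemma rhs_\<Omega>:
  assumes "t > 0"
  shows "d\<phi> x y t = \<tau> t * \<eta> * x + (\<Sum>k=m..N. \<tau> t ^ k * \<Omega> k x y)"
proof -
  have "d\<phi> x y t = (\<Sum>k=1..N. \<tau> t ^ k * \<Omega> k x y)"
    unfolding truncated_rhs_def using tau_power[OF assms] by simp
  also have "{1..N} = insert 1 {2..N}" using N3 by auto
  also have "(\<Sum>k\<in>insert 1 {2..N}. \<tau> t ^ k * \<Omega> k x y) = \<tau> t * \<eta> * x + (\<Sum>k=2..N. \<tau> t ^ k * \<Omega> k x y)"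
    by (simp add: \<Omega>_1[unfolded One_nat_def] mult.assoc)
  also have "(\<Sum>k=2..N. \<tau> t ^ k * \<Omega> k x y) = (\<Sum>k=m..N. \<tau> t ^ k * \<Omega> k x y)"
    by (rule sum.mono_neutral_right) (use m2 in \<open>auto simp: \<Omega>_zero\<close>)
  finally show ?thesis .
qed

section \<open>Size of the particular solution and of its drift\<close>

lemma particular_expansion:
  obtains \<rho>c \<phi>c :: "nat \<Rightarrow> real" where
    "\<And>K. K \<ge> 1 \<Longrightarrow> (\<lambda>t. \<rho>s t - (\<Sum>k=1..<K. t powr (- ((real k + real m - 2) / (2 * real q))) * \<rho>c k))
          \<in> O[at_top](\<lambda>t. t powr (- ((real K + real m - 2) / (2 * real q))))"
    "\<And>K. K \<ge> 1 \<Longrightarrow> (\<lambda>t. \<phi>s t - \<psi>0 - (\<Sum>k=1..<K. t powr (- (real k / (2 * real q))) * \<phi>c k))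
          \<in> O[at_top](\<lambda>t. t powr (- (real K / (2 * real q))))"
  using particular unfolding particular_solution_def by blast

lemma particular_DERIV:
  "\<forall>\<^sub>F t in at_top. (\<rho>s has_real_derivative d\<rho> (\<rho>s t) (\<phi>s t) t) (at t) \<and>
        (\<phi>s has_real_derivative d\<phi> (\<rho>s t) (\<phi>s t) t) (at t)"
  using particular unfolding particular_solution_def by blast

lemma powr_tau_bound:
  fixes b :: "real \<Rightarrow> real"
  assumes "b \<in> O[at_top](\<lambda>t. t powr (- (real k / (2 * real q))))"
  shows "\<exists>C\<ge>0. \<forall>\<^sub>F t in at_top. \<bar>b t\<bar> \<le> C * \<tau> t ^ k"
proof -
  obtain C where C: "C > 0" "\<forall>\<^sub>F t in at_top. norm (b t) \<le> C * norm (t powr (- (real k / (2 * real q))))"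
    using landau_o.bigE[OF assms] by blast
  have "\<forall>\<^sub>F t in at_top. \<bar>b t\<bar> \<le> C * \<tau> t ^ k"
    using C(2) eventually_gt_at_top[of 0] by eventually_elim (simp add: tau_power)
  then show ?thesis using C(1) by (intro exI[of _ C]) auto
qed

lemma \<rho>s_bound: "\<exists>C\<ge>0. \<forall>\<^sub>F t in at_top. \<bar>\<rho>s t\<bar> \<le> C * \<tau> t ^ (m - 1)"
proof -
  obtain \<rho>c \<phi>c :: "nat \<Rightarrow> real" where c: "\<And>K. K \<ge> 1 \<Longrightarrow> (\<lambda>t. \<rho>s t - (\<Sum>k=1..<K. t powr (- ((real k + real m - 2) / (2 * real q))) * \<rho>c k))
          \<in> O[at_top](\<lambda>t. t powr (- ((real K + real m - 2) / (2 * real q))))"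
    using particular_expansion by blast
  have "\<rho>s \<in> O[at_top](\<lambda>t. t powr (- (real (m - 1) / (2 * real q))))"
    using c[of 1] m2 by (simp add: of_nat_diff)
  then show ?thesis by (rule powr_tau_bound)
qed

lemma \<phi>s_bound: "\<exists>C\<ge>0. \<forall>\<^sub>F t in at_top. \<bar>\<phi>s t - \<psi>0\<bar> \<le> C * \<tau> t"
proof -
  obtain \<rho>c \<phi>c :: "nat \<Rightarrow> real" where c: "\<And>K. K \<ge> 1 \<Longrightarrow> (\<lambda>t. \<phi>s t - \<psi>0 - (\<Sum>k=1..<K. t powr (- (real k / (2 * real q))) * \<phi>c k))
          \<in> O[at_top](\<lambda>t. t powr (- (real K / (2 * real q))))"
    using particular_expansion by blast
  have "(\<lambda>t. \<phi>s t - \<psi>0) \<in> O[at_top](\<lambda>t. t powr (- (real 1 / (2 * real q))))" using c[of 1] by simp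
  from powr_tau_bound[OF this] show ?thesis by simp
qed

lemma uniform_C2:
  "\<exists>C\<ge>0. \<forall>k\<in>{1..N}. C2_bounded \<psi>0 C (\<Lambda> k) \<and> C2_bounded \<psi>0 C (\<Omega> k)"
proof -
  have "\<exists>C\<ge>0. C2_bounded \<psi>0 C (\<Lambda> k)" "\<exists>C\<ge>0. C2_bounded \<psi>0 C (\<Omega> k)" if "k \<in> {1..N}" for k
    using C2_estimates[OF smooth_\<Lambda>[of k]] C2_estimates[OF smooth_\<Omega>[of k]] that by auto
  then obtain c d where c: "\<And>k. k \<in> {1..N} \<Longrightarrow> c k \<ge> 0 \<and> C2_bounded \<psi>0 (c k) (\<Lambda> k)"
    and d: "\<And>k. k \<in> {1..N} \<Longrightarrow> d k \<ge> 0 \<and> C2_bounded \<psi>0 (d k) (\<Omega> k)" by metis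
  define C where "C = (\<Sum>k=1..N. c k + d k)"
  have le: "c k + d k \<le> C" if "k \<in> {1..N}" for k
    unfolding C_def by (rule member_le_sum) (use that c d in \<open>auto intro: add_nonneg_nonneg\<close>)
  show ?thesis
  proof (intro exI[of _ C] conjI ballI)
    show "0 \<le> C" unfolding C_def by (intro sum_nonneg add_nonneg_nonneg) (use c d in auto)
    fix k assume k: "k \<in> {1..N}"
    have "c k \<le> C" "d k \<le> C" using le[OF k] c[OF k] d[OF k] by linarith+
    then show "C2_bounded \<psi>0 C (\<Lambda> k)" "C2_bounded \<psi>0 C (\<Omega> k)"
      using c[OF k] d[OF k] C2_bounded_mono by blast+
  qed
qed

text \<open>An asymptotic expansion must not be differentiated termwise, but the equation shows that
  the derivative is \<open>E * \<tau> ^ m\<close> up to \<open>O(\<tau> ^ (m + 1))\<close>. Since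
  \<open>m \<le> 2 * q\<close>, a nonzero \<open>E\<close> would give a rate of at least order
  \<open>1 / t\<close>, hence an increment over \<open>{T..2 * T}\<close> bounded away from zero,
  against the convergence of \<open>\<phi>s\<close>.\<close>

lemma \<phi>s_DERIV_bound: "\<exists>C\<ge>0. \<forall>\<^sub>F t in at_top. \<bar>d\<phi> (\<rho>s t) (\<phi>s t) t\<bar> \<le> C * \<tau> t ^ (m + 1)"
proof -
  obtain \<rho>c \<phi>c :: "nat \<Rightarrow> real" where c: "\<And>K. K \<ge> 1 \<Longrightarrow> (\<lambda>t. \<rho>s t - (\<Sum>k=1..<K. t powr (- ((real k + real m - 2) / (2 * real q))) * \<rho>c k))
          \<in> O[at_top](\<lambda>t. t powr (- ((real K + real m - 2) / (2 * real q))))"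
    using particular_expansion by blast
  have e: "(\<lambda>t. \<rho>s t - t powr (- (real (m - 1) / (2 * real q))) * \<rho>c 1) \<in> O[at_top](\<lambda>t. t powr (- (real m / (2 * real q))))"
    using c[of 2] m2 by (simp add: of_nat_diff numeral_2_eq_2)
  obtain A where A: "A \<ge> 0" "\<forall>\<^sub>F t in at_top. \<bar>\<rho>s t - t powr (- (real (m - 1) / (2 * real q))) * \<rho>c 1\<bar> \<le> A * \<tau> t ^ m"
    using powr_tau_bound[OF e] by blast
  obtain B where B: "B \<ge> 0" "\<forall>\<^sub>F t in at_top. \<bar>\<rho>s t\<bar> \<le> B * \<tau> t ^ (m - 1)" using \<rho>s_bound by blast
  obtain D where D: "D \<ge> 0" "\<forall>\<^sub>F t in at_top. \<bar>\<phi>s t - \<psi>0\<bar> \<le> D * \<tau> t" using \<phi>s_bound by blast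
  obtain C where C: "C \<ge> 0" "\<forall>k\<in>{1..N}. C2_bounded \<psi>0 C (\<Lambda> k) \<and> C2_bounded \<psi>0 C (\<Omega> k)"
    using uniform_C2 by blast
  note C\<Omega> = C(2)[rule_format, THEN conjunct2]
  \<comment> \<open>The coefficient of \<open>\<tau> ^ m\<close> in the angular velocity:
    \<open>\<rho>s\<close> starts at order \<open>m - 1\<close> with coefficient
    \<open>\<rho>c 1\<close> and enters through \<open>\<Omega> 1\<close>, which gains one
    power.\<close>
  define E where "E = \<eta> * \<rho>c 1 + \<Omega> m 0 \<psi>0"
  define M where "M = \<bar>\<eta>\<bar> * A + C * B + C * D + real N * C"
  have M: "M \<ge> 0" using A B C D by (simp add: M_def)
  have BDt: "\<forall>\<^sub>F t in at_top. B * \<tau> t \<le> 1" "\<forall>\<^sub>F t in at_top. D * \<tau> t \<le> 1"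
  proof -
    have "\<forall>\<^sub>F t in at_top. Z * \<tau> t \<le> 1" if "Z \<ge> 0" for Z
    proof -
      have "\<forall>\<^sub>F t in at_top. \<tau> t < 1 / (Z + 1)" by (rule eventually_tau_less[OF q1]) (use that in simp)
      then show ?thesis using eventually_gt_at_top[of 0]
      proof eventually_elim
        case (elim t)
        have "Z * \<tau> t \<le> Z * (1 / (Z + 1))" using elim that by (intro mult_left_mono) auto
        also have "\<dots> \<le> 1" using that by (simp add: field_simps)
        finally show ?case .
      qed
    qed
    then show "\<forall>\<^sub>F t in at_top. B * \<tau> t \<le> 1" "\<forall>\<^sub>F t in at_top. D * \<tau> t \<le> 1" using B D by blast+
  qed
  have main: "\<forall>\<^sub>F t in at_top. \<bar>d\<phi> (\<rho>s t) (\<phi>s t) t - E * \<tau> t ^ m\<bar> \<le> M * \<tau> t ^ (m + 1)"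
    using A(2) B(2) D(2) BDt eventually_ge_at_top[of 1]
  proof eventually_elim
    case (elim t)
    have \<tau>: "0 < \<tau> t" "\<tau> t \<le> 1" using tau_pos[of t q] tau_le_1[of t q] elim by auto
    have pw: "\<tau> t ^ j \<le> \<tau> t ^ i" if "i \<le> j" for i j by (rule tau_power_mono[OF _ that]) (use elim in simp)
    have "B * \<tau> t ^ (m - 1) \<le> B * \<tau> t ^ 1" using m2 B by (intro mult_left_mono pw) auto
    then have r: "\<bar>\<rho>s t\<bar> \<le> B * \<tau> t" "\<bar>\<rho>s t\<bar> \<le> 2" "\<bar>\<phi>s t - \<psi>0\<bar> \<le> 2" using elim by auto
    have tm: "t powr (- (real (m - 1) / (2 * real q))) = \<tau> t ^ (m - 1)" using tau_power[of t q "m - 1"] elim by simp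
    have mm: "\<tau> t * \<tau> t ^ (m - 1) = \<tau> t ^ m" "\<tau> t * \<tau> t ^ m = \<tau> t ^ (m + 1)" using m2 by (simp_all flip: power_Suc)
    have "\<tau> t * \<eta> * \<rho>s t - \<eta> * \<rho>c 1 * \<tau> t ^ m = \<tau> t * \<eta> * (\<rho>s t - t powr (- (real (m - 1) / (2 * real q))) * \<rho>c 1)"
      unfolding tm by (simp add: mm(1)[symmetric] algebra_simps)
    also have "\<bar>\<dots>\<bar> \<le> \<tau> t * \<bar>\<eta>\<bar> * (A * \<tau> t ^ m)"
      unfolding abs_mult using elim(1) \<tau> by (intro mult_mono) auto
    finally have 1: "\<bar>\<tau> t * \<eta> * \<rho>s t - \<eta> * \<rho>c 1 * \<tau> t ^ m\<bar> \<le> \<bar>\<eta>\<bar> * A * \<tau> t ^ (m + 1)"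
      by (simp add: mm(2)[symmetric] algebra_simps)
    have mN: "m \<in> {1..N}" using m2 ml N3 by auto
    have "\<bar>\<Omega> m (\<rho>s t) (\<phi>s t) - \<Omega> m 0 (\<phi>s t)\<bar> \<le> C * \<bar>\<rho>s t\<bar>" "\<bar>\<Omega> m 0 (\<phi>s t) - \<Omega> m 0 \<psi>0\<bar> \<le> C * \<bar>\<phi>s t - \<psi>0\<bar>"
      using C2_boundedD(2)[OF C\<Omega>[OF mN], of "\<rho>s t" 0 "\<phi>s t" "\<phi>s t"] C2_boundedD(3)[OF C\<Omega>[OF mN], of 0 0 "\<phi>s t" \<psi>0] r by auto
    moreover have "C * \<bar>\<rho>s t\<bar> \<le> C * (B * \<tau> t)" "C * \<bar>\<phi>s t - \<psi>0\<bar> \<le> C * (D * \<tau> t)"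
      using r elim C by (auto intro: mult_left_mono)
    ultimately have "\<bar>\<Omega> m (\<rho>s t) (\<phi>s t) - \<Omega> m 0 \<psi>0\<bar> \<le> (C * B + C * D) * \<tau> t"
      unfolding distrib_right by (simp add: mult.assoc)
    then have h0: "\<tau> t ^ m * \<bar>\<Omega> m (\<rho>s t) (\<phi>s t) - \<Omega> m 0 \<psi>0\<bar> \<le> \<tau> t ^ m * ((C * B + C * D) * \<tau> t)"
      using \<tau> by (intro mult_left_mono) auto
    have 2: "\<bar>\<tau> t ^ m * \<Omega> m (\<rho>s t) (\<phi>s t) - \<Omega> m 0 \<psi>0 * \<tau> t ^ m\<bar> \<le> (C * B + C * D) * \<tau> t ^ (m + 1)"
    proof -
      have e: "\<tau> t ^ m * \<Omega> m (\<rho>s t) (\<phi>s t) - \<Omega> m 0 \<psi>0 * \<tau> t ^ m = \<tau> t ^ m * (\<Omega> m (\<rho>s t) (\<phi>s t) - \<Omega> m 0 \<psi>0)"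
        by (simp add: algebra_simps)
      show ?thesis unfolding e abs_mult using h0 \<tau> by (simp add: mm(2)[symmetric] mult_ac)
    qed
    have "\<bar>\<Sum>k=m + 1..N. \<tau> t ^ k * \<Omega> k (\<rho>s t) (\<phi>s t)\<bar> \<le> (\<Sum>k=m + 1..N. \<tau> t ^ (m + 1) * C)"
    proof (rule order_trans[OF sum_abs], rule sum_mono)
      fix k assume k: "k \<in> {m + 1..N}"
      then have "\<bar>\<Omega> k (\<rho>s t) (\<phi>s t)\<bar> \<le> C" using C2_boundedD(1)[OF C\<Omega>[of k], of "\<rho>s t" 0 "\<phi>s t" \<psi>0] r by auto
      then show "\<bar>\<tau> t ^ k * \<Omega> k (\<rho>s t) (\<phi>s t)\<bar> \<le> \<tau> t ^ (m + 1) * C"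
        unfolding abs_mult using pw[of "m + 1" k] k \<tau> by (intro mult_mono) auto
    qed
    also have "\<dots> = real (card {m + 1..N}) * (\<tau> t ^ (m + 1) * C)" by simp
    also have "\<dots> \<le> real N * (\<tau> t ^ (m + 1) * C)" using \<tau> C by (intro mult_right_mono) auto
    finally have 3: "\<bar>\<Sum>k=m + 1..N. \<tau> t ^ k * \<Omega> k (\<rho>s t) (\<phi>s t)\<bar> \<le> real N * C * \<tau> t ^ (m + 1)" by (simp add: algebra_simps)
    have "{m..N} = insert m {m + 1..N}" using mN by auto
    then have "(\<Sum>k=m..N. \<tau> t ^ k * \<Omega> k (\<rho>s t) (\<phi>s t)) = \<tau> t ^ m * \<Omega> m (\<rho>s t) (\<phi>s t) + (\<Sum>k=m + 1..N. \<tau> t ^ k * \<Omega> k (\<rho>s t) (\<phi>s t))"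
      by simp
    then have "d\<phi> (\<rho>s t) (\<phi>s t) t - E * \<tau> t ^ m
       = (\<tau> t * \<eta> * \<rho>s t - \<eta> * \<rho>c 1 * \<tau> t ^ m) + (\<tau> t ^ m * \<Omega> m (\<rho>s t) (\<phi>s t) - \<Omega> m 0 \<psi>0 * \<tau> t ^ m)
         + (\<Sum>k=m + 1..N. \<tau> t ^ k * \<Omega> k (\<rho>s t) (\<phi>s t))"
      using elim by (simp add: rhs_\<Omega> E_def distrib_right)
    then show ?case using 1 2 3 unfolding M_def distrib_right by linarith
  qed
  have "E = 0"
  proof (rule ccontr)
    assume "E \<noteq> 0"
    then have E: "\<bar>E\<bar> > 0" by simp
    have "\<forall>\<^sub>F t in at_top. \<tau> t < \<bar>E\<bar> / (2 * (M + 1))" by (rule eventually_tau_less[OF q1]) (use E M in simp)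
    then have big: "\<forall>\<^sub>F t in at_top. \<bar>d\<phi> (\<rho>s t) (\<phi>s t) t\<bar> \<ge> \<bar>E\<bar> / (2 * t)"
      using main eventually_ge_at_top[of 1]
    proof eventually_elim
      case (elim t)
      have \<tau>: "0 < \<tau> t" using tau_pos[of t q] elim by auto
      have "\<tau> t * (2 * (M + 1)) < \<bar>E\<bar>" using elim(1) M by (simp add: pos_less_divide_eq)
      then have "M * \<tau> t \<le> \<bar>E\<bar> / 2" using \<tau> by (simp add: algebra_simps)
      then have "M * \<tau> t * \<tau> t ^ m \<le> \<bar>E\<bar> / 2 * \<tau> t ^ m" using \<tau> by (intro mult_right_mono) auto
      moreover have "\<bar>E * \<tau> t ^ m\<bar> = \<bar>E\<bar> * \<tau> t ^ m" using \<tau> by (simp add: abs_mult)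
      ultimately have "\<bar>d\<phi> (\<rho>s t) (\<phi>s t) t\<bar> \<ge> \<bar>E\<bar> / 2 * \<tau> t ^ m"
        using elim(2) by (simp add: algebra_simps)
      moreover have "\<tau> t ^ (2 * q) \<le> \<tau> t ^ m" by (rule tau_power_mono) (use elim ml lq in auto)
      then have "\<bar>E\<bar> / 2 * (1 / t) \<le> \<bar>E\<bar> / 2 * \<tau> t ^ m" using tau_power_2q[OF q1, of t] elim by (intro mult_left_mono) auto
      ultimately show ?case by simp
    qed
    have "((\<lambda>t. \<phi>s t - \<psi>0) \<longlongrightarrow> 0) at_top"
    proof (rule Lim_null_comparison)
      show "\<forall>\<^sub>F t in at_top. norm (\<phi>s t - \<psi>0) \<le> D * \<tau> t" using D(2) by simp
      show "((\<lambda>t. D * \<tau> t) \<longlongrightarrow> 0) at_top" using tendsto_mult_right_zero[OF tau_tendsto[OF q1]] by simp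
    qed
    then have "\<forall>\<^sub>F t in at_top. dist (\<phi>s t - \<psi>0) 0 < \<bar>E\<bar> / 8" by (rule tendstoD) (use E in simp)
    then have "\<forall>\<^sub>F t in at_top. t > 1 \<and> \<bar>\<phi>s t - \<psi>0\<bar> < \<bar>E\<bar> / 8 \<and> \<bar>d\<phi> (\<rho>s t) (\<phi>s t) t\<bar> \<ge> \<bar>E\<bar> / (2 * t)
       \<and> (\<phi>s has_real_derivative d\<phi> (\<rho>s t) (\<phi>s t) t) (at t)"
      using big particular_DERIV eventually_gt_at_top[of 1] by eventually_elim auto
    then obtain T where T: "\<And>t. t \<ge> T \<Longrightarrow> t > 1 \<and> \<bar>\<phi>s t - \<psi>0\<bar> < \<bar>E\<bar> / 8 \<and> \<bar>d\<phi> (\<rho>s t) (\<phi>s t) t\<bar> \<ge> \<bar>E\<bar> / (2 * t)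
       \<and> (\<phi>s has_real_derivative d\<phi> (\<rho>s t) (\<phi>s t) t) (at t)"
      unfolding eventually_at_top_linorder by blast
    have T1: "T > 1" using T[of T] by simp
    \<comment> \<open>By the mean value theorem the increment of \<open>\<phi>s\<close> over
      \<open>{T..2 * T}\<close> is at least \<open>\<bar>E\<bar> / 4\<close>, while both end values
      are closer than \<open>\<bar>E\<bar> / 8\<close> to \<open>\<psi>0\<close>.\<close>
    obtain z where z: "T < z" "z < 2 * T" "\<phi>s (2 * T) - \<phi>s T = (2 * T - T) * d\<phi> (\<rho>s z) (\<phi>s z) z"
      using MVT2[of T "2 * T" \<phi>s "\<lambda>z. d\<phi> (\<rho>s z) (\<phi>s z) z"] T T1 by auto
    have "\<bar>E\<bar> / (2 * (2 * T)) \<le> \<bar>E\<bar> / (2 * z)" using z T1 E by (intro divide_left_mono) auto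
    then have "\<bar>E\<bar> / (2 * (2 * T)) \<le> \<bar>d\<phi> (\<rho>s z) (\<phi>s z) z\<bar>" using T[of z] z by linarith
    then have "T * (\<bar>E\<bar> / (2 * (2 * T))) \<le> \<bar>\<phi>s (2 * T) - \<phi>s T\<bar>"
      unfolding z(3) abs_mult using T1 by (intro mult_mono) auto
    moreover have "T * (\<bar>E\<bar> / (2 * (2 * T))) = \<bar>E\<bar> / 4" using T1 by simp
    ultimately show False using T[of T] T[of "2 * T"] T1 by linarith
  qed
  then show ?thesis using main M by (intro exI[of _ M]) simp
qed


section \<open>Potential energy, and the truncated field near the particular solution\<close>

abbreviation "n \<equiv> 2 * l + 1"

text \<open>Any antiderivatives in the angle will do, since only differences of their values enter
  below.\<close>

definition Pot :: "nat \<Rightarrow> real \<Rightarrow> real" where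
  "Pot = (SOME P. \<forall>k\<ge>1. \<forall>y. (P k has_real_derivative \<Lambda> k 0 y) (at y))"

text \<open>The restoring force at radius zero, relative to the particular solution and divided by
  \<open>\<tau> ^ n\<close>, with all orders up to \<open>N\<close> retained.\<close>

definition Asum :: "real \<Rightarrow> real \<Rightarrow> real" where
  "Asum t \<psi> = (\<Sum>k=n..N. \<tau> t ^ (k - n) * (\<Lambda> k 0 \<psi> - \<Lambda> k 0 (\<phi>s t)))"

text \<open>Its derivative in \<open>\<psi>\<close> is \<open>Asum\<close>, and it vanishes to
  second order at \<open>\<psi> = \<phi>s t\<close>: an exact potential of the restoring force, not
  only its quadratic part.\<close>

definition Qsum :: "real \<Rightarrow> real \<Rightarrow> real" where
  "Qsum t \<psi> = (\<Sum>k=n..N. \<tau> t ^ (k - n) * (Pot k \<psi> - Pot k (\<phi>s t) - (\<psi> - \<phi>s t) * \<Lambda> k 0 (\<phi>s t)))"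

text \<open>The part of the time derivative of \<open>Qsum\<close> that is not \<open>Asum\<close>
  times the relative angular velocity. The first summand stems from the powers of
  \<open>\<tau>\<close>, the second from the motion of the centre \<open>\<phi>s\<close> with
  velocity \<open>\<phi>'\<close>; both are quadratic in the deviation.\<close>

definition Esum :: "real \<Rightarrow> real \<Rightarrow> real \<Rightarrow> real" where
  "Esum t \<psi> \<phi>' = (\<Sum>k=n..N.
     - (real (k - n) / (2 * real q)) * \<tau> t ^ (2 * q) * \<tau> t ^ (k - n) * (Pot k \<psi> - Pot k (\<phi>s t) - (\<psi> - \<phi>s t) * \<Lambda> k 0 (\<phi>s t))
     + \<tau> t ^ (k - n) * (\<phi>' * (\<Lambda> k 0 \<psi> - \<Lambda> k 0 (\<phi>s t) - deriv (\<Lambda> k 0) (\<phi>s t) * (\<psi> - \<phi>s t))))"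

lemma DERIV_\<Lambda>0:
  assumes "k \<ge> 1"
  shows "(\<Lambda> k 0 has_real_derivative deriv (\<Lambda> k 0) y) (at y)"
  using DERIV_line[OF open_UNIV smooth_\<Lambda>[OF assms], of "(0, 0)" y "(0, 1)"] DERIV_imp_deriv by force

lemma DERIV_Pot:
  assumes "k \<ge> 1"
  shows "(Pot k has_real_derivative \<Lambda> k 0 y) (at y)"
proof -
  have "\<exists>P. \<forall>y. (P has_real_derivative \<Lambda> k 0 y) (at y)" if "k \<ge> 1" for k
  proof -
    have "isCont (\<Lambda> k 0) y" for y using DERIV_isCont[OF DERIV_\<Lambda>0[OF that]] .
    then obtain P where "\<forall>y. - \<infinity> < ereal y \<longrightarrow> ereal y < \<infinity> \<longrightarrow> (P has_vector_derivative \<Lambda> k 0 y) (at y)"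
      using einterval_antiderivative[of "- \<infinity>" "\<infinity>" "\<Lambda> k 0"] by auto
    then show ?thesis by (auto simp: has_real_derivative_iff_has_vector_derivative)
  qed
  then have "\<exists>P. \<forall>k\<ge>1. \<forall>y. (P k has_real_derivative \<Lambda> k 0 y) (at y)" by metis
  then have "\<forall>k\<ge>1. \<forall>y. (Pot k has_real_derivative \<Lambda> k 0 y) (at y)" unfolding Pot_def by (rule someI_ex)
  then show ?thesis using assms by blast
qed

lemma quadratic_remainder:
  fixes F :: "real \<Rightarrow> real"
  assumes d: "\<And>s. (F has_real_derivative F' s) (at s)" and "F 0 = 0"
    and b: "\<And>s. \<bar>s\<bar> \<le> \<bar>y\<bar> \<Longrightarrow> \<bar>F' s\<bar> \<le> B * \<bar>y\<bar>"
  shows "\<bar>F y\<bar> \<le> B * y\<^sup>2"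
proof -
  have "norm (F y - F 0) \<le> (B * \<bar>y\<bar>) * norm (y - 0)"
  proof (rule field_differentiable_bound[of "{-\<bar>y\<bar>..\<bar>y\<bar>}"])
    fix z assume "z \<in> {-\<bar>y\<bar>..\<bar>y\<bar>}"
    then have "\<bar>z\<bar> \<le> \<bar>y\<bar>" by auto
    then show "norm (F' z) \<le> B * \<bar>y\<bar>" using b by simp
    show "(F has_field_derivative F' z) (at z within {-\<bar>y\<bar>..\<bar>y\<bar>})" by (rule has_field_derivative_at_within[OF d])
  qed auto
  then show ?thesis using assms(2) by (simp add: power2_eq_square mult.assoc)
qed

lemma DERIV_Qsum:
  assumes t: "t > 0" and \<psi>: "(\<psi> has_real_derivative \<psi>') (at t within J)" and \<phi>: "(\<phi>s has_real_derivative \<phi>') (at t within J)"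
  shows "((\<lambda>t. Qsum t (\<psi> t)) has_real_derivative Asum t (\<psi> t) * (\<psi>' - \<phi>') + Esum t (\<psi> t) \<phi>') (at t within J)"
proof -
  note p = DERIV_tau_power[OF q1 t, where A = J]
  have dq: "((\<lambda>t. \<tau> t ^ (k - n) * (Pot k (\<psi> t) - Pot k (\<phi>s t) - (\<psi> t - \<phi>s t) * \<Lambda> k 0 (\<phi>s t))) has_real_derivative
     (- (real (k - n) / (2 * real q)) * \<tau> t ^ (2 * q) * \<tau> t ^ (k - n)) * (Pot k (\<psi> t) - Pot k (\<phi>s t) - (\<psi> t - \<phi>s t) * \<Lambda> k 0 (\<phi>s t))
     + (\<Lambda> k 0 (\<psi> t) * \<psi>' - \<Lambda> k 0 (\<phi>s t) * \<phi>' - ((\<psi>' - \<phi>') * \<Lambda> k 0 (\<phi>s t) + (deriv (\<Lambda> k 0) (\<phi>s t) * \<phi>') * (\<psi> t - \<phi>s t))) * \<tau> t ^ (k - n))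
     (at t within J)" if k: "k \<ge> 1" for k
    by (intro DERIV_mult p DERIV_diff DERIV_chain2[OF DERIV_Pot[OF k]] DERIV_chain2[OF DERIV_\<Lambda>0[OF k]] \<psi> \<phi>)
  have "((\<lambda>t. Qsum t (\<psi> t)) has_real_derivative (\<Sum>k=n..N.
     (- (real (k - n) / (2 * real q)) * \<tau> t ^ (2 * q) * \<tau> t ^ (k - n)) * (Pot k (\<psi> t) - Pot k (\<phi>s t) - (\<psi> t - \<phi>s t) * \<Lambda> k 0 (\<phi>s t))
     + (\<Lambda> k 0 (\<psi> t) * \<psi>' - \<Lambda> k 0 (\<phi>s t) * \<phi>' - ((\<psi>' - \<phi>') * \<Lambda> k 0 (\<phi>s t) + (deriv (\<Lambda> k 0) (\<phi>s t) * \<phi>') * (\<psi> t - \<phi>s t))) * \<tau> t ^ (k - n)))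
     (at t within J)"
    unfolding Qsum_def by (intro DERIV_sum dq) auto
  moreover have "(\<Sum>k=n..N.
     (- (real (k - n) / (2 * real q)) * \<tau> t ^ (2 * q) * \<tau> t ^ (k - n)) * (Pot k (\<psi> t) - Pot k (\<phi>s t) - (\<psi> t - \<phi>s t) * \<Lambda> k 0 (\<phi>s t))
     + (\<Lambda> k 0 (\<psi> t) * \<psi>' - \<Lambda> k 0 (\<phi>s t) * \<phi>' - ((\<psi>' - \<phi>') * \<Lambda> k 0 (\<phi>s t) + (deriv (\<Lambda> k 0) (\<phi>s t) * \<phi>') * (\<psi> t - \<phi>s t))) * \<tau> t ^ (k - n))
     = Asum t (\<psi> t) * (\<psi>' - \<phi>') + Esum t (\<psi> t) \<phi>'"
    unfolding Asum_def Esum_def sum_distrib_right sum.distrib[symmetric]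
    by (rule sum.cong[OF refl]) (simp add: algebra_simps)
  ultimately show ?thesis by simp
qed

text \<open>The leading term keeps its own sharper bound \<open>A\<close>; all others gain a factor
  \<open>x\<close> and may be bounded crudely.\<close>

lemma sum_first_bound:
  fixes h :: "nat \<Rightarrow> real"
  assumes ij: "i \<le> N" and \<tau>: "0 < x" "x \<le> 1" and first: "\<bar>h i\<bar> \<le> A" and rest: "\<And>k. k \<in> {i + 1..N} \<Longrightarrow> \<bar>h k\<bar> \<le> B" and AB: "0 \<le> B"
  shows "\<bar>\<Sum>k=i..N. x ^ (k - i) * h k\<bar> \<le> A + real N * (x * B)"
proof -
  have split: "{i..N} = insert i {i + 1..N}" using ij by auto
  have "\<bar>\<Sum>k=i + 1..N. x ^ (k - i) * h k\<bar> \<le> (\<Sum>k=i + 1..N. x * B)"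
  proof (rule order_trans[OF sum_abs], rule sum_mono)
    fix k assume k: "k \<in> {i + 1..N}"
    have "x ^ (k - i) \<le> x ^ 1" using k \<tau> by (intro power_decreasing) auto
    then show "\<bar>x ^ (k - i) * h k\<bar> \<le> x * B"
      unfolding abs_mult using rest[of k] k \<tau> by (intro mult_mono) auto
  qed
  also have "\<dots> = real (card {i + 1..N}) * (x * B)" by simp
  also have "\<dots> \<le> real N * (x * B)" using \<tau> AB by (intro mult_right_mono) auto
  finally show ?thesis using first unfolding split by simp
qed

lemma eventually_mult_tau_le: "Z \<ge> 0 \<Longrightarrow> e > 0 \<Longrightarrow> \<forall>\<^sub>F t in at_top. Z * \<tau> t \<le> e"
proof -
  assume Z: "Z \<ge> 0" "e > 0"
  have "\<forall>\<^sub>F t in at_top. \<tau> t < e / (Z + 1)" by (rule eventually_tau_less[OF q1]) (use Z in simp)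
  then show ?thesis using eventually_gt_at_top[of 0]
  proof eventually_elim
    case (elim t)
    have "\<tau> t * (Z + 1) < e" using elim Z by (simp add: pos_less_divide_eq)
    then show ?case using tau_pos[OF elim(2), of q] by (simp add: algebra_simps)
  qed
qed

abbreviation "particular_bounds D t \<equiv>
     1 \<le> t \<and> \<bar>\<rho>s t\<bar> \<le> D * \<tau> t ^ (m - 1) \<and> \<bar>\<rho>s t\<bar> \<le> D * \<tau> t \<and> \<bar>\<phi>s t - \<psi>0\<bar> \<le> D * \<tau> t \<and> D * \<tau> t \<le> 1 / 4 \<and>
     \<bar>d\<phi> (\<rho>s t) (\<phi>s t) t\<bar> \<le> D * \<tau> t ^ (m + 1) \<and>
     (\<rho>s has_real_derivative d\<rho> (\<rho>s t) (\<phi>s t) t) (at t) \<and>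
     (\<phi>s has_real_derivative d\<phi> (\<rho>s t) (\<phi>s t) t) (at t)"

lemma particular_near:
  "\<exists>D\<ge>0. \<forall>\<^sub>F t in at_top. particular_bounds D t"
proof -
  obtain A where A: "A \<ge> 0" "\<forall>\<^sub>F t in at_top. \<bar>\<rho>s t\<bar> \<le> A * \<tau> t ^ (m - 1)" using \<rho>s_bound by blast
  obtain B where B: "B \<ge> 0" "\<forall>\<^sub>F t in at_top. \<bar>\<phi>s t - \<psi>0\<bar> \<le> B * \<tau> t" using \<phi>s_bound by blast
  obtain C where C: "C \<ge> 0" "\<forall>\<^sub>F t in at_top. \<bar>d\<phi> (\<rho>s t) (\<phi>s t) t\<bar> \<le> C * \<tau> t ^ (m + 1)" using \<phi>s_DERIV_bound by blast
  define D where "D = A + B + C"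
  have D: "D \<ge> 0" "A \<le> D" "B \<le> D" "C \<le> D" using A B C by (auto simp: D_def)
  have "\<forall>\<^sub>F t in at_top. D * \<tau> t \<le> 1 / 4" by (rule eventually_mult_tau_le[OF D(1)]) simp
  then have "\<forall>\<^sub>F t in at_top. particular_bounds D t"
    using A(2) B(2) C(2) particular_DERIV eventually_ge_at_top[of 1]
  proof eventually_elim
    case (elim t)
    have \<tau>: "0 < \<tau> t" using tau_pos[of t q] elim by auto
    have "A * \<tau> t ^ (m - 1) \<le> D * \<tau> t ^ (m - 1)" "B * \<tau> t \<le> D * \<tau> t" "C * \<tau> t ^ (m + 1) \<le> D * \<tau> t ^ (m + 1)"
      using D \<tau> by (auto intro!: mult_right_mono)
    then have r: "\<bar>\<rho>s t\<bar> \<le> D * \<tau> t ^ (m - 1)" and p: "\<bar>\<phi>s t - \<psi>0\<bar> \<le> D * \<tau> t"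
      and d: "\<bar>d\<phi> (\<rho>s t) (\<phi>s t) t\<bar> \<le> D * \<tau> t ^ (m + 1)"
      using elim(2-4) by linarith+
    have "D * \<tau> t ^ (m - 1) \<le> D * \<tau> t ^ 1" using m2 D elim by (intro mult_left_mono tau_power_mono) auto
    then have r': "\<bar>\<rho>s t\<bar> \<le> D * \<tau> t" using r by simp
    show ?case using r p d r' elim by blast
  qed
  then show ?thesis using D(1) by blast
qed

abbreviation "field_bounds C t \<equiv> \<forall>x y. \<bar>x\<bar> \<le> 1 \<and> \<bar>y\<bar> \<le> 1 \<longrightarrow>
     \<bar>d\<rho> (\<rho>s t + x) (\<phi>s t + y) t - d\<rho> (\<rho>s t) (\<phi>s t) t - \<tau> t ^ n * Asum t (\<phi>s t + y)\<bar>
       \<le> C * (\<tau> t ^ n * \<bar>x\<bar> + \<tau> t ^ (n + m - 1) * \<bar>y\<bar>) \<and>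
     \<bar>d\<phi> (\<rho>s t + x) (\<phi>s t + y) t - d\<phi> (\<rho>s t) (\<phi>s t) t - \<tau> t * \<eta> * x + w * \<tau> t ^ m * y\<bar>
       \<le> C * (\<tau> t ^ m * (\<bar>x\<bar> + (\<bar>y\<bar> + \<tau> t) * \<bar>y\<bar>)) \<and>
     \<bar>Asum t (\<phi>s t + y) - \<nu> * y\<bar> \<le> C * (\<bar>y\<bar> + \<tau> t) * \<bar>y\<bar> \<and>
     \<bar>Qsum t (\<phi>s t + y) - \<nu> / 2 * y\<^sup>2\<bar> \<le> C * (\<bar>y\<bar> + \<tau> t) * y\<^sup>2 \<and>
     \<bar>Esum t (\<phi>s t + y) (d\<phi> (\<rho>s t) (\<phi>s t) t)\<bar> \<le> C * \<tau> t ^ (m + 1) * y\<^sup>2"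

text \<open>With \<open>Asum\<close> kept exact, the radial error in \<open>y\<close> is only of
  order \<open>\<tau> ^ (n + m - 1)\<close> rather than \<open>\<tau> ^ (n + 1)\<close>: it comes
  solely from evaluating the \<open>\<Lambda> k\<close> at radius zero instead of
  \<open>\<rho>s t\<close>, and \<open>\<rho>s\<close> is \<open>O(\<tau> ^ (m - 1))\<close>. This
  is what keeps it below the damping.\<close>

lemma field_estimates:
  "\<exists>C\<ge>0. \<forall>\<^sub>F t in at_top. field_bounds C t"
proof -
  obtain D where D: "D \<ge> 0" "\<forall>\<^sub>F t in at_top. particular_bounds D t"
    using particular_near by blast
  obtain C where C: "C \<ge> 0" "\<forall>k\<in>{1..N}. C2_bounded \<psi>0 C (\<Lambda> k) \<and> C2_bounded \<psi>0 C (\<Omega> k)"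
    using uniform_C2 by blast
  define M where "M = real N * (C * (1 + D)) + (C * (1 + 2 * D) + real N * C) + real N * (N * C + D * C) "
  have CD: "0 \<le> C * D" "0 \<le> real N * C" "0 \<le> real N * (C * (1 + D))" "0 \<le> real N * (N * C + D * C)" "0 \<le> C * (1 + 2 * D)" using C D by simp_all
  have M: "0 \<le> M" "real N * (C * (1 + D)) \<le> M" "C * (1 + 2 * D) + real N * C \<le> M" "real N * (N * C + D * C) \<le> M"
    using CD by (auto simp: M_def)
  have nN: "n \<le> N" "m \<le> N" "1 \<le> n" "1 \<le> m" using N3 ml m2 by auto
  show ?thesis
  proof (intro exI[of _ M] conjI M(1))
    show "\<forall>\<^sub>F t in at_top. \<forall>x y. \<bar>x\<bar> \<le> 1 \<and> \<bar>y\<bar> \<le> 1 \<longrightarrow>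
     \<bar>d\<rho> (\<rho>s t + x) (\<phi>s t + y) t - d\<rho> (\<rho>s t) (\<phi>s t) t - \<tau> t ^ n * Asum t (\<phi>s t + y)\<bar>
       \<le> M * (\<tau> t ^ n * \<bar>x\<bar> + \<tau> t ^ (n + m - 1) * \<bar>y\<bar>) \<and>
     \<bar>d\<phi> (\<rho>s t + x) (\<phi>s t + y) t - d\<phi> (\<rho>s t) (\<phi>s t) t - \<tau> t * \<eta> * x + w * \<tau> t ^ m * y\<bar>
       \<le> M * (\<tau> t ^ m * (\<bar>x\<bar> + (\<bar>y\<bar> + \<tau> t) * \<bar>y\<bar>)) \<and>
     \<bar>Asum t (\<phi>s t + y) - \<nu> * y\<bar> \<le> M * (\<bar>y\<bar> + \<tau> t) * \<bar>y\<bar> \<and>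
     \<bar>Qsum t (\<phi>s t + y) - \<nu> / 2 * y\<^sup>2\<bar> \<le> M * (\<bar>y\<bar> + \<tau> t) * y\<^sup>2 \<and>
     \<bar>Esum t (\<phi>s t + y) (d\<phi> (\<rho>s t) (\<phi>s t) t)\<bar> \<le> M * \<tau> t ^ (m + 1) * y\<^sup>2"
      using D(2)
    proof eventually_elim
      case (elim t)
      then have t1: "1 \<le> t" and r: "\<bar>\<rho>s t\<bar> \<le> D * \<tau> t ^ (m - 1)" "\<bar>\<rho>s t\<bar> \<le> D * \<tau> t" "\<bar>\<phi>s t - \<psi>0\<bar> \<le> D * \<tau> t" "D * \<tau> t \<le> 1 / 4"
        "\<bar>d\<phi> (\<rho>s t) (\<phi>s t) t\<bar> \<le> D * \<tau> t ^ (m + 1)" by blast+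
      have \<tau>: "0 < \<tau> t" "\<tau> t \<le> 1" using tau_pos[of t q] tau_le_1[of t q] t1 by auto
      have pw: "\<tau> t ^ j \<le> \<tau> t ^ i" if "i \<le> j" for i j by (rule tau_power_mono[OF t1 that])
      have pp: "0 \<le> \<tau> t ^ i" for i using \<tau> by simp
      note power_Suc [simp del]
      have pull: "\<tau> t ^ i * (\<Sum>k=i..N. \<tau> t ^ (k - i) * z k) = (\<Sum>k=i..N. \<tau> t ^ k * z k)" for i and z :: "nat \<Rightarrow> real"
        unfolding sum_distrib_left by (rule sum.cong) (auto simp flip: power_add mult.assoc)
      show ?case
      proof (intro allI impI)
        fix x y :: real assume xy: "\<bar>x\<bar> \<le> 1 \<and> \<bar>y\<bar> \<le> 1"
        have in2: "\<bar>\<rho>s t + x\<bar> \<le> 2" "\<bar>\<rho>s t\<bar> \<le> 2" "\<bar>\<phi>s t + y - \<psi>0\<bar> \<le> 2" "\<bar>\<phi>s t - \<psi>0\<bar> \<le> 2" using r xy by linarith+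
        have C\<Lambda>: "C2_bounded \<psi>0 C (\<Lambda> k)" and C\<Omega>: "C2_bounded \<psi>0 C (\<Omega> k)" if "k \<in> {1..N}" for k using C(2) that by blast+
        define Y where "Y = \<bar>y\<bar>"
        define sY where "sY = (Y + \<tau> t) * Y"
        have Y: "0 \<le> Y" "Y \<le> 1" using xy by (auto simp: Y_def)
        have Y2: "y\<^sup>2 = Y * Y" by (simp add: Y_def power2_eq_square)
        have sY: "0 \<le> sY" "\<tau> t * Y \<le> sY" "Y * Y \<le> sY" using Y \<tau> by (auto simp: sY_def distrib_right)
        have lin: "\<bar>\<Lambda> k 0 (\<phi>s t + z) - \<Lambda> k 0 (\<phi>s t)\<bar> \<le> C * \<bar>z\<bar>" if "k \<in> {1..N}" "\<bar>z\<bar> \<le> 1" for k z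
        proof -
          have "\<bar>\<phi>s t + z - \<psi>0\<bar> \<le> 2" using r that by linarith
          from C2_boundedD(3)[OF C\<Lambda>[OF that(1)], of 0 0, OF _ _ this in2(4)] show ?thesis by simp
        qed
        have quad: "\<bar>\<Lambda> n 0 (\<phi>s t + z) - \<Lambda> n 0 (\<phi>s t) - \<nu> * z\<bar> \<le> C * (\<bar>z\<bar> + D * \<tau> t) * \<bar>z\<bar>" if "\<bar>z\<bar> \<le> 1" for z
        proof -
          have b: "\<bar>\<phi>s t + z - \<psi>0\<bar> \<le> 2" using r that by linarith
          have "n \<in> {1..N}" using nN by simp
          from C2_boundedD(5)[OF C\<Lambda>[OF this], of 0 0, OF _ _ b in2(4)]
          have "\<bar>\<Lambda> n 0 (\<phi>s t + z) - \<Lambda> n 0 (\<phi>s t) - \<nu> * z\<bar> \<le> C * (\<bar>z\<bar> + \<bar>\<phi>s t - \<psi>0\<bar>) * \<bar>z\<bar>" by simp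
          also have "\<dots> \<le> C * (\<bar>z\<bar> + D * \<tau> t) * \<bar>z\<bar>" using r C by (intro mult_right_mono mult_left_mono) auto
          finally show ?thesis .
        qed
        have csY: "C * (Y + D * \<tau> t) * Y \<le> C * (1 + 2 * D) * sY"
        proof -
          have "(Y + D * \<tau> t) * Y = Y * Y + D * (\<tau> t * Y)" by (simp add: algebra_simps)
          also have "\<dots> \<le> sY + D * sY" using sY D by (intro add_mono mult_left_mono) auto
          also have "\<dots> \<le> (1 + 2 * D) * sY" using sY D by (simp add: distrib_right)
          finally show ?thesis using C by (simp add: mult.assoc mult_left_mono)
        qed
        have A: "\<bar>Asum t (\<phi>s t + y) - \<nu> * y\<bar> \<le> M * sY"
        proof -
          define h where "h k = \<Lambda> k 0 (\<phi>s t + y) - \<Lambda> k 0 (\<phi>s t) - (if k = n then \<nu> * y else 0)" for k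
          have "(\<Sum>k=n..N. \<tau> t ^ (k - n) * (if k = n then \<nu> * y else 0)) = \<nu> * y"
            using nN by (simp add: if_distrib[of "\<lambda>x. _ * x"] cong: if_cong)
          then have "Asum t (\<phi>s t + y) - \<nu> * y = (\<Sum>k=n..N. \<tau> t ^ (k - n) * h k)"
            unfolding Asum_def h_def right_diff_distrib sum_subtractf by simp
          also have "\<bar>\<dots>\<bar> \<le> C * (Y + D * \<tau> t) * Y + real N * (\<tau> t * (C * Y))"
          proof (rule sum_first_bound[OF nN(1) \<tau>])
            show "\<bar>h n\<bar> \<le> C * (Y + D * \<tau> t) * Y" using quad[of y] xy by (simp add: h_def Y_def)
            show "0 \<le> C * Y" using C Y by simp
            fix k assume k: "k \<in> {n + 1..N}"
            then show "\<bar>h k\<bar> \<le> C * Y" using lin[of k y] xy nN by (auto simp: h_def Y_def)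
          qed
          also have "\<dots> \<le> C * (1 + 2 * D) * sY + real N * C * sY"
          proof (rule add_mono[OF csY])
            have "real N * C * (\<tau> t * Y) \<le> real N * C * sY" using sY CD by (intro mult_left_mono) auto
            then show "real N * (\<tau> t * (C * Y)) \<le> real N * C * sY" by (simp add: mult_ac)
          qed
          also have "\<dots> = (C * (1 + 2 * D) + real N * C) * sY" by (simp add: distrib_right)
          also have "\<dots> \<le> M * sY" using M sY by (intro mult_right_mono) auto
          finally show ?thesis .
        qed
        define Q where "Q k z = Pot k (\<phi>s t + z) - Pot k (\<phi>s t) - z * \<Lambda> k 0 (\<phi>s t)" for k z
        have dQ: "(Q k has_real_derivative \<Lambda> k 0 (\<phi>s t + z) - \<Lambda> k 0 (\<phi>s t)) (at z)" if k: "k \<ge> 1" for k z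
        proof -
          have "((\<lambda>z. Pot k (\<phi>s t + z)) has_real_derivative \<Lambda> k 0 (\<phi>s t + z) * 1) (at z)"
            by (rule DERIV_chain2[OF DERIV_Pot[OF k]]) (auto intro!: derivative_eq_intros)
          then show ?thesis unfolding Q_def by (auto intro!: derivative_eq_intros)
        qed
        have Qb: "\<bar>Q k y\<bar> \<le> C * y\<^sup>2" if k: "k \<in> {1..N}" for k
        proof (rule quadratic_remainder[OF dQ])
          fix z assume "\<bar>z\<bar> \<le> \<bar>y\<bar>"
          moreover have "C * \<bar>z\<bar> \<le> C * \<bar>y\<bar>" using calculation C by (intro mult_left_mono) auto
          ultimately show "\<bar>\<Lambda> k 0 (\<phi>s t + z) - \<Lambda> k 0 (\<phi>s t)\<bar> \<le> C * \<bar>y\<bar>" using lin[OF k, of z] xy by linarith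
        qed (use k in \<open>auto simp: Q_def\<close>)
        have Qn: "\<bar>Q n y - \<nu> / 2 * y\<^sup>2\<bar> \<le> C * (Y + D * \<tau> t) * y\<^sup>2"
        proof -
          have "\<bar>(\<lambda>z. Q n z - \<nu> / 2 * z\<^sup>2) y\<bar> \<le> C * (Y + D * \<tau> t) * y\<^sup>2"
          proof (rule quadratic_remainder)
            fix z
            show "((\<lambda>z. Q n z - \<nu> / 2 * z\<^sup>2) has_real_derivative \<Lambda> n 0 (\<phi>s t + z) - \<Lambda> n 0 (\<phi>s t) - \<nu> * z) (at z)"
              using dQ[OF nN(3), of z] by (auto intro!: derivative_eq_intros)
            assume z: "\<bar>z\<bar> \<le> \<bar>y\<bar>"
            have "C * (\<bar>z\<bar> + D * \<tau> t) * \<bar>z\<bar> \<le> C * (Y + D * \<tau> t) * \<bar>y\<bar>"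
              using z C D \<tau> by (intro mult_mono mult_left_mono add_mono) (auto simp: Y_def)
            then show "\<bar>\<Lambda> n 0 (\<phi>s t + z) - \<Lambda> n 0 (\<phi>s t) - \<nu> * z\<bar> \<le> C * (Y + D * \<tau> t) * \<bar>y\<bar>"
              using quad[of z] z xy by linarith
          qed (simp add: Q_def)
          then show ?thesis by simp
        qed
        have Qsum: "\<bar>Qsum t (\<phi>s t + y) - \<nu> / 2 * y\<^sup>2\<bar> \<le> M * (Y + \<tau> t) * y\<^sup>2"
        proof -
          define h where "h k = Q k y - (if k = n then \<nu> / 2 * y\<^sup>2 else 0)" for k
          have "(\<Sum>k=n..N. \<tau> t ^ (k - n) * (if k = n then \<nu> / 2 * y\<^sup>2 else 0)) = \<nu> / 2 * y\<^sup>2"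
            using nN by (simp add: if_distrib[of "\<lambda>x. _ * x"] cong: if_cong)
          then have "Qsum t (\<phi>s t + y) - \<nu> / 2 * y\<^sup>2 = (\<Sum>k=n..N. \<tau> t ^ (k - n) * h k)"
            unfolding Qsum_def h_def Q_def right_diff_distrib sum_subtractf by simp
          also have "\<bar>\<dots>\<bar> \<le> C * (Y + D * \<tau> t) * y\<^sup>2 + real N * (\<tau> t * (C * y\<^sup>2))"
          proof (rule sum_first_bound[OF nN(1) \<tau>])
            show "\<bar>h n\<bar> \<le> C * (Y + D * \<tau> t) * y\<^sup>2" using Qn by (simp add: h_def)
            show "0 \<le> C * y\<^sup>2" using C by simp
            fix k assume k: "k \<in> {n + 1..N}"
            then show "\<bar>h k\<bar> \<le> C * y\<^sup>2" using Qb[of k] nN by (auto simp: h_def)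
          qed
          also have "\<dots> = (C * Y + (C * D + real N * C) * \<tau> t) * y\<^sup>2" by (simp add: algebra_simps)
          also have "\<dots> \<le> (M * (Y + \<tau> t)) * y\<^sup>2"
          proof (rule mult_right_mono)
            have "C * (1 + 2 * D) = C + 2 * (C * D)" by (simp add: algebra_simps)
            then have "C \<le> M" "C * D + real N * C \<le> M" using M CD C by linarith+
            then show "C * Y + (C * D + real N * C) * \<tau> t \<le> M * (Y + \<tau> t)"
              unfolding distrib_left using Y \<tau> by (intro add_mono mult_right_mono) auto
          qed simp
          finally show ?thesis .
        qed
        have E: "\<bar>Esum t (\<phi>s t + y) (d\<phi> (\<rho>s t) (\<phi>s t) t)\<bar> \<le> M * \<tau> t ^ (m + 1) * y\<^sup>2"
        proof -
          let ?\<phi> = "d\<phi> (\<rho>s t) (\<phi>s t) t"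
          let ?d = "\<lambda>k. \<Lambda> k 0 (\<phi>s t + y) - \<Lambda> k 0 (\<phi>s t) - deriv (\<Lambda> k 0) (\<phi>s t) * y"
          have "\<bar>Esum t (\<phi>s t + y) ?\<phi>\<bar> = \<bar>\<Sum>k=n..N. - (real (k - n) / (2 * real q)) * \<tau> t ^ (2 * q) * \<tau> t ^ (k - n) * Q k y + \<tau> t ^ (k - n) * (?\<phi> * ?d k)\<bar>"
            unfolding Esum_def Q_def by simp
          also have "\<dots> \<le> (\<Sum>k=n..N. (real N * C + D * C) * (\<tau> t ^ (m + 1) * y\<^sup>2))"
          proof (rule order_trans[OF sum_abs], rule sum_mono)
            fix k assume k: "k \<in> {n..N}"
            then have k1: "k \<in> {1..N}" by auto
            have "real (k - n) / (2 * real q) \<le> real (k - n) / 1" using q1 by (intro divide_left_mono) auto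
            also have "\<dots> \<le> real N" using k by auto
            finally have kn: "real (k - n) / (2 * real q) \<le> real N" .
            have "\<tau> t ^ (2 * q) \<le> \<tau> t ^ (m + 1)" using ml lq by (intro pw) auto
            moreover have p1: "\<tau> t ^ (k - n) \<le> 1" using \<tau> by (intro power_le_one) auto
            ultimately have "(real (k - n) / (2 * real q) * \<tau> t ^ (2 * q)) * (\<tau> t ^ (k - n) * \<bar>Q k y\<bar>) \<le> (real N * \<tau> t ^ (m + 1)) * (1 * (C * y\<^sup>2))"
              using kn Qb[OF k1] pp by (intro mult_mono) auto
            then have 1: "\<bar>- (real (k - n) / (2 * real q)) * \<tau> t ^ (2 * q) * \<tau> t ^ (k - n) * Q k y\<bar> \<le> real N * C * (\<tau> t ^ (m + 1) * y\<^sup>2)"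
              using pp by (simp add: abs_mult mult_ac)
            have "\<bar>?d k\<bar> \<le> C * y\<^sup>2" using C2_boundedD(6)[OF C\<Lambda>[OF k1] _ _ in2(3,4), of 0 0] by simp
            then have "\<tau> t ^ (k - n) * (\<bar>?\<phi>\<bar> * \<bar>?d k\<bar>) \<le> 1 * ((D * \<tau> t ^ (m + 1)) * (C * y\<^sup>2))"
              using p1 r(5) D pp by (intro mult_mono) auto
            then have 2: "\<bar>\<tau> t ^ (k - n) * (?\<phi> * ?d k)\<bar> \<le> D * C * (\<tau> t ^ (m + 1) * y\<^sup>2)"
              using pp by (simp add: abs_mult mult_ac)
            show "\<bar>- (real (k - n) / (2 * real q)) * \<tau> t ^ (2 * q) * \<tau> t ^ (k - n) * Q k y + \<tau> t ^ (k - n) * (?\<phi> * ?d k)\<bar>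
              \<le> (real N * C + D * C) * (\<tau> t ^ (m + 1) * y\<^sup>2)"
              unfolding distrib_right using 1 2 by linarith
          qed
          also have "\<dots> = real (card {n..N}) * ((real N * C + D * C) * (\<tau> t ^ (m + 1) * y\<^sup>2))" by simp
          also have "\<dots> \<le> real N * ((real N * C + D * C) * (\<tau> t ^ (m + 1) * y\<^sup>2))"
            using CD D C pp by (intro mult_right_mono mult_nonneg_nonneg add_nonneg_nonneg) auto
          also have "\<dots> = (real N * (real N * C + D * C)) * (\<tau> t ^ (m + 1) * y\<^sup>2)" by (simp add: mult.assoc)
          also have "\<dots> \<le> M * (\<tau> t ^ (m + 1) * y\<^sup>2)" using M pp by (intro mult_right_mono mult_nonneg_nonneg) auto
          finally show ?thesis by (simp add: mult.assoc)
        qed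
        have L1: "\<bar>d\<rho> (\<rho>s t + x) (\<phi>s t + y) t - d\<rho> (\<rho>s t) (\<phi>s t) t - \<tau> t ^ n * Asum t (\<phi>s t + y)\<bar>
          \<le> M * (\<tau> t ^ n * \<bar>x\<bar> + \<tau> t ^ (n + m - 1) * Y)"
        proof -
          \<comment> \<open>Apart from the change of radius by \<open>x\<close>, this is a mixed
            difference between the radii \<open>\<rho>s t\<close> and 0, hence of the size of
            \<open>\<rho>s t\<close> times \<open>y\<close>.\<close>
          let ?d = "\<lambda>k. \<Lambda> k (\<rho>s t + x) (\<phi>s t + y) - \<Lambda> k (\<rho>s t) (\<phi>s t) - (\<Lambda> k 0 (\<phi>s t + y) - \<Lambda> k 0 (\<phi>s t))"
          have "\<tau> t ^ n * Asum t (\<phi>s t + y) = (\<Sum>k=n..N. \<tau> t ^ k * (\<Lambda> k 0 (\<phi>s t + y) - \<Lambda> k 0 (\<phi>s t)))"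
            unfolding Asum_def by (rule pull)
          then have "\<bar>d\<rho> (\<rho>s t + x) (\<phi>s t + y) t - d\<rho> (\<rho>s t) (\<phi>s t) t - \<tau> t ^ n * Asum t (\<phi>s t + y)\<bar>
            = \<bar>\<Sum>k=n..N. \<tau> t ^ k * ?d k\<bar>"
            using t1 by (simp add: rhs_\<Lambda> right_diff_distrib sum_subtractf)
          also have "\<dots> \<le> (\<Sum>k=n..N. \<tau> t ^ n * (C * \<bar>x\<bar> + C * (D * \<tau> t ^ (m - 1)) * Y))"
          proof (rule order_trans[OF sum_abs], rule sum_mono)
            fix k assume k: "k \<in> {n..N}"
            then have k1: "k \<in> {1..N}" by auto
            have "\<bar>\<Lambda> k (\<rho>s t + x) (\<phi>s t + y) - \<Lambda> k (\<rho>s t) (\<phi>s t + y)\<bar> \<le> C * \<bar>x\<bar>"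
              using C2_boundedD(2)[OF C\<Lambda>[OF k1] in2(1,2,3,4)] by simp
            moreover have "\<bar>(\<Lambda> k (\<rho>s t) (\<phi>s t + y) - \<Lambda> k (\<rho>s t) (\<phi>s t)) - (\<Lambda> k 0 (\<phi>s t + y) - \<Lambda> k 0 (\<phi>s t))\<bar> \<le> C * \<bar>\<rho>s t\<bar> * Y"
              using C2_boundedD(4)[OF C\<Lambda>[OF k1] in2(2) _ in2(3,4), of 0] by (simp add: Y_def)
            moreover have "C * \<bar>\<rho>s t\<bar> * Y \<le> C * (D * \<tau> t ^ (m - 1)) * Y"
              using r(1) C Y by (intro mult_right_mono mult_left_mono) auto
            ultimately have "\<bar>?d k\<bar> \<le> C * \<bar>x\<bar> + C * (D * \<tau> t ^ (m - 1)) * Y" by linarith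
            then show "\<bar>\<tau> t ^ k * ?d k\<bar> \<le> \<tau> t ^ n * (C * \<bar>x\<bar> + C * (D * \<tau> t ^ (m - 1)) * Y)"
              unfolding abs_mult using pw[of n k] k pp by (intro mult_mono) auto
          qed
          also have "\<dots> = real (card {n..N}) * (\<tau> t ^ n * (C * \<bar>x\<bar> + C * (D * \<tau> t ^ (m - 1)) * Y))" by simp
          also have "\<dots> \<le> real N * (\<tau> t ^ n * (C * \<bar>x\<bar> + C * (D * \<tau> t ^ (m - 1)) * Y))"
            using C D Y pp by (intro mult_right_mono mult_nonneg_nonneg add_nonneg_nonneg) auto
          also have "\<dots> = real N * (C * (\<tau> t ^ n * \<bar>x\<bar>) + (C * D) * (\<tau> t ^ (n + m - 1) * Y))"
          proof -
            have "n + m - 1 = n + (m - 1)" using nN by simp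
            then have "\<tau> t ^ (n + m - 1) = \<tau> t ^ n * \<tau> t ^ (m - 1)" by (simp only: power_add)
            then show ?thesis by (simp add: algebra_simps)
          qed
          also have "\<dots> \<le> real N * (C * (1 + D) * (\<tau> t ^ n * \<bar>x\<bar>) + C * (1 + D) * (\<tau> t ^ (n + m - 1) * Y))"
            using C D Y pp CD by (intro mult_left_mono add_mono mult_right_mono) (auto simp: distrib_left)
          also have "\<dots> = (real N * (C * (1 + D))) * (\<tau> t ^ n * \<bar>x\<bar> + \<tau> t ^ (n + m - 1) * Y)" by (simp add: algebra_simps)
          also have "\<dots> \<le> M * (\<tau> t ^ n * \<bar>x\<bar> + \<tau> t ^ (n + m - 1) * Y)"
            using M Y pp by (intro mult_right_mono) auto
          finally show ?thesis .
        qed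
        have L2: "\<bar>d\<phi> (\<rho>s t + x) (\<phi>s t + y) t - d\<phi> (\<rho>s t) (\<phi>s t) t - \<tau> t * \<eta> * x + w * \<tau> t ^ m * y\<bar>
          \<le> M * (\<tau> t ^ m * (\<bar>x\<bar> + sY))"
        proof -
          \<comment> \<open>At \<open>k = m\<close> the linear damping is taken out, so that the
            leading summand is of higher order in \<open>y\<close> apart from the effect of
            \<open>x\<close>.\<close>
          define h where "h k = \<Omega> k (\<rho>s t + x) (\<phi>s t + y) - \<Omega> k (\<rho>s t) (\<phi>s t) + (if k = m then w * y else 0)" for k
          have h: "\<bar>\<Omega> k (\<rho>s t + x) (\<phi>s t + y) - \<Omega> k (\<rho>s t) (\<phi>s t + y)\<bar> \<le> C * \<bar>x\<bar>" if "k \<in> {1..N}" for k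
            using C2_boundedD(2)[OF C\<Omega>[OF that] in2(1,2,3,4)] by simp
          have "(\<Sum>k=m..N. \<tau> t ^ (k - m) * h k) = (\<Sum>k=m..N. \<tau> t ^ (k - m) * (\<Omega> k (\<rho>s t + x) (\<phi>s t + y) - \<Omega> k (\<rho>s t) (\<phi>s t))) + w * y"
            unfolding h_def distrib_left sum.distrib using nN by (simp add: if_distrib[of "\<lambda>x. _ * x"] cong: if_cong)
          then have "\<tau> t ^ m * (\<Sum>k=m..N. \<tau> t ^ (k - m) * h k) = (\<Sum>k=m..N. \<tau> t ^ k * (\<Omega> k (\<rho>s t + x) (\<phi>s t + y) - \<Omega> k (\<rho>s t) (\<phi>s t))) + \<tau> t ^ m * (w * y)"
            unfolding pull[symmetric] by (simp only: distrib_left)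
          then have e: "d\<phi> (\<rho>s t + x) (\<phi>s t + y) t - d\<phi> (\<rho>s t) (\<phi>s t) t - \<tau> t * \<eta> * x + w * \<tau> t ^ m * y
            = \<tau> t ^ m * (\<Sum>k=m..N. \<tau> t ^ (k - m) * h k)"
            using t1 by (simp add: rhs_\<Omega> right_diff_distrib sum_subtractf distrib_left)
          have "\<bar>d\<phi> (\<rho>s t + x) (\<phi>s t + y) t - d\<phi> (\<rho>s t) (\<phi>s t) t - \<tau> t * \<eta> * x + w * \<tau> t ^ m * y\<bar>
            = \<tau> t ^ m * \<bar>\<Sum>k=m..N. \<tau> t ^ (k - m) * h k\<bar>"
            unfolding e abs_mult using pp by simp
          also have "\<dots> \<le> \<tau> t ^ m * ((C * \<bar>x\<bar> + C * (1 + 2 * D) * sY) + real N * (\<tau> t * (C * \<bar>x\<bar> + C * Y)))"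
          proof (rule mult_left_mono[OF sum_first_bound[OF nN(2) \<tau>] pp])
            have mN: "m \<in> {1..N}" using nN by simp
            have "\<bar>\<Omega> m (\<rho>s t) (\<phi>s t + y) - \<Omega> m (\<rho>s t) (\<phi>s t) + w * y\<bar> \<le> C * (Y + \<bar>\<rho>s t\<bar> + \<bar>\<phi>s t - \<psi>0\<bar>) * Y"
              using C2_boundedD(5)[OF C\<Omega>[OF mN] in2(2,2,3,4)] by (simp add: Y_def)
            also have "\<dots> \<le> C * (Y + 2 * (D * \<tau> t)) * Y" using r C Y by (intro mult_right_mono mult_left_mono) auto
            also have "\<dots> \<le> C * (1 + 2 * D) * sY"
            proof -
              have "(Y + 2 * (D * \<tau> t)) * Y = Y * Y + 2 * D * (\<tau> t * Y)" by (simp add: algebra_simps)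
              also have "\<dots> \<le> sY + 2 * D * sY" using sY D by (intro add_mono mult_left_mono) auto
              also have "\<dots> = (1 + 2 * D) * sY" by (simp add: distrib_right)
              finally show ?thesis using C by (simp add: mult.assoc mult_left_mono)
            qed
            finally show "\<bar>h m\<bar> \<le> C * \<bar>x\<bar> + C * (1 + 2 * D) * sY" using h[OF mN] by (simp add: h_def)
            show "0 \<le> C * \<bar>x\<bar> + C * Y" using C Y by simp
            fix k assume k: "k \<in> {m + 1..N}"
            then have k1: "k \<in> {1..N}" using nN by auto
            have "\<bar>\<Omega> k (\<rho>s t) (\<phi>s t + y) - \<Omega> k (\<rho>s t) (\<phi>s t)\<bar> \<le> C * Y"
              using C2_boundedD(3)[OF C\<Omega>[OF k1] in2(2,2,3,4)] by (simp add: Y_def)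
            then show "\<bar>h k\<bar> \<le> C * \<bar>x\<bar> + C * Y" using h[OF k1] k by (simp add: h_def)
          qed
          also have "\<dots> \<le> \<tau> t ^ m * (M * (\<bar>x\<bar> + sY))"
          proof (rule mult_left_mono[OF _ pp])
            have "\<tau> t * (C * \<bar>x\<bar> + C * Y) = C * (\<tau> t * \<bar>x\<bar>) + C * (\<tau> t * Y)" by (simp add: algebra_simps)
            also have "\<dots> \<le> C * \<bar>x\<bar> + C * sY"
              using \<tau> C sY by (intro add_mono mult_left_mono mult_left_le_one_le) auto
            finally have "real N * (\<tau> t * (C * \<bar>x\<bar> + C * Y)) \<le> real N * (C * \<bar>x\<bar> + C * sY)" by (intro mult_left_mono) auto
            moreover have "C * \<bar>x\<bar> \<le> C * (1 + 2 * D) * \<bar>x\<bar>" using C D by (intro mult_right_mono) (auto simp: distrib_left)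
            ultimately have "(C * \<bar>x\<bar> + C * (1 + 2 * D) * sY) + real N * (\<tau> t * (C * \<bar>x\<bar> + C * Y))
               \<le> (C * (1 + 2 * D) + real N * C) * (\<bar>x\<bar> + sY)" by (simp add: algebra_simps)
            also have "\<dots> \<le> M * (\<bar>x\<bar> + sY)" using M sY by (intro mult_right_mono) auto
            finally show "(C * \<bar>x\<bar> + C * (1 + 2 * D) * sY) + real N * (\<tau> t * (C * \<bar>x\<bar> + C * Y)) \<le> M * (\<bar>x\<bar> + sY)" .
          qed
          finally show ?thesis by (simp add: mult_ac)
        qed
        show "\<bar>d\<rho> (\<rho>s t + x) (\<phi>s t + y) t - d\<rho> (\<rho>s t) (\<phi>s t) t - \<tau> t ^ n * Asum t (\<phi>s t + y)\<bar>
       \<le> M * (\<tau> t ^ n * \<bar>x\<bar> + \<tau> t ^ (n + m - 1) * \<bar>y\<bar>) \<and>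
     \<bar>d\<phi> (\<rho>s t + x) (\<phi>s t + y) t - d\<phi> (\<rho>s t) (\<phi>s t) t - \<tau> t * \<eta> * x + w * \<tau> t ^ m * y\<bar>
       \<le> M * (\<tau> t ^ m * (\<bar>x\<bar> + (\<bar>y\<bar> + \<tau> t) * \<bar>y\<bar>)) \<and>
     \<bar>Asum t (\<phi>s t + y) - \<nu> * y\<bar> \<le> M * (\<bar>y\<bar> + \<tau> t) * \<bar>y\<bar> \<and>
     \<bar>Qsum t (\<phi>s t + y) - \<nu> / 2 * y\<^sup>2\<bar> \<le> M * (\<bar>y\<bar> + \<tau> t) * y\<^sup>2 \<and>
     \<bar>Esum t (\<phi>s t + y) (d\<phi> (\<rho>s t) (\<phi>s t) t)\<bar> \<le> M * \<tau> t ^ (m + 1) * y\<^sup>2"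
          using L1 L2 A Qsum E by (simp only: Y_def sY_def mult.assoc)
      qed
    qed
  qed
qed

end

text \<open>Nothing is known about the derivative of the remainder. It suffices that the expansion
  is carried to an order \<open>E \<ge> 1\<close>: the remainder is then itself
  \<open>O(1 / t)\<close>, and each power of \<open>t\<close> varies by that amount over a bounded
  time.\<close>

lemma slowly_varying_expansion:
  fixes b :: "real \<Rightarrow> real"
  assumes O: "(\<lambda>t. b t - (\<Sum>k\<in>I. t powr (- e k) * c k)) \<in> O[at_top](\<lambda>t. t powr (- E))"
    and E: "E \<ge> 1" and e: "\<And>k. k \<in> I \<Longrightarrow> e k \<ge> 0" and P: "P \<ge> 0" and I: "finite I"
  shows "\<exists>C\<ge>0. \<forall>\<^sub>F t1 in at_top. \<forall>t2\<in>{t1..t1 + P}. \<bar>b t2 - b t1\<bar> \<le> C / t1"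
proof -
  obtain A where A: "A > 0" "\<forall>\<^sub>F t in at_top. norm (b t - (\<Sum>k\<in>I. t powr (- e k) * c k)) \<le> A * norm (t powr (- E))"
    using landau_o.bigE[OF O] by blast
  then obtain T where T: "\<And>t. t \<ge> T \<Longrightarrow> norm (b t - (\<Sum>k\<in>I. t powr (- e k) * c k)) \<le> A * norm (t powr (- E))"
    unfolding eventually_at_top_linorder by blast
  define C where "C = (\<Sum>k\<in>I. e k * P * \<bar>c k\<bar>)"
  have C: "C \<ge> 0" unfolding C_def using e P by (intro sum_nonneg) auto
  have "\<forall>\<^sub>F t1 in at_top. \<forall>t2\<in>{t1..t1 + P}. \<bar>b t2 - b t1\<bar> \<le> (C + 2 * A) / t1"
    using eventually_ge_at_top[of "max 1 T"]
  proof eventually_elim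
    case (elim t1)
    show ?case
    proof
      fix t2 assume t2: "t2 \<in> {t1..t1 + P}"
      have t: "1 \<le> t1" "t1 \<le> t2" "t2 \<le> t1 + P" "T \<le> t1" "T \<le> t2" using elim t2 by auto
      have p: "t powr (- E) \<le> 1 / t1" if "t1 \<le> t" for t
      proof -
        have "t powr (- E) \<le> t powr (- 1)" using t that E by (intro powr_mono) auto
        also have "\<dots> = 1 / t" using t that by (simp add: powr_minus divide_inverse)
        also have "\<dots> \<le> 1 / t1" using t that by (intro divide_left_mono) auto
        finally show ?thesis .
      qed
      have r: "\<bar>b t - (\<Sum>k\<in>I. t powr (- e k) * c k)\<bar> \<le> A * (1 / t1)" if "t1 \<le> t" for t
      proof -
        have "\<bar>b t - (\<Sum>k\<in>I. t powr (- e k) * c k)\<bar> \<le> A * t powr (- E)" using T[of t] that t by simp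
        also have "\<dots> \<le> A * (1 / t1)" using p[OF that] A by (intro mult_left_mono) auto
        finally show ?thesis .
      qed
      have "\<bar>(\<Sum>k\<in>I. t2 powr (- e k) * c k) - (\<Sum>k\<in>I. t1 powr (- e k) * c k)\<bar> \<le> (\<Sum>k\<in>I. e k * P * \<bar>c k\<bar> / t1)"
        unfolding sum_subtractf[symmetric]
      proof (rule order_trans[OF sum_abs], rule sum_mono)
        fix k assume k: "k \<in> I"
        have "\<bar>t2 powr (- e k) - t1 powr (- e k)\<bar> * \<bar>c k\<bar> \<le> (e k * P / t1) * \<bar>c k\<bar>"
          by (rule mult_right_mono[OF powr_slowly_varying[OF e[OF k] t(1-3)]]) simp
        then show "\<bar>t2 powr (- e k) * c k - t1 powr (- e k) * c k\<bar> \<le> e k * P * \<bar>c k\<bar> / t1"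
          by (simp add: abs_mult flip: left_diff_distrib)
      qed
      also have "\<dots> = C * (1 / t1)" by (simp add: C_def sum_divide_distrib)
      finally have "\<bar>b t2 - b t1\<bar> \<le> C * (1 / t1) + 2 * (A * (1 / t1))" using r[of t1] r[of t2] t by linarith
      also have "\<dots> = (C + 2 * A) / t1" by (simp add: add_divide_distrib)
      finally show "\<bar>b t2 - b t1\<bar> \<le> (C + 2 * A) / t1" .
    qed
  qed
  then show ?thesis using C A(1) by (intro exI[of _ "C + 2 * A"]) auto
qed

lemma smooth_periodic_Lipschitz_on_strip:
  fixes h :: "real \<times> real \<times> real \<Rightarrow> real"
  assumes sm: "smooth_on UNIV h" and per: "\<And>x y S. h (x, y, S + P) = h (x, y, S)" "P > 0"
  shows "\<exists>B\<ge>0. \<forall>R1 R2 \<Psi>1 \<Psi>2 S. \<bar>R1\<bar> \<le> 1 \<and> \<bar>R2\<bar> \<le> 1 \<and> \<bar>\<Psi>1 - \<psi>0\<bar> \<le> 1 \<and> \<bar>\<Psi>2 - \<psi>0\<bar> \<le> 1 \<longrightarrow>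
     \<bar>h (R1, \<Psi>1, S)\<bar> \<le> B \<and> \<bar>h (R1, \<Psi>1, S) - h (R2, \<Psi>2, S)\<bar> \<le> B * (\<bar>R1 - R2\<bar> + \<bar>\<Psi>1 - \<Psi>2\<bar>)"
proof -
  obtain B0 where B0: "\<forall>z\<in>strip \<psi>0. \<bar>h z\<bar> \<le> B0" using smooth_periodic_bounded_on_strip(1)[OF assms] by blast
  obtain B1 where B1: "\<forall>z\<in>strip \<psi>0. \<bar>dir_deriv (1, 0, 0) h z\<bar> \<le> B1" using smooth_periodic_bounded_on_strip(2)[OF assms] by blast
  obtain B2 where B2: "\<forall>z\<in>strip \<psi>0. \<bar>dir_deriv (0, 1, 0) h z\<bar> \<le> B2" using smooth_periodic_bounded_on_strip(2)[OF assms] by blast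
  define B where "B = \<bar>B0\<bar> + \<bar>B1\<bar> + \<bar>B2\<bar>"
  have B: "B \<ge> 0" "B0 \<le> B" "B1 \<le> B" "B2 \<le> B" by (auto simp: B_def)
  show ?thesis
  proof (intro exI[of _ B] conjI B(1) allI impI)
    fix R1 R2 \<Psi>1 \<Psi>2 S :: real assume "\<bar>R1\<bar> \<le> 1 \<and> \<bar>R2\<bar> \<le> 1 \<and> \<bar>\<Psi>1 - \<psi>0\<bar> \<le> 1 \<and> \<bar>\<Psi>2 - \<psi>0\<bar> \<le> 1"
    then have b: "\<bar>R1\<bar> \<le> 1" "\<bar>R2\<bar> \<le> 1" "\<bar>\<Psi>1 - \<psi>0\<bar> \<le> 1" "\<bar>\<Psi>2 - \<psi>0\<bar> \<le> 1" by auto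
    have ins: "(R, \<Psi>, S) \<in> strip \<psi>0" if "\<bar>R\<bar> \<le> 1" "\<bar>\<Psi> - \<psi>0\<bar> \<le> 1" for R \<Psi> :: real using that by (simp add: strip_def)
    show "\<bar>h (R1, \<Psi>1, S)\<bar> \<le> B" using B0 ins[OF b(1,3)] B by force
    have "norm (h (R1, \<Psi>1, S) - h (R2, \<Psi>1, S)) \<le> B * norm (R1 - R2)"
    proof (rule field_differentiable_bound[of "{-1..1}"])
      fix z :: real assume "z \<in> {-1..1}"
      then have z: "\<bar>z\<bar> \<le> 1" by auto
      show "((\<lambda>R. h (R, \<Psi>1, S)) has_field_derivative dir_deriv (1, 0, 0) h (z, \<Psi>1, S)) (at z within {-1..1})"
        using has_field_derivative_at_within[OF DERIV_line[OF open_UNIV sm, of "(0, \<Psi>1, S)" z "(1, 0, 0)"]] by simp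
      show "norm (dir_deriv (1, 0, 0) h (z, \<Psi>1, S)) \<le> B" using B1 ins[OF z b(3)] B by force
    qed (use b in \<open>auto simp: abs_le_iff\<close>)
    moreover have "norm (h (R2, \<Psi>1, S) - h (R2, \<Psi>2, S)) \<le> B * norm (\<Psi>1 - \<Psi>2)"
    proof (rule field_differentiable_bound[of "{\<psi>0 - 1..\<psi>0 + 1}"])
      fix z :: real assume "z \<in> {\<psi>0 - 1..\<psi>0 + 1}"
      then have z: "\<bar>z - \<psi>0\<bar> \<le> 1" by (auto simp: abs_le_iff)
      show "((\<lambda>\<Psi>. h (R2, \<Psi>, S)) has_field_derivative dir_deriv (0, 1, 0) h (R2, z, S)) (at z within {\<psi>0 - 1..\<psi>0 + 1})"
        using has_field_derivative_at_within[OF DERIV_line[OF open_UNIV sm, of "(R2, 0, S)" z "(0, 1, 0)"]] by simp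
      show "norm (dir_deriv (0, 1, 0) h (R2, z, S)) \<le> B" using B2 ins[OF b(2) z] B by force
    qed (use b in \<open>auto simp: abs_le_iff\<close>)
    ultimately show "\<bar>h (R1, \<Psi>1, S) - h (R2, \<Psi>2, S)\<bar> \<le> B * (\<bar>R1 - R2\<bar> + \<bar>\<Psi>1 - \<Psi>2\<bar>)"
      unfolding distrib_left real_norm_def by linarith
  qed
qed

context perturbed_system
begin

lemma u_strip_bounds:
  "\<exists>B\<ge>0. \<forall>k\<in>{1..N}. \<forall>R1 R2 \<Psi>1 \<Psi>2 S. \<bar>R1\<bar> \<le> 1 \<and> \<bar>R2\<bar> \<le> 1 \<and> \<bar>\<Psi>1 - \<psi>0\<bar> \<le> 1 \<and> \<bar>\<Psi>2 - \<psi>0\<bar> \<le> 1 \<longrightarrow>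
     \<bar>u k R1 \<Psi>1 S\<bar> \<le> B \<and> \<bar>u k R1 \<Psi>1 S - u k R2 \<Psi>2 S\<bar> \<le> B * (\<bar>R1 - R2\<bar> + \<bar>\<Psi>1 - \<Psi>2\<bar>)"
proof -
  have "\<exists>B\<ge>0. \<forall>R1 R2 \<Psi>1 \<Psi>2 S. \<bar>R1\<bar> \<le> 1 \<and> \<bar>R2\<bar> \<le> 1 \<and> \<bar>\<Psi>1 - \<psi>0\<bar> \<le> 1 \<and> \<bar>\<Psi>2 - \<psi>0\<bar> \<le> 1 \<longrightarrow>
     \<bar>u k R1 \<Psi>1 S\<bar> \<le> B \<and> \<bar>u k R1 \<Psi>1 S - u k R2 \<Psi>2 S\<bar> \<le> B * (\<bar>R1 - R2\<bar> + \<bar>\<Psi>1 - \<Psi>2\<bar>)" if "k \<in> {1..N}" for k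
    using smooth_periodic_Lipschitz_on_strip[OF smooth_u[of k] _ period_pos, of \<psi>0] periodic_u[of k] that by simp
  then obtain b where b: "\<And>k. k \<in> {1..N} \<Longrightarrow> b k \<ge> 0" "\<And>k R1 R2 \<Psi>1 \<Psi>2 S. k \<in> {1..N} \<Longrightarrow>
      \<bar>R1\<bar> \<le> 1 \<and> \<bar>R2\<bar> \<le> 1 \<and> \<bar>\<Psi>1 - \<psi>0\<bar> \<le> 1 \<and> \<bar>\<Psi>2 - \<psi>0\<bar> \<le> 1 \<Longrightarrow>
     \<bar>u k R1 \<Psi>1 S\<bar> \<le> b k \<and> \<bar>u k R1 \<Psi>1 S - u k R2 \<Psi>2 S\<bar> \<le> b k * (\<bar>R1 - R2\<bar> + \<bar>\<Psi>1 - \<Psi>2\<bar>)"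
    by metis
  show ?thesis
  proof (intro exI[of _ "\<Sum>k=1..N. b k"] conjI ballI allI impI)
    show "0 \<le> (\<Sum>k=1..N. b k)" using b(1) by (intro sum_nonneg) auto
    fix k :: nat and R1 R2 \<Psi>1 \<Psi>2 S :: real assume k: "k \<in> {1..N}" and c: "\<bar>R1\<bar> \<le> 1 \<and> \<bar>R2\<bar> \<le> 1 \<and> \<bar>\<Psi>1 - \<psi>0\<bar> \<le> 1 \<and> \<bar>\<Psi>2 - \<psi>0\<bar> \<le> 1"
    have le: "b k \<le> (\<Sum>k=1..N. b k)" using k b(1) by (intro member_le_sum) auto
    show "\<bar>u k R1 \<Psi>1 S\<bar> \<le> (\<Sum>k=1..N. b k)" using b(2)[OF k c] le by (meson order_trans)
    have "b k * (\<bar>R1 - R2\<bar> + \<bar>\<Psi>1 - \<Psi>2\<bar>) \<le> (\<Sum>k=1..N. b k) * (\<bar>R1 - R2\<bar> + \<bar>\<Psi>1 - \<Psi>2\<bar>)"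
      using le by (intro mult_right_mono) auto
    then show "\<bar>u k R1 \<Psi>1 S - u k R2 \<Psi>2 S\<bar> \<le> (\<Sum>k=1..N. b k) * (\<bar>R1 - R2\<bar> + \<bar>\<Psi>1 - \<Psi>2\<bar>)"
      using b(2)[OF k c] by (meson order_trans)
  qed
qed

text \<open>Serves at the initial time, to compare the image of the initial point with the image of
  the particular solution. The radial deviation is measured in units of \<open>\<tau> ^ l\<close>,
  so closeness of the map to the identity up to \<open>O(\<tau>)\<close> is too weak there.\<close>

lemma \<rho>map_Lipschitz:
  "\<exists>B\<ge>0. \<forall>t\<ge>1. \<forall>R1 R2 \<Psi>1 \<Psi>2 S. \<bar>R1\<bar> \<le> 1 \<and> \<bar>R2\<bar> \<le> 1 \<and> \<bar>\<Psi>1 - \<psi>0\<bar> \<le> 1 \<and> \<bar>\<Psi>2 - \<psi>0\<bar> \<le> 1 \<longrightarrow>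
     \<bar>\<rho>map N R1 \<Psi>1 S t - \<rho>map N R2 \<Psi>2 S t\<bar> \<le> B * (\<bar>R1 - R2\<bar> + \<bar>\<Psi>1 - \<Psi>2\<bar>)"
proof -
  obtain B where B: "B \<ge> 0" "\<And>k R1 R2 \<Psi>1 \<Psi>2 S. k \<in> {1..N} \<Longrightarrow> \<bar>R1\<bar> \<le> 1 \<and> \<bar>R2\<bar> \<le> 1 \<and> \<bar>\<Psi>1 - \<psi>0\<bar> \<le> 1 \<and> \<bar>\<Psi>2 - \<psi>0\<bar> \<le> 1 \<Longrightarrow>
     \<bar>u k R1 \<Psi>1 S\<bar> \<le> B \<and> \<bar>u k R1 \<Psi>1 S - u k R2 \<Psi>2 S\<bar> \<le> B * (\<bar>R1 - R2\<bar> + \<bar>\<Psi>1 - \<Psi>2\<bar>)"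
    using u_strip_bounds[of N \<psi>0] by blast
  show ?thesis
  proof (intro exI[of _ "1 + real N * B"] conjI allI impI)
    show "0 \<le> 1 + real N * B" using B by simp
    fix t R1 R2 \<Psi>1 \<Psi>2 S :: real assume t: "1 \<le> t" and c: "\<bar>R1\<bar> \<le> 1 \<and> \<bar>R2\<bar> \<le> 1 \<and> \<bar>\<Psi>1 - \<psi>0\<bar> \<le> 1 \<and> \<bar>\<Psi>2 - \<psi>0\<bar> \<le> 1"
    let ?d = "\<bar>R1 - R2\<bar> + \<bar>\<Psi>1 - \<Psi>2\<bar>"
    have \<tau>: "0 < tau q t" "tau q t \<le> 1" using tau_pos[of t q] tau_le_1[OF t] t by auto
    have "\<bar>\<Sum>k=1..N. (u k R1 \<Psi>1 S - u k R2 \<Psi>2 S) * tau q t ^ k\<bar> \<le> (\<Sum>k=1..N. B * ?d)"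
    proof (rule order_trans[OF sum_abs], rule sum_mono)
      fix k assume k: "k \<in> {1..N}"
      have "\<bar>u k R1 \<Psi>1 S - u k R2 \<Psi>2 S\<bar> * tau q t ^ k \<le> (B * ?d) * 1"
        using B(2)[OF k c] B(1) \<tau> by (intro mult_mono power_le_one) auto
      then show "\<bar>(u k R1 \<Psi>1 S - u k R2 \<Psi>2 S) * tau q t ^ k\<bar> \<le> B * ?d" using \<tau> by (simp add: abs_mult)
    qed
    then have "\<bar>\<Sum>k=1..N. (u k R1 \<Psi>1 S - u k R2 \<Psi>2 S) * tau q t ^ k\<bar> \<le> real N * (B * ?d)" by simp
    moreover have "\<rho>map N R1 \<Psi>1 S t - \<rho>map N R2 \<Psi>2 S t = (R1 - R2) + (\<Sum>k=1..N. (u k R1 \<Psi>1 S - u k R2 \<Psi>2 S) * tau q t ^ k)"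
      by (simp add: \<rho>map_def left_diff_distrib sum_subtractf)
    moreover have "(1 + real N * B) * ?d = ?d + real N * (B * ?d)" by (simp add: algebra_simps)
    ultimately show "\<bar>\<rho>map N R1 \<Psi>1 S t - \<rho>map N R2 \<Psi>2 S t\<bar> \<le> (1 + real N * B) * ?d" by linarith
  qed
qed

text \<open>The derivative of the phase tends to \<open>s 0\<close>, so it eventually exceeds
  \<open>s 0 / 2\<close>, and the time \<open>2 * period / s 0\<close> suffices for a full
  period.\<close>

lemma phase_increases:
  "\<exists>P>0. \<forall>\<^sub>F t in at_top. phase q s t + period \<le> phase q s (t + P)"
proof -
  have "((\<lambda>t. \<Sum>k\<le>2 * q. \<sigma> k * tau q t ^ k) \<longlongrightarrow> (\<Sum>k\<le>2 * q. \<sigma> k * 0 ^ k)) at_top"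
    by (intro tendsto_intros tau_tendsto q1)
  moreover have "(\<Sum>k\<le>2 * q. \<sigma> k * 0 ^ k) = s 0"
    using phase_deriv_coeff_0[OF q1, of s] by (simp add: power_0_left if_distrib[of "\<lambda>x. _ * x"] cong: if_cong)
  ultimately have "((\<lambda>t. \<Sum>k\<le>2 * q. \<sigma> k * tau q t ^ k) \<longlongrightarrow> s 0) at_top" by simp
  then have "\<forall>\<^sub>F t in at_top. s 0 / 2 < (\<Sum>k\<le>2 * q. \<sigma> k * tau q t ^ k)" by (rule order_tendstoD(1)) (use s0 in simp)
  then obtain T where T: "\<And>t. t \<ge> T \<Longrightarrow> s 0 / 2 < (\<Sum>k\<le>2 * q. \<sigma> k * tau q t ^ k)"
    unfolding eventually_at_top_linorder by blast
  define P where "P = 2 * period / s 0"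
  have P: "P > 0" using s0 period_pos by (simp add: P_def)
  have "\<forall>\<^sub>F t in at_top. phase q s t + period \<le> phase q s (t + P)"
    using eventually_ge_at_top[of "max 1 T"]
  proof eventually_elim
    case (elim t)
    obtain z where z: "t < z" "z < t + P" "phase q s (t + P) - phase q s t = (t + P - t) * (\<Sum>k\<le>2 * q. \<sigma> k * tau q z ^ k)"
      using MVT2[of t "t + P" "phase q s" "\<lambda>z. \<Sum>k\<le>2 * q. \<sigma> k * tau q z ^ k"] DERIV_phase[OF q1] elim P by auto
    have "P * (s 0 / 2) \<le> P * (\<Sum>k\<le>2 * q. \<sigma> k * tau q z ^ k)" using T[of z] z elim P by (intro mult_left_mono) auto
    moreover have "P * (s 0 / 2) = period" using s0 by (simp add: P_def)
    ultimately show ?case using z(3) by simp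
  qed
  then show ?thesis using P by blast
qed

end

section \<open>Choice of the initial time\<close>

context resonant_system
begin

text \<open>The change of variables moves the particular solution by \<open>O(\<tau>)\<close>, which is not small in the
  norm of the Lyapunov function.  Since the correction has zero mean in \<open>S\<close>, the initial time can be
  chosen such that its radial component nearly vanishes.\<close>

lemma good_initial_times:
  "\<exists>C\<ge>0. \<forall>T. \<exists>ts\<ge>T. ts \<ge> 1 \<and> \<bar>\<rho>map N (\<rho>s ts) (\<phi>s ts) (phase q s ts) ts - \<rho>s ts\<bar> \<le> C * \<tau> ts ^ (2 * q)"
proof -
  obtain P where P: "P > 0" "\<forall>\<^sub>F t in at_top. phase q s t + period \<le> phase q s (t + P)" using phase_increases by blast
  obtain \<rho>c \<phi>c :: "nat \<Rightarrow> real" where c: "\<And>K. K \<ge> 1 \<Longrightarrow> (\<lambda>t. \<rho>s t - (\<Sum>k=1..<K. t powr (- ((real k + real m - 2) / (2 * real q))) * \<rho>c k))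
          \<in> O[at_top](\<lambda>t. t powr (- ((real K + real m - 2) / (2 * real q))))"
    "\<And>K. K \<ge> 1 \<Longrightarrow> (\<lambda>t. \<phi>s t - \<psi>0 - (\<Sum>k=1..<K. t powr (- (real k / (2 * real q))) * \<phi>c k))
          \<in> O[at_top](\<lambda>t. t powr (- (real K / (2 * real q))))"
    using particular_expansion by blast
  \<comment> \<open>The expansions are used with \<open>K = 2 * q\<close>, which takes the
    remainders to order \<open>1 / t\<close> at least; for \<open>\<rho>s\<close> this relies on
    \<open>m \<ge> 2\<close>.\<close>
  have q2: "1 \<le> 2 * q" using q1 by simp
  have "\<exists>C\<ge>0. \<forall>\<^sub>F t1 in at_top. \<forall>t2\<in>{t1..t1 + P}. \<bar>\<rho>s t2 - \<rho>s t1\<bar> \<le> C / t1"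
    by (rule slowly_varying_expansion[OF c(1)[OF q2]]) (use q1 m2 P in auto)
  then obtain A1 where A1: "A1 \<ge> 0" "\<forall>\<^sub>F t1 in at_top. \<forall>t2\<in>{t1..t1 + P}. \<bar>\<rho>s t2 - \<rho>s t1\<bar> \<le> A1 / t1" by blast
  have "\<exists>C\<ge>0. \<forall>\<^sub>F t1 in at_top. \<forall>t2\<in>{t1..t1 + P}. \<bar>(\<phi>s t2 - \<psi>0) - (\<phi>s t1 - \<psi>0)\<bar> \<le> C / t1"
    by (rule slowly_varying_expansion[OF c(2)[OF q2]]) (use q1 P in auto)
  then obtain A2 where A2: "A2 \<ge> 0" "\<forall>\<^sub>F t1 in at_top. \<forall>t2\<in>{t1..t1 + P}. \<bar>\<phi>s t2 - \<phi>s t1\<bar> \<le> A2 / t1" by auto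
  obtain D where D: "D \<ge> 0" "\<forall>\<^sub>F t in at_top. particular_bounds D t"
    using particular_near by blast
  have "\<forall>\<^sub>F t in at_top. \<bar>\<rho>s t\<bar> \<le> 1 \<and> \<bar>\<phi>s t - \<psi>0\<bar> \<le> 1"
    using D(2) by eventually_elim auto
  then obtain T1 where T1: "\<And>t. t \<ge> T1 \<Longrightarrow> \<bar>\<rho>s t\<bar> \<le> 1 \<and> \<bar>\<phi>s t - \<psi>0\<bar> \<le> 1"
    unfolding eventually_at_top_linorder by blast
  obtain B where B: "B \<ge> 0" "\<And>k R1 R2 \<Psi>1 \<Psi>2 S. k \<in> {1..N} \<Longrightarrow> \<bar>R1\<bar> \<le> 1 \<and> \<bar>R2\<bar> \<le> 1 \<and> \<bar>\<Psi>1 - \<psi>0\<bar> \<le> 1 \<and> \<bar>\<Psi>2 - \<psi>0\<bar> \<le> 1 \<Longrightarrow>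
     \<bar>u k R1 \<Psi>1 S\<bar> \<le> B \<and> \<bar>u k R1 \<Psi>1 S - u k R2 \<Psi>2 S\<bar> \<le> B * (\<bar>R1 - R2\<bar> + \<bar>\<Psi>1 - \<Psi>2\<bar>)"
    using u_strip_bounds[of N \<psi>0] by blast
  have "\<forall>\<^sub>F t in at_top. phase q s t + period \<le> phase q s (t + P) \<and> (\<forall>t2\<in>{t..t + P}. \<bar>\<rho>s t2 - \<rho>s t\<bar> \<le> A1 / t) \<and> (\<forall>t2\<in>{t..t + P}. \<bar>\<phi>s t2 - \<phi>s t\<bar> \<le> A2 / t)"
    using P(2) A1(2) A2(2) by eventually_elim auto
  then obtain T2 where T2: "\<And>t. t \<ge> T2 \<Longrightarrow> phase q s t + period \<le> phase q s (t + P) \<and> (\<forall>t2\<in>{t..t + P}. \<bar>\<rho>s t2 - \<rho>s t\<bar> \<le> A1 / t) \<and> (\<forall>t2\<in>{t..t + P}. \<bar>\<phi>s t2 - \<phi>s t\<bar> \<le> A2 / t)"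
    unfolding eventually_at_top_linorder by blast
  \<comment> \<open>The radial displacement with time and phase decoupled: \<open>t\<close> enters
    only through slowly varying quantities, while \<open>S\<close> is a free variable.\<close>
  define U where "U t S = (\<Sum>k=1..N. u k (\<rho>s t) (\<phi>s t) S * \<tau> t ^ k)" for t S
  define C where "C = real N * (B * (A1 + A2) + B * (real N * P))"
  have C: "C \<ge> 0" using A1 A2 B P by (simp add: C_def)
  have diff: "\<bar>U t2 S - U t1 S\<bar> \<le> C / t1" if t: "max (max T1 T2) 1 \<le> t1" "t1 \<le> t2" "t2 \<le> t1 + P" for t1 t2 S
  proof -
    have t1: "1 \<le> t1" "0 < t1" using t by auto
    have \<tau>2: "0 < \<tau> t2" "\<tau> t2 \<le> 1" using tau_pos[of t2 q] tau_le_1[of t2 q] t by auto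
    have r: "\<bar>\<rho>s t2 - \<rho>s t1\<bar> \<le> A1 / t1" "\<bar>\<phi>s t2 - \<phi>s t1\<bar> \<le> A2 / t1" using T2[of t1] t by auto
    have ins: "\<bar>\<rho>s t2\<bar> \<le> 1 \<and> \<bar>\<rho>s t1\<bar> \<le> 1 \<and> \<bar>\<phi>s t2 - \<psi>0\<bar> \<le> 1 \<and> \<bar>\<phi>s t1 - \<psi>0\<bar> \<le> 1" using T1[of t1] T1[of t2] t by auto
    have ins': "\<bar>\<rho>s t1\<bar> \<le> 1 \<and> \<bar>\<rho>s t1\<bar> \<le> 1 \<and> \<bar>\<phi>s t1 - \<psi>0\<bar> \<le> 1 \<and> \<bar>\<phi>s t1 - \<psi>0\<bar> \<le> 1" using ins by auto
    have "\<bar>U t2 S - U t1 S\<bar> \<le> (\<Sum>k=1..N. (B * (A1 + A2) + B * (real N * P)) / t1)"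
      unfolding U_def sum_subtractf[symmetric]
    proof (rule order_trans[OF sum_abs], rule sum_mono)
      fix k assume k: "k \<in> {1..N}"
      have "\<bar>u k (\<rho>s t2) (\<phi>s t2) S - u k (\<rho>s t1) (\<phi>s t1) S\<bar> \<le> B * (\<bar>\<rho>s t2 - \<rho>s t1\<bar> + \<bar>\<phi>s t2 - \<phi>s t1\<bar>)"
        using B(2)[OF k ins] by blast
      also have "\<dots> \<le> B * (A1 / t1 + A2 / t1)" using r B(1) by (intro mult_left_mono add_mono) auto
      finally have "\<bar>u k (\<rho>s t2) (\<phi>s t2) S - u k (\<rho>s t1) (\<phi>s t1) S\<bar> * \<tau> t2 ^ k \<le> (B * (A1 / t1 + A2 / t1)) * 1"
        using \<tau>2 A1 A2 B t1 by (intro mult_mono power_le_one) auto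
      then have 1: "\<bar>(u k (\<rho>s t2) (\<phi>s t2) S - u k (\<rho>s t1) (\<phi>s t1) S) * \<tau> t2 ^ k\<bar> \<le> B * (A1 + A2) / t1"
        using \<tau>2 by (simp add: abs_mult add_divide_distrib distrib_left)
      have "\<bar>t2 powr (- (real k / (2 * real q))) - t1 powr (- (real k / (2 * real q)))\<bar> \<le> (real k / (2 * real q)) * P / t1"
        by (rule powr_slowly_varying) (use t in auto)
      then have "\<bar>\<tau> t2 ^ k - \<tau> t1 ^ k\<bar> \<le> (real k / (2 * real q)) * P / t1" using tau_power[of _ q k] t by simp
      also have "\<dots> \<le> real N * P / t1"
      proof -
        have "real k / (2 * real q) \<le> real k / 1" using q1 by (intro divide_left_mono) auto
        also have "\<dots> \<le> real N" using k by simp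
        finally show ?thesis using P t1 by (intro divide_right_mono mult_right_mono) auto
      qed
      finally have "\<bar>u k (\<rho>s t1) (\<phi>s t1) S\<bar> * \<bar>\<tau> t2 ^ k - \<tau> t1 ^ k\<bar> \<le> B * (real N * P / t1)"
        using B(2)[OF k ins', of S] B(1) by (intro mult_mono) auto
      then have 2: "\<bar>u k (\<rho>s t1) (\<phi>s t1) S * (\<tau> t2 ^ k - \<tau> t1 ^ k)\<bar> \<le> B * (real N * P) / t1" by (simp add: abs_mult)
      have "u k (\<rho>s t2) (\<phi>s t2) S * \<tau> t2 ^ k - u k (\<rho>s t1) (\<phi>s t1) S * \<tau> t1 ^ k
        = (u k (\<rho>s t2) (\<phi>s t2) S - u k (\<rho>s t1) (\<phi>s t1) S) * \<tau> t2 ^ k + u k (\<rho>s t1) (\<phi>s t1) S * (\<tau> t2 ^ k - \<tau> t1 ^ k)"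
        by (simp add: algebra_simps)
      then show "\<bar>u k (\<rho>s t2) (\<phi>s t2) S * \<tau> t2 ^ k - u k (\<rho>s t1) (\<phi>s t1) S * \<tau> t1 ^ k\<bar> \<le> (B * (A1 + A2) + B * (real N * P)) / t1"
        unfolding add_divide_distrib using 1 2 by linarith
    qed
    then show ?thesis by (simp add: C_def)
  qed
  have cu: "continuous_on UNIV (\<lambda>S. u k R \<Psi> S)" if "k \<ge> 1" for k R \<Psi>
    using smooth_slices(3)[OF smooth_u[OF that]]
    by (intro continuous_at_imp_continuous_on ballI) (auto intro: field_differentiable_imp_continuous_at)
  show ?thesis
  proof (rule exI[of _ "C * (1 + P)"], intro conjI allI)
    show "0 \<le> C * (1 + P)" using C P by simp
    fix T
    define t1 where "t1 = max (max (max T1 T2) 1) T"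
    have t1: "max (max T1 T2) 1 \<le> t1" "T \<le> t1" "1 \<le> t1" by (auto simp: t1_def)
    have cU: "continuous_on UNIV (U t1)" unfolding U_def by (intro continuous_intros cu) auto
    have pU: "U t1 (S + period) = U t1 S" for S unfolding U_def by (simp add: periodic_u)
    have iu: "(\<lambda>S. u k (\<rho>s t1) (\<phi>s t1) S * \<tau> t1 ^ k) integrable_on {0..period}" if "k \<ge> 1" for k
      by (intro integrable_continuous_real continuous_intros continuous_on_subset[OF cu[OF that]]) simp
    have "integral {0..period} (U t1) = (\<Sum>k=1..N. integral {0..period} (\<lambda>S. u k (\<rho>s t1) (\<phi>s t1) S * \<tau> t1 ^ k))"
      unfolding U_def by (rule integral_sum) (auto intro: iu)
    also have "\<dots> = 0"
    proof (rule sum.neutral, rule ballI)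
      fix k assume "k \<in> {1..N}"
      then have "integral {0..period} (u k (\<rho>s t1) (\<phi>s t1)) = 0" using mean_u by simp
      then show "integral {0..period} (\<lambda>S. u k (\<rho>s t1) (\<phi>s t1) S * \<tau> t1 ^ k) = 0" by simp
    qed
    finally have mU: "integral {0..period} (U t1) = 0" .
    \<comment> \<open>With the slow quantities frozen at \<open>t1\<close> the displacement has zero
      mean, hence a zero within the next period of the phase. The phase attains this value at some
      \<open>ts \<le> t1 + P\<close>, and until then the slow quantities have moved by
      \<open>O(1 / t1)\<close> only.\<close>
    obtain S where S: "phase q s t1 \<le> S" "S < phase q s t1 + period" "U t1 S = 0"
      using zero_mean_has_zero[OF cU pU period_pos mU] .
    have "phase q s t1 + period \<le> phase q s (t1 + P)" using T2[of t1] t1 by auto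
    moreover have "continuous_on {t1..t1 + P} (phase q s)" using t1 by (intro continuous_on_phase) auto
    ultimately obtain ts where ts: "t1 \<le> ts" "ts \<le> t1 + P" "phase q s ts = S"
      using IVT'[of "phase q s" t1 S "t1 + P"] S P by auto
    have "\<bar>\<rho>map N (\<rho>s ts) (\<phi>s ts) (phase q s ts) ts - \<rho>s ts\<bar> = \<bar>U ts S - U t1 S\<bar>"
      using ts(3) S(3) by (simp add: \<rho>map_def U_def)
    also have "\<dots> \<le> C / t1" using diff[OF t1(1) ts(1,2)] .
    also have "\<dots> \<le> C * ((1 + P) / ts)"
    proof -
      have "P * 1 \<le> P * t1" using P t1 by (intro mult_left_mono) auto
      then have "ts \<le> (1 + P) * t1" using ts by (simp add: distrib_right)
      then have "1 / t1 \<le> (1 + P) / ts" using ts t1 by (simp add: field_simps)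
      then have "C * (1 / t1) \<le> C * ((1 + P) / ts)" using C by (rule mult_left_mono)
      then show ?thesis by simp
    qed
    also have "\<dots> = C * (1 + P) * \<tau> ts ^ (2 * q)" using tau_power_2q[OF q1, of ts] ts t1 by simp
    finally show "\<exists>ts\<ge>T. ts \<ge> 1 \<and> \<bar>\<rho>map N (\<rho>s ts) (\<phi>s ts) (phase q s ts) ts - \<rho>s ts\<bar> \<le> C * (1 + P) * \<tau> ts ^ (2 * q)"
      using ts t1 by (intro exI[of _ ts]) auto
  qed
qed

section \<open>The Lyapunov function along solutions\<close>

abbreviation "\<gamma> \<equiv> (if l + 1 \<le> m then m - (l + 1) else (l + 1) - m)"

text \<open>The factor \<open>sgn \<eta>\<close> treats both signs of \<open>\<eta>\<close>
  together: as \<open>\<nu> * \<eta> < 0\<close>, it turns the coupling coefficients into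
  \<open>\<bar>\<eta>\<bar>\<close> and \<open>- \<bar>\<nu>\<bar>\<close>, those of an oscillator
  with positive definite energy.\<close>

definition Wfun :: "real \<Rightarrow> real \<Rightarrow> real \<Rightarrow> real \<Rightarrow> real" where
  "Wfun c t \<rho> \<psi> = (let X = sgn \<eta> * ((\<rho> - \<rho>s t) / \<tau> t ^ l) in
     \<bar>\<eta>\<bar> / 2 * X\<^sup>2 - sgn \<eta> * Qsum t \<psi> - c * \<tau> t ^ \<gamma> * X * (\<psi> - \<phi>s t))"

text \<open>The derivative of \<open>Wfun\<close> along a curve whose velocity
  \<open>(\<rho>', \<psi>')\<close> is left free, so that a velocity known only up to the averaging
  error can be inserted. The second summand of \<open>X'\<close> comes from differentiating the
  factor \<open>\<tau> ^ (- l)\<close>.\<close>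

definition Wderiv :: "real \<Rightarrow> real \<Rightarrow> real \<Rightarrow> real \<Rightarrow> real \<Rightarrow> real \<Rightarrow> real" where
  "Wderiv c t \<rho> \<psi> \<rho>' \<psi>' = (let X = sgn \<eta> * ((\<rho> - \<rho>s t) / \<tau> t ^ l);
      X' = sgn \<eta> * ((\<rho>' - d\<rho> (\<rho>s t) (\<phi>s t) t) / \<tau> t ^ l) + real l / (2 * real q) * \<tau> t ^ (2 * q) * X;
      y' = \<psi>' - d\<phi> (\<rho>s t) (\<phi>s t) t in
     \<bar>\<eta>\<bar> * X * X' - sgn \<eta> * (Asum t \<psi> * y' + Esum t \<psi> (d\<phi> (\<rho>s t) (\<phi>s t) t))
      - c * \<tau> t ^ \<gamma> * (X' * (\<psi> - \<phi>s t) + X * y')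
      + c * (real \<gamma> / (2 * real q)) * \<tau> t ^ (\<gamma> + 2 * q) * X * (\<psi> - \<phi>s t))"

lemma DERIV_Wfun:
  assumes t: "t > 0"
    and \<rho>s: "(\<rho>s has_real_derivative d\<rho> (\<rho>s t) (\<phi>s t) t) (at t)"
    and \<phi>s: "(\<phi>s has_real_derivative d\<phi> (\<rho>s t) (\<phi>s t) t) (at t)"
    and \<rho>: "(\<rho> has_real_derivative \<rho>') (at t within J)" and \<psi>: "(\<psi> has_real_derivative \<psi>') (at t within J)"
  shows "((\<lambda>t. Wfun c t (\<rho> t) (\<psi> t)) has_real_derivative Wderiv c t (\<rho> t) (\<psi> t) \<rho>' \<psi>') (at t within J)"
proof -
  let ?\<rho>1 = "d\<rho> (\<rho>s t) (\<phi>s t) t" and ?\<phi>1 = "d\<phi> (\<rho>s t) (\<phi>s t) t"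
  define X where "X t = sgn \<eta> * ((\<rho> t - \<rho>s t) / \<tau> t ^ l)" for t
  define X' where "X' = sgn \<eta> * ((\<rho>' - ?\<rho>1) / \<tau> t ^ l) + real l / (2 * real q) * \<tau> t ^ (2 * q) * X t"
  have \<tau>: "\<tau> t \<noteq> 0" using tau_pos[OF t, of q] by simp
  note p = DERIV_tau_power[OF q1 t, where A = J]
  note \<rho>s' = has_field_derivative_at_within[OF \<rho>s, of J] and \<phi>s' = has_field_derivative_at_within[OF \<phi>s, of J]
  have "((\<lambda>t. (\<rho> t - \<rho>s t) / \<tau> t ^ l) has_real_derivative
     ((\<rho>' - ?\<rho>1) * \<tau> t ^ l - (\<rho> t - \<rho>s t) * (- (real l / (2 * real q)) * \<tau> t ^ (2 * q) * \<tau> t ^ l)) / (\<tau> t ^ l * \<tau> t ^ l)) (at t within J)"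
    by (intro DERIV_divide DERIV_diff \<rho> \<rho>s' p) (use \<tau> in simp)
  moreover have "((\<rho>' - ?\<rho>1) * \<tau> t ^ l - (\<rho> t - \<rho>s t) * (- (real l / (2 * real q)) * \<tau> t ^ (2 * q) * \<tau> t ^ l)) / (\<tau> t ^ l * \<tau> t ^ l)
     = (\<rho>' - ?\<rho>1) / \<tau> t ^ l + real l / (2 * real q) * \<tau> t ^ (2 * q) * ((\<rho> t - \<rho>s t) / \<tau> t ^ l)"
  proof -
    have "(a * T - x * (- k * T)) / (T * T) = a / T + k * (x / T)" if "T \<noteq> 0" for a x k T :: real
      using that by (simp add: field_simps)
    from this[of "\<tau> t ^ l" "\<rho>' - ?\<rho>1" "\<rho> t - \<rho>s t" "real l / (2 * real q) * \<tau> t ^ (2 * q)"] show ?thesis using \<tau> by simp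
  qed
  ultimately have "((\<lambda>t. (\<rho> t - \<rho>s t) / \<tau> t ^ l) has_real_derivative
     (\<rho>' - ?\<rho>1) / \<tau> t ^ l + real l / (2 * real q) * \<tau> t ^ (2 * q) * ((\<rho> t - \<rho>s t) / \<tau> t ^ l)) (at t within J)" by simp
  from DERIV_cmult[OF this, of "sgn \<eta>"] have X: "(X has_real_derivative X') (at t within J)"
    by (simp add: X_def[abs_def] X'_def distrib_left mult_ac)
  have "((\<lambda>t. \<bar>\<eta>\<bar> / 2 * (X t)\<^sup>2 - sgn \<eta> * Qsum t (\<psi> t) - c * (\<tau> t ^ \<gamma> * (X t * (\<psi> t - \<phi>s t)))) has_real_derivative
     \<bar>\<eta>\<bar> / 2 * (2 * X t * X') - sgn \<eta> * (Asum t (\<psi> t) * (\<psi>' - ?\<phi>1) + Esum t (\<psi> t) ?\<phi>1)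
     - c * ((- (real \<gamma> / (2 * real q)) * \<tau> t ^ (2 * q) * \<tau> t ^ \<gamma>) * (X t * (\<psi> t - \<phi>s t)) + (X' * (\<psi> t - \<phi>s t) + (\<psi>' - ?\<phi>1) * X t) * \<tau> t ^ \<gamma>)) (at t within J)"
  proof (intro DERIV_diff DERIV_cmult DERIV_mult p X \<psi> \<phi>s' DERIV_Qsum[OF t \<psi> \<phi>s'])
    show "((\<lambda>t. (X t)\<^sup>2) has_real_derivative 2 * X t * X') (at t within J)"
      using DERIV_power[OF X, of 2] by (simp add: mult_ac)
  qed
  moreover have "\<bar>\<eta>\<bar> / 2 * (2 * X t * X') - sgn \<eta> * (Asum t (\<psi> t) * (\<psi>' - ?\<phi>1) + Esum t (\<psi> t) ?\<phi>1)
     - c * ((- (real \<gamma> / (2 * real q)) * \<tau> t ^ (2 * q) * \<tau> t ^ \<gamma>) * (X t * (\<psi> t - \<phi>s t)) + (X' * (\<psi> t - \<phi>s t) + (\<psi>' - ?\<phi>1) * X t) * \<tau> t ^ \<gamma>)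
     = Wderiv c t (\<rho> t) (\<psi> t) \<rho>' \<psi>'"
    unfolding Wderiv_def Let_def X_def[symmetric] X'_def[symmetric] power_add by (simp add: algebra_simps)
  moreover have "(\<lambda>t. Wfun c t (\<rho> t) (\<psi> t)) = (\<lambda>t. \<bar>\<eta>\<bar> / 2 * (X t)\<^sup>2 - sgn \<eta> * Qsum t (\<psi> t) - c * (\<tau> t ^ \<gamma> * (X t * (\<psi> t - \<phi>s t))))"
    by (simp add: Wfun_def Let_def X_def mult.assoc)
  ultimately show ?thesis by simp
qed

abbreviation "lyapunov_bounds C1 c s1 \<theta> K t \<equiv> \<forall>\<rho> \<psi>.
     \<bar>(\<rho> - \<rho>s t) / \<tau> t ^ l\<bar> \<le> 1 \<and> \<bar>\<psi> - \<phi>s t\<bar> + \<tau> t \<le> s1 \<longrightarrow>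
     (((\<rho> - \<rho>s t) / \<tau> t ^ l)\<^sup>2 + (\<psi> - \<phi>s t)\<^sup>2) / K \<le> Wfun c t \<rho> \<psi> \<and>
     Wfun c t \<rho> \<psi> \<le> K * (((\<rho> - \<rho>s t) / \<tau> t ^ l)\<^sup>2 + (\<psi> - \<phi>s t)\<^sup>2) \<and>
     (\<forall>\<rho>' \<psi>'. \<bar>\<rho>' - d\<rho> \<rho> \<psi> t\<bar> \<le> C1 * \<tau> t ^ Suc N \<and> \<bar>\<psi>' - d\<phi> \<rho> \<psi> t\<bar> \<le> C1 * \<tau> t ^ Suc N \<longrightarrow>
       Wderiv c t \<rho> \<psi> \<rho>' \<psi>' \<le> - \<theta> * \<tau> t ^ (2 * l) * (((\<rho> - \<rho>s t) / \<tau> t ^ l)\<^sup>2 + (\<psi> - \<phi>s t)\<^sup>2) + K * \<tau> t ^ (Suc N - l))"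

text \<open>The constant \<open>C1\<close> stands for the averaging error: decay is obtained for
  every velocity within \<open>C1 * \<tau> ^ (N + 1)\<close> of the truncated field. Division by
  \<open>\<tau> ^ l\<close> leaves \<open>\<tau> ^ (N + 1 - l)\<close>, which takes the place of
  \<open>\<rho>\<close> in \<open>lyapunov_derivative_bound\<close>.\<close>

lemma lyapunov_function:
  assumes C1: "C1 \<ge> 0"
  shows "\<exists>c>0. \<exists>s1>0. \<exists>\<theta>>0. \<exists>K>0. \<forall>\<^sub>F t in at_top. lyapunov_bounds C1 c s1 \<theta> K t"
proof -
  obtain C where C: "C \<ge> 0" "\<forall>\<^sub>F t in at_top. field_bounds C t"
    using field_estimates by blast
  define M where "M = C + C1 + real l"
  have M: "M \<ge> 0" "C \<le> M" "C1 \<le> M" using C C1 by (auto simp: M_def)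
  have sg: "\<bar>sgn \<eta>\<bar> = 1" "sgn \<eta> * \<eta> = \<bar>\<eta>\<bar>" "sgn \<eta> * \<nu> = - \<bar>\<nu>\<bar>" "sgn \<eta> * sgn \<eta> = 1"
    using \<nu>\<eta> by (auto simp: sgn_if mult_less_0_iff)
  have pos: "\<bar>\<eta>\<bar> > 0" "\<bar>\<nu>\<bar> > 0" "w > 0" using \<eta>_nz \<nu>_nz damping by auto
  obtain c s0 \<theta> K where cs: "c > 0" "s0 > 0" "\<theta> > 0" "K > 0" and ly: "\<And>\<tau> X y A Q E1 E2 E3 \<rho>.
     0 < \<tau> \<and> \<bar>y\<bar> + \<tau> \<le> s0 \<and> \<bar>X\<bar> \<le> 1 \<and> 0 \<le> \<rho> \<and>
     \<bar>A + \<bar>\<nu>\<bar> * y\<bar> \<le> M * (\<bar>y\<bar> + \<tau>) * \<bar>y\<bar> \<and> \<bar>Q + \<bar>\<nu>\<bar> / 2 * y\<^sup>2\<bar> \<le> M * (\<bar>y\<bar> + \<tau>) * y\<^sup>2 \<and>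
     \<bar>E1\<bar> \<le> M * (\<tau> ^ (2 * l + 1) * \<bar>X\<bar> + \<tau> ^ (l + m) * \<bar>y\<bar> + \<rho>) \<and>
     \<bar>E2 + w * \<tau> ^ m * y\<bar> \<le> M * (\<tau> ^ m * (\<tau> ^ l * \<bar>X\<bar> + (\<bar>y\<bar> + \<tau>) * \<bar>y\<bar>) + \<rho>) \<and>
     \<bar>E3\<bar> \<le> M * \<tau> ^ (m + 1) * y\<^sup>2 \<Longrightarrow>
     (X\<^sup>2 + y\<^sup>2) / K \<le> \<bar>\<eta>\<bar> / 2 * X\<^sup>2 - Q - c * \<tau> ^ \<gamma> * X * y \<and>
     \<bar>\<eta>\<bar> / 2 * X\<^sup>2 - Q - c * \<tau> ^ \<gamma> * X * y \<le> K * (X\<^sup>2 + y\<^sup>2) \<and>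
     \<bar>\<eta>\<bar> * X * (\<tau> ^ (l + 1) * A + E1) - (A * (\<tau> ^ (l + 1) * \<bar>\<eta>\<bar> * X + E2) + E3)
      - c * \<tau> ^ \<gamma> * ((\<tau> ^ (l + 1) * A + E1) * y + X * (\<tau> ^ (l + 1) * \<bar>\<eta>\<bar> * X + E2))
      + c * (real \<gamma> / (2 * real q)) * \<tau> ^ (\<gamma> + 2 * q) * X * y
      \<le> - \<theta> * \<tau> ^ (2 * l) * (X\<^sup>2 + y\<^sup>2) + K * \<rho>"
    using lyapunov_derivative_bound[OF pos M(1) m2 ml lq refl] by blast
  show ?thesis
  proof (intro exI conjI)
    show "c > 0" "min s0 1 > 0" "\<theta> > 0" "K > 0" using cs by auto
    show "\<forall>\<^sub>F t in at_top. lyapunov_bounds C1 c (min s0 1) \<theta> K t"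
      using C(2) eventually_ge_at_top[of 1]
    proof eventually_elim
      case (elim t)
      have \<tau>: "0 < \<tau> t" "\<tau> t \<le> 1" using tau_pos[of t q] tau_le_1[of t q] elim by auto
      have pp: "0 \<le> \<tau> t ^ i" for i using \<tau> by simp
      have pw: "\<tau> t ^ j \<le> \<tau> t ^ i" if "i \<le> j" for i j by (rule tau_power_mono[OF elim(2) that])
      show ?case
      proof (intro allI impI)
        fix \<rho> \<psi> assume as: "\<bar>(\<rho> - \<rho>s t) / \<tau> t ^ l\<bar> \<le> 1 \<and> \<bar>\<psi> - \<phi>s t\<bar> + \<tau> t \<le> min s0 1"
        define x where "x = \<rho> - \<rho>s t"
        define y where "y = \<psi> - \<phi>s t"
        define X where "X = sgn \<eta> * (x / \<tau> t ^ l)"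
        have Xa: "\<bar>X\<bar> = \<bar>x\<bar> / \<tau> t ^ l" "\<bar>X\<bar> = \<bar>x / \<tau> t ^ l\<bar>" using sg(1) \<tau> by (simp_all add: X_def abs_mult)
        have X1: "\<bar>X\<bar> \<le> 1" using as Xa(2) by (simp add: x_def)
        have X2: "(x / \<tau> t ^ l)\<^sup>2 = X\<^sup>2" using Xa(2) by (metis power2_abs)
        have xX: "\<bar>x\<bar> = \<tau> t ^ l * \<bar>X\<bar>" using Xa \<tau> by simp
        have x1: "\<bar>x\<bar> \<le> 1" unfolding xX using X1 \<tau> by (intro mult_le_one power_le_one) auto
        have y1: "\<bar>y\<bar> \<le> 1" "\<bar>y\<bar> + \<tau> t \<le> s0" using as \<tau> by (auto simp: y_def)
        have e: "\<rho> = \<rho>s t + x" "\<psi> = \<phi>s t + y" by (simp_all add: x_def y_def)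
        let ?\<rho>1 = "d\<rho> (\<rho>s t) (\<phi>s t) t" and ?\<phi>1 = "d\<phi> (\<rho>s t) (\<phi>s t) t"
        have est: "\<bar>d\<rho> \<rho> \<psi> t - ?\<rho>1 - \<tau> t ^ n * Asum t \<psi>\<bar> \<le> C * (\<tau> t ^ n * \<bar>x\<bar> + \<tau> t ^ (n + m - 1) * \<bar>y\<bar>)"
          "\<bar>d\<phi> \<rho> \<psi> t - ?\<phi>1 - \<tau> t * \<eta> * x + w * \<tau> t ^ m * y\<bar> \<le> C * (\<tau> t ^ m * (\<bar>x\<bar> + (\<bar>y\<bar> + \<tau> t) * \<bar>y\<bar>))"
          "\<bar>Asum t \<psi> - \<nu> * y\<bar> \<le> C * (\<bar>y\<bar> + \<tau> t) * \<bar>y\<bar>"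
          "\<bar>Qsum t \<psi> - \<nu> / 2 * y\<^sup>2\<bar> \<le> C * (\<bar>y\<bar> + \<tau> t) * y\<^sup>2"
          "\<bar>Esum t \<psi> ?\<phi>1\<bar> \<le> C * \<tau> t ^ (m + 1) * y\<^sup>2"
          using elim(1) x1 y1 unfolding e by blast+
        have up: "C * z \<le> M * z" if "0 \<le> z" for z using M(2) that by (rule mult_right_mono)
        have sgabs: "\<bar>sgn \<eta> * z\<bar> = \<bar>z\<bar>" for z using sg(1) by (simp add: abs_mult)
        have A: "\<bar>sgn \<eta> * Asum t \<psi> + \<bar>\<nu>\<bar> * y\<bar> \<le> M * (\<bar>y\<bar> + \<tau> t) * \<bar>y\<bar>"
        proof -
          have "sgn \<eta> * Asum t \<psi> + \<bar>\<nu>\<bar> * y = sgn \<eta> * (Asum t \<psi> - \<nu> * y)"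
            using sg(3) by (simp add: right_diff_distrib mult.assoc[symmetric])
          then have "\<bar>sgn \<eta> * Asum t \<psi> + \<bar>\<nu>\<bar> * y\<bar> \<le> C * ((\<bar>y\<bar> + \<tau> t) * \<bar>y\<bar>)" using est(3) sgabs by (simp add: mult.assoc)
          also have "\<dots> \<le> M * ((\<bar>y\<bar> + \<tau> t) * \<bar>y\<bar>)" using \<tau> by (intro up) auto
          finally show ?thesis by (simp add: mult.assoc)
        qed
        have Q: "\<bar>sgn \<eta> * Qsum t \<psi> + \<bar>\<nu>\<bar> / 2 * y\<^sup>2\<bar> \<le> M * (\<bar>y\<bar> + \<tau> t) * y\<^sup>2"
        proof -
          have "sgn \<eta> * Qsum t \<psi> + \<bar>\<nu>\<bar> / 2 * y\<^sup>2 = sgn \<eta> * (Qsum t \<psi> - \<nu> / 2 * y\<^sup>2)"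
            using sg(3) by (simp add: right_diff_distrib mult.assoc[symmetric])
          then have "\<bar>sgn \<eta> * Qsum t \<psi> + \<bar>\<nu>\<bar> / 2 * y\<^sup>2\<bar> \<le> C * ((\<bar>y\<bar> + \<tau> t) * y\<^sup>2)" using est(4) sgabs by (simp add: mult.assoc)
          also have "\<dots> \<le> M * ((\<bar>y\<bar> + \<tau> t) * y\<^sup>2)" using \<tau> by (intro up) auto
          finally show ?thesis by (simp add: mult.assoc)
        qed
        have E3: "\<bar>sgn \<eta> * Esum t \<psi> ?\<phi>1\<bar> \<le> M * \<tau> t ^ (m + 1) * y\<^sup>2"
        proof -
          have "\<bar>sgn \<eta> * Esum t \<psi> ?\<phi>1\<bar> \<le> C * (\<tau> t ^ (m + 1) * y\<^sup>2)" using est(5) sgabs by (simp only: mult.assoc)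
          also have "\<dots> \<le> M * (\<tau> t ^ (m + 1) * y\<^sup>2)" using pp[of "m + 1"] by (intro up) simp
          finally show ?thesis by (simp only: mult.assoc)
        qed
        have Wf: "Wfun c t \<rho> \<psi> = \<bar>\<eta>\<bar> / 2 * X\<^sup>2 - sgn \<eta> * Qsum t \<psi> - c * \<tau> t ^ \<gamma> * X * y"
          unfolding Wfun_def Let_def x_def[symmetric] y_def[symmetric] X_def[symmetric] ..
        have res: "(X\<^sup>2 + y\<^sup>2) / K \<le> Wfun c t \<rho> \<psi> \<and> Wfun c t \<rho> \<psi> \<le> K * (X\<^sup>2 + y\<^sup>2) \<and>
           Wderiv c t \<rho> \<psi> \<rho>' \<psi>' \<le> - \<theta> * \<tau> t ^ (2 * l) * (X\<^sup>2 + y\<^sup>2) + K * \<tau> t ^ (Suc N - l)"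
          if r: "\<bar>\<rho>' - d\<rho> \<rho> \<psi> t\<bar> \<le> C1 * \<tau> t ^ Suc N" "\<bar>\<psi>' - d\<phi> \<rho> \<psi> t\<bar> \<le> C1 * \<tau> t ^ Suc N" for \<rho>' \<psi>'
        proof -
          define X' where "X' = sgn \<eta> * ((\<rho>' - ?\<rho>1) / \<tau> t ^ l) + real l / (2 * real q) * \<tau> t ^ (2 * q) * X"
          define y' where "y' = \<psi>' - ?\<phi>1"
          define E1 where "E1 = X' - \<tau> t ^ (l + 1) * (sgn \<eta> * Asum t \<psi>)"
          define E2 where "E2 = y' - \<tau> t ^ (l + 1) * \<bar>\<eta>\<bar> * X"
          have N: "l \<le> Suc N" using N3 by simp
          have tN: "\<tau> t ^ Suc N / \<tau> t ^ l = \<tau> t ^ (Suc N - l)" using \<tau> N by (simp add: power_diff)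
          \<comment> \<open>Here the scaling takes effect: the force of order
            \<open>\<tau> ^ n\<close> becomes \<open>\<tau> ^ (l + 1)\<close> for \<open>X\<close>,
            the same power that \<open>\<tau> * \<eta> * x\<close> acquires when written in terms of
            \<open>X\<close>.\<close>
          have "n = (l + 1) + l" by simp
          then have "\<tau> t ^ n = \<tau> t ^ (l + 1) * \<tau> t ^ l" by (simp only: power_add)
          then have tn: "\<tau> t ^ n / \<tau> t ^ l = \<tau> t ^ (l + 1)" using \<tau> by simp
          have E1b: "\<bar>E1\<bar> \<le> M * (\<tau> t ^ (2 * l + 1) * \<bar>X\<bar> + \<tau> t ^ (l + m) * \<bar>y\<bar> + \<tau> t ^ (Suc N - l))"
          proof -
            let ?a = "\<rho>' - d\<rho> \<rho> \<psi> t" and ?b = "d\<rho> \<rho> \<psi> t - ?\<rho>1 - \<tau> t ^ n * Asum t \<psi>"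
            have "\<rho>' - ?\<rho>1 = ?a + ?b + \<tau> t ^ n * Asum t \<psi>" by simp
            then have "(\<rho>' - ?\<rho>1) / \<tau> t ^ l = ?a / \<tau> t ^ l + ?b / \<tau> t ^ l + \<tau> t ^ n / \<tau> t ^ l * Asum t \<psi>"
              by (simp only: add_divide_distrib times_divide_eq_left)
            then have "E1 = sgn \<eta> * (?a / \<tau> t ^ l) + sgn \<eta> * (?b / \<tau> t ^ l) + real l / (2 * real q) * \<tau> t ^ (2 * q) * X"
              unfolding E1_def X'_def tn by (simp add: distrib_left)
            moreover have tri: "\<bar>E\<bar> \<le> \<bar>a\<bar> + \<bar>b\<bar> + \<bar>z\<bar>" if "E = sgn \<eta> * a + sgn \<eta> * b + z" for E a b z :: real
              using that sgabs[of a] sgabs[of b] by linarith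
            ultimately have "\<bar>E1\<bar> \<le> \<bar>?a / \<tau> t ^ l\<bar> + \<bar>?b / \<tau> t ^ l\<bar> + \<bar>real l / (2 * real q) * \<tau> t ^ (2 * q) * X\<bar>"
              by blast
            moreover have "\<bar>?a / \<tau> t ^ l\<bar> \<le> C1 * \<tau> t ^ (Suc N - l)"
            proof -
              have "\<bar>?a / \<tau> t ^ l\<bar> \<le> C1 * \<tau> t ^ Suc N / \<tau> t ^ l"
                using divide_right_mono[OF r(1) pp[of l]] pp[of l] by (simp add: abs_divide del: power_Suc)
              also have "\<dots> = C1 * \<tau> t ^ (Suc N - l)" unfolding tN[symmetric] by simp
              finally show ?thesis .
            qed
            moreover have "\<bar>?b / \<tau> t ^ l\<bar> \<le> C * (\<tau> t ^ (2 * l + 1) * \<bar>X\<bar> + \<tau> t ^ (l + m) * \<bar>y\<bar>)"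
            proof -
              have "\<bar>?b / \<tau> t ^ l\<bar> \<le> C * (\<tau> t ^ n * \<bar>x\<bar> + \<tau> t ^ (n + m - 1) * \<bar>y\<bar>) / \<tau> t ^ l"
                using divide_right_mono[OF est(1) pp[of l]] pp[of l] by (simp add: abs_divide del: power_Suc)
              moreover have "n + m - 1 = (l + m) + l" using m2 by simp
              then have "\<tau> t ^ (n + m - 1) = \<tau> t ^ (l + m) * \<tau> t ^ l" by (simp only: power_add)
              moreover have "C * (p * (T * x) + r * T * y) / T = C * (p * x + r * y)" if "T > 0" for p r T x y :: real
                using that by (simp add: field_simps)
              ultimately show ?thesis using \<tau> unfolding xX by (simp del: power_Suc)
            qed
            moreover have "\<bar>real l / (2 * real q) * \<tau> t ^ (2 * q) * X\<bar> \<le> real l * (\<tau> t ^ (2 * l + 1) * \<bar>X\<bar>)"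
            proof -
              have "real l / (2 * real q) \<le> real l / 1" using q1 by (intro divide_left_mono) auto
              moreover have "\<tau> t ^ (2 * q) \<le> \<tau> t ^ (2 * l + 1)" using lq by (intro pw) simp
              ultimately have "real l / (2 * real q) * (\<tau> t ^ (2 * q) * \<bar>X\<bar>) \<le> real l * (\<tau> t ^ (2 * l + 1) * \<bar>X\<bar>)"
                using pp by (intro mult_mono mult_right_mono) auto
              then show ?thesis using pp by (simp add: abs_mult del: power_Suc)
            qed
            moreover have "0 \<le> \<tau> t ^ (2 * l + 1) * \<bar>X\<bar>" "0 \<le> \<tau> t ^ (l + m) * \<bar>y\<bar>" "0 \<le> \<tau> t ^ (Suc N - l)"
              using pp[of "2 * l + 1"] pp[of "l + m"] pp[of "Suc N - l"] by (simp_all del: power_Suc)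
            then have "C1 * \<tau> t ^ (Suc N - l) + C * (\<tau> t ^ (2 * l + 1) * \<bar>X\<bar> + \<tau> t ^ (l + m) * \<bar>y\<bar>) + real l * (\<tau> t ^ (2 * l + 1) * \<bar>X\<bar>)
               \<le> M * (\<tau> t ^ (2 * l + 1) * \<bar>X\<bar> + \<tau> t ^ (l + m) * \<bar>y\<bar> + \<tau> t ^ (Suc N - l))"
            proof -
              assume nn: "0 \<le> \<tau> t ^ (2 * l + 1) * \<bar>X\<bar>" "0 \<le> \<tau> t ^ (l + m) * \<bar>y\<bar>" "0 \<le> \<tau> t ^ (Suc N - l)"
              have g: "C1 * r + C * (p + q) + L * p \<le> (C + C1 + L) * (p + q + r)" if "0 \<le> p" "0 \<le> q" "0 \<le> r" "0 \<le> L" for p q r L :: real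
              proof -
                have "0 \<le> C * r" "0 \<le> C1 * p" "0 \<le> C1 * q" "0 \<le> L * q" "0 \<le> L * r" using that C C1 by simp_all
                then show ?thesis by (simp add: algebra_simps)
              qed
              show ?thesis unfolding M_def by (rule g[OF nn]) simp
            qed
            ultimately show ?thesis by linarith
          qed
          have E2b: "\<bar>E2 + w * \<tau> t ^ m * y\<bar> \<le> M * (\<tau> t ^ m * (\<tau> t ^ l * \<bar>X\<bar> + (\<bar>y\<bar> + \<tau> t) * \<bar>y\<bar>) + \<tau> t ^ (Suc N - l))"
          proof -
            have "\<tau> t ^ (l + 1) * \<bar>\<eta>\<bar> * X = \<tau> t * \<tau> t ^ l * ((sgn \<eta> * \<eta>) * (sgn \<eta> * (x / \<tau> t ^ l)))"
              unfolding sg(2) X_def by simp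
            also have "\<dots> = \<tau> t * \<eta> * x * (sgn \<eta> * sgn \<eta>)" using \<tau> by simp
            finally have ex: "\<tau> t ^ (l + 1) * \<bar>\<eta>\<bar> * X = \<tau> t * \<eta> * x" unfolding sg(4) by simp
            have "E2 + w * \<tau> t ^ m * y = (\<psi>' - d\<phi> \<rho> \<psi> t) + (d\<phi> \<rho> \<psi> t - ?\<phi>1 - \<tau> t * \<eta> * x + w * \<tau> t ^ m * y)"
              unfolding E2_def ex y'_def by simp
            then have "\<bar>E2 + w * \<tau> t ^ m * y\<bar> \<le> C1 * \<tau> t ^ Suc N + C * (\<tau> t ^ m * (\<bar>x\<bar> + (\<bar>y\<bar> + \<tau> t) * \<bar>y\<bar>))"
              using r(2) est(2) by linarith
            also have "\<dots> \<le> M * \<tau> t ^ (Suc N - l) + M * (\<tau> t ^ m * (\<tau> t ^ l * \<bar>X\<bar> + (\<bar>y\<bar> + \<tau> t) * \<bar>y\<bar>))"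
              unfolding xX using M pp \<tau> by (intro add_mono mult_mono pw up mult_nonneg_nonneg) auto
            finally show ?thesis by (simp add: distrib_left)
          qed
          have "0 < \<tau> t \<and> \<bar>y\<bar> + \<tau> t \<le> s0 \<and> \<bar>X\<bar> \<le> 1 \<and> 0 \<le> \<tau> t ^ (Suc N - l) \<and>
             \<bar>sgn \<eta> * Asum t \<psi> + \<bar>\<nu>\<bar> * y\<bar> \<le> M * (\<bar>y\<bar> + \<tau> t) * \<bar>y\<bar> \<and> \<bar>sgn \<eta> * Qsum t \<psi> + \<bar>\<nu>\<bar> / 2 * y\<^sup>2\<bar> \<le> M * (\<bar>y\<bar> + \<tau> t) * y\<^sup>2 \<and>
             \<bar>E1\<bar> \<le> M * (\<tau> t ^ (2 * l + 1) * \<bar>X\<bar> + \<tau> t ^ (l + m) * \<bar>y\<bar> + \<tau> t ^ (Suc N - l)) \<and>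
             \<bar>E2 + w * \<tau> t ^ m * y\<bar> \<le> M * (\<tau> t ^ m * (\<tau> t ^ l * \<bar>X\<bar> + (\<bar>y\<bar> + \<tau> t) * \<bar>y\<bar>) + \<tau> t ^ (Suc N - l)) \<and>
             \<bar>sgn \<eta> * Esum t \<psi> ?\<phi>1\<bar> \<le> M * \<tau> t ^ (m + 1) * y\<^sup>2"
            by (intro conjI \<tau>(1) y1(2) X1 pp A Q E1b E2b E3)
          from ly[OF this] have L: "(X\<^sup>2 + y\<^sup>2) / K \<le> Wfun c t \<rho> \<psi>" "Wfun c t \<rho> \<psi> \<le> K * (X\<^sup>2 + y\<^sup>2)"
            and Ld: "\<bar>\<eta>\<bar> * X * (\<tau> t ^ (l + 1) * (sgn \<eta> * Asum t \<psi>) + E1) - (sgn \<eta> * Asum t \<psi> * (\<tau> t ^ (l + 1) * \<bar>\<eta>\<bar> * X + E2) + sgn \<eta> * Esum t \<psi> ?\<phi>1)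
              - c * \<tau> t ^ \<gamma> * ((\<tau> t ^ (l + 1) * (sgn \<eta> * Asum t \<psi>) + E1) * y + X * (\<tau> t ^ (l + 1) * \<bar>\<eta>\<bar> * X + E2))
              + c * (real \<gamma> / (2 * real q)) * \<tau> t ^ (\<gamma> + 2 * q) * X * y
              \<le> - \<theta> * \<tau> t ^ (2 * l) * (X\<^sup>2 + y\<^sup>2) + K * \<tau> t ^ (Suc N - l)"
            unfolding Wf by blast+
          have a: "\<tau> t ^ (l + 1) * (sgn \<eta> * Asum t \<psi>) + E1 = X'" "\<tau> t ^ (l + 1) * \<bar>\<eta>\<bar> * X + E2 = y'" by (simp_all add: E1_def E2_def)
          have "Wderiv c t \<rho> \<psi> \<rho>' \<psi>' = \<bar>\<eta>\<bar> * X * X' - (sgn \<eta> * Asum t \<psi> * y' + sgn \<eta> * Esum t \<psi> ?\<phi>1)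
              - c * \<tau> t ^ \<gamma> * (X' * y + X * y') + c * (real \<gamma> / (2 * real q)) * \<tau> t ^ (\<gamma> + 2 * q) * X * y"
            unfolding Wderiv_def Let_def x_def[symmetric] y_def[symmetric] X_def[symmetric] X'_def[symmetric] y'_def[symmetric]
            by (simp add: distrib_left mult.assoc)
          then show ?thesis using L Ld unfolding a by simp
        qed
        \<comment> \<open>The two bounds on \<open>Wfun\<close> involve no velocity; they are
          extracted from \<open>res\<close> by inserting the truncated field itself.\<close>
        have z: "\<bar>z - z\<bar> \<le> C1 * \<tau> t ^ Suc N" for z :: real using C1 pp[of "Suc N"] by simp
        show "(((\<rho> - \<rho>s t) / \<tau> t ^ l)\<^sup>2 + (\<psi> - \<phi>s t)\<^sup>2) / K \<le> Wfun c t \<rho> \<psi> \<and>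
         Wfun c t \<rho> \<psi> \<le> K * (((\<rho> - \<rho>s t) / \<tau> t ^ l)\<^sup>2 + (\<psi> - \<phi>s t)\<^sup>2) \<and>
         (\<forall>\<rho>' \<psi>'. \<bar>\<rho>' - d\<rho> \<rho> \<psi> t\<bar> \<le> C1 * \<tau> t ^ Suc N \<and> \<bar>\<psi>' - d\<phi> \<rho> \<psi> t\<bar> \<le> C1 * \<tau> t ^ Suc N \<longrightarrow>
         Wderiv c t \<rho> \<psi> \<rho>' \<psi>' \<le> - \<theta> * \<tau> t ^ (2 * l) * (((\<rho> - \<rho>s t) / \<tau> t ^ l)\<^sup>2 + (\<psi> - \<phi>s t)\<^sup>2) + K * \<tau> t ^ (Suc N - l))"
          unfolding x_def[symmetric] y_def[symmetric] X2 using res[OF z z] res by blast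
      qed
    qed
  qed
qed

end

section \<open>Continuity along solutions, and confinement to a sublevel set\<close>

lemma continuous_on_tau: "q \<ge> 1 \<Longrightarrow> A \<subseteq> {0<..} \<Longrightarrow> continuous_on A (tau q)"
  by (rule DERIV_continuous_on[OF DERIV_tau]) auto

context perturbed_system
begin

lemma continuous_on_maps:
  assumes A: "A \<subseteq> {0<..}" and R: "continuous_on A R" and \<Psi>: "continuous_on A \<Psi>" and S: "continuous_on A S"
  shows "continuous_on A (\<lambda>t. \<rho>map N (R t) (\<Psi> t) (S t) t)" "continuous_on A (\<lambda>t. \<psi>map N (R t) (\<Psi> t) (S t) t)"
proof -
  have w: "continuous_on A (\<lambda>t. w (R t) (\<Psi> t) (S t))" if "smooth_on UNIV (\<lambda>(R, \<Psi>, S). w R \<Psi> S)" for w :: "real \<Rightarrow> real \<Rightarrow> real \<Rightarrow> real"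
  proof -
    have "Ck_on 0 UNIV (\<lambda>(R, \<Psi>, S). w R \<Psi> S)" using that unfolding smooth_on_def by blast
    then have "continuous_on UNIV (\<lambda>(R, \<Psi>, S). w R \<Psi> S)" by simp
    from continuous_on_compose2[OF this continuous_on_Pair[OF R continuous_on_Pair[OF \<Psi> S]]] show ?thesis by simp
  qed
  show "continuous_on A (\<lambda>t. \<rho>map N (R t) (\<Psi> t) (S t) t)" "continuous_on A (\<lambda>t. \<psi>map N (R t) (\<Psi> t) (S t) t)"
    unfolding \<rho>map_def \<psi>map_def
    by (intro continuous_intros R \<Psi> w[OF smooth_u] w[OF smooth_v] continuous_on_tau[OF q1 A]; simp)+
qed

end

context resonant_system
begin

lemma continuous_on_Wfun:
  assumes A: "A \<subseteq> {0<..}" and c: "continuous_on A \<rho>" "continuous_on A \<psi>" "continuous_on A \<rho>s" "continuous_on A \<phi>s"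
  shows "continuous_on A (\<lambda>t. Wfun c t (\<rho> t) (\<psi> t))"
proof -
  have "continuous_on UNIV (\<Lambda> k 0)" "continuous_on UNIV (Pot k)" if "k \<ge> 1" for k
    using DERIV_isCont[OF DERIV_\<Lambda>0[OF that]] DERIV_isCont[OF DERIV_Pot[OF that]]
    by (auto intro: continuous_at_imp_continuous_on)
  then have \<Lambda>: "continuous_on A (\<lambda>t. \<Lambda> k 0 (z t))" and P: "continuous_on A (\<lambda>t. Pot k (z t))"
    if "k \<ge> 1" "continuous_on A z" for k z
    using continuous_on_compose2[of UNIV _ A z] that by blast+
  have "\<And>t. t \<in> A \<Longrightarrow> \<tau> t \<noteq> 0" using A tau_pos[of _ q] by force
  then show ?thesis
    unfolding Wfun_def Let_def Qsum_def
    by (intro continuous_intros c \<Lambda> P continuous_on_tau[OF q1 A]) auto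
qed

text \<open>The order of choices matters: the level of the Lyapunov function depends on
  \<open>\<epsilon>\<close>, the time \<open>ts\<close> on the level, and \<open>\<delta>\<close> on
  \<open>ts\<close>. The radial tolerance is divided by \<open>\<tau> ts\<close> to pass to
  \<open>R\<close> and by \<open>\<tau> ts ^ l\<close> to pass to \<open>X\<close>, so
  \<open>\<delta>\<close> has to shrink as \<open>ts\<close> grows.\<close>

lemma stability:
  assumes \<epsilon>: "\<epsilon> > 0"
  shows "\<exists>\<delta>>0. \<exists>ts\<ge>T0. \<forall>J r \<phi>.
       is_interval J \<and> ts \<in> J \<and> J \<subseteq> {ts..} \<and>
       perturbed_solution \<R> \<omega> f g (phase q s) J r \<phi> \<and>
       resonant_deviation q \<kappa> \<mu> a (phase q s) \<rho>s \<phi>s r \<phi> ts \<le> \<delta> \<longrightarrow>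
       (\<exists>r' \<phi>'. (\<forall>t\<in>J. r' t = r t \<and> \<phi>' t = \<phi> t) \<and>
          perturbed_solution \<R> \<omega> f g (phase q s) {ts..} r' \<phi>' \<and>
          (\<forall>t>ts. resonant_deviation q \<kappa> \<mu> a (phase q s) \<rho>s \<phi>s r' \<phi>' t < \<epsilon>))"
proof -
  let ?S = "phase q s"
  obtain C T1 where C: "C \<ge> 0" and T1: "\<And>t. t \<ge> T1 \<Longrightarrow> \<forall>R \<Psi> S. \<bar>R\<bar> \<le> 1 \<and> \<bar>\<Psi> - \<psi>0\<bar> \<le> 1 \<longrightarrow>
     \<bar>total_deriv_sum U N (R, \<Psi>, S) t - d\<rho> (\<rho>map N R \<Psi> S t) (\<psi>map N R \<Psi> S t) t\<bar> \<le> C * \<tau> t ^ Suc N \<and>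
     \<bar>total_deriv_sum V N (R, \<Psi>, S) t - d\<phi> (\<rho>map N R \<Psi> S t) (\<psi>map N R \<Psi> S t) t\<bar> \<le> C * \<tau> t ^ Suc N \<and>
     \<bar>\<rho>map N R \<Psi> S t - R\<bar> \<le> C * \<tau> t \<and> \<bar>\<psi>map N R \<Psi> S t - \<Psi>\<bar> \<le> C * \<tau> t"
    using averaged_remainder[of \<psi>0 N, unfolded eventually_at_top_linorder] by blast
  obtain D T2 where T2: "\<And>t. t \<ge> T2 \<Longrightarrow> particular_bounds D t"
    using particular_near[unfolded eventually_at_top_linorder] by blast
  obtain c s1 \<theta> K T3 where cs: "s1 > 0" "\<theta> > 0" "K > 0" and T3: "\<And>t. t \<ge> T3 \<Longrightarrow> lyapunov_bounds C c s1 \<theta> K t"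
    using lyapunov_function[OF C, unfolded eventually_at_top_linorder] by blast
  obtain Cg where Cg: "Cg \<ge> 0" "\<forall>T. \<exists>ts\<ge>T. ts \<ge> 1 \<and> \<bar>\<rho>map N (\<rho>s ts) (\<phi>s ts) (?S ts) ts - \<rho>s ts\<bar> \<le> Cg * \<tau> ts ^ (2 * q)"
    using good_initial_times by blast
  obtain B where B: "B \<ge> 0" "\<forall>t\<ge>1. \<forall>R1 R2 \<Psi>1 \<Psi>2 S. \<bar>R1\<bar> \<le> 1 \<and> \<bar>R2\<bar> \<le> 1 \<and> \<bar>\<Psi>1 - \<psi>0\<bar> \<le> 1 \<and> \<bar>\<Psi>2 - \<psi>0\<bar> \<le> 1 \<longrightarrow>
     \<bar>\<rho>map N R1 \<Psi>1 S t - \<rho>map N R2 \<Psi>2 S t\<bar> \<le> B * (\<bar>R1 - R2\<bar> + \<bar>\<Psi>1 - \<Psi>2\<bar>)"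
    using \<rho>map_Lipschitz[of \<psi>0 N] by blast
  \<comment> \<open>Three nested sizes: \<open>\<epsilon>2\<close> is the radius allowed for
    \<open>(X, y)\<close>; \<open>W \<le> \<epsilon>1\<close> forces the point strictly inside this
    radius; and an initial deviation of at most \<open>2 * \<beta>\<close> in each of
    \<open>X\<close> and \<open>y\<close> makes \<open>W\<close> strictly smaller than
    \<open>\<epsilon>1\<close>.\<close>
  define \<epsilon>2 where "\<epsilon>2 = min (\<epsilon> / 4) (min (s1 / 2) (1 / 4))"
  define \<epsilon>1 where "\<epsilon>1 = \<epsilon>2\<^sup>2 / (2 * K)"
  define \<beta> where "\<beta> = min (\<epsilon>2 / 4) (\<epsilon>1 / (16 * K))"
  have \<epsilon>2: "0 < \<epsilon>2" "\<epsilon>2 \<le> \<epsilon> / 4" "\<epsilon>2 \<le> s1 / 2" "\<epsilon>2 \<le> 1 / 4" using \<epsilon> cs by (auto simp: \<epsilon>2_def)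
  have \<epsilon>1: "0 < \<epsilon>1" "K * \<epsilon>1 < \<epsilon>2\<^sup>2" using \<epsilon>2 cs by (auto simp: \<epsilon>1_def)
  have \<beta>: "0 < \<beta>" "\<beta> \<le> \<epsilon>2 / 4" "\<beta> \<le> \<epsilon>1 / (16 * K)" using \<epsilon>1 \<epsilon>2 cs by (auto simp: \<beta>_def)
  have \<beta>2: "8 * \<beta>\<^sup>2 < \<epsilon>2\<^sup>2" "K * (8 * \<beta>\<^sup>2) < \<epsilon>1"
  proof -
    have "\<beta>\<^sup>2 \<le> (\<epsilon>2 / 4)\<^sup>2" using \<beta> by (intro power_mono) auto
    moreover have "(\<epsilon>2 / 4)\<^sup>2 = \<epsilon>2\<^sup>2 / 16" by (simp add: power_divide)
    moreover have "0 < \<epsilon>2\<^sup>2" using \<epsilon>2 by simp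
    ultimately show "8 * \<beta>\<^sup>2 < \<epsilon>2\<^sup>2" by linarith
    have "\<beta> * \<beta> \<le> 1 * \<beta>" using \<beta> \<epsilon>2 by (intro mult_right_mono) auto
    then have "K * (8 * \<beta>\<^sup>2) \<le> K * (8 * \<beta>)" using cs by (simp add: power2_eq_square)
    also have "\<dots> \<le> \<epsilon>1 / 2" using \<beta>(3) cs by (simp add: field_simps)
    finally show "K * (8 * \<beta>\<^sup>2) < \<epsilon>1" using \<epsilon>1 by simp
  qed
  have ev: "\<forall>\<^sub>F t in at_top. Z * \<tau> t \<le> e" if "Z \<ge> 0" "e > 0" for Z e
    using eventually_mult_tau_le that by blast
  have "\<forall>\<^sub>F t in at_top. C * \<tau> t \<le> min (min (1 / 4) (\<epsilon> / 8)) \<beta>" by (rule ev) (use C \<epsilon> \<beta> in auto)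
  moreover have "\<forall>\<^sub>F t in at_top. Cg * \<tau> t \<le> \<beta>" by (rule ev) (use Cg \<beta> in auto)
  moreover have "\<forall>\<^sub>F t in at_top. \<tau> t < min (s1 / 2) (\<R> - \<bar>a\<bar>)"
    by (rule eventually_tau_less[OF q1]) (use cs a_less in auto)
  \<comment> \<open>Makes the averaging error smaller than the dissipation on the level
    \<open>W = \<epsilon>1\<close>, where \<open>X\<^sup>2 + y\<^sup>2\<close> is at least
    \<open>\<epsilon>1 / K\<close>.\<close>
  moreover have "\<forall>\<^sub>F t in at_top. \<tau> t < \<theta> * (\<epsilon>1 / K) / K"
    by (rule eventually_tau_less[OF q1]) (use cs \<epsilon>1 in auto)
  ultimately have "\<forall>\<^sub>F t in at_top. (C * \<tau> t \<le> min (min (1 / 4) (\<epsilon> / 8)) \<beta>) \<and> (Cg * \<tau> t \<le> \<beta>) \<and>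
     (\<tau> t < min (s1 / 2) (\<R> - \<bar>a\<bar>)) \<and> (\<tau> t < \<theta> * (\<epsilon>1 / K) / K)"
    by eventually_elim blast
  then obtain T4 where T4: "\<And>t. t \<ge> T4 \<Longrightarrow> (C * \<tau> t \<le> min (min (1 / 4) (\<epsilon> / 8)) \<beta>) \<and> (Cg * \<tau> t \<le> \<beta>) \<and>
     (\<tau> t < min (s1 / 2) (\<R> - \<bar>a\<bar>)) \<and> (\<tau> t < \<theta> * (\<epsilon>1 / K) / K)"
    unfolding eventually_at_top_linorder by blast
  obtain ts where ts: "ts \<ge> max (max (max T1 T2) (max T3 T4)) T0" "\<bar>\<rho>map N (\<rho>s ts) (\<phi>s ts) (?S ts) ts - \<rho>s ts\<bar> \<le> Cg * \<tau> ts ^ (2 * q)"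
    using Cg(2) by blast
  have near: "1 \<le> t" "\<bar>\<rho>s t\<bar> \<le> 1 / 4" "\<bar>\<phi>s t - \<psi>0\<bar> \<le> 1 / 4" and
    \<rho>s': "(\<rho>s has_real_derivative d\<rho> (\<rho>s t) (\<phi>s t) t) (at t)" and
    \<phi>s': "(\<phi>s has_real_derivative d\<phi> (\<rho>s t) (\<phi>s t) t) (at t)" and
    \<tau>: "0 < \<tau> t" "\<tau> t \<le> 1" "\<tau> t < s1 / 2" "\<tau> t < \<R> - \<bar>a\<bar>" "K * \<tau> t < \<theta> * (\<epsilon>1 / K)" and
    C\<tau>: "C * \<tau> t \<le> 1 / 4" "C * \<tau> t \<le> \<epsilon> / 8" "C * \<tau> t \<le> \<beta>" "Cg * \<tau> t \<le> \<beta>" if "ts \<le> t" for t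
  proof -
    have t: "T2 \<le> t" "T4 \<le> t" using that ts(1) by simp_all
    show "1 \<le> t" "\<bar>\<rho>s t\<bar> \<le> 1 / 4" "\<bar>\<phi>s t - \<psi>0\<bar> \<le> 1 / 4"
      "(\<rho>s has_real_derivative d\<rho> (\<rho>s t) (\<phi>s t) t) (at t)"
      "(\<phi>s has_real_derivative d\<phi> (\<rho>s t) (\<phi>s t) t) (at t)"
      using T2[OF t(1)] by linarith+
    then show "0 < \<tau> t" "\<tau> t \<le> 1" using tau_pos[of t q] tau_le_1[of t q] by auto
    show "\<tau> t < s1 / 2" "\<tau> t < \<R> - \<bar>a\<bar>" "K * \<tau> t < \<theta> * (\<epsilon>1 / K)"
      "C * \<tau> t \<le> 1 / 4" "C * \<tau> t \<le> \<epsilon> / 8" "C * \<tau> t \<le> \<beta>" "Cg * \<tau> t \<le> \<beta>"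
      using T4[OF t(2)] cs by (simp_all add: pos_less_divide_eq mult.commute)
  qed
  have ts1: "1 \<le> ts" "0 < \<tau> ts" "\<tau> ts \<le> 1" using near(1) \<tau>(1,2) by simp_all
  \<comment> \<open>Three demands: \<open>R\<close> starts within 1/4 of \<open>\<rho>s\<close>; the
    angle starts within \<open>\<beta>\<close>; and, after division by \<open>\<tau> ts\<close> and
    the Lipschitz map, the radial error is at most \<open>\<beta> * \<tau> ts ^ l\<close>, that is,
    \<open>\<beta>\<close> in terms of \<open>X\<close>.\<close>
  define \<delta> where "\<delta> = min (min (\<tau> ts / 4) \<beta>) (\<beta> * \<tau> ts ^ (l + 1) / (2 * B + 1))"
  have "0 < \<delta>" unfolding \<delta>_def using ts1 \<beta>(1) B(1) by simp
  moreover have "\<delta> \<le> \<tau> ts / 4" "\<delta> \<le> \<beta>" "\<delta> \<le> \<beta> * \<tau> ts ^ (l + 1) / (2 * B + 1)"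
    unfolding \<delta>_def by linarith+
  ultimately have \<delta>: "0 < \<delta>" "\<delta> \<le> \<tau> ts / 4" "\<delta> \<le> \<beta>" "\<delta> \<le> \<beta> * \<tau> ts ^ (l + 1) / (2 * B + 1)" .
  have "\<exists>r' \<phi>'. (\<forall>t\<in>J. r' t = r t \<and> \<phi>' t = \<phi> t) \<and>
          perturbed_solution \<R> \<omega> f g ?S {ts..} r' \<phi>' \<and>
          (\<forall>t>ts. resonant_deviation q \<kappa> \<mu> a ?S \<rho>s \<phi>s r' \<phi>' t < \<epsilon>)"
    if as: "is_interval J" "ts \<in> J" "J \<subseteq> {ts..}" "perturbed_solution \<R> \<omega> f g ?S J r \<phi>"
      "resonant_deviation q \<kappa> \<mu> a ?S \<rho>s \<phi>s r \<phi> ts \<le> \<delta>" for J r \<phi>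
  proof -
    have "0 < ts" using ts1 by simp
    then obtain r' \<phi>' where eq: "\<And>t. t \<in> J \<Longrightarrow> r' t = r t \<and> \<phi>' t = \<phi> t"
      and r': "\<And>t. t \<ge> ts \<Longrightarrow> (r' has_real_derivative f (clamp_radius \<R> (r' t)) (\<phi>' t) (?S t) t) (at t within {ts..})"
      and \<phi>': "\<And>t. t \<ge> ts \<Longrightarrow> (\<phi>' has_real_derivative \<omega> (clamp_radius \<R> (r' t)) + g (clamp_radius \<R> (r' t)) (\<phi>' t) (?S t) t) (at t within {ts..})"
      using clamped_extension[OF _ as(1-4)] by blast
    define R where "R t = (r' t - a) / \<tau> t" for t
    define \<Psi> where "\<Psi> t = \<phi>' t - real \<kappa> / real \<mu> * ?S t" for t
    define \<rho> where "\<rho> t = \<rho>map N (R t) (\<Psi> t) (?S t) t" for t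
    define \<psi> where "\<psi> t = \<psi>map N (R t) (\<Psi> t) (?S t) t" for t
    define X where "X t = (\<rho> t - \<rho>s t) / \<tau> t ^ l" for t
    define y where "y t = \<psi> t - \<phi>s t" for t
    define W where "W t = Wfun c t (\<rho> t) (\<psi> t)" for t
    \<comment> \<open>Negative exactly when four constraints hold strictly: two keep the point in
      the strip where the averaging estimates apply, one keeps \<open>X\<close> and \<open>y\<close>
      where the Lyapunov estimates apply, and the last is the sublevel set.\<close>
    define h where "h t = max (max (\<bar>R t\<bar> - 1) (\<bar>\<Psi> t - \<psi>0\<bar> - 1)) (max ((X t)\<^sup>2 + (y t)\<^sup>2 - \<epsilon>2\<^sup>2) (W t - \<epsilon>1))" for t
    have rt: "r' t = a + \<tau> t * R t" if "ts \<le> t" for t using \<tau>(1)[OF that] by (simp add: R_def)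
    have dev: "resonant_deviation q \<kappa> \<mu> a ?S \<rho>s \<phi>s r' \<phi>' t = \<tau> t * \<bar>R t - \<rho>s t\<bar> + \<bar>\<Psi> t - \<phi>s t\<bar>" if "ts \<le> t" for t
    proof -
      have "t powr (- (1 / (2 * real q))) = \<tau> t" using tau_power[of t q 1] near(1)[OF that] by simp
      moreover have "r' t - a - \<tau> t * \<rho>s t = \<tau> t * (R t - \<rho>s t)" unfolding rt[OF that] by (simp add: right_diff_distrib)
      ultimately show ?thesis using \<tau>(1)[OF that] unfolding resonant_deviation_def \<Psi>_def by (simp add: abs_mult)
    qed
    have maps: "\<bar>\<rho> t - R t\<bar> \<le> C * \<tau> t" "\<bar>\<psi> t - \<Psi> t\<bar> \<le> C * \<tau> t"
      "\<bar>total_deriv_sum U N (R t, \<Psi> t, ?S t) t - d\<rho> (\<rho> t) (\<psi> t) t\<bar> \<le> C * \<tau> t ^ Suc N"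
      "\<bar>total_deriv_sum V N (R t, \<Psi> t, ?S t) t - d\<phi> (\<rho> t) (\<psi> t) t\<bar> \<le> C * \<tau> t ^ Suc N"
      if "ts \<le> t" "\<bar>R t\<bar> \<le> 1" "\<bar>\<Psi> t - \<psi>0\<bar> \<le> 1" for t
      using T1[rule_format, of t "R t" "\<Psi> t" "?S t"] that ts(1) unfolding \<rho>_def \<psi>_def by (simp_all del: power_Suc)
    have ly: "((X t)\<^sup>2 + (y t)\<^sup>2) / K \<le> W t" "W t \<le> K * ((X t)\<^sup>2 + (y t)\<^sup>2)"
      "\<And>\<rho>' \<psi>'. \<bar>\<rho>' - d\<rho> (\<rho> t) (\<psi> t) t\<bar> \<le> C * \<tau> t ^ Suc N \<Longrightarrow> \<bar>\<psi>' - d\<phi> (\<rho> t) (\<psi> t) t\<bar> \<le> C * \<tau> t ^ Suc N \<Longrightarrow>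
       Wderiv c t (\<rho> t) (\<psi> t) \<rho>' \<psi>' \<le> - \<theta> * \<tau> t ^ (2 * l) * ((X t)\<^sup>2 + (y t)\<^sup>2) + K * \<tau> t ^ (Suc N - l)"
      if "ts \<le> t" "\<bar>X t\<bar> \<le> 1" "\<bar>y t\<bar> \<le> s1 / 2" for t
    proof -
      have "\<bar>(\<rho> t - \<rho>s t) / \<tau> t ^ l\<bar> \<le> 1 \<and> \<bar>\<psi> t - \<phi>s t\<bar> + \<tau> t \<le> s1"
        using that(2,3) \<tau>(3)[OF that(1)] unfolding X_def y_def by simp
      note L = T3[rule_format, OF _ this]
      have "T3 \<le> t" using ts(1) that(1) by simp
      note L = L[OF this]
      show "((X t)\<^sup>2 + (y t)\<^sup>2) / K \<le> W t" "W t \<le> K * ((X t)\<^sup>2 + (y t)\<^sup>2)"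
        using L unfolding X_def y_def W_def by blast+
      show "Wderiv c t (\<rho> t) (\<psi> t) \<rho>' \<psi>' \<le> - \<theta> * \<tau> t ^ (2 * l) * ((X t)\<^sup>2 + (y t)\<^sup>2) + K * \<tau> t ^ (Suc N - l)"
        if "\<bar>\<rho>' - d\<rho> (\<rho> t) (\<psi> t) t\<bar> \<le> C * \<tau> t ^ Suc N" "\<bar>\<psi>' - d\<phi> (\<rho> t) (\<psi> t) t\<bar> \<le> C * \<tau> t ^ Suc N" for \<rho>' \<psi>'
        using L that unfolding X_def y_def by blast
    qed
    have small: "\<bar>X t\<bar> \<le> \<epsilon>2" "\<bar>y t\<bar> \<le> \<epsilon>2" if "(X t)\<^sup>2 + (y t)\<^sup>2 \<le> \<epsilon>2\<^sup>2" for t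
    proof -
      have "(X t)\<^sup>2 \<le> \<epsilon>2\<^sup>2" "(y t)\<^sup>2 \<le> \<epsilon>2\<^sup>2" using that zero_le_power2[of "X t"] zero_le_power2[of "y t"] by linarith+
      then show "\<bar>X t\<bar> \<le> \<epsilon>2" "\<bar>y t\<bar> \<le> \<epsilon>2" using \<epsilon>2(1) unfolding abs_le_square_iff[symmetric] by linarith+
    qed
    have x: "\<bar>\<rho> t - \<rho>s t\<bar> \<le> \<bar>X t\<bar>" if "ts \<le> t" for t
    proof -
      have "\<bar>\<rho> t - \<rho>s t\<bar> = \<tau> t ^ l * \<bar>X t\<bar>" using \<tau>(1)[OF that] by (simp add: X_def abs_divide)
      also have "\<dots> \<le> 1 * \<bar>X t\<bar>" using \<tau>(1,2)[OF that] by (intro mult_right_mono power_le_one) auto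
      finally show ?thesis by simp
    qed
    have radius: "\<bar>r' t\<bar> \<le> \<R>" if "ts \<le> t" "\<bar>R t\<bar> \<le> 1" for t
    proof -
      have "\<bar>\<tau> t * R t\<bar> \<le> \<tau> t * 1" using that \<tau>(1)[of t] by (simp add: abs_mult)
      then show ?thesis unfolding rt[OF that(1)] using \<tau>(4)[OF that(1)] by linarith
    qed
    have A: "{ts..} \<subseteq> {0<..}" using ts1 by auto
    have c\<tau>: "continuous_on {ts..} \<tau>" by (rule continuous_on_tau[OF q1 A])
    have cr: "continuous_on {ts..} r'" by (rule DERIV_continuous_on[OF r']) auto
    have c\<phi>: "continuous_on {ts..} \<phi>'" by (rule DERIV_continuous_on[OF \<phi>']) auto
    have cS: "continuous_on {ts..} ?S" by (rule continuous_on_phase[OF A])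
    have c\<rho>s: "continuous_on {ts..} \<rho>s"
      by (rule DERIV_continuous_on[OF has_field_derivative_at_within[OF \<rho>s']]) auto
    have c\<phi>s: "continuous_on {ts..} \<phi>s"
      by (rule DERIV_continuous_on[OF has_field_derivative_at_within[OF \<phi>s']]) auto
    have \<tau>0: "\<tau> t \<noteq> 0" if "t \<in> {ts..}" for t using \<tau>(1)[of t] that by auto
    have cR: "continuous_on {ts..} R" unfolding R_def by (intro continuous_intros cr c\<tau>) (use \<tau>0 in auto)
    have c\<Psi>: "continuous_on {ts..} \<Psi>" unfolding \<Psi>_def by (intro continuous_intros c\<phi> cS)
    have c\<rho>: "continuous_on {ts..} \<rho>" unfolding \<rho>_def by (rule continuous_on_maps[OF A cR c\<Psi> cS])
    have c\<psi>: "continuous_on {ts..} \<psi>" unfolding \<psi>_def by (rule continuous_on_maps[OF A cR c\<Psi> cS])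
    have cW: "continuous_on {ts..} W" unfolding W_def by (rule continuous_on_Wfun[OF A c\<rho> c\<psi> c\<rho>s c\<phi>s])
    have cX: "continuous_on {ts..} X" unfolding X_def by (intro continuous_intros c\<rho> c\<rho>s c\<tau>) (use \<tau>0 in auto)
    have cy: "continuous_on {ts..} y" unfolding y_def by (intro continuous_intros c\<psi> c\<phi>s)
    have ch: "continuous_on {ts..} h" unfolding h_def by (intro continuous_intros cR c\<Psi> cX cy cW)
    have init: "h ts < 0"
    proof -
      have "resonant_deviation q \<kappa> \<mu> a ?S \<rho>s \<phi>s r' \<phi>' ts \<le> \<delta>"
        using as(5) eq[OF as(2)] by (simp add: resonant_deviation_def)
      then have d: "\<tau> ts * \<bar>R ts - \<rho>s ts\<bar> + \<bar>\<Psi> ts - \<phi>s ts\<bar> \<le> \<delta>" using dev[of ts] by simp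
      have "0 \<le> \<tau> ts * \<bar>R ts - \<rho>s ts\<bar>" using ts1 by simp
      with d have d': "\<tau> ts * \<bar>R ts - \<rho>s ts\<bar> \<le> \<delta>" "\<bar>\<Psi> ts - \<phi>s ts\<bar> \<le> \<delta>" by linarith+
      then have d1: "\<bar>R ts - \<rho>s ts\<bar> \<le> \<delta> / \<tau> ts" using ts1 by (simp add: field_simps)
      have "\<delta> / \<tau> ts \<le> 1 / 4" using \<delta>(2) ts1 by (simp add: field_simps)
      then have R0: "\<bar>R ts\<bar> \<le> 1 / 2" using d1 near(2)[of ts] by linarith
      have "\<delta> \<le> 1 / 4" using \<delta>(2) ts1 by linarith
      then have \<Psi>0: "\<bar>\<Psi> ts - \<psi>0\<bar> \<le> 1 / 2" using d'(2) near(3)[of ts] by linarith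
      have "\<bar>\<rho> ts - \<rho>map N (\<rho>s ts) (\<phi>s ts) (?S ts) ts\<bar> \<le> B * (\<bar>R ts - \<rho>s ts\<bar> + \<bar>\<Psi> ts - \<phi>s ts\<bar>)"
        unfolding \<rho>_def using R0 \<Psi>0 near(2,3)[of ts] by (intro B(2)[rule_format, OF ts1(1)]) auto
      also have "\<dots> \<le> B * (\<delta> / \<tau> ts + \<delta> / \<tau> ts)"
      proof -
        have "\<delta> * \<tau> ts \<le> \<delta> * 1" using \<delta>(1) ts1 by (intro mult_left_mono) auto
        then have "\<delta> \<le> \<delta> / \<tau> ts" using ts1 by (simp add: field_simps)
        then show ?thesis using d1 d'(2) B(1) by (intro mult_left_mono) auto
      qed
      also have "\<dots> \<le> \<beta> * \<tau> ts ^ l"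
      proof -
        have "(2 * B) * \<delta> \<le> (2 * B + 1) * \<delta>" using \<delta>(1) by (intro mult_right_mono) auto
        also have "\<dots> \<le> \<beta> * \<tau> ts ^ (l + 1)" using \<delta>(4) B(1) by (simp add: field_simps)
        finally show ?thesis using ts1 by (simp add: field_simps)
      qed
      finally have 1: "\<bar>\<rho> ts - \<rho>map N (\<rho>s ts) (\<phi>s ts) (?S ts) ts\<bar> \<le> \<beta> * \<tau> ts ^ l" .
      \<comment> \<open>At a good initial time the radial displacement is of order
        \<open>\<tau> ^ (2 * q)\<close>, and \<open>l + 1 \<le> q\<close> makes this small even in
        units of \<open>\<tau> ^ l\<close>.\<close>
      have "Cg * \<tau> ts ^ (2 * q) \<le> Cg * \<tau> ts ^ (l + 1)"
        using Cg(1) lq by (intro mult_left_mono tau_power_mono ts1) auto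
      also have "\<dots> = (Cg * \<tau> ts) * \<tau> ts ^ l" by simp
      also have "\<dots> \<le> \<beta> * \<tau> ts ^ l" using C\<tau>(4)[of ts] ts1 by (intro mult_right_mono) auto
      finally have "\<bar>\<rho> ts - \<rho>s ts\<bar> \<le> (2 * \<beta>) * \<tau> ts ^ l" using 1 ts(2) by linarith
      then have X0: "\<bar>X ts\<bar> \<le> 2 * \<beta>" using ts1 by (simp add: X_def abs_divide pos_divide_le_eq)
      \<comment> \<open>The angle is not rescaled, so its displacement \<open>C * \<tau>\<close> is
        already small and places no condition on the phase.\<close>
      have y0: "\<bar>y ts\<bar> \<le> 2 * \<beta>"
        using maps(2)[of ts] R0 \<Psi>0 d'(2) \<delta>(3) C\<tau>(3)[of ts] unfolding y_def by linarith
      have "\<bar>X ts\<bar>\<^sup>2 \<le> (2 * \<beta>)\<^sup>2" "\<bar>y ts\<bar>\<^sup>2 \<le> (2 * \<beta>)\<^sup>2" using X0 y0 by (intro power_mono; simp)+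
      then have s0: "(X ts)\<^sup>2 + (y ts)\<^sup>2 \<le> 8 * \<beta>\<^sup>2" by (simp add: power_mult_distrib)
      have "W ts \<le> K * ((X ts)\<^sup>2 + (y ts)\<^sup>2)" using X0 y0 \<beta> \<epsilon>2 by (intro ly(2)) linarith+
      also have "\<dots> \<le> K * (8 * \<beta>\<^sup>2)" using s0 cs by (intro mult_left_mono) auto
      finally have "W ts < \<epsilon>1" using \<beta>2 by linarith
      then show ?thesis using s0 \<beta>2 R0 \<Psi>0 by (simp add: h_def)
    qed
    \<comment> \<open>At a first contact the four constraints hold weakly, and together they imply
      the first three strictly. So the contact is with the level \<open>W = \<epsilon>1\<close>,
      where \<open>W\<close> is strictly decreasing although it was below this level just
      before.\<close>
    have bar: False if t: "ts < t" and before: "\<And>s. ts \<le> s \<Longrightarrow> s < t \<Longrightarrow> h s < 0" and zero: "h t = 0" for t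
    proof -
      have tst: "ts \<le> t" using t by simp
      have le: "\<bar>R t\<bar> \<le> 1" "\<bar>\<Psi> t - \<psi>0\<bar> \<le> 1" "(X t)\<^sup>2 + (y t)\<^sup>2 \<le> \<epsilon>2\<^sup>2" "W t \<le> \<epsilon>1"
        using zero unfolding h_def by linarith+
      note m = maps[OF tst le(1,2)]
      note sm = small[OF le(3)]
      have "\<bar>R t\<bar> < 1" "\<bar>\<Psi> t - \<psi>0\<bar> < 1"
        using m(1,2) sm x[OF tst] near(2,3)[OF tst] C\<tau>(1)[OF tst] \<epsilon>2(4) unfolding y_def by linarith+
      have X1: "\<bar>X t\<bar> \<le> 1" "\<bar>y t\<bar> \<le> s1 / 2" using sm \<epsilon>2 by linarith+
      note L = ly[OF tst X1]
      have "(X t)\<^sup>2 + (y t)\<^sup>2 \<le> K * W t" using L(1) cs by (simp add: field_simps)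
      also have "\<dots> \<le> K * \<epsilon>1" using le(4) cs by simp
      finally have "(X t)\<^sup>2 + (y t)\<^sup>2 < \<epsilon>2\<^sup>2" using \<epsilon>1 by linarith
      then have Wt: "W t = \<epsilon>1" using zero \<open>\<bar>R t\<bar> < 1\<close> \<open>\<bar>\<Psi> t - \<psi>0\<bar> < 1\<close> unfolding h_def by linarith
      let ?\<rho>' = "total_deriv_sum U N (R t, \<Psi> t, ?S t) t" and ?\<psi>' = "total_deriv_sum V N (R t, \<Psi> t, ?S t) t"
      have t0: "0 < t" using t ts1 by simp
      note cl = clamp_radius_id[OF radius[OF tst le(1)]]
      have \<rho>d: "(\<rho> has_real_derivative ?\<rho>') (at t within {ts..})"
        and \<psi>d: "(\<psi> has_real_derivative ?\<psi>') (at t within {ts..})"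
        using DERIV_scaled_solution[OF t0 r'[OF tst, unfolded cl] \<phi>'[OF tst, unfolded cl], of N]
        unfolding \<rho>_def \<psi>_def R_def \<Psi>_def .
      have W': "(W has_real_derivative Wderiv c t (\<rho> t) (\<psi> t) ?\<rho>' ?\<psi>') (at t within {ts..})"
        unfolding W_def[abs_def] by (rule DERIV_Wfun[OF t0 \<rho>s'[OF tst] \<phi>s'[OF tst] \<rho>d \<psi>d])
      have "\<epsilon>1 \<le> K * ((X t)\<^sup>2 + (y t)\<^sup>2)" using L(2) Wt by simp
      then have "\<epsilon>1 / K \<le> (X t)\<^sup>2 + (y t)\<^sup>2" using cs by (simp add: field_simps)
      then have "\<theta> * \<tau> t ^ (2 * l) * (\<epsilon>1 / K) \<le> \<theta> * \<tau> t ^ (2 * l) * ((X t)\<^sup>2 + (y t)\<^sup>2)"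
        using cs \<tau>(1)[OF tst] by (intro mult_left_mono) auto
      moreover have "K * \<tau> t ^ (Suc N - l) \<le> K * \<tau> t ^ (2 * l + 1)"
        using cs N3 by (intro mult_left_mono tau_power_mono near(1) tst) auto
      moreover have "K * \<tau> t ^ (2 * l + 1) = (K * \<tau> t) * \<tau> t ^ (2 * l)" by simp
      moreover have "(K * \<tau> t) * \<tau> t ^ (2 * l) < (\<theta> * (\<epsilon>1 / K)) * \<tau> t ^ (2 * l)"
        using \<tau>(1,5)[OF tst] by (intro mult_strict_right_mono) auto
      moreover have "(\<theta> * (\<epsilon>1 / K)) * \<tau> t ^ (2 * l) = \<theta> * \<tau> t ^ (2 * l) * (\<epsilon>1 / K)" by simp
      moreover have "Wderiv c t (\<rho> t) (\<psi> t) ?\<rho>' ?\<psi>' \<le> - (\<theta> * \<tau> t ^ (2 * l) * ((X t)\<^sup>2 + (y t)\<^sup>2)) + K * \<tau> t ^ (Suc N - l)"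
        using L(3)[OF m(3,4)] by simp
      ultimately have "Wderiv c t (\<rho> t) (\<psi> t) ?\<rho>' ?\<psi>' < 0" by linarith
      from has_real_derivative_neg_dec_left[OF W' this] obtain d where
        d: "d > 0" "\<And>e. e > 0 \<Longrightarrow> t - e \<in> {ts..} \<Longrightarrow> e < d \<Longrightarrow> W t < W (t - e)" by blast
      define e where "e = min (d / 2) (t - ts)"
      have e: "e > 0" "t - e \<in> {ts..}" "e < d" using d(1) t by (auto simp: e_def)
      have "h (t - e) < 0" using before[of "t - e"] e by simp
      then have "W (t - e) < \<epsilon>1" unfolding h_def by linarith
      then show False using d(2)[OF e] Wt by simp
    qed
    have inside: "h t < 0" if "ts \<le> t" for t by (rule barrier_argument[OF ch init _ that]) (use bar in blast)
    have fin: "\<bar>R t\<bar> \<le> 1" "resonant_deviation q \<kappa> \<mu> a ?S \<rho>s \<phi>s r' \<phi>' t < \<epsilon>" if t: "ts \<le> t" for t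
    proof -
      have le: "\<bar>R t\<bar> \<le> 1" "\<bar>\<Psi> t - \<psi>0\<bar> \<le> 1" "(X t)\<^sup>2 + (y t)\<^sup>2 \<le> \<epsilon>2\<^sup>2"
        using inside[OF t] unfolding h_def by linarith+
      show "\<bar>R t\<bar> \<le> 1" by fact
      note m = maps[OF t le(1,2)]
      note sm = small[OF le(3)]
      have "\<bar>R t - \<rho>s t\<bar> \<le> \<epsilon> / 4 + \<epsilon> / 8" "\<bar>\<Psi> t - \<phi>s t\<bar> \<le> \<epsilon> / 4 + \<epsilon> / 8"
        using m(1,2) sm x[OF t] C\<tau>(2)[OF t] \<epsilon>2(2) unfolding y_def by linarith+
      moreover have "\<tau> t * \<bar>R t - \<rho>s t\<bar> \<le> 1 * \<bar>R t - \<rho>s t\<bar>" using \<tau>(2)[OF t] by (intro mult_right_mono) auto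
      ultimately have "\<tau> t * \<bar>R t - \<rho>s t\<bar> + \<bar>\<Psi> t - \<phi>s t\<bar> \<le> (\<epsilon> / 4 + \<epsilon> / 8) + (\<epsilon> / 4 + \<epsilon> / 8)" by (intro add_mono) simp_all
      also have "\<dots> < \<epsilon>" using \<epsilon> by simp
      finally show "resonant_deviation q \<kappa> \<mu> a ?S \<rho>s \<phi>s r' \<phi>' t < \<epsilon>" unfolding dev[OF t] .
    qed
    \<comment> \<open>Confinement keeps the radius within \<open>\<R>\<close>, so the clamped
      equation is the original one on the whole half-line.\<close>
    have "perturbed_solution \<R> \<omega> f g ?S {ts..} r' \<phi>'"
      unfolding perturbed_solution_def
    proof (intro ballI conjI)
      fix t assume "t \<in> {ts..}"
      then have t: "ts \<le> t" by simp
      show rr: "\<bar>r' t\<bar> \<le> \<R>" by (rule radius[OF t fin(1)[OF t]])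
      show "(r' has_real_derivative f (r' t) (\<phi>' t) (?S t) t) (at t within {ts..})"
        "(\<phi>' has_real_derivative \<omega> (r' t) + g (r' t) (\<phi>' t) (?S t) t) (at t within {ts..})"
        using r'[OF t] \<phi>'[OF t] unfolding clamp_radius_id[OF rr] .
    qed
    then show ?thesis using eq fin(2) by (intro exI[of _ r'] exI[of _ \<phi>']) auto
  qed
  then show ?thesis using \<delta>(1) ts(1) by (intro exI[of _ \<delta>] exI[of _ ts] conjI) auto
qed

end

text \<open>Solutions are given on an arbitrary interval \<open>J\<close> that starts at
  \<open>ts\<close>, so that continuation to the whole half-line is part of the conclusion and not
  an assumption. The averaged coefficients enter as families that satisfy \<open>averaging\<close>,
  and the particular solution as any pair of functions with the required equations and
  expansions.\<close>

theorem theorem2: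
  fixes \<R> a \<psi>0 :: real
    and \<omega> :: "real \<Rightarrow> real"
    and f g :: "real \<Rightarrow> real \<Rightarrow> real \<Rightarrow> real \<Rightarrow> real"
    and fc gc u v :: "nat \<Rightarrow> real \<Rightarrow> real \<Rightarrow> real \<Rightarrow> real"
    and \<Lambda> \<Omega> :: "nat \<Rightarrow> real \<Rightarrow> real \<Rightarrow> real"
    and s :: "nat \<Rightarrow> real"
    and t0 :: "nat \<Rightarrow> real"
    and q \<kappa> \<mu> n m :: nat
  assumes "\<R> > 0" and "q \<ge> 1"
    and "smooth_on {-\<R>..\<R>} \<omega>" and "\<forall>r\<in>{-\<R>..\<R>}. \<omega> r > 0"
    and "\<exists>r. \<bar>r\<bar> < \<R> \<and> deriv \<omega> r \<noteq> 0"
    and "admissible_perturbation \<R> q f fc"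
    and "admissible_perturbation \<R> q g gc"
    and "s 0 > 0"
    and "0 < \<bar>a\<bar>" and "\<bar>a\<bar> < \<R>"
    and "\<kappa> \<ge> 1" and "\<mu> \<ge> 1" and "coprime \<kappa> \<mu>"
    and "real \<kappa> * s 0 = real \<mu> * \<omega> a"
    and "deriv \<omega> a \<noteq> 0"
    and "averaging q \<kappa> \<mu> a s \<omega> fc gc u v \<Lambda> \<Omega>"
    and "\<forall>N. t0 N \<ge> 1"
    and "1 \<le> n" and "n \<le> 2 * q" and "2 \<le> m" and "m \<le> 2 * q"
    and "\<forall>i. 1 \<le> i \<and> i < n \<longrightarrow> (\<forall>\<rho> \<psi>. \<Lambda> i \<rho> \<psi> = 0)"
    and "\<exists>\<rho> \<psi>. \<Lambda> n \<rho> \<psi> \<noteq> 0"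
    and "\<forall>j. 1 < j \<and> j < m \<longrightarrow> (\<forall>\<rho> \<psi>. \<Omega> j \<rho> \<psi> = 0)"
    and "\<exists>\<rho> \<psi>. \<Omega> m \<rho> \<psi> \<noteq> 0"
    and "\<Lambda> n 0 \<psi>0 = 0"
    and "deriv (\<lambda>\<psi>. \<Lambda> n 0 \<psi>) \<psi>0 \<noteq> 0"
    and "deriv (\<lambda>\<psi>. \<Lambda> n 0 \<psi>) \<psi>0 * deriv \<omega> a < 0"
    and "d_coeff n m \<psi>0 \<Lambda> \<Omega> < 0"
  shows "\<exists>N0\<ge>1. \<forall>N\<ge>N0. \<forall>\<rho>s \<phi>s. particular_solution q m \<psi>0 N \<Lambda> \<Omega> \<rho>s \<phi>s \<longrightarrow>
    (\<forall>\<epsilon>>0. \<exists>\<delta>>0. \<exists>ts\<ge>t0 N. \<forall>J r \<phi>.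
       is_interval J \<and> ts \<in> J \<and> J \<subseteq> {ts..} \<and>
       perturbed_solution \<R> \<omega> f g (phase q s) J r \<phi> \<and>
       resonant_deviation q \<kappa> \<mu> a (phase q s) \<rho>s \<phi>s r \<phi> ts \<le> \<delta> \<longrightarrow>
       (\<exists>r' \<phi>'. (\<forall>t\<in>J. r' t = r t \<and> \<phi>' t = \<phi> t) \<and>
          perturbed_solution \<R> \<omega> f g (phase q s) {ts..} r' \<phi>' \<and>
          (\<forall>t>ts. resonant_deviation q \<kappa> \<mu> a (phase q s) \<rho>s \<phi>s r' \<phi>' t < \<epsilon>)))"
proof -
  have n: "1 \<le> n" "n \<le> 2 * q" and m: "2 \<le> m"
    and \<nu>: "deriv (\<lambda>\<psi>. \<Lambda> n 0 \<psi>) \<psi>0 \<noteq> 0" and d: "d_coeff n m \<psi>0 \<Lambda> \<Omega> < 0"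
    and \<Lambda>0: "\<And>i \<rho> \<psi>. 1 \<le> i \<Longrightarrow> i < n \<Longrightarrow> \<Lambda> i \<rho> \<psi> = 0" and \<Omega>0: "\<And>j \<rho> \<psi>. 1 < j \<Longrightarrow> j < m \<Longrightarrow> \<Omega> j \<rho> \<psi> = 0"
    and eq: "\<Lambda> n 0 \<psi>0 = 0" and \<nu>\<eta>: "deriv (\<lambda>\<psi>. \<Lambda> n 0 \<psi>) \<psi>0 * deriv \<omega> a < 0"
    using assms by simp_all
  interpret perturbed_system q \<kappa> \<mu> a s \<omega> fc gc u v \<Lambda> \<Omega> \<R> f g
    by unfold_locales fact+
  note par = parity_restriction[OF n(1) m n(2) \<nu> d]
  obtain l where l: "n = 2 * l + 1" using par(1) by (rule oddE)
  have "resonant_system q \<kappa> \<mu> a s \<omega> fc gc u v \<Lambda> \<Omega> \<R> f g l m N \<psi>0 \<rho>s \<phi>s"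
    if N: "3 * n \<le> N" and ps: "particular_solution q m \<psi>0 N \<Lambda> \<Omega> \<rho>s \<phi>s" for N \<rho>s \<phi>s
  proof unfold_locales
    show "2 \<le> m" "m \<le> 2 * l" "l + 1 \<le> q" "3 * (2 * l + 1) \<le> N" using m par(2,3) N unfolding l by simp_all
    show "\<Lambda> (2 * l + 1) 0 \<psi>0 = 0" "deriv (\<Lambda> (2 * l + 1) 0) \<psi>0 * deriv \<omega> a < 0"
      using eq \<nu>\<eta> unfolding l by simp_all
    show "deriv (\<Omega> m 0) \<psi>0 < 0" by (rule par(4))
    show "particular_solution q m \<psi>0 N \<Lambda> \<Omega> \<rho>s \<phi>s" by (rule ps)
  qed (use \<Lambda>0 \<Omega>0 l in auto)
  note stable = resonant_system.stability[OF this]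
  show ?thesis
  proof (intro exI[of _ "3 * n"] conjI allI impI)
    show "1 \<le> 3 * n" using n by simp
  qed (rule stable)
qed

end
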